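(* (Binomial theorem for cyclic operads.) Let $A$ be a dg $k$-vector space of finite type. There is an isomorphism of cyclic operads $$\phi_!(End_A^{di})\cong End^{cyc}_{(\mathsf d(A),\langle-,-\rangle)}.$$
   Context: $k$ is a field of characteristic $0$; all objects are in $dgVect_k$ and operadic structures are considered without units. A cyclic operad $\mathcal O=\{\mathcal O((n))\}$ has $S_n$-modules $\mathcal O((n))$ and compositions along trees. A dioperad $\mathcal P=\{\mathcal P(r,s)\}$ has $S_r\times S_s$-modules ($r$ outputs, $s$ inputs) and compositions along directed trees, each edge joining an output flag to an input flag; here dioperads are allowed to have empty inputs or empty outputs, but not both. $\phi$ is the functor from the (Feynman) category encoding such dioperads to that encoding cyclic operads which forgets directions. The functor $\phi_!$ from dioperads to cyclic operads is $\phi_!(\mathcal P)((n))=\bigoplus_{r+s=n}\mathcal P(r,s)\otimes_{k[S_r\times S_s]}k[S_n]$: elements are corollas all of whose flags are directed, decorated by $\mathcal P$; composing two such elements by gluing two flags is given by the composition of $\mathcal P$ if one of the flags is an output and the other an input, and is $0$ otherwise. With linear dual $A^*$, $\mathsf d(A)=A\oplus A^*$ has the symmetric non-degenerate bilinear form $\langle a\oplus\eta,b\oplus\xi\rangle=\eta(b)+\xi(a)$. $End_A^{di}(r,s)\cong A^{\otimes r}\otimes(A^* )^{\otimes s}$ is the endomorphism dioperad, with composition by evaluation; for a finite type $V$ with symmetric non-degenerate form $\langle-,-\rangle$, $End^{cyc}_{(V,\langle-,-\rangle)}((n))\cong V^{\otimes n}$ is the endomorphism cyclic operad, with composition given by contracting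 with the form. *)

theory Defs
  imports
    "HOL-Algebra.Algebraic_Closure_Type"
    "HOL-Algebra.Module"
    "HOL-Library.Poly_Mapping"
    "HOL-Library.Set_Algebras"
    "HOL-Combinatorics.Permutations"
begin

section \<open>Differential graded vector spaces\<close>

text \<open>
  The ground field is a type \<open>'k\<close> of class \<open>field_char_0\<close>. A graded vector space is a family
  of vector spaces indexed by the integers, so every element under consideration is homogeneous;
  operations that involve Koszul signs take the degrees of their arguments as parameters.
  Differentials have degree \<open>1\<close>.
\<close>

abbreviation kring :: "'k::field ring" where
  "kring \<equiv> ring_of_type_algebra"

definition ground :: "('k::field, 'k) module" where
  "ground = \<lparr>carrier = UNIV, monoid.mult = (*), one = 1, zero = 0, add = (+), module.smult = (*)\<rparr>"

definition linear_on :: "('k::field, 'a) module \<Rightarrow> ('k, 'b) module \<Rightarrow> ('a \<Rightarrow> 'b) \<Rightarrow> bool" where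
  "linear_on M N f \<longleftrightarrow>
     (\<forall>x\<in>carrier M. f x \<in> carrier N) \<and>
     (\<forall>x\<in>carrier M. \<forall>y\<in>carrier M. f (x \<oplus>\<^bsub>M\<^esub> y) = f x \<oplus>\<^bsub>N\<^esub> f y) \<and>
     (\<forall>c. \<forall>x\<in>carrier M. f (c \<odot>\<^bsub>M\<^esub> x) = c \<odot>\<^bsub>N\<^esub> f x)"

definition bilinear_on ::
    "('k::field, 'a) module \<Rightarrow> ('k, 'b) module \<Rightarrow> ('k, 'c) module \<Rightarrow> ('a \<Rightarrow> 'b \<Rightarrow> 'c) \<Rightarrow> bool" where
  "bilinear_on M N L f \<longleftrightarrow>
     (\<forall>x\<in>carrier M. linear_on N L (f x)) \<and> (\<forall>y\<in>carrier N. linear_on M L (\<lambda>x. f x y))"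

record ('k, 'a) dg =
  gr :: "int \<Rightarrow> ('k, 'a) module"
  dif :: "int \<Rightarrow> 'a \<Rightarrow> 'a"

abbreviation el :: "('k, 'a) dg \<Rightarrow> int \<Rightarrow> 'a set" where
  "el V d \<equiv> carrier (gr V d)"

locale dg_vector_space =
  fixes V :: "('k::field_char_0, 'a) dg"
  assumes vector_space: "Module.module (kring :: 'k ring) (gr V d)"
    and dif_linear: "linear_on (gr V d) (gr V (d + 1)) (dif V d)"
    and dif_dif: "x \<in> el V d \<Longrightarrow> dif V (d + 1) (dif V d x) = \<zero>\<^bsub>gr V (d + 2)\<^esub>"

text \<open>Finite type: every homogeneous piece is finite dimensional.\<close>

definition finite_type :: "('k::field_char_0, 'a) dg \<Rightarrow> bool" where
  "finite_type V \<longleftrightarrow> (\<forall>d. \<exists>B. finite B \<and> B \<subseteq> el V d \<and>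
     (\<forall>v\<in>el V d. \<exists>c. v = (\<Oplus>\<^bsub>gr V d\<^esub>b\<in>B. c b \<odot>\<^bsub>gr V d\<^esub> b)))"

definition ksign :: "int \<Rightarrow> 'k::field_char_0" where
  "ksign d = (if even d then 1 else - 1)"

text \<open>
  The degree \<open>d\<close> part of the dual consists of the linear functionals on the degree \<open>- d\<close> part;
  the differential is the one that makes evaluation a chain map.
\<close>

definition dual :: "('k::field_char_0, 'a) dg \<Rightarrow> ('k, 'a \<Rightarrow> 'k) dg" where
  "dual V = \<lparr>
     gr = (\<lambda>d. \<lparr>
       carrier = {f \<in> extensional (el V (- d)). linear_on (gr V (- d)) ground f},
       monoid.mult = undefined, one = undefined,
       zero = (\<lambda>x\<in>el V (- d). 0),
       add = (\<lambda>f g. \<lambda>x\<in>el V (- d). f x + g x),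
       module.smult = (\<lambda>c f. \<lambda>x\<in>el V (- d). c * f x)\<rparr>),
     dif = (\<lambda>d f. \<lambda>x\<in>el V (- (d + 1)). - ksign d * f (dif V (- (d + 1)) x))\<rparr>"

definition dsum :: "('k::field_char_0, 'a) dg \<Rightarrow> ('k, 'b) dg \<Rightarrow> ('k, 'a \<times> 'b) dg" where
  "dsum V W = \<lparr>
     gr = (\<lambda>d. \<lparr>
       carrier = el V d \<times> el W d,
       monoid.mult = undefined, one = undefined,
       zero = (\<zero>\<^bsub>gr V d\<^esub>, \<zero>\<^bsub>gr W d\<^esub>),
       add = (\<lambda>(a, b) (a', b'). (a \<oplus>\<^bsub>gr V d\<^esub> a', b \<oplus>\<^bsub>gr W d\<^esub> b')),
       module.smult = (\<lambda>c (a, b). (c \<odot>\<^bsub>gr V d\<^esub> a, c \<odot>\<^bsub>gr W d\<^esub> b))\<rparr>),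
     dif = (\<lambda>d (a, b). (dif V d a, dif W d b))\<rparr>"

definition double :: "('k::field_char_0, 'a) dg \<Rightarrow> ('k, 'a \<times> ('a \<Rightarrow> 'k)) dg" where
  "double A = dsum A (dual A)"

text \<open>
  The form \<open>\<langle>a \<oplus> \<eta>, b \<oplus> \<xi>\<rangle> = \<eta>(b) + \<xi>(a)\<close> of degree \<open>0\<close>, on arguments of degrees \<open>p\<close> and \<open>q\<close>.
  The second summand interchanges \<open>a\<close> and \<open>\<xi>\<close> and hence carries the Koszul sign; with it
  the form is symmetric in the graded sense.
\<close>

definition double_form ::
    "('k::field_char_0, 'a) dg \<Rightarrow> int \<Rightarrow> int \<Rightarrow> 'a \<times> ('a \<Rightarrow> 'k) \<Rightarrow> 'a \<times> ('a \<Rightarrow> 'k) \<Rightarrow> 'k" where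
  "double_form A p q = (\<lambda>(a, \<eta>) (b, \<xi>). if p + q = 0 then \<eta> b + ksign (p * q) * \<xi> a else 0)"


section \<open>Vector spaces given by generators and relations\<close>

definition fscale :: "'k::field \<Rightarrow> ('g \<Rightarrow>\<^sub>0 'k) \<Rightarrow> ('g \<Rightarrow>\<^sub>0 'k)" where
  "fscale c = Poly_Mapping.map ((*) c)"

lemma lookup_fscale [simp]: "Poly_Mapping.lookup (fscale c x) g = c * Poly_Mapping.lookup x g"
  by (simp add: fscale_def Poly_Mapping.map.rep_eq when_def)

global_interpretation free: vector_space "fscale :: 'k::field \<Rightarrow> ('g \<Rightarrow>\<^sub>0 'k) \<Rightarrow> ('g \<Rightarrow>\<^sub>0 'k)"
  by standard (auto intro!: poly_mapping_eqI simp: lookup_add algebra_simps)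

text \<open>
  The quotient of the free vector space on \<open>G\<close> by the span of \<open>R\<close>; its elements are cosets.
\<close>

definition presented :: "'g set \<Rightarrow> ('g \<Rightarrow>\<^sub>0 'k) set \<Rightarrow> ('k::field, ('g \<Rightarrow>\<^sub>0 'k) set) module" where
  "presented G R = \<lparr>
     carrier = (\<lambda>x. x +o free.span R) ` {x. Poly_Mapping.keys x \<subseteq> G},
     monoid.mult = undefined, one = undefined,
     zero = free.span R,
     add = (+),
     module.smult = (\<lambda>c S. fscale c ` S + free.span R)\<rparr>"

definition fextend :: "('g \<Rightarrow> ('h \<Rightarrow>\<^sub>0 'k)) \<Rightarrow> ('g \<Rightarrow>\<^sub>0 'k::field) \<Rightarrow> ('h \<Rightarrow>\<^sub>0 'k)" where
  "fextend f x = (\<Sum>g\<in>Poly_Mapping.keys x. fscale (Poly_Mapping.lookup x g) (f g))"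

text \<open>
  The map on cosets induced by a map given on generators, and its bilinear version. Here \<open>R\<close> is
  the set of relations of the target; if the map on generators respects the relations, the union
  is a single coset.
\<close>

definition induced ::
    "('h \<Rightarrow>\<^sub>0 'k) set \<Rightarrow> ('g \<Rightarrow> ('h \<Rightarrow>\<^sub>0 'k)) \<Rightarrow> ('g \<Rightarrow>\<^sub>0 'k::field) set \<Rightarrow> ('h \<Rightarrow>\<^sub>0 'k) set" where
  "induced R f S = (\<Union>x\<in>S. fextend f x +o free.span R)"

definition induced2 ::
    "('h \<Rightarrow>\<^sub>0 'k) set \<Rightarrow> ('g \<Rightarrow> 'g' \<Rightarrow> ('h \<Rightarrow>\<^sub>0 'k)) \<Rightarrow>
     ('g \<Rightarrow>\<^sub>0 'k::field) set \<Rightarrow> ('g' \<Rightarrow>\<^sub>0 'k) set \<Rightarrow> ('h \<Rightarrow>\<^sub>0 'k) set" where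
  "induced2 R f S T =
     (\<Union>x\<in>S. \<Union>y\<in>T. fextend (\<lambda>g. fextend (f g) y) x +o free.span R)"

text \<open>The relations saying that the generator \<open>C v\<close> depends linearly on \<open>v \<in> M\<close>.\<close>

definition lin_rels :: "('k::field, 'v) module \<Rightarrow> ('v \<Rightarrow> 'g) \<Rightarrow> ('g \<Rightarrow>\<^sub>0 'k) set" where
  "lin_rels M C =
     {Poly_Mapping.single (C (v \<oplus>\<^bsub>M\<^esub> w)) 1 - Poly_Mapping.single (C v) 1
        - Poly_Mapping.single (C w) 1 | v w. v \<in> carrier M \<and> w \<in> carrier M} \<union>
     {Poly_Mapping.single (C (c \<odot>\<^bsub>M\<^esub> v)) 1 - Poly_Mapping.single (C v) c | c v. v \<in> carrier M}"


section \<open>Tensor words\<close>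

text \<open>
  A generator \<open>v\<^sub>1 \<otimes> \<dots> \<otimes> v\<^sub>n\<close> of a tensor power is a list of homogeneous elements, each
  paired with its degree.
\<close>

definition wdeg :: "(int \<times> 'v) list \<Rightarrow> int" where
  "wdeg w = sum_list (map fst w)"

definition words :: "('k, 'v) dg \<Rightarrow> nat \<Rightarrow> int \<Rightarrow> (int \<times> 'v) list set" where
  "words V n d = {w. length w = n \<and> (\<forall>(e, v)\<in>set w. v \<in> el V e) \<and> wdeg w = d}"

text \<open>
  Multilinearity of the generator \<open>C w\<close> in the letters of the word \<open>w\<close>. The condition on the
  word with a zero inserted says that \<open>w1\<close>, \<open>w2\<close> complete a letter of degree \<open>e\<close> to
  a word in \<open>words V n d\<close>.
\<close>

definition multilin_rels ::
    "('k::field, 'v) dg \<Rightarrow> nat \<Rightarrow> int \<Rightarrow> ((int \<times> 'v) list \<Rightarrow> 'g) \<Rightarrow> ('g \<Rightarrow>\<^sub>0 'k) set" where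
  "multilin_rels V n d C =
     \<Union>{lin_rels (gr V e) (\<lambda>v. C (w1 @ (e, v) # w2)) | w1 e w2.
         w1 @ (e, \<zero>\<^bsub>gr V e\<^esub>) # w2 \<in> words V n d}"

definition wdif :: "('k::field_char_0, 'v) dg \<Rightarrow> (int \<times> 'v) list \<Rightarrow> ((int \<times> 'v) list \<Rightarrow>\<^sub>0 'k)" where
  "wdif V w = (\<Sum>i<length w.
     Poly_Mapping.single (w[i := (fst (w ! i) + 1, dif V (fst (w ! i)) (snd (w ! i)))])
       (ksign (wdeg (take i w))))"

text \<open>
  Symmetric groups act from the right throughout: the letter (or flag) in position \<open>l\<close> of
  \<open>x\<sigma>\<close> is the one in position \<open>\<sigma> l\<close> of \<open>x\<close>. Positions are numbered from \<open>0\<close>.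
\<close>

definition wperm :: "(nat \<Rightarrow> nat) \<Rightarrow> (int \<times> 'v) list \<Rightarrow> (int \<times> 'v) list" where
  "wperm \<sigma> w = map (\<lambda>l. w ! \<sigma> l) [0..<length w]"

definition wsign :: "(nat \<Rightarrow> nat) \<Rightarrow> (int \<times> 'v) list \<Rightarrow> 'k::field_char_0" where
  "wsign \<sigma> w = (\<Prod>(k, l)\<in>{(k, l). k < l \<and> l < length w \<and> \<sigma> l < \<sigma> k}.
     ksign (fst (w ! \<sigma> k) * fst (w ! \<sigma> l)))"

definition del_nth :: "nat \<Rightarrow> 'b list \<Rightarrow> 'b list" where
  "del_nth i w = take i w @ drop (Suc i) w"


section \<open>Numbering the flags of a composite\<close>

text \<open>
  \<open>skip i\<close> enumerates the positions other than \<open>i\<close> in increasing order, and \<open>unskip i\<close> is the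
  inverse numbering.
\<close>

definition skip :: "nat \<Rightarrow> nat \<Rightarrow> nat" where
  "skip i l = (if l < i then l else Suc l)"

definition unskip :: "nat \<Rightarrow> nat \<Rightarrow> nat" where
  "unskip i l = (if l < i then l else l - 1)"

definition perm_upto :: "nat \<Rightarrow> (nat \<Rightarrow> nat) \<Rightarrow> nat \<Rightarrow> nat" where
  "perm_upto n f l = (if l < n then f l else l)"

text \<open>
  When flag \<open>i\<close> of a corolla with \<open>n\<close> flags is glued to flag \<open>j\<close> of a second one, the flags of the
  composite are the remaining flags of the first (\<open>Inl\<close>) followed by those of the second
  (\<open>Inr\<close>). \<open>cflag\<close> finds the flag in a given position and \<open>cpos\<close> the position of a flag.
\<close>

definition cflag :: "nat \<Rightarrow> nat \<Rightarrow> nat \<Rightarrow> nat \<Rightarrow> nat + nat" where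
  "cflag n i j l = (if l < n - 1 then Inl (skip i l) else Inr (skip j (l - (n - 1))))"

definition cpos :: "nat \<Rightarrow> nat \<Rightarrow> nat \<Rightarrow> nat + nat \<Rightarrow> nat" where
  "cpos n i j = case_sum (unskip i) (\<lambda>b. n - 1 + unskip j b)"

text \<open>
  When output \<open>i\<close> of a directed corolla with \<open>r\<close> outputs and \<open>s\<close> inputs is glued to input \<open>j\<close> of a
  second one, the outputs (inputs) of the composite are the remaining outputs (inputs) of
  the first followed by those of the second.
\<close>

definition oflag :: "nat \<Rightarrow> nat \<Rightarrow> nat \<Rightarrow> nat + nat" where
  "oflag r i l = (if l < r - 1 then Inl (skip i l) else Inr (l - (r - 1)))"

definition opos :: "nat \<Rightarrow> nat \<Rightarrow> nat + nat \<Rightarrow> nat" where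
  "opos r i = case_sum (unskip i) (\<lambda>b. r - 1 + b)"

definition iflag :: "nat \<Rightarrow> nat \<Rightarrow> nat \<Rightarrow> nat + nat" where
  "iflag s j l = (if l < s then Inl l else Inr (skip j (l - s)))"

definition ipos :: "nat \<Rightarrow> nat \<Rightarrow> nat + nat \<Rightarrow> nat" where
  "ipos s j = case_sum (\<lambda>a. a) (\<lambda>b. s + unskip j b)"

text \<open>\<open>block_swap c p q\<close> maps \<open>c + a\<close> to \<open>c + q + a\<close> for \<open>a < p\<close> and \<open>c + p + b\<close> to \<open>c + b\<close> for \<open>b < q\<close>.\<close>

definition block_swap :: "nat \<Rightarrow> nat \<Rightarrow> nat \<Rightarrow> nat \<Rightarrow> nat" where
  "block_swap c p q l =
     (if c \<le> l \<and> l < c + p then l + q else if c + p \<le> l \<and> l < c + p + q then l - p else l)"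

definition block_sum :: "nat \<Rightarrow> nat \<Rightarrow> (nat \<Rightarrow> nat) \<Rightarrow> (nat \<Rightarrow> nat) \<Rightarrow> nat \<Rightarrow> nat" where
  "block_sum r s \<sigma> \<tau> l = (if l < r then \<sigma> l else if l < r + s then r + \<tau> (l - r) else l)"


section \<open>Cyclic operads\<close>

text \<open>
  Non-unital cyclic operads \<open>\<O>((n))\<close>, \<open>n \<ge> 1\<close>, in dg vector spaces. \<open>cact \<O> n \<sigma> d x\<close> is
  \<open>x\<sigma>\<close> for \<open>x \<in> \<O>((n))\<close> of degree \<open>d\<close>. \<open>ccomp \<O> n i m j d e x y\<close> is the composition along the
  tree with one edge, joining flag \<open>i\<close> of \<open>x \<in> \<O>((n))\<close> to flag \<open>j\<close> of \<open>y \<in> \<O>((m))\<close>, of degrees \<open>d\<close>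
  and \<open>e\<close>. The compositions along all trees are obtained by contracting one edge at a time;
  \<open>symmetry\<close> and \<open>assoc\<close> say that the result depends on the tree alone. Trees without leaves
  do not occur, since there is no \<open>\<O>((0))\<close>.
\<close>

record ('k, 'x) cyclic_data =
  cobj :: "nat \<Rightarrow> ('k, 'x) dg"
  cact :: "nat \<Rightarrow> (nat \<Rightarrow> nat) \<Rightarrow> int \<Rightarrow> 'x \<Rightarrow> 'x"
  ccomp :: "nat \<Rightarrow> nat \<Rightarrow> nat \<Rightarrow> nat \<Rightarrow> int \<Rightarrow> int \<Rightarrow> 'x \<Rightarrow> 'x \<Rightarrow> 'x"

locale cyclic_operad =
  fixes C :: "('k::field_char_0, 'x) cyclic_data"
  assumes dg: "1 \<le> n \<Longrightarrow> dg_vector_space (cobj C n)"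
    and act_linear: "\<lbrakk>1 \<le> n; \<sigma> permutes {..<n}\<rbrakk> \<Longrightarrow>
      linear_on (gr (cobj C n) d) (gr (cobj C n) d) (cact C n \<sigma> d)"
    and act_dif: "\<lbrakk>1 \<le> n; \<sigma> permutes {..<n}; x \<in> el (cobj C n) d\<rbrakk> \<Longrightarrow>
      cact C n \<sigma> (d + 1) (dif (cobj C n) d x) = dif (cobj C n) d (cact C n \<sigma> d x)"
    and act_id: "\<lbrakk>1 \<le> n; x \<in> el (cobj C n) d\<rbrakk> \<Longrightarrow> cact C n id d x = x"
    and act_comp: "\<lbrakk>1 \<le> n; \<sigma> permutes {..<n}; \<tau> permutes {..<n}; x \<in> el (cobj C n) d\<rbrakk> \<Longrightarrow>
      cact C n (\<sigma> \<circ> \<tau>) d x = cact C n \<tau> d (cact C n \<sigma> d x)"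
    and comp_bilinear: "\<lbrakk>3 \<le> n + m; i < n; j < m\<rbrakk> \<Longrightarrow>
      bilinear_on (gr (cobj C n) d) (gr (cobj C m) e) (gr (cobj C (n + m - 2)) (d + e))
        (ccomp C n i m j d e)"
    and comp_dif: "\<lbrakk>3 \<le> n + m; i < n; j < m; x \<in> el (cobj C n) d; y \<in> el (cobj C m) e\<rbrakk> \<Longrightarrow>
      dif (cobj C (n + m - 2)) (d + e) (ccomp C n i m j d e x y) =
        ccomp C n i m j (d + 1) e (dif (cobj C n) d x) y
          \<oplus>\<^bsub>gr (cobj C (n + m - 2)) (d + e + 1)\<^esub>
        ksign d \<odot>\<^bsub>gr (cobj C (n + m - 2)) (d + e + 1)\<^esub>
          ccomp C n i m j d (e + 1) x (dif (cobj C m) e y)"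
    and equivariance: "\<lbrakk>3 \<le> n + m; i < n; j < m; \<sigma> permutes {..<n}; \<tau> permutes {..<m};
        x \<in> el (cobj C n) d; y \<in> el (cobj C m) e\<rbrakk> \<Longrightarrow>
      ccomp C n i m j d e (cact C n \<sigma> d x) (cact C m \<tau> e y) =
        cact C (n + m - 2)
          (perm_upto (n + m - 2) (cpos n (\<sigma> i) (\<tau> j) \<circ> map_sum \<sigma> \<tau> \<circ> cflag n i j)) (d + e)
          (ccomp C n (\<sigma> i) m (\<tau> j) d e x y)"
    and symmetry: "\<lbrakk>3 \<le> n + m; i < n; j < m; x \<in> el (cobj C n) d; y \<in> el (cobj C m) e\<rbrakk> \<Longrightarrow>
      ccomp C n i m j d e x y =
        ksign (d * e) \<odot>\<^bsub>gr (cobj C (n + m - 2)) (d + e)\<^esub>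
          cact C (n + m - 2)
            (perm_upto (n + m - 2) (cpos m j i \<circ> case_sum Inr Inl \<circ> cflag n i j)) (d + e)
            (ccomp C m j n i e d y x)"
    and assoc: "\<lbrakk>5 \<le> n + m + p; i < n; j < m; k < m; j \<noteq> k; l < p;
        x \<in> el (cobj C n) d; y \<in> el (cobj C m) e; z \<in> el (cobj C p) f\<rbrakk> \<Longrightarrow>
      ccomp C (n + m - 2) (n - 1 + unskip j k) p l (d + e) f (ccomp C n i m j d e x y) z =
        ccomp C n i (m + p - 2) (unskip k j) d (e + f) x (ccomp C m k p l e f y z)"

definition cyclic_operad_iso ::
    "('k::field_char_0, 'x) cyclic_data \<Rightarrow> ('k, 'y) cyclic_data \<Rightarrow> (nat \<Rightarrow> int \<Rightarrow> 'x \<Rightarrow> 'y) \<Rightarrow> bool" where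
  "cyclic_operad_iso C D \<Phi> \<longleftrightarrow>
     (\<forall>n d. 1 \<le> n \<longrightarrow>
        linear_on (gr (cobj C n) d) (gr (cobj D n) d) (\<Phi> n d) \<and>
        bij_betw (\<Phi> n d) (el (cobj C n) d) (el (cobj D n) d)) \<and>
     (\<forall>n d. \<forall>x\<in>el (cobj C n) d. 1 \<le> n \<longrightarrow>
        \<Phi> n (d + 1) (dif (cobj C n) d x) = dif (cobj D n) d (\<Phi> n d x)) \<and>
     (\<forall>n d \<sigma>. \<forall>x\<in>el (cobj C n) d. 1 \<le> n \<longrightarrow> \<sigma> permutes {..<n} \<longrightarrow>
        \<Phi> n d (cact C n \<sigma> d x) = cact D n \<sigma> d (\<Phi> n d x)) \<and>
     (\<forall>n m i j d e. \<forall>x\<in>el (cobj C n) d. \<forall>y\<in>el (cobj C m) e.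
        3 \<le> n + m \<longrightarrow> i < n \<longrightarrow> j < m \<longrightarrow>
        \<Phi> (n + m - 2) (d + e) (ccomp C n i m j d e x y) =
          ccomp D n i m j d e (\<Phi> n d x) (\<Phi> m e y))"


section \<open>Dioperads\<close>

text \<open>
  Non-unital dioperads \<open>\<P>(r, s)\<close> with \<open>r\<close> outputs and \<open>s\<close> inputs, \<open>r + s \<ge> 1\<close>.
  \<open>dcomp \<P> r s i r' s' j d e x y\<close> joins output \<open>i\<close> of \<open>x \<in> \<P>(r, s)\<close> to input \<open>j\<close> of
  \<open>y \<in> \<P>(r', s')\<close>. The associativity axioms correspond to the directed trees with two
  edges: \<open>x \<rightarrow> y \<rightarrow> z\<close>, \<open>x \<rightarrow> y \<leftarrow> z\<close> and \<open>x \<leftarrow> y \<rightarrow> z\<close>.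
\<close>

record ('k, 'x) dioperad_data =
  dobj :: "nat \<Rightarrow> nat \<Rightarrow> ('k, 'x) dg"
  dact :: "nat \<Rightarrow> nat \<Rightarrow> (nat \<Rightarrow> nat) \<Rightarrow> (nat \<Rightarrow> nat) \<Rightarrow> int \<Rightarrow> 'x \<Rightarrow> 'x"
  dcomp :: "nat \<Rightarrow> nat \<Rightarrow> nat \<Rightarrow> nat \<Rightarrow> nat \<Rightarrow> nat \<Rightarrow> int \<Rightarrow> int \<Rightarrow> 'x \<Rightarrow> 'x \<Rightarrow> 'x"

locale dioperad =
  fixes P :: "('k::field_char_0, 'x) dioperad_data"
  assumes dg: "1 \<le> r + s \<Longrightarrow> dg_vector_space (dobj P r s)"
    and act_linear: "\<lbrakk>1 \<le> r + s; \<sigma> permutes {..<r}; \<tau> permutes {..<s}\<rbrakk> \<Longrightarrow>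
      linear_on (gr (dobj P r s) d) (gr (dobj P r s) d) (dact P r s \<sigma> \<tau> d)"
    and act_dif: "\<lbrakk>1 \<le> r + s; \<sigma> permutes {..<r}; \<tau> permutes {..<s}; x \<in> el (dobj P r s) d\<rbrakk> \<Longrightarrow>
      dact P r s \<sigma> \<tau> (d + 1) (dif (dobj P r s) d x) = dif (dobj P r s) d (dact P r s \<sigma> \<tau> d x)"
    and act_id: "\<lbrakk>1 \<le> r + s; x \<in> el (dobj P r s) d\<rbrakk> \<Longrightarrow> dact P r s id id d x = x"
    and act_comp: "\<lbrakk>1 \<le> r + s; \<sigma> permutes {..<r}; \<tau> permutes {..<s};
        \<sigma>' permutes {..<r}; \<tau>' permutes {..<s}; x \<in> el (dobj P r s) d\<rbrakk> \<Longrightarrow>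
      dact P r s (\<sigma> \<circ> \<sigma>') (\<tau> \<circ> \<tau>') d x = dact P r s \<sigma>' \<tau>' d (dact P r s \<sigma> \<tau> d x)"
    and comp_bilinear: "\<lbrakk>3 \<le> r + s + r' + s'; i < r; j < s'\<rbrakk> \<Longrightarrow>
      bilinear_on (gr (dobj P r s) d) (gr (dobj P r' s') e)
        (gr (dobj P (r + r' - 1) (s + s' - 1)) (d + e)) (dcomp P r s i r' s' j d e)"
    and comp_dif: "\<lbrakk>3 \<le> r + s + r' + s'; i < r; j < s';
        x \<in> el (dobj P r s) d; y \<in> el (dobj P r' s') e\<rbrakk> \<Longrightarrow>
      dif (dobj P (r + r' - 1) (s + s' - 1)) (d + e) (dcomp P r s i r' s' j d e x y) =
        dcomp P r s i r' s' j (d + 1) e (dif (dobj P r s) d x) y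
          \<oplus>\<^bsub>gr (dobj P (r + r' - 1) (s + s' - 1)) (d + e + 1)\<^esub>
        ksign d \<odot>\<^bsub>gr (dobj P (r + r' - 1) (s + s' - 1)) (d + e + 1)\<^esub>
          dcomp P r s i r' s' j d (e + 1) x (dif (dobj P r' s') e y)"
    and equivariance: "\<lbrakk>3 \<le> r + s + r' + s'; i < r; j < s';
        \<sigma> permutes {..<r}; \<tau> permutes {..<s}; \<sigma>' permutes {..<r'}; \<tau>' permutes {..<s'};
        x \<in> el (dobj P r s) d; y \<in> el (dobj P r' s') e\<rbrakk> \<Longrightarrow>
      dcomp P r s i r' s' j d e (dact P r s \<sigma> \<tau> d x) (dact P r' s' \<sigma>' \<tau>' e y) =
        dact P (r + r' - 1) (s + s' - 1)
          (perm_upto (r + r' - 1) (opos r (\<sigma> i) \<circ> map_sum \<sigma> \<sigma>' \<circ> oflag r i))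
          (perm_upto (s + s' - 1) (ipos s (\<tau>' j) \<circ> map_sum \<tau> \<tau>' \<circ> iflag s j)) (d + e)
          (dcomp P r s (\<sigma> i) r' s' (\<tau>' j) d e x y)"
    and assoc_chain: "\<lbrakk>5 \<le> r + s + r' + s' + r'' + s''; i < r; j < s'; k < r'; l < s'';
        x \<in> el (dobj P r s) d; y \<in> el (dobj P r' s') e; z \<in> el (dobj P r'' s'') f\<rbrakk> \<Longrightarrow>
      dcomp P (r + r' - 1) (s + s' - 1) (r - 1 + k) r'' s'' l (d + e) f
          (dcomp P r s i r' s' j d e x y) z =
        dcomp P r s i (r' + r'' - 1) (s' + s'' - 1) j d (e + f) x
          (dcomp P r' s' k r'' s'' l e f y z)"
    and assoc_inputs: "\<lbrakk>5 \<le> r + s + r' + s' + r'' + s''; i < r; j < s'; k < r''; l < s'; j \<noteq> l;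
        x \<in> el (dobj P r s) d; y \<in> el (dobj P r' s') e; z \<in> el (dobj P r'' s'') f\<rbrakk> \<Longrightarrow>
      dcomp P r s i (r'' + r' - 1) (s'' + s' - 1) (s'' + unskip l j) d (f + e) x
          (dcomp P r'' s'' k r' s' l f e z y) =
        ksign (d * f) \<odot>\<^bsub>gr (dobj P (r + r' + r'' - 2) (s + s' + s'' - 2)) (d + e + f)\<^esub>
          dact P (r + r' + r'' - 2) (s + s' + s'' - 2)
            (block_swap 0 (r - 1) (r'' - 1)) (block_swap 0 s s'') (d + e + f)
            (dcomp P r'' s'' k (r + r' - 1) (s + s' - 1) (s + unskip j l) f (d + e) z
              (dcomp P r s i r' s' j d e x y))"
    and assoc_outputs: "\<lbrakk>5 \<le> r + s + r' + s' + r'' + s''; i < r'; j < s; k < r'; l < s''; i \<noteq> k;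
        x \<in> el (dobj P r s) d; y \<in> el (dobj P r' s') e; z \<in> el (dobj P r'' s'') f\<rbrakk> \<Longrightarrow>
      dcomp P (r' + r - 1) (s' + s - 1) (unskip i k) r'' s'' l (e + d) f
          (dcomp P r' s' i r s j e d y x) z =
        ksign (d * f) \<odot>\<^bsub>gr (dobj P (r + r' + r'' - 2) (s + s' + s'' - 2)) (d + e + f)\<^esub>
          dact P (r + r' + r'' - 2) (s + s' + s'' - 2)
            (block_swap (r' - 2) r r'') (block_swap s' (s - 1) (s'' - 1)) (d + e + f)
            (dcomp P (r' + r'' - 1) (s' + s'' - 1) (unskip k i) r s j (e + f) d
              (dcomp P r' s' k r'' s'' l e f y z) x)"


section \<open>The functor from dioperads to cyclic operads\<close>

text \<open>
  A generator \<open>(r, p, \<rho>)\<close> stands for \<open>p \<otimes> \<rho>\<close> in the summand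
  \<open>\<P>(r, s) \<otimes> k[S\<^sub>n]\<close>, \<open>s = n - r\<close>, taken over \<open>k[S\<^sub>r \<times> S\<^sub>s]\<close>. It is the corolla whose flag \<open>l\<close> is the
  flag \<open>\<rho> l\<close> of \<open>p\<close>, where the outputs \<open>0, \<dots>, r - 1\<close> of \<open>p\<close> are followed by
  its inputs \<open>r, \<dots>, r + s - 1\<close>.
\<close>

definition corollas :: "('k, 'x) dioperad_data \<Rightarrow> nat \<Rightarrow> int \<Rightarrow> (nat \<times> 'x \<times> (nat \<Rightarrow> nat)) set" where
  "corollas P n d = {(r, p, \<rho>). r \<le> n \<and> p \<in> el (dobj P r (n - r)) d \<and> \<rho> permutes {..<n}}"

definition corolla_rels ::
    "('k::field_char_0, 'x) dioperad_data \<Rightarrow> nat \<Rightarrow> int \<Rightarrow> (nat \<times> 'x \<times> (nat \<Rightarrow> nat) \<Rightarrow>\<^sub>0 'k) set" where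
  "corolla_rels P n d =
     \<Union>{lin_rels (gr (dobj P r (n - r)) d) (\<lambda>p. (r, p, \<rho>)) | r \<rho>. r \<le> n \<and> \<rho> permutes {..<n}} \<union>
     {Poly_Mapping.single (r, dact P r (n - r) \<sigma> \<tau> d p, \<rho>) 1 -
        Poly_Mapping.single (r, p, block_sum r (n - r) \<sigma> \<tau> \<circ> \<rho>) 1 | r p \<rho> \<sigma> \<tau>.
        (r, p, \<rho>) \<in> corollas P n d \<and> \<sigma> permutes {..<r} \<and> \<tau> permutes {..<n - r}}"

text \<open>
  The position, among all flags of a composite joining output \<open>a\<close> of a corolla in \<open>\<P>(r, s)\<close>
  (\<open>Inl\<close>) to input \<open>b\<close> of one with \<open>r'\<close> outputs (\<open>Inr\<close>), of a flag of either corolla.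
\<close>

definition dpos :: "nat \<Rightarrow> nat \<Rightarrow> nat \<Rightarrow> nat \<Rightarrow> nat \<Rightarrow> nat + nat \<Rightarrow> nat" where
  "dpos r s r' a b = case_sum
     (\<lambda>h. if h < r then opos r a (Inl h) else r + r' - 1 + ipos s b (Inl (h - r)))
     (\<lambda>h. if h < r' then opos r a (Inr h) else r + r' - 1 + ipos s b (Inr (h - r')))"

definition corolla_glue ::
    "('k::field_char_0, 'x) dioperad_data \<Rightarrow> nat \<Rightarrow> nat \<Rightarrow> nat \<Rightarrow> nat \<Rightarrow> int \<Rightarrow> int \<Rightarrow>
     nat \<times> 'x \<times> (nat \<Rightarrow> nat) \<Rightarrow> nat \<times> 'x \<times> (nat \<Rightarrow> nat) \<Rightarrow> (nat \<times> 'x \<times> (nat \<Rightarrow> nat) \<Rightarrow>\<^sub>0 'k)" where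
  "corolla_glue P n i m j d e = (\<lambda>(r, p, \<rho>) (r', q, \<pi>).
     let s = n - r; s' = m - r'; a = \<rho> i; b = \<pi> j in
     if a < r \<and> r' \<le> b then
       Poly_Mapping.single
         (r + r' - 1, dcomp P r s a r' s' (b - r') d e p q,
          perm_upto (n + m - 2) (dpos r s r' a (b - r') \<circ> map_sum \<rho> \<pi> \<circ> cflag n i j)) 1
     else if r \<le> a \<and> b < r' then
       Poly_Mapping.single
         (r + r' - 1, dcomp P r' s' b r s (a - r) e d q p,
          perm_upto (n + m - 2)
            (dpos r' s' r b (a - r) \<circ> case_sum Inr Inl \<circ> map_sum \<rho> \<pi> \<circ> cflag n i j))
         (ksign (d * e))
     else 0)"

definition phi_shriek ::
    "('k::field_char_0, 'x) dioperad_data \<Rightarrow> ('k, (nat \<times> 'x \<times> (nat \<Rightarrow> nat) \<Rightarrow>\<^sub>0 'k) set) cyclic_data"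
    (\<open>\<phi>\<^sub>!\<close>) where
  "\<phi>\<^sub>! P = \<lparr>
     cobj = (\<lambda>n. \<lparr>
       gr = (\<lambda>d. presented (corollas P n d) (corolla_rels P n d)),
       dif = (\<lambda>d. induced (corolla_rels P n (d + 1))
         (\<lambda>(r, p, \<rho>). Poly_Mapping.single (r, dif (dobj P r (n - r)) d p, \<rho>) 1))\<rparr>),
     cact = (\<lambda>n \<sigma> d. induced (corolla_rels P n d)
       (\<lambda>(r, p, \<rho>). Poly_Mapping.single (r, p, \<rho> \<circ> \<sigma>) 1)),
     ccomp = (\<lambda>n i m j d e. induced2 (corolla_rels P (n + m - 2) (d + e))
       (corolla_glue P n i m j d e))\<rparr>"


section \<open>Endomorphism operads\<close>

text \<open>
  \<open>End((n)) = V\<^sup>\<otimes>\<^sup>n\<close>. The sign in the composition comes from moving the letters \<open>w ! i\<close>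
  and \<open>u ! j\<close> next to each other before the form \<open>B\<close> is applied.
\<close>

definition End_cyc ::
    "('k::field_char_0, 'v) dg \<Rightarrow> (int \<Rightarrow> int \<Rightarrow> 'v \<Rightarrow> 'v \<Rightarrow> 'k) \<Rightarrow>
     ('k, ((int \<times> 'v) list \<Rightarrow>\<^sub>0 'k) set) cyclic_data" where
  "End_cyc V B = \<lparr>
     cobj = (\<lambda>n. \<lparr>
       gr = (\<lambda>d. presented (words V n d) (multilin_rels V n d id)),
       dif = (\<lambda>d. induced (multilin_rels V n (d + 1) id) (wdif V))\<rparr>),
     cact = (\<lambda>n \<sigma> d. induced (multilin_rels V n d id)
       (\<lambda>w. Poly_Mapping.single (wperm \<sigma> w) (wsign \<sigma> w))),
     ccomp = (\<lambda>n i m j d e. induced2 (multilin_rels V (n + m - 2) (d + e) id)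
       (\<lambda>w u. Poly_Mapping.single (del_nth i w @ del_nth j u)
         (ksign (fst (w ! i) * wdeg (drop (Suc i) w) + fst (u ! j) * wdeg (take j u)) *
          B (fst (w ! i)) (fst (u ! j)) (snd (w ! i)) (snd (u ! j)))))\<rparr>"

text \<open>
  \<open>End(r, s) = A\<^sup>\<otimes>\<^sup>r \<otimes> (A\<^sup>*)\<^sup>\<otimes>\<^sup>s\<close>; a generator is a pair of words.
\<close>

type_synonym ('k, 'a) di_word = "(int \<times> 'a) list \<times> (int \<times> ('a \<Rightarrow> 'k)) list"

definition di_words :: "('k::field_char_0, 'a) dg \<Rightarrow> nat \<Rightarrow> nat \<Rightarrow> int \<Rightarrow> ('k, 'a) di_word set" where
  "di_words A r s d = {(u, w). \<exists>p q. u \<in> words A r p \<and> w \<in> words (dual A) s q \<and> p + q = d}"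

definition di_rels ::
    "('k::field_char_0, 'a) dg \<Rightarrow> nat \<Rightarrow> nat \<Rightarrow> int \<Rightarrow> (('k, 'a) di_word \<Rightarrow>\<^sub>0 'k) set" where
  "di_rels A r s d =
     \<Union>{multilin_rels A r p (\<lambda>u. (u, w)) | p q w. w \<in> words (dual A) s q \<and> p + q = d} \<union>
     \<Union>{multilin_rels (dual A) s q (\<lambda>w. (u, w)) | p q u. u \<in> words A r p \<and> p + q = d}"

text \<open>
  For the composite of \<open>u \<otimes> w\<close> and \<open>u' \<otimes> w'\<close>, the letter \<open>a = u ! i\<close> is first moved to the right until
  it precedes \<open>\<eta> = w' ! j\<close>, then \<open>a \<otimes> \<eta>\<close> is replaced by its evaluation, and finally the
  remaining letters of \<open>w\<close> and \<open>u'\<close> are interchanged.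
\<close>

definition di_glue ::
    "nat \<Rightarrow> nat \<Rightarrow> ('k::field_char_0, 'a) di_word \<Rightarrow> ('k, 'a) di_word \<Rightarrow> (('k, 'a) di_word \<Rightarrow>\<^sub>0 'k)" where
  "di_glue i j = (\<lambda>(u, w) (u', w').
     let p = fst (u ! i); a = snd (u ! i); q = fst (w' ! j); \<eta> = snd (w' ! j) in
     Poly_Mapping.single (del_nth i u @ u', w @ del_nth j w')
       (ksign (p * (wdeg (drop (Suc i) u) + wdeg w + wdeg u' + wdeg (take j w'))) *
        (if p + q = 0 then ksign (p * q) * \<eta> a else 0) *
        ksign (wdeg w * wdeg u')))"

definition End_di ::
    "('k::field_char_0, 'a) dg \<Rightarrow> ('k, (('k, 'a) di_word \<Rightarrow>\<^sub>0 'k) set) dioperad_data" where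
  "End_di A = \<lparr>
     dobj = (\<lambda>r s. \<lparr>
       gr = (\<lambda>d. presented (di_words A r s d) (di_rels A r s d)),
       dif = (\<lambda>d. induced (di_rels A r s (d + 1)) (\<lambda>(u, w).
         fextend (\<lambda>u'. Poly_Mapping.single (u', w) 1) (wdif A u) +
         fextend (\<lambda>w'. Poly_Mapping.single (u, w') (ksign (wdeg u))) (wdif (dual A) w)))\<rparr>),
     dact = (\<lambda>r s \<sigma> \<tau> d. induced (di_rels A r s d) (\<lambda>(u, w).
       Poly_Mapping.single (wperm \<sigma> u, wperm \<tau> w) (wsign \<sigma> u * wsign \<tau> w))),
     dcomp = (\<lambda>r s i r' s' j d e.
       induced2 (di_rels A (r + r' - 1) (s + s' - 1) (d + e)) (di_glue i j))\<rparr>"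

end

theory Submission
  imports Defs
begin

text \<open>
  Let \<open>D = A \<oplus> A\<^sup>*\<close>. Reading a pair of words as one word identifies
  \<open>End(r, s) = A\<^sup>\<otimes>\<^sup>r \<otimes> (A\<^sup>*)\<^sup>\<otimes>\<^sup>s\<close> with a direct summand of \<open>D\<^sup>\<otimes>\<^sup>r\<^sup>+\<^sup>s\<close>. The form on \<open>D\<close> restricts to
  the evaluation on \<open>A \<otimes> A\<^sup>*\<close>, so that composition in the dioperad is composition in the cyclic
  operad of \<open>D\<close> followed by a block permutation; the axioms of a dioperad are pulled back along
  this embedding \<open>\<iota>\<close>. The isomorphism sends \<open>p \<otimes> \<rho>\<close> to \<open>\<iota>(p)\<rho>\<close>. For its inverse, a word in \<open>D\<close> is
  expanded multilinearly into the words that have letters in \<open>A\<close> at the positions in \<open>S\<close> and letters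
  in \<open>A\<^sup>*\<close> elsewhere, for all sets \<open>S\<close> of positions, and the letters of such a word are moved to the
  order \<open>A\<^sup>\<otimes>\<^sup>r \<otimes> (A\<^sup>*)\<^sup>\<otimes>\<^sup>s\<close>, \<open>r = |S|\<close>. Gluing two outputs or two inputs gives \<open>0\<close> on both sides,
  because \<open>A\<close> and \<open>A\<^sup>*\<close> are isotropic in \<open>D\<close>.
\<close>

section \<open>Presented vector spaces\<close>

text \<open>All objects are quotients of free spaces, and \<open>induced\<close> and
  \<open>induced2\<close> are unions over cosets, so an operation has a meaning only once its map on
  generators respects the relations. For the operations on pairs of words and on corollas this is
  not checked directly. An embedding of presentations reflects relations; hence a map on generators
  that turns into a known map of presentations after the embedding respects the relations too, and
  identities can be tested in tensor powers of D. The device serves twice: for \<iota>, and for the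
  map from corollas to words. Signs then have to be mastered only for words in D, where the Koszul
  sign is a cocycle and deletion of a letter changes it in a controlled way. Two features need care.
  Cyclic composition lists the flags of the second factor after all flags of the first, while a
  dioperad lists outputs before inputs; this is the origin of all block permutations. And a corolla
  is decorated by a coset, so its image depends on a chosen representative and is determined only
  modulo relations. The axioms for \<open>\<phi>\<^sub>!\<close> come last, transported back along
  the bijection.\<close>

definition cls :: "('g \<Rightarrow>\<^sub>0 'k::field) set \<Rightarrow> ('g \<Rightarrow>\<^sub>0 'k) \<Rightarrow> ('g \<Rightarrow>\<^sub>0 'k) set" where
  "cls R x = x +o free.span R"

definition csmult :: "('g \<Rightarrow>\<^sub>0 'k::field) set \<Rightarrow> 'k \<Rightarrow> ('g \<Rightarrow>\<^sub>0 'k) set \<Rightarrow> ('g \<Rightarrow>\<^sub>0 'k) set" where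
  "csmult R c S = fscale c ` S + free.span R"

section \<open>Linear maps between free vector spaces\<close>

definition flin :: "(('g \<Rightarrow>\<^sub>0 'k::field) \<Rightarrow> ('h \<Rightarrow>\<^sub>0 'k)) \<Rightarrow> bool" where
  "flin L \<longleftrightarrow> (\<forall>x y. L (x + y) = L x + L y) \<and> (\<forall>c x. L (fscale c x) = fscale c (L x))"

lemma flinI:
  assumes "\<And>x y. L (x + y) = L x + L y" and "\<And>c x. L (fscale c x) = fscale c (L x)"
  shows "flin L"
  using assms by (simp add: flin_def)

lemma flin_add: "flin L \<Longrightarrow> L (x + y) = L x + L y"
  and flin_scale: "flin L \<Longrightarrow> L (fscale c x) = fscale c (L x)"
  by (simp_all add: flin_def)

lemma flin_0: "flin L \<Longrightarrow> L 0 = 0"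
  using flin_scale[of L 0 0] by simp

lemma flin_uminus: "flin L \<Longrightarrow> L (- x) = - L x"
  using flin_add[of L x "- x"] flin_0[of L] by (simp add: eq_neg_iff_add_eq_0 add.commute)

lemma flin_diff: "flin L \<Longrightarrow> L (x - y) = L x - L y"
  using flin_add[of L x "- y"] flin_uminus[of L y] by simp

lemma flin_sum: "flin L \<Longrightarrow> L (\<Sum>a\<in>A. f a) = (\<Sum>a\<in>A. L (f a))"
  by (induction A rule: infinite_finite_induct) (simp_all add: flin_0 flin_add)

lemma flin_id: "flin (\<lambda>x. x)"
  by (simp add: flin_def)

lemma fscale_single [simp]: "fscale c (Poly_Mapping.single g a) = Poly_Mapping.single g (c * a)"
  by (rule poly_mapping_eqI) (simp add: lookup_single when_def)

lemma flin_fscale: "flin L \<Longrightarrow> flin (\<lambda>x. fscale c (L x))"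
  by (simp add: flin_def free.scale_right_distrib mult.commute)

lemma flin_span:
  assumes "flin L" and "\<And>r. r \<in> R \<Longrightarrow> L r \<in> free.span S" and "x \<in> free.span R"
  shows "L x \<in> free.span S"
  using assms(3)
  by (induction rule: free.span_induct_alt)
    (auto simp: flin_0 flin_add flin_scale assms(1,2) free.span_zero free.span_add free.span_scale)

text \<open>\<open>fextend\<close> sums over the support of its argument, and the support is not
  additive. Over a common finite superset the sums for several vectors can be compared term by
  term.\<close>

lemma fextend_superset:
  assumes "finite A" "Poly_Mapping.keys x \<subseteq> A"
  shows "fextend f x = (\<Sum>g\<in>A. fscale (Poly_Mapping.lookup x g) (f g))"
  unfolding fextend_def using assms
  by (intro sum.mono_neutral_left) (auto simp: in_keys_iff)

lemma flin_fextend: "flin (fextend (f :: 'g \<Rightarrow> ('h \<Rightarrow>\<^sub>0 'k::field)))"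
proof (rule flinI)
  fix x y :: "'g \<Rightarrow>\<^sub>0 'k"
  let ?A = "Poly_Mapping.keys x \<union> Poly_Mapping.keys y"
  have "Poly_Mapping.keys (x + y) \<subseteq> ?A" by (rule Poly_Mapping.keys_add)
  then show "fextend f (x + y) = fextend f x + fextend f y"
    using fextend_superset[of ?A "x + y" f] fextend_superset[of ?A x f] fextend_superset[of ?A y f]
    by (simp add: lookup_add free.scale_left_distrib sum.distrib)
next
  fix c :: 'k and x :: "'g \<Rightarrow>\<^sub>0 'k"
  have "Poly_Mapping.keys (fscale c x) \<subseteq> Poly_Mapping.keys x" by (auto simp: in_keys_iff)
  then show "fextend f (fscale c x) = fscale c (fextend f x)"
    using fextend_superset[of "Poly_Mapping.keys x" "fscale c x" f] fextend_superset[of "Poly_Mapping.keys x" x f]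
    by (simp add: free.scale_sum_right)
qed

lemmas fextend_add = flin_add[OF flin_fextend]
  and fextend_scale = flin_scale[OF flin_fextend]
  and fextend_0 [simp] = flin_0[OF flin_fextend]
  and fextend_diff = flin_diff[OF flin_fextend]
  and fextend_sum = flin_sum[OF flin_fextend]

lemma fextend_single [simp]: "fextend f (Poly_Mapping.single g c) = fscale c (f g)"
  using fextend_superset[of "{g}" "Poly_Mapping.single g c" f] by (simp add: lookup_single)

lemma fextend_fun_add: "fextend (\<lambda>g. f g + h g) x = fextend f x + fextend h x"
  by (simp add: fextend_def free.scale_right_distrib sum.distrib)

lemma fextend_fun_scale: "fextend (\<lambda>g. fscale c (f g)) x = fscale c (fextend f x)"
  by (simp add: fextend_def free.scale_sum_right mult.commute)

lemma flin_fextend_compose: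
  assumes "flin L" shows "L (fextend f x) = fextend (\<lambda>g. L (f g)) x"
  by (simp add: fextend_def flin_sum[OF assms] flin_scale[OF assms])

lemma flin_fextend_fun: "flin (\<lambda>y. fextend (\<lambda>g. fextend (f g) y) x)"
  by (rule flinI) (simp_all add: fextend_add fextend_scale fextend_fun_add fextend_fun_scale)

text \<open>Every vector is the extension of the inclusion of the generators. Rewriting a vector in
  this way and moving a linear map inside the sum is how identities are reduced to
  generators.\<close>

lemma fextend_single_eq: "fextend (\<lambda>g. Poly_Mapping.single g 1) x = x"
proof (rule poly_mapping_eqI)
  fix g
  have "Poly_Mapping.lookup (fextend (\<lambda>g. Poly_Mapping.single g 1) x) g =
      (\<Sum>h\<in>Poly_Mapping.keys x. Poly_Mapping.lookup x h * (1 when h = g))"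
    by (simp add: fextend_def lookup_sum lookup_single mult_when)
  also have "\<dots> = (\<Sum>h\<in>Poly_Mapping.keys x. if h = g then Poly_Mapping.lookup x h else 0)"
    by (intro sum.cong) (auto simp: when_def)
  also have "\<dots> = Poly_Mapping.lookup x g"
    by (simp add: in_keys_iff)
  finally show "Poly_Mapping.lookup (fextend (\<lambda>g. Poly_Mapping.single g 1) x) g = Poly_Mapping.lookup x g" .
qed

section \<open>Cosets of the span of the relations\<close>

lemma cls_eq_iff: "cls R x = cls R y \<longleftrightarrow> x - y \<in> free.span R"
proof
  assume "cls R x = cls R y"
  moreover have "x \<in> cls R x"
    unfolding cls_def using set_plus_intro2[OF free.span_zero, of x R] by simp
  ultimately show "x - y \<in> free.span R"
    by (simp add: cls_def set_minus_plus)
next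
  assume *: "x - y \<in> free.span R"
  have "cls R u \<subseteq> cls R v" if "u - v \<in> free.span R" for u v
  proof
    fix z assume "z \<in> cls R u"
    then have "z - u \<in> free.span R" by (simp add: cls_def set_minus_plus)
    from free.span_add[OF this that] show "z \<in> cls R v"
      by (simp add: cls_def flip: set_minus_plus)
  qed
  from this[OF *] this[of y x] show "cls R x = cls R y"
    using free.span_neg[OF *] by auto
qed

lemma mem_cls: "y \<in> cls R x \<longleftrightarrow> cls R y = cls R x"
  unfolding cls_eq_iff by (simp add: cls_def set_minus_plus)

lemma cls_self: "x \<in> cls R x"
  by (simp add: mem_cls)

lemma cls_eq_0_iff: "cls R x = cls R 0 \<longleftrightarrow> x \<in> free.span R"
  by (simp add: cls_eq_iff)

lemma span_plus_span: "free.span R + free.span R = (free.span R :: ('g \<Rightarrow>\<^sub>0 'k::field) set)"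
proof
  show "free.span R + free.span R \<subseteq> (free.span R :: ('g \<Rightarrow>\<^sub>0 'k) set)"
    by (auto elim!: set_plus_elim intro: free.span_add)
  show "(free.span R :: ('g \<Rightarrow>\<^sub>0 'k) set) \<subseteq> free.span R + free.span R"
    by (rule set_zero_plus2) (rule free.span_zero)
qed

lemma cls_add: "cls R (x + y) = cls R x + cls R y"
  by (simp add: cls_def set_plus_rearrange span_plus_span)

text \<open>Scaling maps a coset into a coset, but for the scalar 0 the image is the single point 0.
  The span added in \<open>csmult\<close> fills it up to a full coset.\<close>

lemma cls_scale: "cls R (fscale c x) = csmult R c (cls R x)"
proof -
  have "fscale c ` cls R x + free.span R = cls R (fscale c x)" (is "?L = ?R")
  proof
    show "?L \<subseteq> ?R"
    proof
      fix z assume "z \<in> ?L"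
      then obtain u v where *: "z = fscale c u + v" "u \<in> cls R x" "v \<in> free.span R"
        by (auto elim!: set_plus_elim)
      then have "u - x \<in> free.span R" by (simp add: cls_def set_minus_plus)
      then have "fscale c (u - x) + v \<in> free.span R"
        using *(3) by (intro free.span_add free.span_scale)
      then show "z \<in> ?R"
        by (simp add: cls_def * free.scale_right_diff_distrib algebra_simps flip: set_minus_plus)
    qed
    show "?R \<subseteq> ?L"
      by (auto simp: cls_def elt_set_plus_def intro!: set_plus_intro imageI
          intro: bexI[of _ 0] free.span_zero)
  qed
  then show ?thesis by (simp add: csmult_def)
qed

lemma cls_cong_add: "cls R x = cls R x' \<Longrightarrow> cls R y = cls R y' \<Longrightarrow> cls R (x + y) = cls R (x' + y')"
  by (simp add: cls_add)

lemma cls_cong_scale: "cls R x = cls R x' \<Longrightarrow> cls R (fscale c x) = cls R (fscale c x')"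
  by (simp add: cls_scale)

lemma cls_cong_sum: "(\<And>a. a \<in> A \<Longrightarrow> cls R (f a) = cls R (g a)) \<Longrightarrow> cls R (sum f A) = cls R (sum g A)"
  by (induction A rule: infinite_finite_induct) (auto intro!: cls_cong_add)

lemma cls_flin:
  assumes "flin L" and "\<And>r. r \<in> R \<Longrightarrow> L r \<in> free.span S" and "cls R x = cls R y"
  shows "cls S (L x) = cls S (L y)"
  using flin_span[OF assms(1,2), where x = "x - y"] assms(1,3) by (simp add: cls_eq_iff flin_diff)

text \<open>Used wherever an identity holds on generators only modulo relations;
  \<open>flin_ext\<close> is the strict version.\<close>

lemma flin_cls_ext:
  assumes "flin L" "flin M" and "\<And>g. g \<in> G \<Longrightarrow> cls R (L (Poly_Mapping.single g 1)) = cls R (M (Poly_Mapping.single g 1))"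
    and "Poly_Mapping.keys x \<subseteq> G"
  shows "cls R (L x) = cls R (M x)"
proof -
  have "cls R (L (fextend (\<lambda>g. Poly_Mapping.single g 1) x)) = cls R (M (fextend (\<lambda>g. Poly_Mapping.single g 1) x))"
    unfolding flin_fextend_compose[OF assms(1)] flin_fextend_compose[OF assms(2)]
    unfolding fextend_def
    using assms(3,4) by (intro cls_cong_sum cls_cong_scale) auto
  then show ?thesis by (simp add: fextend_single_eq)
qed

lemma flin_ext:
  assumes "flin L" "flin M" and "\<And>g. g \<in> Poly_Mapping.keys x \<Longrightarrow> L (Poly_Mapping.single g 1) = M (Poly_Mapping.single g 1)"
  shows "L x = M x"
proof -
  have "L (fextend (\<lambda>g. Poly_Mapping.single g 1) x) = M (fextend (\<lambda>g. Poly_Mapping.single g 1) x)"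
    unfolding flin_fextend_compose[OF assms(1)] flin_fextend_compose[OF assms(2)]
    unfolding fextend_def
    using assms(3) by (intro sum.cong) auto
  then show ?thesis by (simp add: fextend_single_eq)
qed

section \<open>Vectors supported on the generators, and the quotient module\<close>

definition frees :: "'g set \<Rightarrow> ('g \<Rightarrow>\<^sub>0 'k::field) set" where
  "frees G = {x. Poly_Mapping.keys x \<subseteq> G}"

lemma frees_subspace: "free.subspace (frees G :: ('a \<Rightarrow>\<^sub>0 'b::field) set)"
  unfolding frees_def
proof (rule free.subspaceI)
  fix x y :: "'a \<Rightarrow>\<^sub>0 'b" assume "x \<in> {x. Poly_Mapping.keys x \<subseteq> G}" "y \<in> {x. Poly_Mapping.keys x \<subseteq> G}"
  then show "x + y \<in> {x. Poly_Mapping.keys x \<subseteq> G}"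
    using Poly_Mapping.keys_add[of x y] by blast
qed (auto simp: in_keys_iff subset_iff)

lemma frees_add: "x \<in> frees G \<Longrightarrow> y \<in> frees G \<Longrightarrow> x + y \<in> frees G"
  and frees_scale: "x \<in> frees G \<Longrightarrow> fscale c x \<in> frees G"
  and frees_0: "0 \<in> frees G"
  and frees_diff: "x \<in> frees G \<Longrightarrow> y \<in> frees G \<Longrightarrow> x - y \<in> frees G"
  using frees_subspace[of G] by (auto intro: free.subspace_add free.subspace_scale free.subspace_0 free.subspace_diff)

lemma frees_sum: "(\<And>a. a \<in> A \<Longrightarrow> f a \<in> frees G) \<Longrightarrow> sum f A \<in> frees G"
  using frees_subspace[of G] by (intro free.subspace_sum) auto

lemma frees_single: "g \<in> G \<Longrightarrow> Poly_Mapping.single g c \<in> frees G"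
  by (auto simp: frees_def)

lemma frees_fextend: "x \<in> frees G \<Longrightarrow> (\<And>g. g \<in> G \<Longrightarrow> f g \<in> frees H) \<Longrightarrow> fextend f x \<in> frees H"
  unfolding fextend_def by (intro frees_sum frees_scale) (auto simp: frees_def)

lemma presented_simps [simp]:
  "carrier (presented G R) = cls R ` frees G"
  "\<zero>\<^bsub>presented G R\<^esub> = cls R 0"
  "S \<oplus>\<^bsub>presented G R\<^esub> T = S + T"
  "c \<odot>\<^bsub>presented G R\<^esub> S = csmult R c S"
  by (auto simp: presented_def cls_def csmult_def frees_def fun_eq_iff)

lemma kring_simps [simp]:
  "carrier kring = UNIV" "x \<oplus>\<^bsub>kring\<^esub> y = x + y" "x \<otimes>\<^bsub>kring\<^esub> y = x * y" "\<one>\<^bsub>kring\<^esub> = 1" "\<zero>\<^bsub>kring\<^esub> = 0"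
  by (simp_all add: ring_of_type_algebra_def)

lemma presented_module: "Module.module (kring :: 'k::field_char_0 ring) (presented G R)"
proof (rule moduleI)
  show "cring (kring :: 'k ring)" by (rule cring_from_type_algebra)
  show "abelian_group (presented G (R :: ('a \<Rightarrow>\<^sub>0 'k) set))"
  proof (rule abelian_groupI)
    fix S assume "S \<in> carrier (presented G R)"
    then obtain x where x: "x \<in> frees G" "S = cls R x" by auto
    have "cls R (- x) + cls R x = cls R 0" by (simp flip: cls_add)
    moreover have "- x \<in> frees G" using frees_diff[OF frees_0 x(1)] by simp
    ultimately show "\<exists>Y\<in>carrier (presented G R). Y \<oplus>\<^bsub>presented G R\<^esub> S = \<zero>\<^bsub>presented G R\<^esub>"
      using x by auto
  qed (auto simp: ac_simps simp flip: cls_add intro!: imageI frees_add frees_0)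
qed (auto simp: ring_of_type_algebra_def free.scale_right_distrib free.scale_left_distrib
    simp flip: cls_add cls_scale intro!: imageI frees_scale)

section \<open>Maps of presentations and the maps that they induce\<close>

definition presentation :: "'g set \<Rightarrow> ('g \<Rightarrow>\<^sub>0 'k::field) set \<Rightarrow> bool" where
  "presentation G R \<longleftrightarrow> R \<subseteq> frees G"

text \<open>Cosets are taken in the free space on the whole type. Relations that involve only
  generators in \<open>G\<close> keep every representative of an element of the quotient supported
  on \<open>G\<close>, so representatives may be exchanged freely.\<close>

lemma presentation_span: "presentation G R \<Longrightarrow> x \<in> free.span R \<Longrightarrow> x \<in> frees G"
  unfolding presentation_def using free.span_minimal[OF _ frees_subspace] by blast

text \<open>The condition on relations makes the union in \<open>induced\<close> a union of equal
  cosets; the condition on generators makes the induced map land in the target module.\<close>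

definition rel_map ::
  "'g set \<Rightarrow> ('g \<Rightarrow>\<^sub>0 'k::field) set \<Rightarrow> 'h set \<Rightarrow> ('h \<Rightarrow>\<^sub>0 'k) set \<Rightarrow> ('g \<Rightarrow> ('h \<Rightarrow>\<^sub>0 'k)) \<Rightarrow> bool" where
  "rel_map G R H S f \<longleftrightarrow> (\<forall>g\<in>G. f g \<in> frees H) \<and> (\<forall>r\<in>R. fextend f r \<in> free.span S)"

lemma rel_map_frees: "rel_map G R H S f \<Longrightarrow> x \<in> frees G \<Longrightarrow> fextend f x \<in> frees H"
  unfolding rel_map_def by (blast intro: frees_fextend)

lemma rel_map_cls: "rel_map G R H S f \<Longrightarrow> cls R x = cls R y \<Longrightarrow> cls S (fextend f x) = cls S (fextend f y)"
  using cls_flin[OF flin_fextend, of R f S] unfolding rel_map_def by blast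

lemma induced_cls:
  assumes "rel_map G R H S f"
  shows "induced S f (cls R x) = cls S (fextend f x)"
proof -
  have "\<And>y. y \<in> cls R x \<Longrightarrow> cls S (fextend f y) = cls S (fextend f x)"
    using rel_map_cls[OF assms] unfolding mem_cls by blast
  then have "(\<Union>y\<in>cls R x. cls S (fextend f y)) = (\<Union>y\<in>cls R x. cls S (fextend f x))"
    by (intro SUP_cong refl)
  also have "\<dots> = cls S (fextend f x)"
    using cls_self[of x R] by (intro SUP_eq_const) auto
  finally show ?thesis by (simp add: induced_def cls_def)
qed

lemma induced_linear:
  fixes R :: "('g \<Rightarrow>\<^sub>0 'k::field_char_0) set"
  assumes "rel_map G R H S f"
  shows "linear_on (presented G R) (presented H S) (induced S f)"
  unfolding linear_on_def
  by (auto simp: induced_cls[OF assms] fextend_add fextend_scale rel_map_frees[OF assms]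
      simp flip: cls_add cls_scale)

text \<open>Each argument gives a map of presentations when the other is fixed at a generator.
  \<open>presentation\<close> is required on both sides because arguments are replaced one at a
  time, and the intermediate representative must remain supported on its generators.\<close>

definition rel_map2 ::
  "'g set \<Rightarrow> ('g \<Rightarrow>\<^sub>0 'k::field) set \<Rightarrow> 'g' set \<Rightarrow> ('g' \<Rightarrow>\<^sub>0 'k) set \<Rightarrow> 'h set \<Rightarrow> ('h \<Rightarrow>\<^sub>0 'k) set \<Rightarrow>
    ('g \<Rightarrow> 'g' \<Rightarrow> ('h \<Rightarrow>\<^sub>0 'k)) \<Rightarrow> bool" where
  "rel_map2 G R G' R' H S f \<longleftrightarrow> presentation G R \<and> presentation G' R' \<and>
     (\<forall>g\<in>G. rel_map G' R' H S (f g)) \<and> (\<forall>g'\<in>G'. rel_map G R H S (\<lambda>g. f g g'))"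

definition fextend2 :: "('g \<Rightarrow> 'g' \<Rightarrow> ('h \<Rightarrow>\<^sub>0 'k)) \<Rightarrow> ('g \<Rightarrow>\<^sub>0 'k::field) \<Rightarrow> ('g' \<Rightarrow>\<^sub>0 'k) \<Rightarrow> ('h \<Rightarrow>\<^sub>0 'k)" where
  "fextend2 f x y = fextend (\<lambda>g. fextend (f g) y) x"

lemma flin_fextend2_left: "flin (\<lambda>x. fextend2 f x y)"
  unfolding fextend2_def by (rule flin_fextend)

lemma flin_fextend2_right: "flin (fextend2 f x)"
  unfolding fextend2_def by (rule flin_fextend_fun)

lemma fextend2_single [simp]: "fextend2 f (Poly_Mapping.single g c) (Poly_Mapping.single h d) = fscale (c * d) (f g h)"
  by (simp add: fextend2_def)

lemma fextend2_swap: "fextend2 f x y = fextend2 (\<lambda>h g. f g h) y x"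
  unfolding fextend2_def
  by (rule flin_ext[where x = y]) (auto intro: flin_fextend flin_fextend_fun)

lemma rel_map2_frees:
  "rel_map2 G R G' R' H S f \<Longrightarrow> x \<in> frees G \<Longrightarrow> y \<in> frees G' \<Longrightarrow> fextend2 f x y \<in> frees H"
  unfolding fextend2_def rel_map2_def by (auto intro!: frees_fextend[of x G] frees_fextend[of y G'] simp: rel_map_def)

lemma rel_map2_cls_right:
  assumes "rel_map2 G R G' R' H S f" and "x \<in> frees G" and "cls R' y = cls R' y'"
  shows "cls S (fextend2 f x y) = cls S (fextend2 f x y')"
proof -
  have "fextend2 f x r \<in> free.span S" if "r \<in> R'" for r
    unfolding fextend2_def fextend_def[of _ x] using assms(1,2) that
    by (intro free.span_sum free.span_scale) (auto simp: rel_map2_def rel_map_def frees_def)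
  from cls_flin[OF flin_fextend2_right this assms(3)] show ?thesis .
qed

lemma rel_map2_swap: "rel_map2 G R G' R' H S f \<Longrightarrow> rel_map2 G' R' G R H S (\<lambda>h g. f g h)"
  unfolding rel_map2_def by auto

lemma rel_map2_cls:
  assumes "rel_map2 G R G' R' H S f" and "x \<in> frees G" "y \<in> frees G'"
    and "cls R x = cls R x'" "cls R' y = cls R' y'"
  shows "cls S (fextend2 f x y) = cls S (fextend2 f x' y')"
proof -
  \<comment> \<open>Of \<open>x'\<close> it is only known that it represents the same class; its
    support is controlled through the difference, which lies in the span of the relations.\<close>
  have "x' - x \<in> frees G"
    using assms(1,4) presentation_span[of G R "x' - x"] cls_eq_iff[of R x' x] unfolding rel_map2_def by metis
  then have x': "x' \<in> frees G" using frees_add[OF assms(2)] by fastforce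
  have "cls S (fextend2 f x y) = cls S (fextend2 f x' y)"
    using rel_map2_cls_right[OF rel_map2_swap[OF assms(1)] assms(3,4)] by (simp add: fextend2_swap[of f])
  then show ?thesis using rel_map2_cls_right[OF assms(1) x' assms(5)] by simp
qed

lemma induced2_cls:
  assumes "rel_map2 G R G' R' H S f" and "x \<in> frees G" "y \<in> frees G'"
  shows "induced2 S f (cls R x) (cls R' y) = cls S (fextend2 f x y)"
proof -
  have "\<And>x' y'. x' \<in> cls R x \<Longrightarrow> y' \<in> cls R' y \<Longrightarrow> cls S (fextend2 f x' y') = cls S (fextend2 f x y)"
    using rel_map2_cls[OF assms] unfolding mem_cls by metis
  then have "(\<Union>x'\<in>cls R x. \<Union>y'\<in>cls R' y. cls S (fextend2 f x' y')) =
      (\<Union>x'\<in>cls R x. \<Union>y'\<in>cls R' y. cls S (fextend2 f x y))"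
    by (intro SUP_cong refl)
  also have "\<dots> = (\<Union>x'\<in>cls R x. cls S (fextend2 f x y))"
    using cls_self[of y R'] by (intro SUP_cong refl SUP_eq_const) auto
  also have "\<dots> = cls S (fextend2 f x y)"
    using cls_self[of x R] by (intro SUP_eq_const) auto
  finally show ?thesis by (simp add: induced2_def cls_def fextend2_def)
qed

lemma induced2_bilinear:
  fixes R :: "('g \<Rightarrow>\<^sub>0 'k::field_char_0) set"
  assumes "rel_map2 G R G' R' H S f"
  shows "bilinear_on (presented G R) (presented G' R') (presented H S) (induced2 S f)"
  unfolding bilinear_on_def linear_on_def
  by (auto simp: induced2_cls[OF assms] flin_add[OF flin_fextend2_left] flin_scale[OF flin_fextend2_left]
      flin_add[OF flin_fextend2_right] flin_scale[OF flin_fextend2_right] rel_map2_frees[OF assms]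
      frees_add frees_scale simp flip: cls_add cls_scale)

section \<open>Dependence on a module element that is linear modulo relations\<close>

definition lin_mod :: "('k::field, 'v) module \<Rightarrow> ('g \<Rightarrow>\<^sub>0 'k) set \<Rightarrow> ('v \<Rightarrow> ('g \<Rightarrow>\<^sub>0 'k)) \<Rightarrow> bool" where
  "lin_mod M R h \<longleftrightarrow>
     (\<forall>v\<in>carrier M. \<forall>w\<in>carrier M. cls R (h (v \<oplus>\<^bsub>M\<^esub> w)) = cls R (h v + h w)) \<and>
     (\<forall>c. \<forall>v\<in>carrier M. cls R (h (c \<odot>\<^bsub>M\<^esub> v)) = cls R (fscale c (h v)))"

lemma lin_mod_add: "lin_mod M R h \<Longrightarrow> v \<in> carrier M \<Longrightarrow> w \<in> carrier M \<Longrightarrow> cls R (h (v \<oplus>\<^bsub>M\<^esub> w)) = cls R (h v + h w)"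
  and lin_mod_smult: "lin_mod M R h \<Longrightarrow> v \<in> carrier M \<Longrightarrow> cls R (h (c \<odot>\<^bsub>M\<^esub> v)) = cls R (fscale c (h v))"
  by (auto simp: lin_mod_def)

text \<open>Links the two forms of linearity: \<open>lin_rels\<close> lists relations among
  generators, \<open>lin_mod\<close> speaks of a dependence on \<open>v\<close> with values in a
  free space. The second form is stable under sums, linear maps and reparametrization, so
  multilinearity is verified in it.\<close>

lemma lin_mod_fextend_rels:
  assumes "lin_mod M R (\<lambda>v. f (C v))" and "r \<in> lin_rels M C"
  shows "fextend f r \<in> free.span R"
  using assms unfolding lin_mod_def lin_rels_def cls_eq_iff
  by (auto simp: fextend_diff fextend_add simp flip: diff_diff_eq)

lemma lin_mod_single:
  fixes R :: "('g \<Rightarrow>\<^sub>0 'k::field) set"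
  assumes "lin_rels M C \<subseteq> free.span R"
  shows "lin_mod M R (\<lambda>v. Poly_Mapping.single (C v) c)"
proof -
  \<comment> \<open>The coefficient \<open>c\<close> is produced by rescaling every generator, so
    each claim becomes \<open>c\<close> times a listed relation.\<close>
  have "lin_mod M R (\<lambda>v. fextend (\<lambda>g. Poly_Mapping.single g c) (Poly_Mapping.single (C v) 1))"
    unfolding lin_mod_def cls_eq_iff
  proof (intro conjI ballI allI, goal_cases)
    case (1 v w)
    have "Poly_Mapping.single (C (v \<oplus>\<^bsub>M\<^esub> w)) 1 - Poly_Mapping.single (C v) 1 - Poly_Mapping.single (C w) (1::'k) \<in> free.span R"
      using 1 assms unfolding lin_rels_def by blast
    from free.span_scale[OF this, of c] show ?case
      by (simp only: free.scale_right_diff_distrib free.scale_right_distrib diff_diff_eq fscale_single fextend_single mult_1_right mult_1)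
  next
    case (2 a v)
    have "Poly_Mapping.single (C (a \<odot>\<^bsub>M\<^esub> v)) 1 - Poly_Mapping.single (C v) a \<in> free.span R"
      using 2 assms unfolding lin_rels_def by blast
    from free.span_scale[OF this, of c] show ?case
      by (simp only: free.scale_right_diff_distrib fscale_single fextend_single mult_1_right mult_1 mult.commute[of a])
  qed
  then show ?thesis by simp
qed

lemma lin_mod_flin:
  assumes "flin L" and "\<And>r. r \<in> R \<Longrightarrow> L r \<in> free.span S" and "lin_mod M R h"
  shows "lin_mod M S (\<lambda>v. L (h v))"
  unfolding lin_mod_def flin_add[OF assms(1), symmetric] flin_scale[OF assms(1), symmetric]
  using lin_mod_add[OF assms(3)] lin_mod_smult[OF assms(3)]
  by (intro conjI ballI allI cls_flin[OF assms(1,2)]) simp_all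

lemma lin_mod_plus: "lin_mod M R h \<Longrightarrow> lin_mod M R h' \<Longrightarrow> lin_mod M R (\<lambda>v. h v + h' v)"
  unfolding lin_mod_def by (simp add: cls_add free.scale_right_distrib ac_simps)

lemma lin_mod_fscale: "lin_mod M R h \<Longrightarrow> lin_mod M R (\<lambda>v. fscale c (h v))"
  by (rule lin_mod_flin[of "fscale c" R]) (auto intro: flin_fscale flin_id free.span_scale free.span_base)

lemma lin_mod_0: "lin_mod M R (\<lambda>v. 0)"
  by (simp add: lin_mod_def)

lemma lin_mod_sum: "(\<And>a. a \<in> A \<Longrightarrow> lin_mod M R (h a)) \<Longrightarrow> lin_mod M R (\<lambda>v. \<Sum>a\<in>A. h a v)"
  by (induction A rule: infinite_finite_induct) (auto intro: lin_mod_0 lin_mod_plus)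

text \<open>The linear dependence may sit in the coefficient instead of the generator. This is the
  case of a glued letter, which disappears from the word and survives only through the form.\<close>

lemma lin_mod_scalar:
  "linear_on M ground b \<Longrightarrow> lin_mod M R (\<lambda>v. Poly_Mapping.single g (b v))"
  unfolding lin_mod_def linear_on_def by (simp add: ground_def single_add)

lemma lin_mod_compose:
  assumes "linear_on N M f" "lin_mod M R h"
  shows "lin_mod N R (\<lambda>v. h (f v))"
  using assms unfolding lin_mod_def linear_on_def by simp

text \<open>Makes words with a zero letter, and corollas decorated by zero, vanish in the
  quotient.\<close>

lemma lin_mod_zero:
  assumes "lin_mod M R h" "Module.module (kring :: 'k::field_char_0 ring) M"
  shows "cls R (h \<zero>\<^bsub>M\<^esub>) = cls R 0"
proof -
  interpret Module.module kring M by fact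
  have "cls R (h ((0::'k) \<odot>\<^bsub>M\<^esub> \<zero>\<^bsub>M\<^esub>)) = cls R 0"
    using lin_mod_smult[OF assms(1) M.zero_closed, of 0] by simp
  moreover have "(0::'k) \<odot>\<^bsub>M\<^esub> \<zero>\<^bsub>M\<^esub> = \<zero>\<^bsub>M\<^esub>"
    using smult_r_null[of 0] by simp
  ultimately show ?thesis by simp
qed

section \<open>Koszul signs\<close>

lemma ksign_0 [simp]: "ksign 0 = 1"
  and ksign_minus [simp]: "ksign (- a) = ksign a"
  and ksign_add: "ksign (a + b) = (ksign a * ksign b :: 'k::field_char_0)"
  and ksign_square [simp]: "ksign a * ksign a = (1 :: 'k::field_char_0)"
  by (auto simp: ksign_def)

lemma ksign_square_left [simp]: "ksign a * (ksign a * c) = (c :: 'k::field_char_0)"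
  by (auto simp: ksign_def)

lemma ksign_sum: "ksign (\<Sum>a\<in>A. f a) = (\<Prod>a\<in>A. ksign (f a) :: 'k::field_char_0)"
  by (induction A rule: infinite_finite_induct) (simp_all add: ksign_add)

lemma ksign_nonzero [simp]: "ksign a \<noteq> (0 :: 'k::field_char_0)"
  by (auto simp: ksign_def)

section \<open>Positions\<close>

abbreviation pinv :: "('a \<Rightarrow> 'b) \<Rightarrow> 'b \<Rightarrow> 'a" where
  "pinv \<equiv> inv_into UNIV"

lemma skip_neq [simp]: "skip i l \<noteq> i" "i \<noteq> skip i l"
  and unskip_skip [simp]: "unskip i (skip i l) = l"
  and skip_unskip: "l \<noteq> i \<Longrightarrow> skip i (unskip i l) = l"
  and skip_less_skip [simp]: "skip i k < skip i l \<longleftrightarrow> k < l"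
  by (auto simp: skip_def unskip_def split: if_splits)

lemma skip_less: "l < n - 1 \<Longrightarrow> skip i l < n"
  and unskip_less: "l < n \<Longrightarrow> i < n \<Longrightarrow> l \<noteq> i \<Longrightarrow> unskip i l < n - 1"
  by (auto simp: skip_def unskip_def split: if_splits)

lemma bij_betw_skip:
  assumes "i < n" shows "bij_betw (skip i) {..<n - 1} ({..<n} - {i})"
  by (rule bij_betw_byWitness[where f' = "unskip i"])
    (use assms in \<open>auto simp: skip_def unskip_def split: if_splits\<close>)

text \<open>Splits off one position; the remaining summands are numbered in the same way as the
  letters of \<open>del_nth i\<close>.\<close>

lemma sum_skip:
  assumes "i < n" shows "(\<Sum>k<n. f k) = f i + (\<Sum>l<n - 1. f (skip i l) :: 'a::comm_monoid_add)"
proof -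
  have "(\<Sum>k<n. f k) = f i + sum f ({..<n} - {i})"
    using assms by (intro sum.remove) auto
  then show ?thesis using sum.reindex_bij_betw[OF bij_betw_skip[OF assms], of f] by simp
qed

lemma prod_skip:
  assumes "i < n" shows "(\<Prod>k<n. f k) = f i * (\<Prod>l<n - 1. f (skip i l) :: 'a::comm_monoid_mult)"
proof -
  have "(\<Prod>k<n. f k) = f i * prod f ({..<n} - {i})"
    using assms by (intro prod.remove) auto
  then show ?thesis using prod.reindex_bij_betw[OF bij_betw_skip[OF assms], of f] by simp
qed

lemma sum_lessThan_add: "(\<Sum>k<r + (s::nat). f k) = (\<Sum>k<r. f k) + (\<Sum>k<s. f (r + k) :: 'a::comm_monoid_add)"
  by (induction s) (simp_all add: add.assoc)

lemma prod_lessThan_add: "(\<Prod>k<r + (s::nat). f k) = (\<Prod>k<r. f k) * (\<Prod>k<s. f (r + k) :: 'a::comm_monoid_mult)"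
  by (induction s) (simp_all add: mult.assoc)

lemma permutes_lessThan [simp]: "\<sigma> permutes {..<n} \<Longrightarrow> \<sigma> l < n \<longleftrightarrow> l < (n::nat)"
  using permutes_in_image[of \<sigma> "{..<n}" l] by simp

lemma permutes_eq_iff: "\<sigma> permutes A \<Longrightarrow> \<sigma> a = \<sigma> b \<longleftrightarrow> a = b"
  using permutes_inj[of \<sigma> A] by (auto dest: injD)

lemma perm_upto_permutes:
  assumes "inj_on f {..<n}" and "\<And>l. l < n \<Longrightarrow> f l < n"
  shows "perm_upto n f permutes {..<n}"
proof (rule bij_imp_permutes)
  have "f ` {..<n} = {..<n}"
    using assms by (intro endo_inj_surj) auto
  then have "bij_betw f {..<n} {..<n}" using assms(1) by (simp add: bij_betw_def)
  then show "bij_betw (perm_upto n f) {..<n} {..<n}"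
    by (rule bij_betw_cong[THEN iffD1, rotated]) (simp add: perm_upto_def)
qed (simp add: perm_upto_def)

text \<open>The permutation left over when a position and its image are removed: \<open>i\<close> is
  deleted from the source and \<open>\<sigma> i\<close> from the target, and both are renumbered in
  order.\<close>

definition del_perm :: "nat \<Rightarrow> nat \<Rightarrow> (nat \<Rightarrow> nat) \<Rightarrow> nat \<Rightarrow> nat" where
  "del_perm n i \<sigma> = perm_upto (n - 1) (\<lambda>l. unskip (\<sigma> i) (\<sigma> (skip i l)))"

lemma skip_del_perm:
  "\<sigma> permutes {..<n} \<Longrightarrow> l < n - 1 \<Longrightarrow> skip (\<sigma> i) (del_perm n i \<sigma> l) = \<sigma> (skip i l)"
  by (simp add: del_perm_def perm_upto_def skip_unskip permutes_eq_iff)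

lemma del_perm_permutes:
  assumes "\<sigma> permutes {..<n}" "i < n"
  shows "del_perm n i \<sigma> permutes {..<n - 1}"
  unfolding del_perm_def
proof (rule perm_upto_permutes)
  show "inj_on (\<lambda>l. unskip (\<sigma> i) (\<sigma> (skip i l))) {..<n - 1}"
    by (rule inj_onI) (metis assms(1) permutes_eq_iff skip_neq skip_unskip unskip_skip)
  show "\<And>l. l < n - 1 \<Longrightarrow> unskip (\<sigma> i) (\<sigma> (skip i l)) < n - 1"
    using assms by (intro unskip_less) (auto simp: skip_less permutes_eq_iff)
qed

text \<open>A block sum is the identity from \<open>r + s\<close> on, hence equal to its own
  truncation by \<open>perm_upto\<close>; on a finite set injectivity is then enough.\<close>

lemma block_sum_permutes:
  assumes "\<sigma> permutes {..<r}" "\<tau> permutes {..<s}"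
  shows "block_sum r s \<sigma> \<tau> permutes {..<r + s}"
proof -
  have eq: "block_sum r s \<sigma> \<tau> = perm_upto (r + s) (block_sum r s \<sigma> \<tau>)"
    by (auto simp: block_sum_def perm_upto_def fun_eq_iff)
  have "perm_upto (r + s) (block_sum r s \<sigma> \<tau>) permutes {..<r + s}"
  proof (rule perm_upto_permutes)
    show "inj_on (block_sum r s \<sigma> \<tau>) {..<r + s}"
    proof (rule inj_onI)
      fix x y assume *: "x \<in> {..<r + s}" "y \<in> {..<r + s}" "block_sum r s \<sigma> \<tau> x = block_sum r s \<sigma> \<tau> y"
      have "\<And>l. l < r \<Longrightarrow> \<sigma> l < r" using assms by simp
      then show "x = y"
        using * permutes_eq_iff[OF assms(1), of x y] permutes_eq_iff[OF assms(2), of "x - r" "y - r"]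
        by (fastforce simp: block_sum_def split: if_splits)
    qed
    show "\<And>l. l < r + s \<Longrightarrow> block_sum r s \<sigma> \<tau> l < r + s"
      using assms by (auto simp: block_sum_def intro: trans_less_add1)
  qed
  then show ?thesis unfolding eq[symmetric] .
qed

lemma block_swap_permutes:
  assumes "c + p + q \<le> n"
  shows "block_swap c p q permutes {..<n}"
proof -
  have eq: "block_swap c p q = perm_upto n (block_swap c p q)"
    using assms by (auto simp: block_swap_def perm_upto_def fun_eq_iff)
  have "perm_upto n (block_swap c p q) permutes {..<n}"
    using assms by (intro perm_upto_permutes) (auto simp: block_swap_def inj_on_def split: if_splits)
  then show ?thesis unfolding eq[symmetric] .
qed

section \<open>Words\<close>

lemma wdeg_simps [simp]: "wdeg [] = 0" "wdeg (x # w) = fst x + wdeg w" "wdeg (u @ w) = wdeg u + wdeg w"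
  by (simp_all add: wdeg_def)

lemma wdeg_conv_sum: "wdeg w = (\<Sum>k<length w. fst (w ! k))"
  by (simp add: wdeg_def sum_list_sum_nth atLeast0LessThan)

text \<open>Degrees of segments are written as sums over all positions with a condition on the
  index, a form that survives reindexing by permutations and by \<open>skip\<close>.\<close>

lemma wdeg_take: "wdeg (take i w) = (\<Sum>k<length w. if k < i then fst (w ! k) else 0)"
proof -
  have "wdeg (take i w) = (\<Sum>k\<in>{..<length w} \<inter> {k. k < i}. fst (w ! k))"
    unfolding wdeg_conv_sum by (intro sum.cong) auto
  then show ?thesis by (simp add: sum.inter_restrict[of "{..<length w}" _ "{k. k < i}"])
qed

lemma wdeg_take_drop: "wdeg (take i w) + wdeg (drop i w) = wdeg w"
  by (metis append_take_drop_id wdeg_simps(3))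

lemma wdeg_drop: "wdeg (drop i w) = (\<Sum>k<length w. if i \<le> k then fst (w ! k) else 0)"
proof -
  have "wdeg (take i w) + (\<Sum>k<length w. if i \<le> k then fst (w ! k) else 0) = wdeg w"
    unfolding wdeg_take wdeg_conv_sum[of w] sum.distrib[symmetric] by (intro sum.cong) auto
  then show ?thesis using wdeg_take_drop[of i w] by simp
qed

lemma wdeg_Suc_drop: "i < length w \<Longrightarrow> wdeg (take i w) + fst (w ! i) + wdeg (drop (Suc i) w) = wdeg w"
  using wdeg_take_drop[of i w] by (simp add: Cons_nth_drop_Suc[symmetric])

lemma words_iff:
  "w \<in> words V n d \<longleftrightarrow> length w = n \<and> (\<forall>k<n. snd (w ! k) \<in> el V (fst (w ! k))) \<and> wdeg w = d"
  by (auto simp: words_def all_set_conv_all_nth case_prod_unfold)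

lemma wdeg_cong: "map fst w = map fst u \<Longrightarrow> wdeg w = wdeg u"
  by (simp add: wdeg_def)

lemma wdeg_take_cong: "map fst w = map fst u \<Longrightarrow> wdeg (take i w) = wdeg (take i u)"
  and wdeg_drop_cong: "map fst w = map fst u \<Longrightarrow> wdeg (drop i w) = wdeg (drop i u)"
  by (simp_all add: wdeg_def flip: take_map drop_map)

lemma map_fst_update [simp]: "map fst (w[k := (fst (w ! k), v)]) = map fst w"
  by (cases "k < length w") (simp_all add: map_update list_update_same_conv list_update_beyond)

lemma wdeg_update_fst [simp]:
  "wdeg (w[k := (fst (w ! k), v)]) = wdeg w"
  "wdeg (take i (w[k := (fst (w ! k), v)])) = wdeg (take i w)"
  "wdeg (drop i (w[k := (fst (w ! k), v)])) = wdeg (drop i w)"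
  by (rule wdeg_cong wdeg_take_cong wdeg_drop_cong, simp)+

lemma fst_update_nth [simp]: "fst (w[k := (fst (w ! k), v)] ! l) = fst (w ! l)"
  by (cases "k < length w"; cases "l = k") (auto simp: list_update_beyond)

lemma wdeg_update:
  assumes "k < length w"
  shows "wdeg (w[k := (e, v)]) = wdeg w - fst (w ! k) + e"
  using sum_skip[OF assms, of "\<lambda>l. fst (w ! l)"] sum_skip[of k "length w" "\<lambda>l. fst (w[k := (e, v)] ! l)"] assms
  by (simp add: wdeg_conv_sum)

lemma wdeg_take_update:
  assumes "k < length w"
  shows "wdeg (take i (w[k := (e, v)])) = wdeg (take i w) + (if k < i then e - fst (w ! k) else 0)"
  using assms
  by (simp add: wdeg_take sum_skip[OF assms] nth_list_update cong: if_cong)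

lemma wdeg_drop_update:
  assumes "k < length w"
  shows "wdeg (drop i (w[k := (e, v)])) = wdeg (drop i w) + (if i \<le> k then e - fst (w ! k) else 0)"
  using assms
  by (simp add: wdeg_drop sum_skip[OF assms] nth_list_update cong: if_cong)

lemma words_update:
  assumes "w \<in> words V n d" "k < n" "v \<in> el V e"
  shows "w[k := (e, v)] \<in> words V n (d - fst (w ! k) + e)"
  using assms by (auto simp: words_iff wdeg_update nth_list_update)

lemma words_update_fst:
  assumes "w \<in> words V n d" "k < n" "v \<in> el V (fst (w ! k))"
  shows "w[k := (fst (w ! k), v)] \<in> words V n d"
  using words_update[OF assms] by simp

lemma words_append: "u \<in> words V n d \<Longrightarrow> w \<in> words V m e \<Longrightarrow> u @ w \<in> words V (n + m) (d + e)"
  by (auto simp: words_def)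

section \<open>Multilinearity relations as updates of one letter\<close>

lemma multilin_rels_mem:
  assumes "w \<in> words V n d" "k < n" "\<zero>\<^bsub>gr V (fst (w ! k))\<^esub> \<in> el V (fst (w ! k))"
  shows "lin_rels (gr V (fst (w ! k))) (\<lambda>v. C (w[k := (fst (w ! k), v)])) \<subseteq> multilin_rels V n d C"
proof -
  have k: "k < length w" using assms by (simp add: words_iff)
  have *: "w[k := y] = take k w @ y # drop (Suc k) w" for y
    using k by (simp add: upd_conv_take_nth_drop)
  have "take k w @ (fst (w ! k), \<zero>\<^bsub>gr V (fst (w ! k))\<^esub>) # drop (Suc k) w \<in> words V n d"
    using words_update_fst[OF assms] by (simp add: *)
  then show ?thesis unfolding multilin_rels_def * by blast
qed

text \<open>The relations insert a letter between two words, whereas later arguments update the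
  letter at a fixed position, because a position can be followed through deletions and
  permutations.\<close>

lemma multilin_rels_cases:
  assumes "r \<in> multilin_rels V n d C"
  obtains w k where "w \<in> words V n d" "k < n" "r \<in> lin_rels (gr V (fst (w ! k))) (\<lambda>v. C (w[k := (fst (w ! k), v)]))"
proof -
  from assms obtain w1 e w2 where *: "r \<in> lin_rels (gr V e) (\<lambda>v. C (w1 @ (e, v) # w2))"
    "w1 @ (e, \<zero>\<^bsub>gr V e\<^esub>) # w2 \<in> words V n d"
    unfolding multilin_rels_def by blast
  \<comment> \<open>The word with a zero letter serves as base word; its other letters and its
    degrees are those of the relation.\<close>
  then show ?thesis
    by (intro that[of "w1 @ (e, \<zero>\<^bsub>gr V e\<^esub>) # w2" "length w1"]) (auto simp: words_iff)
qed

lemma multilin_rels_fextend: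
  assumes "r \<in> multilin_rels V n d C"
    and "\<And>w k. w \<in> words V n d \<Longrightarrow> k < n \<Longrightarrow>
      lin_mod (gr V (fst (w ! k))) R (\<lambda>v. f (C (w[k := (fst (w ! k), v)])))"
  shows "fextend f r \<in> free.span R"
proof -
  from assms(1) obtain w k where *: "w \<in> words V n d" "k < n"
    "r \<in> lin_rels (gr V (fst (w ! k))) (\<lambda>v. C (w[k := (fst (w ! k), v)]))"
    by (rule multilin_rels_cases)
  from lin_mod_fextend_rels[OF assms(2)[OF *(1,2)] *(3)] show ?thesis .
qed

lemma lin_mod_letter:
  assumes "w \<in> words V n d" "k < n" "\<zero>\<^bsub>gr V (fst (w ! k))\<^esub> \<in> el V (fst (w ! k))"
    and "multilin_rels V n d C \<subseteq> free.span R"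
  shows "lin_mod (gr V (fst (w ! k))) R (\<lambda>v. Poly_Mapping.single (C (w[k := (fst (w ! k), v)])) c)"
  using lin_mod_single[OF order_trans[OF multilin_rels_mem[OF assms(1-3)] assms(4)]] by simp

section \<open>Deleting and permuting letters\<close>

lemma length_del_nth [simp]: "i < length w \<Longrightarrow> length (del_nth i w) = length w - 1"
  by (simp add: del_nth_def)

lemma nth_del_nth: "i < length w \<Longrightarrow> l < length w - 1 \<Longrightarrow> del_nth i w ! l = w ! skip i l"
  by (auto simp: del_nth_def skip_def nth_append)

lemma wdeg_del_nth: "i < length w \<Longrightarrow> wdeg (del_nth i w) = wdeg w - fst (w ! i)"
  using wdeg_Suc_drop[of i w] by (simp add: del_nth_def)

lemma del_nth_words:
  assumes "w \<in> words V n d" "i < n"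
  shows "del_nth i w \<in> words V (n - 1) (d - fst (w ! i))"
  using assms by (auto simp: words_iff wdeg_del_nth nth_del_nth skip_less)

lemma del_nth_update_same [simp]: "del_nth i (w[i := v]) = del_nth i w"
  by (simp add: del_nth_def)

lemma del_nth_update:
  assumes "i < length w" "k < length w" "k \<noteq> i"
  shows "del_nth i (w[k := v]) = (del_nth i w)[unskip i k := v]"
proof (rule nth_equalityI)
  fix l assume "l < length (del_nth i (w[k := v]))"
  moreover have "skip i l = k \<longleftrightarrow> unskip i k = l" using skip_unskip[OF assms(3)] by auto
  moreover have "unskip i k < length w - 1" using assms by (intro unskip_less) auto
  ultimately show "del_nth i (w[k := v]) ! l = (del_nth i w)[unskip i k := v] ! l"
    using assms by (auto simp: nth_del_nth nth_list_update skip_less)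
qed (use assms in simp)

lemma del_nth_append_left: "i < length u \<Longrightarrow> del_nth i (u @ w) = del_nth i u @ w"
  by (simp add: del_nth_def)

lemma del_nth_append_right: "length u = n \<Longrightarrow> del_nth (n + i) (u @ w) = u @ del_nth i w"
  by (auto simp: del_nth_def)

lemma length_wperm [simp]: "length (wperm \<sigma> w) = length w"
  by (simp add: wperm_def)

lemma nth_wperm [simp]: "l < length w \<Longrightarrow> wperm \<sigma> w ! l = w ! \<sigma> l"
  by (simp add: wperm_def)

lemma wdeg_wperm:
  assumes "\<sigma> permutes {..<length w}" shows "wdeg (wperm \<sigma> w) = wdeg w"
  using sum.permute[OF assms, of "\<lambda>k. fst (w ! k)"] by (simp add: wdeg_conv_sum)

lemma wperm_words:
  assumes "w \<in> words V n d" "\<sigma> permutes {..<n}" shows "wperm \<sigma> w \<in> words V n d"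
  using assms wdeg_wperm[of \<sigma> w] by (auto simp: words_iff)

lemma wperm_id [simp]: "wperm id w = w"
  by (rule nth_equalityI) auto

lemma wperm_comp:
  "\<tau> permutes {..<length w} \<Longrightarrow> wperm \<tau> (wperm \<sigma> w) = wperm (\<sigma> \<circ> \<tau>) w"
  by (rule nth_equalityI) auto

lemma wperm_update:
  assumes "\<sigma> permutes {..<length w}"
  shows "wperm \<sigma> (w[k := v]) = (wperm \<sigma> w)[pinv \<sigma> k := v]"
proof (rule nth_equalityI)
  fix l assume l: "l < length (wperm \<sigma> (w[k := v]))"
  have "k = \<sigma> l \<longleftrightarrow> pinv \<sigma> k = l" using permutes_inv_eq[OF assms] by auto
  moreover have "pinv \<sigma> k < length w \<longleftrightarrow> k < length w" using permutes_lessThan[OF permutes_inv[OF assms]] .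
  ultimately show "wperm \<sigma> (w[k := v]) ! l = (wperm \<sigma> w)[pinv \<sigma> k := v] ! l"
    using l assms by (auto simp: nth_list_update)
qed simp

lemma del_nth_wperm:
  assumes "\<sigma> permutes {..<length w}" "i < length w"
  shows "del_nth i (wperm \<sigma> w) = wperm (del_perm (length w) i \<sigma>) (del_nth (\<sigma> i) w)"
proof (rule nth_equalityI)
  fix l assume "l < length (del_nth i (wperm \<sigma> w))"
  then have l: "l < length w - 1" using assms by simp
  have "del_perm (length w) i \<sigma> l < length w - 1"
    using del_perm_permutes[OF assms] l by simp
  then show "del_nth i (wperm \<sigma> w) ! l = wperm (del_perm (length w) i \<sigma>) (del_nth (\<sigma> i) w) ! l"
    using assms l by (simp add: nth_del_nth skip_less skip_del_perm)
qed (use assms in simp)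

lemma wperm_block_sum:
  assumes "length u = r" "length w = s" "\<sigma> permutes {..<r}" "\<tau> permutes {..<s}"
  shows "wperm (block_sum r s \<sigma> \<tau>) (u @ w) = wperm \<sigma> u @ wperm \<tau> w"
  by (rule nth_equalityI) (use assms in \<open>auto simp: block_sum_def nth_append\<close>)

lemma wperm_block_swap:
  assumes "length w1 = c" "length w2 = q" "length w3 = p"
  shows "wperm (block_swap c p q) (w1 @ w2 @ w3 @ w4) = w1 @ w3 @ w2 @ w4"
proof (rule nth_equalityI)
  fix l assume "l < length (wperm (block_swap c p q) (w1 @ w2 @ w3 @ w4))"
  then have "wperm (block_swap c p q) (w1 @ w2 @ w3 @ w4) ! l = (w1 @ w2 @ w3 @ w4) ! block_swap c p q l"
    by simp
  then show "wperm (block_swap c p q) (w1 @ w2 @ w3 @ w4) ! l = (w1 @ w3 @ w2 @ w4) ! l"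
    using assms by (auto simp: block_swap_def nth_append ac_simps)
qed (use assms in simp)

subsection \<open>The sign of a permutation of a word\<close>

text \<open>The factor of a pair of positions is set to 1 if the pair is not inverted. Then
  \<open>wsign\<close> is a product over a full square, which can be split by rows and
  columns.\<close>

definition inv_sign :: "(nat \<Rightarrow> nat) \<Rightarrow> (int \<times> 'v) list \<Rightarrow> nat \<Rightarrow> nat \<Rightarrow> 'k::field_char_0" where
  "inv_sign \<sigma> w k l = (if k < l \<and> \<sigma> l < \<sigma> k then ksign (fst (w ! \<sigma> k) * fst (w ! \<sigma> l)) else 1)"

lemma wsign_conv_prod: "wsign \<sigma> w = (\<Prod>k<length w. \<Prod>l<length w. inv_sign \<sigma> w k l)"
proof -
  have "wsign \<sigma> w = (\<Prod>(k, l)\<in>{(k, l). k < l \<and> l < length w \<and> \<sigma> l < \<sigma> k}. inv_sign \<sigma> w k l)"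
    unfolding wsign_def inv_sign_def by (intro prod.cong) auto
  also have "\<dots> = (\<Prod>(k, l)\<in>{..<length w} \<times> {..<length w}. inv_sign \<sigma> w k l)"
    by (rule prod.mono_neutral_left) (auto simp: inv_sign_def split: if_splits)
  finally show ?thesis by (simp add: prod.cartesian_product)
qed

lemma wsign_cong:
  assumes "map fst w = map fst u" and "\<And>l. l < length w \<Longrightarrow> \<sigma> l = \<tau> l" and "\<sigma> permutes {..<length w}"
  shows "wsign \<sigma> w = wsign \<tau> u"
proof -
  have len: "length w = length u" using arg_cong[OF assms(1), of length] by simp
  have "fst (w ! k) = fst (u ! k)" if "k < length w" for k
    using arg_cong[OF assms(1), of "\<lambda>x. x ! k"] that len by simp
  then show ?thesis
    unfolding wsign_conv_prod inv_sign_def len[symmetric]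
    by (intro prod.cong refl) (use assms in \<open>auto simp flip: assms(2)\<close>)
qed

lemma wsign_id [simp]: "wsign id w = 1"
  unfolding wsign_conv_prod by (intro prod.neutral ballI) (auto simp: inv_sign_def)

text \<open>A permutation acts on unordered pairs. The reindexing maps sort each image pair with
  \<open>min\<close> and \<open>max\<close>, which a symmetric \<open>f\<close> does not
  notice.\<close>

lemma prod_pairs_permute:
  assumes "\<sigma> permutes {..<n::nat}" and sym: "\<And>k l. f k l = f l k"
  shows "(\<Prod>(k, l)\<in>{(k, l). k < l \<and> l < n}. f (\<sigma> k) (\<sigma> l)) = (\<Prod>(k, l)\<in>{(k, l). k < l \<and> l < n}. f k l)"
proof (rule prod.reindex_bij_witness[where
      i = "\<lambda>(k, l). (min (pinv \<sigma> k) (pinv \<sigma> l), max (pinv \<sigma> k) (pinv \<sigma> l))" and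
      j = "\<lambda>(k, l). (min (\<sigma> k) (\<sigma> l), max (\<sigma> k) (\<sigma> l))"], goal_cases)
  case (1 a)
  obtain k l where "a = (k, l)" "k < l" using 1 by auto
  then show ?case using permutes_inverses[OF assms(1)] by (auto simp: min_def max_def)
next
  case (2 a)
  then obtain k l where a: "a = (k, l)" "k < l" "l < n" by auto
  then have "\<sigma> k \<noteq> \<sigma> l" using permutes_eq_iff[OF assms(1)] by simp
  then show ?case using a assms(1) by (auto simp: min_def max_def)
next
  case (3 a)
  obtain k l where "a = (k, l)" "k < l" using 3 by auto
  then show ?case using permutes_inverses[OF assms(1)] by (auto simp: min_def max_def)
next
  case (4 a)
  then obtain k l where a: "a = (k, l)" "k < l" "l < n" by auto
  then have "pinv \<sigma> k \<noteq> pinv \<sigma> l" using permutes_eq_iff[OF permutes_inv[OF assms(1)]] by simp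
  then show ?case using a permutes_inv[OF assms(1)] by (auto simp: min_def max_def)
next
  case (5 a)
  then show ?case using sym by (auto simp: min_def max_def)
qed

lemma wsign_conv_pairs:
  "wsign \<sigma> w = (\<Prod>(k, l)\<in>{(k, l). k < l \<and> l < length w}.
     if \<sigma> l < \<sigma> k then ksign (fst (w ! \<sigma> k) * fst (w ! \<sigma> l)) else 1)"
proof -
  have "finite {(k, l). k < l \<and> l < length w}"
    by (rule finite_subset[of _ "{..<length w} \<times> {..<length w}"]) auto
  then show ?thesis
    unfolding wsign_def by (intro prod.mono_neutral_cong_left) (auto split: if_splits)
qed

text \<open>A pair is inverted by \<open>\<sigma> \<circ> \<tau>\<close> iff exactly one of two
  things happens: \<open>\<tau>\<close> inverts it, or \<open>\<sigma>\<close> inverts its image. If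
  both happen, the two equal signs cancel. Since \<open>f\<close> ignores the order of a pair, the
  product for \<open>\<sigma>\<close> can be reindexed along \<open>\<tau>\<close>.\<close>

lemma wsign_comp:
  fixes w :: "(int \<times> 'v) list"
  assumes "\<sigma> permutes {..<length w}" "\<tau> permutes {..<length w}"
  shows "wsign (\<sigma> \<circ> \<tau>) w = (wsign \<sigma> w * wsign \<tau> (wperm \<sigma> w) :: 'k::field_char_0)"
proof -
  let ?P = "{(k, l). k < l \<and> l < length w}"
  define f :: "nat \<Rightarrow> nat \<Rightarrow> 'k" where
    "f k l = (if (k < l) \<noteq> (\<sigma> k < \<sigma> l) then ksign (fst (w ! \<sigma> k) * fst (w ! \<sigma> l)) else 1)" for k l
  have sym: "f k l = f l k" for k l
    using permutes_eq_iff[OF assms(1), of k l] by (auto simp: f_def mult.commute)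
  have "wsign \<sigma> w = (\<Prod>(k, l)\<in>?P. f k l)"
    unfolding wsign_conv_pairs using permutes_eq_iff[OF assms(1)]
    by (intro prod.cong) (auto simp: f_def)
  also have "\<dots> = (\<Prod>(k, l)\<in>?P. f (\<tau> k) (\<tau> l))"
    using prod_pairs_permute[OF assms(2), of f] sym by simp
  finally have "wsign \<sigma> w * wsign \<tau> (wperm \<sigma> w) = (\<Prod>(k, l)\<in>?P. f (\<tau> k) (\<tau> l) *
      (if \<tau> l < \<tau> k then ksign (fst (w ! \<sigma> (\<tau> k)) * fst (w ! \<sigma> (\<tau> l))) else 1))"
    unfolding wsign_conv_pairs[of \<tau>] by (simp add: case_prod_unfold flip: prod.distrib)
      (intro prod.cong, use assms(2) in auto)
  also have "\<dots> = wsign (\<sigma> \<circ> \<tau>) w"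
    unfolding wsign_conv_pairs
  proof (intro prod.cong refl, clarify)
    fix k l assume "k < l" "l < length w"
    then show "f (\<tau> k) (\<tau> l) * (if \<tau> l < \<tau> k then ksign (fst (w ! \<sigma> (\<tau> k)) * fst (w ! \<sigma> (\<tau> l))) else 1) =
        (if (\<sigma> \<circ> \<tau>) l < (\<sigma> \<circ> \<tau>) k then ksign (fst (w ! (\<sigma> \<circ> \<tau>) k) * fst (w ! (\<sigma> \<circ> \<tau>) l)) else 1)"
      using permutes_eq_iff[OF assms(1), of "\<tau> k" "\<tau> l"] permutes_eq_iff[OF assms(2), of k l]
      by (auto simp: f_def)
  qed
  finally show ?thesis by simp
qed

text \<open>Pairs without \<open>i\<close> give the sign of the remaining permutation. The pair of
  \<open>i\<close> and \<open>k\<close> is inverted iff exactly one of \<open>i < k\<close> and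
  \<open>\<sigma> i < \<sigma> k\<close> holds, so modulo 2 the exponents add up to the degrees to
  the right of the letter in the permuted and in the original word, as if the letter were moved to
  the right end of both.\<close>

lemma wsign_del_nth:
  fixes w :: "(int \<times> 'v) list"
  assumes "\<sigma> permutes {..<length w}" "i < length w"
  shows "wsign \<sigma> w = (wsign (del_perm (length w) i \<sigma>) (del_nth (\<sigma> i) w) *
    ksign (fst (w ! \<sigma> i) * (wdeg (drop (Suc i) (wperm \<sigma> w)) + wdeg (drop (Suc (\<sigma> i)) w))) :: 'k::field_char_0)"
proof -
  let ?n = "length w"
  let ?F = "inv_sign \<sigma> w :: nat \<Rightarrow> nat \<Rightarrow> 'k"
  have "wsign \<sigma> w = (\<Prod>k<?n. ?F k i * (\<Prod>l<?n - 1. ?F k (skip i l)))"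
    unfolding wsign_conv_prod by (intro prod.cong refl prod_skip assms)
  also have "\<dots> = (\<Prod>k<?n. ?F k i) * ((\<Prod>l<?n - 1. ?F i (skip i l)) *
      (\<Prod>k<?n - 1. \<Prod>l<?n - 1. ?F (skip i k) (skip i l)))"
    by (simp only: prod.distrib prod_skip[OF assms(2), of "\<lambda>k. \<Prod>l<?n - 1. ?F k (skip i l)"])
  also have "(\<Prod>k<?n - 1. \<Prod>l<?n - 1. ?F (skip i k) (skip i l)) =
      wsign (del_perm ?n i \<sigma>) (del_nth (\<sigma> i) w)"
  proof -
    have "?F (skip i k) (skip i l) = inv_sign (del_perm ?n i \<sigma>) (del_nth (\<sigma> i) w) k l"
      if "k < ?n - 1" "l < ?n - 1" for k l
    proof -
      have "del_perm ?n i \<sigma> k < ?n - 1" "del_perm ?n i \<sigma> l < ?n - 1"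
        using del_perm_permutes[OF assms] that by simp_all
      moreover have "\<sigma> (skip i l) < \<sigma> (skip i k) \<longleftrightarrow> del_perm ?n i \<sigma> l < del_perm ?n i \<sigma> k"
        using that skip_less_skip[of "\<sigma> i" "del_perm ?n i \<sigma> l" "del_perm ?n i \<sigma> k"]
        by (simp add: skip_del_perm[OF assms(1)])
      ultimately show ?thesis
        using that assms by (simp add: inv_sign_def nth_del_nth skip_del_perm[OF assms(1)])
    qed
    then show ?thesis
      using assms by (simp add: wsign_conv_prod)
  qed
  also have "(\<Prod>k<?n. ?F k i) = (\<Prod>l<?n - 1. ?F (skip i l) i)"
    by (simp add: prod_skip[OF assms(2)]) (simp add: inv_sign_def)
  also have "(\<Prod>l<?n - 1. ?F (skip i l) i) * ((\<Prod>l<?n - 1. ?F i (skip i l)) * c) =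
      c * (\<Prod>l<?n - 1. ?F (skip i l) i * ?F i (skip i l))" for c
    by (simp add: prod.distrib)
  also have "(\<Prod>l<?n - 1. ?F (skip i l) i * ?F i (skip i l)) =
      (\<Prod>k<?n. ?F k i * ?F i k)"
    by (simp add: prod_skip[OF assms(2)]) (simp add: inv_sign_def)
  also have "\<dots> = (\<Prod>k<?n. ksign (fst (w ! \<sigma> i) * ((if i < k then fst (w ! \<sigma> k) else 0) +
      (if \<sigma> i < \<sigma> k then fst (w ! \<sigma> k) else 0))))"
  proof (intro prod.cong refl)
    fix k
    show "?F k i * ?F i k = ksign (fst (w ! \<sigma> i) * ((if i < k then fst (w ! \<sigma> k) else 0) +
      (if \<sigma> i < \<sigma> k then fst (w ! \<sigma> k) else 0)))"
      using permutes_eq_iff[OF assms(1), of i k]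
      by (cases i k rule: linorder_cases; cases "\<sigma> i" "\<sigma> k" rule: linorder_cases)
        (auto simp: inv_sign_def mult.commute ksign_def)
  qed
  also have "\<dots> = ksign (fst (w ! \<sigma> i) * ((\<Sum>k<?n. if i < k then fst (w ! \<sigma> k) else 0) +
      (\<Sum>k<?n. if \<sigma> i < \<sigma> k then fst (w ! \<sigma> k) else 0)))"
    by (simp only: ksign_sum[symmetric] sum_distrib_left[symmetric] sum.distrib)
  also have "(\<Sum>k<?n. if \<sigma> i < \<sigma> k then fst (w ! \<sigma> k) else 0) = (\<Sum>k<?n. if \<sigma> i < k then fst (w ! k) else 0)"
    using sum.permute[OF assms(1), of "\<lambda>k. if \<sigma> i < k then fst (w ! k) else 0"] by simp
  also have "(\<Sum>k<?n. if \<sigma> i < k then fst (w ! k) else 0) = wdeg (drop (Suc (\<sigma> i)) w)"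
    by (simp add: wdeg_drop Suc_le_eq)
  also have "(\<Sum>k<?n. if i < k then fst (w ! \<sigma> k) else 0) = wdeg (drop (Suc i) (wperm \<sigma> w))"
    unfolding wdeg_drop by (intro sum.cong) (auto simp: Suc_le_eq)
  finally show ?thesis .
qed

lemma wsign_block_sum:
  assumes "length u = r" "length w = s" "\<sigma> permutes {..<r}" "\<tau> permutes {..<s}"
  shows "wsign (block_sum r s \<sigma> \<tau>) (u @ w) = wsign \<sigma> u * wsign \<tau> w"
proof -
  let ?F = "inv_sign (block_sum r s \<sigma> \<tau>) (u @ w)"
  have *: "\<And>l. l < r \<Longrightarrow> \<sigma> l < r" using assms(3) by simp
  have 1: "?F k l = inv_sign \<sigma> u k l" if "k < r" "l < r" for k l
    using that assms * by (auto simp: inv_sign_def block_sum_def nth_append)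
  have 2: "?F k (r + l) = 1" if "k < r" "l < s" for k l
    using that *[OF that(1)] by (auto simp: inv_sign_def block_sum_def)
  have 3: "?F (r + k) l = 1" if "k < s" "l < r" for k l
    using that by (auto simp: inv_sign_def block_sum_def)
  have 4: "?F (r + k) (r + l) = inv_sign \<tau> w k l" if "k < s" "l < s" for k l
    using that assms by (auto simp: inv_sign_def block_sum_def nth_append)
  show ?thesis
    using assms(1,2) by (simp add: wsign_conv_prod prod_lessThan_add 1 2 3 4 cong: prod.cong_simp)
qed

text \<open>The inverted pairs are exactly those with one position in each of the exchanged blocks,
  so the exponent is the sum of all products of degrees across the two blocks.\<close>

lemma wsign_block_swap:
  assumes "length w1 = c" "length w2 = q" "length w3 = p"
  shows "wsign (block_swap c p q) (w1 @ w2 @ w3 @ w4) = ksign (wdeg w2 * wdeg w3)"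
proof -
  let ?w = "w1 @ w2 @ w3 @ w4"
  have "{(k, l). k < l \<and> l < length ?w \<and> block_swap c p q l < block_swap c p q k} =
      (\<lambda>(a, b). (c + a, c + p + b)) ` ({..<p} \<times> {..<q})" (is "?L = ?R")
  proof
    show "?L \<subseteq> ?R"
    proof clarify
      fix k l assume "k < l" "l < length ?w" "block_swap c p q l < block_swap c p q k"
      then have "c \<le> k" "k < c + p" "c + p \<le> l" "l < c + p + q"
        by (auto simp: block_swap_def split: if_splits)
      then show "(k, l) \<in> ?R"
        by (intro image_eqI[of _ _ "(k - c, l - (c + p))"]) auto
    qed
    show "?R \<subseteq> ?L" using assms by (auto simp: block_swap_def)
  qed
  then have "wsign (block_swap c p q) ?w = (\<Prod>(k, l)\<in>(\<lambda>(a, b). (c + a, c + p + b)) ` ({..<p} \<times> {..<q}).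
      ksign (fst (?w ! block_swap c p q k) * fst (?w ! block_swap c p q l)))"
    by (simp add: wsign_def)
  also have "\<dots> = (\<Prod>(a, b)\<in>{..<p} \<times> {..<q}. ksign (fst (w3 ! a) * fst (w2 ! b)))"
    by (subst prod.reindex)
      (use assms in \<open>auto simp: inj_on_def block_swap_def nth_append intro!: prod.cong\<close>)
  also have "\<dots> = ksign (\<Sum>(a, b)\<in>{..<p} \<times> {..<q}. fst (w3 ! a) * fst (w2 ! b))"
    by (simp add: ksign_sum case_prod_unfold)
  also have "(\<Sum>(a, b)\<in>{..<p} \<times> {..<q}. fst (w3 ! a) * fst (w2 ! b)) = wdeg w2 * wdeg w3"
    using assms by (simp add: wdeg_conv_sum sum_product flip: sum.cartesian_product)
      (subst sum.swap, simp add: mult.commute)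
  finally show ?thesis .
qed

text \<open>By deletion of the letter, raising its degree by one multiplies the sign by that of the
  degrees to its right before and after the permutation. As the total degree is preserved, these can
  be traded for the degrees to its left, which are the signs in the differential.\<close>

lemma wsign_update:
  assumes "\<sigma> permutes {..<length w}" "k < length w"
  shows "wsign \<sigma> (w[k := (fst (w ! k) + 1, v)]) * ksign (wdeg (take k w)) =
    wsign \<sigma> w * ksign (wdeg (take (pinv \<sigma> k) (wperm \<sigma> w)))"
proof -
  let ?i = "pinv \<sigma> k" and ?w = "w[k := (fst (w ! k) + 1, v)]"
  have i: "?i < length w" "\<sigma> ?i = k"
    using permutes_lessThan[OF permutes_inv[OF assms(1)]] assms permutes_inverses[OF assms(1)] by auto
  have s1: "wsign \<sigma> w = wsign (del_perm (length w) ?i \<sigma>) (del_nth k w) *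
      ksign (fst (w ! k) * (wdeg (drop (Suc ?i) (wperm \<sigma> w)) + wdeg (drop (Suc k) w)))"
    using wsign_del_nth[OF assms(1) i(1)] i(2) by simp
  have "wsign \<sigma> ?w = wsign (del_perm (length w) ?i \<sigma>) (del_nth k w) *
      ksign ((fst (w ! k) + 1) * (wdeg (drop (Suc ?i) (wperm \<sigma> w)) + wdeg (drop (Suc k) w)))"
    using wsign_del_nth[of \<sigma> ?w ?i] i assms wdeg_drop_update[of ?i "wperm \<sigma> w" "Suc ?i"]
      wdeg_drop_update[of k w "Suc k"] by (simp add: wperm_update)
  moreover have "wdeg (take k w) + fst (w ! k) + wdeg (drop (Suc k) w) = 
      wdeg (take ?i (wperm \<sigma> w)) + fst (w ! k) + wdeg (drop (Suc ?i) (wperm \<sigma> w))"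
    using wdeg_Suc_drop[of ?i "wperm \<sigma> w"] wdeg_Suc_drop[OF assms(2)] wdeg_wperm[OF assms(1)] i by simp
  then have "wdeg (take k w) =  wdeg (take ?i (wperm \<sigma> w)) + wdeg (drop (Suc ?i) (wperm \<sigma> w)) - wdeg (drop (Suc k) w)"
    by simp
  ultimately show ?thesis unfolding s1 by (auto simp: ksign_def)
qed

section \<open>The endomorphism cyclic operad of a symmetric form\<close>

declare One_nat_def [simp del]

lemma ksign_diff: "ksign (a - b) = (ksign a * ksign b :: 'k::field_char_0)"
  by (auto simp: ksign_def)

lemma no_less: "0 < n \<Longrightarrow> \<not> n + l - 1 < n - (1::nat)"
  by simp

lemma bilin_ext:
  assumes "\<And>y. flin (\<lambda>x. L x y)" "\<And>x. flin (L x)" "\<And>y. flin (\<lambda>x. M x y)" "\<And>x. flin (M x)"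
    and "\<And>g h. g \<in> G \<Longrightarrow> h \<in> H \<Longrightarrow> L (Poly_Mapping.single g 1) (Poly_Mapping.single h 1) = M (Poly_Mapping.single g 1) (Poly_Mapping.single h 1)"
    and "x \<in> frees G" "y \<in> frees H"
  shows "L x y = M x y"
proof (rule flin_ext[where L = "\<lambda>x. L x y" and M = "\<lambda>x. M x y", OF assms(1,3)])
  fix g assume "g \<in> Poly_Mapping.keys x"
  then have "g \<in> G" using assms(6) by (auto simp: frees_def)
  show "L (Poly_Mapping.single g 1) y = M (Poly_Mapping.single g 1) y"
  proof (rule flin_ext[OF assms(2,4)])
    fix h assume "h \<in> Poly_Mapping.keys y"
    then have "h \<in> H" using assms(7) by (auto simp: frees_def)
    then show "L (Poly_Mapping.single g 1) (Poly_Mapping.single h 1) = M (Poly_Mapping.single g 1) (Poly_Mapping.single h 1)"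
      by (rule assms(5)[OF \<open>g \<in> G\<close>])
  qed
qed

lemmas lin_simps = fextend_add fextend_scale flin_add[OF flin_fextend2_left] flin_scale[OF flin_fextend2_left]
  flin_add[OF flin_fextend2_right] flin_scale[OF flin_fextend2_right] free.scale_right_distrib free.scale_scale ac_simps

lemma fextend2_sum_left: "fextend2 f (\<Sum>a\<in>A. h a) y = (\<Sum>a\<in>A. fextend2 f (h a) y)"
  by (rule flin_sum[OF flin_fextend2_left])

lemma fextend2_sum_right: "fextend2 f x (\<Sum>a\<in>A. h a) = (\<Sum>a\<in>A. fextend2 f x (h a))"
  by (rule flin_sum[OF flin_fextend2_right])

lemma fscale_sum: "fscale c (\<Sum>a\<in>A. h a) = (\<Sum>a\<in>A. fscale c (h a))"
  by (rule free.scale_sum_right)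

lemma lin_rels_frees:
  fixes M :: "('k::field_char_0, 'v) module"
  assumes "Module.module (kring :: 'k ring) M" "\<And>v. v \<in> carrier M \<Longrightarrow> C v \<in> G"
  shows "lin_rels M C \<subseteq> frees G"
proof -
  interpret Module.module kring M by fact
  have "c \<odot>\<^bsub>M\<^esub> v \<in> carrier M" if "v \<in> carrier M" for c v
    using smult_closed[of c v] that by simp
  then show ?thesis
    using assms(2) M.add.m_closed by (auto simp: lin_rels_def intro!: frees_diff frees_single)
qed

lemma linear_on_zero:
  fixes M :: "('k::field_char_0, 'v) module"
  assumes "linear_on M N f" "Module.module (kring :: 'k ring) M" "Module.module (kring :: 'k ring) N"
  shows "f \<zero>\<^bsub>M\<^esub> = \<zero>\<^bsub>N\<^esub>"
proof -
  interpret M: Module.module kring M by fact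
  interpret N: Module.module kring N by fact
  have "(0::'k) \<odot>\<^bsub>M\<^esub> \<zero>\<^bsub>M\<^esub> = \<zero>\<^bsub>M\<^esub>" using M.smult_r_null[of 0] by simp
  then have "f \<zero>\<^bsub>M\<^esub> = (0::'k) \<odot>\<^bsub>N\<^esub> f \<zero>\<^bsub>M\<^esub>"
    using assms(1) M.zero_closed unfolding linear_on_def by metis
  also have "\<dots> = \<zero>\<^bsub>N\<^esub>"
    using assms(1) M.zero_closed N.smult_l_null[of "f \<zero>\<^bsub>M\<^esub>"] unfolding linear_on_def by simp
  finally show ?thesis .
qed

lemma del_nth_del_nth:
  assumes "j < length u" "k < length u" "j \<noteq> k"
  shows "del_nth (unskip j k) (del_nth j u) = del_nth (unskip k j) (del_nth k u)"
proof (rule nth_equalityI)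
  have 1: "unskip j k < length u - 1" "unskip k j < length u - 1"
    using assms by (metis unskip_less)+
  then show "length (del_nth (unskip j k) (del_nth j u)) = length (del_nth (unskip k j) (del_nth k u))"
    using assms by simp
  fix l assume "l < length (del_nth (unskip j k) (del_nth j u))"
  then have l: "l < length u - 1 - 1" using assms 1 by simp
  then have "skip (unskip j k) l < length u - 1" "skip (unskip k j) l < length u - 1"
    by (auto intro: skip_less)
  moreover have "skip j (skip (unskip j k) l) = skip k (skip (unskip k j) l)"
    using assms(3) by (auto simp: skip_def unskip_def)
  ultimately show "del_nth (unskip j k) (del_nth j u) ! l = del_nth (unskip k j) (del_nth k u) ! l"
    using assms l 1 by (simp add: nth_del_nth)
qed

text \<open>\<open>skip j l\<close> is the place of the letter in the original word; the deleted
  letter is subtracted only if it lies on the side that is summed.\<close>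

lemma wdeg_take_del_nth:
  assumes "j < length u" "l < length u - 1"
  shows "wdeg (take l (del_nth j u)) = wdeg (take (skip j l) u) - (if j < skip j l then fst (u ! j) else 0)"
    and "wdeg (drop (Suc l) (del_nth j u)) = wdeg (drop (Suc (skip j l)) u) - (if skip j l < j then fst (u ! j) else 0)"
  using assms
  by (simp_all add: wdeg_take wdeg_drop sum_skip[OF assms(1)] nth_del_nth Suc_le_eq cong: sum.cong_simp if_cong)

section \<open>Action, differential and gluing on the level of words\<close>

definition wact :: "(nat \<Rightarrow> nat) \<Rightarrow> (int \<times> 'v) list \<Rightarrow> ((int \<times> 'v) list \<Rightarrow>\<^sub>0 'k::field_char_0)" where
  "wact \<sigma> w = Poly_Mapping.single (wperm \<sigma> w) (wsign \<sigma> w)"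

lemma wact_comp:
  assumes "\<sigma> permutes {..<length w}" "\<tau> permutes {..<length w}"
  shows "fextend (wact \<tau>) (wact \<sigma> w) = wact (\<sigma> \<circ> \<tau>) w"
  using assms by (simp add: wact_def wsign_comp wperm_comp)

text \<open>The summand that differentiates letter \<open>k\<close> is carried to the summand at
  position \<open>pinv \<sigma> k\<close> of the permuted word; the signs agree by
  \<open>wsign_update\<close>.\<close>

lemma wact_wdif:
  assumes "\<sigma> permutes {..<length w}"
  shows "fextend (wact \<sigma>) (wdif V w) = fextend (wdif V) (wact \<sigma> w :: _ \<Rightarrow>\<^sub>0 'k::field_char_0)"
proof -
  let ?t = "\<lambda>k w. w[k := (fst (w ! k) + 1, dif V (fst (w ! k)) (snd (w ! k)))]"
  let ?g = "\<lambda>l. Poly_Mapping.single (?t l (wperm \<sigma> w)) (wsign \<sigma> w * ksign (wdeg (take l (wperm \<sigma> w))) :: 'k)"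
  have "fextend (wact \<sigma>) (wdif V w) =
      (\<Sum>k<length w. Poly_Mapping.single (wperm \<sigma> (?t k w)) (wsign \<sigma> (?t k w) * ksign (wdeg (take k w))))"
    by (simp add: wdif_def fextend_sum wact_def mult.commute)
  also have "\<dots> = (\<Sum>k<length w. ?g (pinv \<sigma> k))"
    using assms permutes_inverses[OF assms] permutes_lessThan[OF permutes_inv[OF assms]]
    by (intro sum.cong refl arg_cong2[where f = Poly_Mapping.single])
      (simp_all add: wsign_update wperm_update)
  also have "\<dots> = (\<Sum>k<length w. ?g k)"
    using sum.permute[OF permutes_inv[OF assms], of ?g] by (simp add: comp_def)
  also have "\<dots> = fextend (wdif V) (wact \<sigma> w)"
    by (simp add: wdif_def wact_def fscale_sum)
  finally show ?thesis .
qed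

definition wcoef :: "(int \<Rightarrow> int \<Rightarrow> 'v \<Rightarrow> 'v \<Rightarrow> 'k::field_char_0) \<Rightarrow> nat \<Rightarrow> nat \<Rightarrow> (int \<times> 'v) list \<Rightarrow> (int \<times> 'v) list \<Rightarrow> 'k" where
  "wcoef B i j w u =
     ksign (fst (w ! i) * wdeg (drop (Suc i) w) + fst (u ! j) * wdeg (take j u)) *
     B (fst (w ! i)) (fst (u ! j)) (snd (w ! i)) (snd (u ! j))"

definition wglue :: "(int \<Rightarrow> int \<Rightarrow> 'v \<Rightarrow> 'v \<Rightarrow> 'k::field_char_0) \<Rightarrow> nat \<Rightarrow> nat \<Rightarrow> (int \<times> 'v) list \<Rightarrow> (int \<times> 'v) list \<Rightarrow> ((int \<times> 'v) list \<Rightarrow>\<^sub>0 'k)" where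
  "wglue B i j w u = Poly_Mapping.single (del_nth i w @ del_nth j u) (wcoef B i j w u)"

lemma End_cyc_simps:
  "gr (cobj (End_cyc V B) n) d = presented (words V n d) (multilin_rels V n d id)"
  "dif (cobj (End_cyc V B) n) d = induced (multilin_rels V n (d + 1) id) (wdif V)"
  "cact (End_cyc V B) n \<sigma> d = induced (multilin_rels V n d id) (wact \<sigma>)"
  "ccomp (End_cyc V B) n i m j d e = induced2 (multilin_rels V (n + m - 2) (d + e) id) (wglue B i j)"
  by (simp_all add: End_cyc_def wact_def[abs_def] wglue_def[abs_def] wcoef_def)

text \<open>The relabelling of the composite is the block sum of what remains of
  \<open>\<sigma>\<close> and \<open>\<tau>\<close> after deletion of the glued flags. The factors
  by which \<open>wsign\<close> changes under these deletions are exactly the Koszul signs in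
  \<open>wcoef\<close> before and after the permutation.\<close>

lemma wglue_equivariant:
  assumes "length w = n" "length u = m" "\<sigma> permutes {..<n}" "\<tau> permutes {..<m}" "i < n" "j < m"
  shows "fextend2 (wglue B i j) (wact \<sigma> w) (wact \<tau> u) =
    fextend (wact (perm_upto (n + m - 2) (cpos n (\<sigma> i) (\<tau> j) \<circ> map_sum \<sigma> \<tau> \<circ> cflag n i j)))
      (wglue B (\<sigma> i) (\<tau> j) w u :: _ \<Rightarrow>\<^sub>0 'k::field_char_0)"
proof -
  let ?s = "del_perm n i \<sigma>" and ?t = "del_perm m j \<tau>"
  have perms: "?s permutes {..<n - 1}" "?t permutes {..<m - 1}"
    using del_perm_permutes[OF assms(3,5)] del_perm_permutes[OF assms(4,6)] by simp_all
  have \<rho>: "perm_upto (n + m - 2) (cpos n (\<sigma> i) (\<tau> j) \<circ> map_sum \<sigma> \<tau> \<circ> cflag n i j) = block_sum (n - 1) (m - 1) ?s ?t"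
    using assms(5,6) by (auto simp: fun_eq_iff perm_upto_def block_sum_def cpos_def cflag_def del_perm_def)
  have len: "length (del_nth (\<sigma> i) w) = n - 1" "length (del_nth (\<tau> j) u) = m - 1"
    using assms by auto
  \<comment> \<open>\<open>wcoef\<close> uses the degrees to the left of the glued letter of
    \<open>u\<close>. Passing from right to left introduces the total degree twice, hence no
    sign.\<close>
  have 1: "wsign \<tau> u = (wsign ?t (del_nth (\<tau> j) u) *
      ksign (fst (u ! \<tau> j) * (wdeg (take j (wperm \<tau> u)) + wdeg (take (\<tau> j) u))) :: 'k)"
  proof -
    have "wdeg (take j (wperm \<tau> u)) = wdeg u - fst (u ! \<tau> j) - wdeg (drop (Suc j) (wperm \<tau> u))"
      "wdeg (take (\<tau> j) u) = wdeg u - fst (u ! \<tau> j) - wdeg (drop (Suc (\<tau> j)) u)"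
      using wdeg_Suc_drop[of j "wperm \<tau> u"] wdeg_Suc_drop[of "\<tau> j" u] assms wdeg_wperm[of \<tau> u] by auto
    then show ?thesis
      using wsign_del_nth[where 'k = 'k, of \<tau> u j] assms by (auto simp: ksign_def)
  qed
  have 2: "wsign \<sigma> w = (wsign ?s (del_nth (\<sigma> i) w) *
      ksign (fst (w ! \<sigma> i) * (wdeg (drop (Suc i) (wperm \<sigma> w)) + wdeg (drop (Suc (\<sigma> i)) w))) :: 'k)"
    using wsign_del_nth[where 'k = 'k, of \<sigma> w i] assms by simp
  have 3: "del_nth i (wperm \<sigma> w) = wperm ?s (del_nth (\<sigma> i) w)" "del_nth j (wperm \<tau> u) = wperm ?t (del_nth (\<tau> j) u)"
    using assms del_nth_wperm[of \<sigma> w i] del_nth_wperm[of \<tau> u j] by simp_all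
  have "wsign \<sigma> w * wsign \<tau> u * wcoef B i j (wperm \<sigma> w) (wperm \<tau> u) =
      wcoef B (\<sigma> i) (\<tau> j) w u * (wsign ?s (del_nth (\<sigma> i) w) * wsign ?t (del_nth (\<tau> j) u))"
    using assms by (simp add: 1 2 wcoef_def ksign_add distrib_left mult_ac)
  then show ?thesis
    by (simp add: wact_def wglue_def \<rho> 3 wperm_block_sum[OF len perms] wsign_block_sum[OF len perms])
qed

text \<open>Together with linearity, \<open>form_degree\<close> and \<open>form_dif\<close> say that
  the form is a chain map to the ground field placed in degree 0.\<close>

locale dg_form = dg_vector_space V for V :: "('k::field_char_0, 'v) dg" +
  fixes B :: "int \<Rightarrow> int \<Rightarrow> 'v \<Rightarrow> 'v \<Rightarrow> 'k"
  assumes form_linear_left: "b \<in> el V q \<Longrightarrow> linear_on (gr V p) ground (\<lambda>a. B p q a b)"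
    and form_linear_right: "a \<in> el V p \<Longrightarrow> linear_on (gr V q) ground (B p q a)"
    and form_sym: "a \<in> el V p \<Longrightarrow> b \<in> el V q \<Longrightarrow> B p q a b = ksign (p * q) * B q p b a"
    and form_degree: "p + q \<noteq> 0 \<Longrightarrow> B p q a b = 0"
    and form_dif: "a \<in> el V p \<Longrightarrow> b \<in> el V q \<Longrightarrow>
      B (p + 1) q (dif V p a) b + ksign p * B p (q + 1) a (dif V q b) = 0"

section \<open>Multilinearity of the action and of the differential\<close>

context dg_vector_space
begin

lemma zero_closed: "\<zero>\<^bsub>gr V d\<^esub> \<in> el V d"
proof -
  interpret Module.module kring "gr V d" by (rule vector_space)
  show ?thesis by (rule M.zero_closed)
qed

lemma dif_closed: "x \<in> el V d \<Longrightarrow> dif V d x \<in> el V (d + 1)"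
  using dif_linear[of d] unfolding linear_on_def by blast

lemma words_presentation: "presentation (words V n d) (multilin_rels V n d id)"
  unfolding presentation_def
proof
  fix r assume "r \<in> multilin_rels V n d (id :: (int \<times> 'a) list \<Rightarrow> (int \<times> 'a) list)"
  then obtain w k where *: "w \<in> words V n d" "k < n"
    "r \<in> lin_rels (gr V (fst (w ! k))) (\<lambda>v. w[k := (fst (w ! k), v)])"
    by (rule multilin_rels_cases) simp
  then show "r \<in> frees (words V n d)"
    using lin_rels_frees[OF vector_space[of "fst (w ! k)"], of "\<lambda>v. w[k := (fst (w ! k), v)]" "words V n d"]
      words_update_fst[OF *(1,2)] by auto
qed

lemma lin_mod_word:
  assumes "w \<in> words V n d" "k < n" "fst (w ! k) = e"
  shows "lin_mod (gr V e) (multilin_rels V n d id) (\<lambda>v. Poly_Mapping.single (w[k := (e, v)]) c)"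
  using lin_mod_letter[OF assms(1,2) zero_closed, of id "multilin_rels V n d id" c] assms(3)
  by (simp add: free.span_superset)

text \<open>The criterion by which maps on words descend to tensor powers: linearity is checked in
  one letter at a time, with the other letters and all degrees fixed.\<close>

lemma words_rel_mapI:
  assumes "\<And>w. w \<in> words V n d \<Longrightarrow> f w \<in> frees H"
    and "\<And>w k. w \<in> words V n d \<Longrightarrow> k < n \<Longrightarrow>
      lin_mod (gr V (fst (w ! k))) S (\<lambda>v. f (w[k := (fst (w ! k), v)]))"
  shows "rel_map (words V n d) (multilin_rels V n d id) H S f"
  unfolding rel_map_def using assms by (auto intro!: multilin_rels_fextend)

text \<open>Letter \<open>k\<close> reappears at position \<open>pinv \<sigma> k\<close>, and the
  sign depends only on the degrees, which do not change with the letter.\<close>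

lemma wact_rel_map:
  assumes "\<sigma> permutes {..<n}"
  shows "rel_map (words V n d) (multilin_rels V n d id) (words V n d) (multilin_rels V n d id) (wact \<sigma>)"
proof (rule words_rel_mapI)
  fix w assume w: "w \<in> words V n d"
  then show "wact \<sigma> w \<in> frees (words V n d)"
    using assms by (auto simp: wact_def intro!: frees_single wperm_words)
  fix k assume k: "k < n"
  have len: "length w = n" using w by (simp add: words_iff)
  have "pinv \<sigma> k < n" "\<sigma> (pinv \<sigma> k) = k"
    using permutes_lessThan[OF permutes_inv[OF assms]] k permutes_inverses[OF assms] by auto
  then have "lin_mod (gr V (fst (w ! k))) (multilin_rels V n d id)
      (\<lambda>v. Poly_Mapping.single ((wperm \<sigma> w)[pinv \<sigma> k := (fst (w ! k), v)]) (wsign \<sigma> w))"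
    using len by (intro lin_mod_word wperm_words w assms) auto
  moreover have "wact \<sigma> (w[k := (fst (w ! k), v)]) =
      Poly_Mapping.single ((wperm \<sigma> w)[pinv \<sigma> k := (fst (w ! k), v)]) (wsign \<sigma> w :: 'k)" for v
    using assms len by (simp add: wact_def wperm_update wsign_cong[of "w[k := (fst (w ! k), v)]" w \<sigma> \<sigma>])
  ultimately show "lin_mod (gr V (fst (w ! k))) (multilin_rels V n d id)
      (\<lambda>v. wact \<sigma> (w[k := (fst (w ! k), v)]))" by simp
qed

lemma wdif_word: 
  assumes "w \<in> words V n d" "k < n"
  shows "w[k := (fst (w ! k) + 1, dif V (fst (w ! k)) (snd (w ! k)))] \<in> words V n (d + 1)"
  using words_update[OF assms, of "dif V (fst (w ! k)) (snd (w ! k))" "fst (w ! k) + 1"] assms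
  by (simp add: words_iff dif_closed)

lemma wdif_rel_map:
  "rel_map (words V n d) (multilin_rels V n d id) (words V n (d + 1)) (multilin_rels V n (d + 1) id) (wdif V)"
proof (rule words_rel_mapI)
  fix w assume w: "w \<in> words V n d"
  then have len: "length w = n" by (simp add: words_iff)
  show "wdif V w \<in> frees (words V n (d + 1))"
    unfolding wdif_def using wdif_word[OF w] len by (intro frees_sum frees_single) auto
  fix k assume k: "k < n"
  let ?e = "fst (w ! k)" and ?R = "multilin_rels V n (d + 1) id"
  show "lin_mod (gr V ?e) ?R (\<lambda>v. wdif V (w[k := (?e, v)]))"
    unfolding wdif_def length_list_update
  proof (rule lin_mod_sum)
    fix i assume "i \<in> {..<length w}"
    then have i: "i < n" using len by simp
    show "lin_mod (gr V ?e) ?R (\<lambda>v. Poly_Mapping.single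
        ((w[k := (?e, v)])[i := (fst (w[k := (?e, v)] ! i) + 1, dif V (fst (w[k := (?e, v)] ! i)) (snd (w[k := (?e, v)] ! i)))])
        (ksign (wdeg (take i (w[k := (?e, v)])))))"
    \<comment> \<open>If the varied letter is the one being differentiated, linearity comes from the
      differential itself; otherwise the two updates commute.\<close>
    proof (cases "i = k")
      case True
      let ?w = "w[k := (?e + 1, dif V ?e (snd (w ! k)))]"
      have "lin_mod (gr V (?e + 1)) ?R (\<lambda>v. Poly_Mapping.single (?w[k := (?e + 1, v)]) (ksign (wdeg (take k w))))"
        using k len by (intro lin_mod_word wdif_word w k) auto
      from lin_mod_compose[OF dif_linear this] show ?thesis
        using True k len by simp
    next
      case False
      let ?w = "w[i := (fst (w ! i) + 1, dif V (fst (w ! i)) (snd (w ! i)))]"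
      have "lin_mod (gr V ?e) ?R (\<lambda>v. Poly_Mapping.single (?w[k := (?e, v)]) (ksign (wdeg (take i w))))"
        using i k len False by (intro lin_mod_word wdif_word w) auto
      then show ?thesis using False by (simp add: list_update_swap[of k i])
    qed
  qed
qed

text \<open>Differentiating two different letters in the two possible orders gives opposite signs;
  differentiating one letter twice produces a zero letter.\<close>

lemma wdif_wdif:
  assumes w: "w \<in> words V n d"
  shows "cls (multilin_rels V n (d + 2) id) (fextend (wdif V) (wdif V w)) = cls (multilin_rels V n (d + 2) id) 0"
proof -
  have len: "length w = n" using w by (simp add: words_iff)
  let ?t = "\<lambda>k w. w[k := (fst (w ! k) + 1, dif V (fst (w ! k)) (snd (w ! k)))]"
  let ?R = "multilin_rels V n (d + 2) id"
  define F where "F i k = Poly_Mapping.single (?t k (?t i w)) (ksign (wdeg (take i w)) * ksign (wdeg (take k (?t i w))) :: 'k)" for i k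
  have S: "fextend (wdif V) (wdif V w) = (\<Sum>i<n. \<Sum>k<n. F i k)"
    by (simp add: wdif_def fextend_sum fscale_sum len F_def)
  have anti: "F i k + F k i = 0" if "i < n" "k < n" "i \<noteq> k" for i k
  proof -
    have "ksign (wdeg (take i w)) * ksign (wdeg (take k (?t i w))) =
        - (ksign (wdeg (take k w)) * ksign (wdeg (take i (?t k w))) :: 'k)"
      using that len by (auto simp: wdeg_take_update ksign_add ksign_def)
    moreover have "?t k (?t i w) = ?t i (?t k w)"
      using that len by (simp add: list_update_swap[of k i])
    ultimately show ?thesis unfolding F_def by (simp flip: single_add)
  qed
  have diag: "cls ?R (F i i) = cls ?R 0" if i: "i < n" for i
  proof -
    let ?e = "fst (w ! i)"
    have v: "snd (w ! i) \<in> el V ?e" using w i by (simp add: words_iff)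
    have "?t i (?t i w) \<in> words V n (d + 1 + 1)" by (rule wdif_word[OF wdif_word[OF w i] i])
    then have "?t i (?t i w) \<in> words V n (d + 2)" by (simp add: add.assoc)
    from lin_mod_zero[OF lin_mod_word[OF this i refl] vector_space] show ?thesis
      using i len dif_dif[OF v] by (simp add: F_def add.assoc)
  qed
  \<comment> \<open>One copy of the double sum is transposed, so that opposite terms meet without an
    ordering of the indices. The result is twice the desired sum, and characteristic 0 allows
    halving it.\<close>
  have "(\<Sum>i<n. \<Sum>k<n. F i k) + (\<Sum>i<n. \<Sum>k<n. F i k) = (\<Sum>i<n. \<Sum>k<n. F i k + F k i)"
    by (subst (2) sum.swap) (simp add: sum.distrib)
  also have "\<dots> = (\<Sum>i<n. \<Sum>k<n. if k = i then F i i + F i i else 0)"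
    by (intro sum.cong refl) (use anti in auto)
  also have "\<dots> = (\<Sum>i<n. F i i + F i i)" by simp
  finally have "cls ?R ((\<Sum>i<n. \<Sum>k<n. F i k) + (\<Sum>i<n. \<Sum>k<n. F i k)) = cls ?R (\<Sum>i<n. F i i + F i i)"
    by simp
  also have "\<dots> = cls ?R (\<Sum>i<n. 0 + 0)"
    by (intro cls_cong_sum cls_cong_add diag) auto
  finally have *: "cls ?R ((\<Sum>i<n. \<Sum>k<n. F i k) + (\<Sum>i<n. \<Sum>k<n. F i k)) = cls ?R 0"
    by simp
  have "(\<Sum>i<n. \<Sum>k<n. F i k) = fscale (1/2) ((\<Sum>i<n. \<Sum>k<n. F i k) + (\<Sum>i<n. \<Sum>k<n. F i k))"
    by (rule poly_mapping_eqI) (simp add: lookup_add)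
  then show ?thesis using cls_cong_scale[OF *, of "1/2"] by (simp add: S)
qed

end

section \<open>Gluing two words along the form\<close>

context dg_form
begin

abbreviation rels :: "nat \<Rightarrow> int \<Rightarrow> ((int \<times> 'v) list \<Rightarrow>\<^sub>0 'k) set" where
  "rels n d \<equiv> multilin_rels V n d id"

lemma wcoef_eq_0: "fst (w ! i) + fst (u ! j) \<noteq> 0 \<Longrightarrow> wcoef B i j w u = 0"
  by (simp add: wcoef_def form_degree)

lemma wglue_words:
  assumes "w \<in> words V n d" "u \<in> words V m e" "i < n" "j < m" "fst (w ! i) + fst (u ! j) = 0"
  shows "del_nth i w @ del_nth j u \<in> words V (n + m - 2) (d + e)"
proof -
  have *: "(n - 1) + (m - 1) = n + m - 2" "d - fst (w ! i) + (e - fst (u ! j)) = d + e"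
    using assms by linarith+
  show ?thesis using words_append[OF del_nth_words del_nth_words, OF assms(1,3,2,4)] unfolding * .
qed

text \<open>If the degrees of the glued letters do not add up to 0, everything vanishes. Otherwise
  the varied letter is either the glued one, and enters linearly through the form, or it survives in
  the composite word at its renumbered position.\<close>

lemma wglue_lin_left:
  assumes w: "w \<in> words V n d" and u: "u \<in> words V m e" and "i < n" "j < m" "k < n"
  shows "lin_mod (gr V (fst (w ! k))) (rels (n + m - 2) (d + e)) (\<lambda>v. wglue B i j (w[k := (fst (w ! k), v)]) u)"
proof -
  have len: "length w = n" "length u = m" using w u by (auto simp: words_iff)
  consider "fst (w ! i) + fst (u ! j) \<noteq> 0" | "k = i" | "fst (w ! i) + fst (u ! j) = 0" "k \<noteq> i" by blast
  then show ?thesis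
  proof cases
    case 1
    then show ?thesis by (simp add: wglue_def wcoef_eq_0 lin_mod_0)
  next
    case 2
    let ?s = "ksign (fst (w ! i) * wdeg (drop (Suc i) w) + fst (u ! j) * wdeg (take j u))"
    have "snd (u ! j) \<in> el V (fst (u ! j))" using u assms by (simp add: words_iff)
    from lin_mod_fscale[OF lin_mod_scalar[OF form_linear_left[OF this]], where c = ?s]
    show ?thesis using 2 assms len by (simp add: wglue_def wcoef_def)
  next
    case 3
    have "unskip i k < n - 1" using assms 3 by (intro unskip_less) auto
    moreover have "(del_nth i w @ del_nth j u) ! unskip i k = w ! k"
      using assms 3 len \<open>unskip i k < n - 1\<close> by (simp add: nth_append nth_del_nth skip_unskip)
    ultimately have "lin_mod (gr V (fst (w ! k))) (rels (n + m - 2) (d + e))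
       (\<lambda>v. Poly_Mapping.single ((del_nth i w @ del_nth j u)[unskip i k := (fst (w ! k), v)]) (wcoef B i j w u))"
      using assms 3 by (intro lin_mod_word wglue_words) auto
    moreover have "wglue B i j (w[k := (fst (w ! k), v)]) u =
        Poly_Mapping.single ((del_nth i w @ del_nth j u)[unskip i k := (fst (w ! k), v)]) (wcoef B i j w u)" for v
      using assms 3 len \<open>unskip i k < n - 1\<close>
      by (simp add: wglue_def del_nth_update list_update_append wcoef_def)
    ultimately show ?thesis by simp
  qed
qed

lemma wglue_lin_right:
  assumes w: "w \<in> words V n d" and u: "u \<in> words V m e" and "i < n" "j < m" "k < m"
  shows "lin_mod (gr V (fst (u ! k))) (rels (n + m - 2) (d + e)) (\<lambda>v. wglue B i j w (u[k := (fst (u ! k), v)]))"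
proof -
  have len: "length w = n" "length u = m" using w u by (auto simp: words_iff)
  consider "fst (w ! i) + fst (u ! j) \<noteq> 0" | "k = j" | "fst (w ! i) + fst (u ! j) = 0" "k \<noteq> j" by blast
  then show ?thesis
  proof cases
    case 1
    then show ?thesis by (simp add: wglue_def wcoef_eq_0 lin_mod_0)
  next
    case 2
    let ?s = "ksign (fst (w ! i) * wdeg (drop (Suc i) w) + fst (u ! j) * wdeg (take j u))"
    have "snd (w ! i) \<in> el V (fst (w ! i))" using w assms by (simp add: words_iff)
    from lin_mod_fscale[OF lin_mod_scalar[OF form_linear_right[OF this]], where c = ?s]
    show ?thesis using 2 assms len by (simp add: wglue_def wcoef_def)
  next
    case 3
    have k': "unskip j k < m - 1" using assms 3 by (intro unskip_less) auto
    moreover have "(del_nth i w @ del_nth j u) ! (n - 1 + unskip j k) = u ! k"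
      using assms 3 len k' no_less[of n] by (simp add: nth_append nth_del_nth skip_unskip)
    ultimately have "lin_mod (gr V (fst (u ! k))) (rels (n + m - 2) (d + e))
       (\<lambda>v. Poly_Mapping.single ((del_nth i w @ del_nth j u)[n - 1 + unskip j k := (fst (u ! k), v)]) (wcoef B i j w u))"
      using assms 3 by (intro lin_mod_word wglue_words) auto
    moreover have "wglue B i j w (u[k := (fst (u ! k), v)]) =
        Poly_Mapping.single ((del_nth i w @ del_nth j u)[n - 1 + unskip j k := (fst (u ! k), v)]) (wcoef B i j w u)" for v
      using assms 3 len k' no_less[of n]
      by (simp add: wglue_def del_nth_update list_update_append wcoef_def)
    ultimately show ?thesis by simp
  qed
qed

lemma wglue_rel_map2:
  assumes "i < n" "j < m"
  shows "rel_map2 (words V n d) (rels n d) (words V m e) (rels m e) (words V (n + m - 2) (d + e)) (rels (n + m - 2) (d + e)) (wglue B i j)"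
proof -
  have "wglue B i j w u \<in> frees (words V (n + m - 2) (d + e))" if "w \<in> words V n d" "u \<in> words V m e" for w u
    using wglue_words[OF that assms] wcoef_eq_0[of w i u j]
    by (cases "fst (w ! i) + fst (u ! j) = 0") (auto simp: wglue_def intro: frees_single frees_0)
  then show ?thesis
    unfolding rel_map2_def using assms
    by (auto intro!: words_presentation words_rel_mapI wglue_lin_left wglue_lin_right)
qed

text \<open>The surviving letters contribute equal terms on both sides, matched by
  \<open>skip\<close>. The two remaining terms on the right differentiate the glued letters and
  cancel because the form is a chain map.\<close>

lemma wglue_dif:
  assumes w: "w \<in> words V n d" and u: "u \<in> words V m e" and ij: "i < n" "j < m"
  shows "fextend (wdif V) (wglue B i j w u) =
    fextend2 (wglue B i j) (wdif V w) (Poly_Mapping.single u 1) +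
    fscale (ksign d) (fextend2 (wglue B i j) (Poly_Mapping.single w 1) (wdif V u))"
proof -
  have len: "length w = n" "length u = m" and d: "wdeg w = d" using w u by (auto simp: words_iff)
  let ?t = "\<lambda>k w. w[k := (fst (w ! k) + 1, dif V (fst (w ! k)) (snd (w ! k)))]"
  let ?p = "fst (w ! i)" and ?q = "fst (u ! j)" and ?c = "wcoef B i j w u"
  let ?D = "del_nth i w @ del_nth j u"
  let ?L = "\<lambda>l. Poly_Mapping.single (?t l ?D) (?c * ksign (wdeg (take l ?D)))"
  let ?F1 = "\<lambda>k. fscale (ksign (wdeg (take k w))) (wglue B i j (?t k w) u)"
  let ?F2 = "\<lambda>k. fscale (ksign (d + wdeg (take k u))) (wglue B i j w (?t k u))"
  have "fextend (wdif V) (wglue B i j w u) = (\<Sum>l<(n - 1) + (m - 1). ?L l)"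
    using len ij by (simp add: wglue_def wdif_def fscale_sum)
  then have L: "fextend (wdif V) (wglue B i j w u) = (\<Sum>l<n - 1. ?L l) + (\<Sum>l<m - 1. ?L (n - 1 + l))"
    by (simp only: sum_lessThan_add)
  have R1: "fextend2 (wglue B i j) (wdif V w) (Poly_Mapping.single u 1) = ?F1 i + (\<Sum>l<n - 1. ?F1 (skip i l))"
    using sum_skip[OF ij(1), of ?F1] by (simp add: wdif_def fextend2_sum_left len)
  have R2: "fscale (ksign d) (fextend2 (wglue B i j) (Poly_Mapping.single w 1) (wdif V u)) = ?F2 j + (\<Sum>l<m - 1. ?F2 (skip j l))"
    using sum_skip[OF ij(2), of ?F2] by (simp add: wdif_def fextend2_sum_right len fscale_sum ksign_add)
  have 1: "?L l = ?F1 (skip i l)" if l: "l < n - 1" for l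
  proof -
    have "skip i l < n" using l by (rule skip_less)
    then show ?thesis
      using l len ij wdeg_take_del_nth(1)[of i w l]
      by (simp add: wglue_def wcoef_def del_nth_update nth_append nth_del_nth list_update_append
          wdeg_drop_update distrib_left ksign_add ksign_diff Suc_le_eq mult_ac)
  qed
  \<comment> \<open>The letters before this one now include \<open>w\<close> without its glued
    letter. The form vanishes unless \<open>?p + ?q = 0\<close>, so the missing degree
    \<open>?p\<close> is matched by \<open>?q\<close>, which is either missing as well or enters
    through the changed sign in \<open>wcoef\<close>.\<close>
  have 2: "?L (n - 1 + l) = ?F2 (skip j l)" if l: "l < m - 1" for l
  proof -
    have sk: "skip j l < m" using l by (rule skip_less)
    have cc: "wcoef B i j w (?t (skip j l) u) = ?c * (if skip j l < j then ksign ?q else 1)"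
      using sk len by (simp add: wcoef_def wdeg_take_update distrib_left ksign_add)
    have "?c * ksign (wdeg (take (n - 1 + l) ?D)) =
        ksign (d + wdeg (take (skip j l) u)) * wcoef B i j w (?t (skip j l) u)"
    proof (cases "?p + ?q = 0")
      case True
      then have p: "?p = - ?q" by simp
      have "wdeg (take (n - 1 + l) ?D) = d - ?p + (wdeg (take (skip j l) u) - (if j < skip j l then ?q else 0))"
        using l len ij wdeg_take_del_nth(1)[of j u l] d by (simp add: wdeg_del_nth)
      then show ?thesis
        using skip_neq[of j l] unfolding cc p by (auto simp: ksign_add ksign_diff)
    next
      case False
      then show ?thesis by (simp add: cc wcoef_eq_0)
    qed
    then show ?thesis
      using l len ij sk no_less[of n]
      by (simp add: wglue_def del_nth_update nth_append nth_del_nth list_update_append)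
  qed
  \<comment> \<open>Splitting \<open>d\<close> into the degrees before, at and after position
    \<open>i\<close> leaves exactly the sign \<open>ksign ?p\<close> of \<open>form_dif\<close>
    between the two terms.\<close>
  have 3: "?F1 i + ?F2 j = 0"
  proof -
    have "B (?p + 1) ?q (dif V ?p (snd (w ! i))) (snd (u ! j)) = - ksign ?p * B ?p (?q + 1) (snd (w ! i)) (dif V ?q (snd (u ! j)))"
      using form_dif[of "snd (w ! i)" ?p "snd (u ! j)" ?q] w u ij by (simp add: words_iff eq_neg_iff_add_eq_0)
    moreover have "d = wdeg (take i w) + ?p + wdeg (drop (Suc i) w)"
      using wdeg_Suc_drop[of i w] len ij d by simp
    ultimately have "ksign (wdeg (take i w)) * wcoef B i j (?t i w) u + ksign (d + wdeg (take j u)) * wcoef B i j w (?t j u) = 0"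
      using len ij by (simp add: wcoef_def wdeg_drop_update wdeg_take_update ksign_add distrib_right distrib_left mult_ac)
    then show ?thesis by (simp add: wglue_def flip: single_add)
  qed
  have "fextend2 (wglue B i j) (wdif V w) (Poly_Mapping.single u 1) +
      fscale (ksign d) (fextend2 (wglue B i j) (Poly_Mapping.single w 1) (wdif V u)) =
      (?F1 i + ?F2 j) + ((\<Sum>l<n - 1. ?F1 (skip i l)) + (\<Sum>l<m - 1. ?F2 (skip j l)))"
    unfolding R1 R2 by (simp only: add_ac)
  then show ?thesis unfolding L 3 using 1 2 by simp
qed

text \<open>The relabelling exchanges the two blocks of remaining letters. For glued letters of
  opposite degrees graded symmetry contributes \<open>ksign\<close> of one of these degrees, and
  then the signs combine to that of exchanging the whole words.\<close>

lemma wglue_symmetric: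
  assumes w: "w \<in> words V n d" and u: "u \<in> words V m e" and ij: "i < n" "j < m"
  shows "wglue B i j w u = fscale (ksign (d * e))
    (fextend (wact (perm_upto (n + m - 2) (cpos m j i \<circ> case_sum Inr Inl \<circ> cflag n i j))) (wglue B j i u w))"
proof -
  have len: "length w = n" "length u = m" and d: "wdeg w = d" "wdeg u = e" using w u by (auto simp: words_iff)
  let ?p = "fst (w ! i)" and ?q = "fst (u ! j)"
  have \<rho>: "perm_upto (n + m - 2) (cpos m j i \<circ> case_sum Inr Inl \<circ> cflag n i j) = block_swap 0 (n - 1) (m - 1)"
    using ij by (auto simp: fun_eq_iff perm_upto_def block_swap_def cpos_def cflag_def)
  have len': "length ([] :: (int \<times> 'v) list) = 0" "length (del_nth j u) = m - 1" "length (del_nth i w) = n - 1"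
    using len ij by auto
  have "wcoef B i j w u = ksign (d * e) * (wcoef B j i u w * ksign (wdeg (del_nth j u) * wdeg (del_nth i w)))"
  proof (cases "?p + ?q = 0")
    case True
    then have q: "?q = - ?p" by simp
    have 1: "wdeg (take i w) = d - ?p - wdeg (drop (Suc i) w)" "wdeg (drop (Suc j) u) = e - ?q - wdeg (take j u)"
      using wdeg_Suc_drop[of i w] wdeg_Suc_drop[of j u] len ij d by auto
    have "snd (w ! i) \<in> el V ?p" "snd (u ! j) \<in> el V ?q"
      using w u ij by (simp_all add: words_iff)
    then have 2: "B ?p ?q (snd (w ! i)) (snd (u ! j)) = ksign ?p * B ?q ?p (snd (u ! j)) (snd (w ! i))"
      using form_sym[of "snd (w ! i)" ?p "snd (u ! j)" ?q] q by (simp add: ksign_def)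
    show ?thesis
      using len ij d unfolding wcoef_def 2 unfolding q by (auto simp: 1 q wdeg_del_nth ksign_def)
  next
    case False
    then show ?thesis by (simp add: wcoef_eq_0 add.commute)
  qed
  then show ?thesis
    using wperm_block_swap[OF len', of "[]"]
    by (simp add: wglue_def wact_def \<rho> wsign_block_swap[OF len', of "[]", simplified])
qed

text \<open>Both composites delete the same four letters, so the words agree before passing to
  classes. Each gluing at \<open>u\<close> alters the degrees seen by the other only if
  \<open>k < j\<close>, and then both signs change by the same product of the degrees of the two
  glued letters of \<open>u\<close>.\<close>

lemma wglue_assoc:
  assumes w: "w \<in> words V n d" and u: "u \<in> words V m e" and v: "v \<in> words V p f"
    and ij: "i < n" "j < m" "k < m" "j \<noteq> k" "l < p"
  shows "fextend2 (wglue B (n - 1 + unskip j k) l) (wglue B i j w u) (Poly_Mapping.single v 1) =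
    fextend2 (wglue B i (unskip k j)) (Poly_Mapping.single w 1) (wglue B k l u v)"
proof -
  have len: "length w = n" "length u = m" "length v = p" using w u v by (auto simp: words_iff)
  have k': "unskip j k < m - 1" "unskip k j < m - 1" using ij by (metis unskip_less)+
  have words: "del_nth (n - 1 + unskip j k) (del_nth i w @ del_nth j u) @ del_nth l v =
      del_nth i w @ del_nth (unskip k j) (del_nth k u @ del_nth l v)"
    using len ij k' del_nth_del_nth[of j u k]
      del_nth_append_right[of "del_nth i w" "n - 1" "unskip j k" "del_nth j u"]
    by (simp add: del_nth_append_left)
  have a: "(del_nth i w @ del_nth j u) ! (n - 1 + unskip j k) = u ! k"
    "(del_nth k u @ del_nth l v) ! unskip k j = u ! j"
    using len ij k' by (auto simp: nth_append nth_del_nth skip_unskip)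
  have b: "wdeg (drop (Suc (n - 1 + unskip j k)) (del_nth i w @ del_nth j u)) = wdeg (drop (Suc k) u) - (if k < j then fst (u ! j) else 0)"
    using len ij k' wdeg_take_del_nth(2)[of j u "unskip j k"] by (simp add: skip_unskip Suc_eq_plus1 del: Suc_eq_plus1_left)
  have c: "wdeg (take (unskip k j) (del_nth k u @ del_nth l v)) = wdeg (take j u) - (if k < j then fst (u ! k) else 0)"
    using len ij k' wdeg_take_del_nth(1)[of k u "unskip k j"] by (simp add: skip_unskip)
  have "wcoef B i j w u * wcoef B (n - 1 + unskip j k) l (del_nth i w @ del_nth j u) v =
      wcoef B k l u v * wcoef B i (unskip k j) w (del_nth k u @ del_nth l v)"
    unfolding wcoef_def a b c by (simp add: ksign_add ksign_diff right_diff_distrib mult_ac)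
  then show ?thesis by (simp add: wglue_def words)
qed

section \<open>The cyclic operad axioms on classes\<close>

lemma End_cyc_ops:
  "x \<in> frees (words V n d) \<Longrightarrow> dif (cobj (End_cyc V B) n) d (cls (rels n d) x) = cls (rels n (d + 1)) (fextend (wdif V) x)"
  "\<sigma> permutes {..<n} \<Longrightarrow> x \<in> frees (words V n d) \<Longrightarrow>
     cact (End_cyc V B) n \<sigma> d (cls (rels n d) x) = cls (rels n d) (fextend (wact \<sigma>) x)"
  "i < n \<Longrightarrow> j < m \<Longrightarrow> x \<in> frees (words V n d) \<Longrightarrow> y \<in> frees (words V m e) \<Longrightarrow>
     ccomp (End_cyc V B) n i m j d e (cls (rels n d) x) (cls (rels m e) y) =
       cls (rels (n + m - 2) (d + e)) (fextend2 (wglue B i j) x y)"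
  by (simp_all add: End_cyc_simps induced_cls[OF wdif_rel_map] induced_cls[OF wact_rel_map]
      induced2_cls[OF wglue_rel_map2])

lemma End_cyc_frees:
  "x \<in> frees (words V n d) \<Longrightarrow> fextend (wdif V) x \<in> frees (words V n (d + 1))"
  "\<sigma> permutes {..<n} \<Longrightarrow> x \<in> frees (words V n d) \<Longrightarrow> fextend (wact \<sigma>) x \<in> frees (words V n d)"
  "i < n \<Longrightarrow> j < m \<Longrightarrow> x \<in> frees (words V n d) \<Longrightarrow> y \<in> frees (words V m e) \<Longrightarrow>
     fextend2 (wglue B i j) x y \<in> frees (words V (n + m - 2) (d + e))"
  using rel_map_frees[OF wdif_rel_map] rel_map_frees[OF wact_rel_map] rel_map2_frees[OF wglue_rel_map2]
  by blast+

lemma el_End_cyc: "x \<in> el (cobj (End_cyc V B) n) d \<longleftrightarrow> (\<exists>x'\<in>frees (words V n d). x = cls (rels n d) x')"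
  by (auto simp: End_cyc_simps)

lemma length_word_key: "x \<in> frees (words V n d) \<Longrightarrow> w \<in> Poly_Mapping.keys x \<Longrightarrow> length w = n"
  by (auto simp: frees_def words_iff)

text \<open>Each identity among the axioms is already exact between maps of free spaces, with the
  exception of the square of the differential, which vanishes only modulo relations.\<close>

theorem End_cyc_cyclic_operad: "cyclic_operad (End_cyc V B)"
proof (rule cyclic_operad.intro)
  fix n
  show "dg_vector_space (cobj (End_cyc V B) n)"
  proof (rule dg_vector_space.intro)
    fix d show "Module.module (kring :: 'k ring) (gr (cobj (End_cyc V B) n) d)"
      by (simp add: End_cyc_simps presented_module)
  next
    fix d show "linear_on (gr (cobj (End_cyc V B) n) d) (gr (cobj (End_cyc V B) n) (d + 1)) (dif (cobj (End_cyc V B) n) d)"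
      unfolding End_cyc_simps by (rule induced_linear[OF wdif_rel_map])
  next
    fix d x assume "x \<in> el (cobj (End_cyc V B) n) d"
    then obtain x' where x: "x = cls (rels n d) x'" "x' \<in> frees (words V n d)" by (auto simp: el_End_cyc)
    have "cls (rels n (d + 2)) (fextend (wdif V) (fextend (wdif V) x')) = cls (rels n (d + 2)) ((\<lambda>x. 0) x')"
      using x(2) by - (rule flin_cls_ext[where G = "words V n d" and L = "\<lambda>x. fextend (wdif V) (fextend (wdif V) x)" and M = "\<lambda>x. 0"];
        auto intro!: flinI simp: frees_def wdif_wdif lin_simps)
    then show "dif (cobj (End_cyc V B) n) (d + 1) (dif (cobj (End_cyc V B) n) d x) = \<zero>\<^bsub>gr (cobj (End_cyc V B) n) (d + 2)\<^esub>"
      using x by (simp add: End_cyc_ops End_cyc_frees End_cyc_simps(1) add.assoc)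
  qed
next
  fix n :: nat and \<sigma> d assume "\<sigma> permutes {..<n}"
  then show "linear_on (gr (cobj (End_cyc V B) n) d) (gr (cobj (End_cyc V B) n) d) (cact (End_cyc V B) n \<sigma> d)"
    unfolding End_cyc_simps by (intro induced_linear[OF wact_rel_map])
next
  fix n :: nat and \<sigma> x d assume \<sigma>: "\<sigma> permutes {..<n}" and "x \<in> el (cobj (End_cyc V B) n) d"
  then obtain x' where x: "x = cls (rels n d) x'" "x' \<in> frees (words V n d)" by (auto simp: el_End_cyc)
  have "fextend (wact \<sigma>) (fextend (wdif V) x') = fextend (wdif V) (fextend (wact \<sigma>) x')"
    using \<sigma> length_word_key[OF x(2)]
    by - (rule flin_ext[where x = x' and L = "\<lambda>x. fextend (wact \<sigma>) (fextend (wdif V) x)"]; (rule flinI)?; simp add: lin_simps wact_wdif)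
  then show "cact (End_cyc V B) n \<sigma> (d + 1) (dif (cobj (End_cyc V B) n) d x) = dif (cobj (End_cyc V B) n) d (cact (End_cyc V B) n \<sigma> d x)"
    using x \<sigma> by (simp add: End_cyc_ops End_cyc_frees)
next
  fix n x d assume "x \<in> el (cobj (End_cyc V B) n) d"
  then obtain x' where x: "x = cls (rels n d) x'" "x' \<in> frees (words V n d)" by (auto simp: el_End_cyc)
  have "fextend (wact id) x' = x'"
    by (simp add: wact_def[abs_def] fextend_single_eq)
  then show "cact (End_cyc V B) n id d x = x"
    using x by (simp add: End_cyc_ops permutes_id)
next
  fix n :: nat and \<sigma> \<tau> x d assume \<sigma>: "\<sigma> permutes {..<n}" "\<tau> permutes {..<n}" and "x \<in> el (cobj (End_cyc V B) n) d"
  then obtain x' where x: "x = cls (rels n d) x'" "x' \<in> frees (words V n d)" by (auto simp: el_End_cyc)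
  have "fextend (wact (\<sigma> \<circ> \<tau>)) x' = fextend (wact \<tau>) (fextend (wact \<sigma>) x')"
    using \<sigma> length_word_key[OF x(2)]
    by - (rule flin_ext[where x = x' and L = "fextend (wact (\<sigma> \<circ> \<tau>))" and M = "\<lambda>x. fextend (wact \<tau>) (fextend (wact \<sigma>) x)"];
      (rule flinI)?; simp add: lin_simps wact_comp)
  then show "cact (End_cyc V B) n (\<sigma> \<circ> \<tau>) d x = cact (End_cyc V B) n \<tau> d (cact (End_cyc V B) n \<sigma> d x)"
    using x \<sigma> permutes_compose[OF \<sigma>(2,1)] by (simp add: End_cyc_ops End_cyc_frees)
next
  fix n m i j :: nat and d e assume "i < n" "j < m"
  then show "bilinear_on (gr (cobj (End_cyc V B) n) d) (gr (cobj (End_cyc V B) m) e)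
      (gr (cobj (End_cyc V B) (n + m - 2)) (d + e)) (ccomp (End_cyc V B) n i m j d e)"
    unfolding End_cyc_simps by (intro induced2_bilinear[OF wglue_rel_map2])
next
  fix n m i j :: nat and x d y e
  assume ij: "i < n" "j < m" and "x \<in> el (cobj (End_cyc V B) n) d" "y \<in> el (cobj (End_cyc V B) m) e"
  then obtain x' y' where x: "x = cls (rels n d) x'" "x' \<in> frees (words V n d)"
    and y: "y = cls (rels m e) y'" "y' \<in> frees (words V m e)" by (auto simp: el_End_cyc)
  have "fextend (wdif V) (fextend2 (wglue B i j) x' y') =
      fextend2 (wglue B i j) (fextend (wdif V) x') y' +
      fscale (ksign d) (fextend2 (wglue B i j) x' (fextend (wdif V) y'))"
    by (rule bilin_ext[where L = "\<lambda>x y. fextend (wdif V) (fextend2 (wglue B i j) x y)" and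
        M = "\<lambda>x y. fextend2 (wglue B i j) (fextend (wdif V) x) y +
          fscale (ksign d) (fextend2 (wglue B i j) x (fextend (wdif V) y))", OF _ _ _ _ _ x(2) y(2)]; (rule flinI)?; simp add: lin_simps wglue_dif[OF _ _ ij])
  moreover have "d + 1 + e = d + e + 1" "d + (e + 1) = d + e + 1" by simp_all
  ultimately show "dif (cobj (End_cyc V B) (n + m - 2)) (d + e) (ccomp (End_cyc V B) n i m j d e x y) =
      ccomp (End_cyc V B) n i m j (d + 1) e (dif (cobj (End_cyc V B) n) d x) y
        \<oplus>\<^bsub>gr (cobj (End_cyc V B) (n + m - 2)) (d + e + 1)\<^esub>
      ksign d \<odot>\<^bsub>gr (cobj (End_cyc V B) (n + m - 2)) (d + e + 1)\<^esub>
        ccomp (End_cyc V B) n i m j d (e + 1) x (dif (cobj (End_cyc V B) m) e y)"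
    using x y ij by (simp add: End_cyc_ops End_cyc_frees End_cyc_simps(1) cls_add cls_scale) (simp add: ac_simps)
next
  fix n m i j :: nat and \<sigma> \<tau> x d y e
  assume ij: "i < n" "j < m" and \<sigma>: "\<sigma> permutes {..<n}" "\<tau> permutes {..<m}"
    and "x \<in> el (cobj (End_cyc V B) n) d" "y \<in> el (cobj (End_cyc V B) m) e"
  then obtain x' y' where x: "x = cls (rels n d) x'" "x' \<in> frees (words V n d)"
    and y: "y = cls (rels m e) y'" "y' \<in> frees (words V m e)" by (auto simp: el_End_cyc)
  let ?\<rho> = "perm_upto (n + m - 2) (cpos n (\<sigma> i) (\<tau> j) \<circ> map_sum \<sigma> \<tau> \<circ> cflag n i j)"
  have \<rho>: "?\<rho> permutes {..<n + m - 2}"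
  proof -
    have "?\<rho> = block_sum (n - 1) (m - 1) (del_perm n i \<sigma>) (del_perm m j \<tau>)"
      using ij by (auto simp: fun_eq_iff perm_upto_def block_sum_def cpos_def cflag_def del_perm_def)
    moreover have "n - 1 + (m - 1) = n + m - 2" using ij by simp
    ultimately show ?thesis
      using block_sum_permutes[OF del_perm_permutes[OF \<sigma>(1) ij(1)] del_perm_permutes[OF \<sigma>(2) ij(2)]] by simp
  qed
  have "fextend2 (wglue B i j) (fextend (wact \<sigma>) x') (fextend (wact \<tau>) y') =
      fextend (wact ?\<rho>) (fextend2 (wglue B (\<sigma> i) (\<tau> j)) x' y')"
    using ij \<sigma> by - (rule bilin_ext[where L = "\<lambda>x y. fextend2 (wglue B i j) (fextend (wact \<sigma>) x) (fextend (wact \<tau>) y)" and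
        M = "\<lambda>x y. fextend (wact ?\<rho>) (fextend2 (wglue B (\<sigma> i) (\<tau> j)) x y)", OF _ _ _ _ _ x(2) y(2)]; (rule flinI)?; simp add: lin_simps wglue_equivariant words_iff)
  then show "ccomp (End_cyc V B) n i m j d e (cact (End_cyc V B) n \<sigma> d x) (cact (End_cyc V B) m \<tau> e y) =
      cact (End_cyc V B) (n + m - 2) ?\<rho> (d + e) (ccomp (End_cyc V B) n (\<sigma> i) m (\<tau> j) d e x y)"
    using x y ij \<sigma> \<rho> by (simp add: End_cyc_ops End_cyc_frees)
next
  fix n m i j :: nat and x d y e
  assume ij: "i < n" "j < m" and "x \<in> el (cobj (End_cyc V B) n) d" "y \<in> el (cobj (End_cyc V B) m) e"
  then obtain x' y' where x: "x = cls (rels n d) x'" "x' \<in> frees (words V n d)"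
    and y: "y = cls (rels m e) y'" "y' \<in> frees (words V m e)" by (auto simp: el_End_cyc)
  let ?\<rho> = "perm_upto (n + m - 2) (cpos m j i \<circ> case_sum Inr Inl \<circ> cflag n i j)"
  have "?\<rho> = block_swap 0 (n - 1) (m - 1)"
    using ij by (auto simp: fun_eq_iff perm_upto_def block_swap_def cpos_def cflag_def)
  then have \<rho>: "?\<rho> permutes {..<n + m - 2}" using ij by (simp add: block_swap_permutes)
  have "fextend2 (wglue B i j) x' y' =
      fscale (ksign (d * e)) (fextend (wact ?\<rho>) (fextend2 (wglue B j i) y' x'))"
    using ij by - (rule bilin_ext[where L = "\<lambda>x y. fextend2 (wglue B i j) x y" and
        M = "\<lambda>x y. fscale (ksign (d * e)) (fextend (wact ?\<rho>) (fextend2 (wglue B j i) y x))", OF _ _ _ _ _ x(2) y(2)]; (rule flinI)?; simp add: lin_simps wglue_symmetric[of _ n d _ m e])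
  moreover have "ccomp (End_cyc V B) m j n i e d y x = cls (rels (n + m - 2) (d + e)) (fextend2 (wglue B j i) y' x')"
    "fextend2 (wglue B j i) y' x' \<in> frees (words V (n + m - 2) (d + e))"
    using x y ij End_cyc_ops(3)[OF ij(2,1) y(2) x(2)] End_cyc_frees(3)[OF ij(2,1) y(2) x(2)]
    by (simp_all add: add.commute)
  ultimately show "ccomp (End_cyc V B) n i m j d e x y =
      ksign (d * e) \<odot>\<^bsub>gr (cobj (End_cyc V B) (n + m - 2)) (d + e)\<^esub>
        cact (End_cyc V B) (n + m - 2) ?\<rho> (d + e) (ccomp (End_cyc V B) m j n i e d y x)"
    using x y ij \<rho> by (simp add: End_cyc_ops End_cyc_simps(1) cls_scale)
next
  fix n m p i j k l :: nat and x d y e z f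
  assume ij: "i < n" "j < m" "k < m" "j \<noteq> k" "l < p"
    and "x \<in> el (cobj (End_cyc V B) n) d" "y \<in> el (cobj (End_cyc V B) m) e" "z \<in> el (cobj (End_cyc V B) p) f"
  then obtain x' y' z' where x: "x = cls (rels n d) x'" "x' \<in> frees (words V n d)"
    and y: "y = cls (rels m e) y'" "y' \<in> frees (words V m e)"
    and z: "z = cls (rels p f) z'" "z' \<in> frees (words V p f)" by (auto simp: el_End_cyc)
  let ?a = "n - 1 + unskip j k" and ?b = "unskip k j"
  have k': "unskip j k < m - 1" "?b < m - 1" using ij by (metis unskip_less)+
  have "fextend2 (wglue B ?a l) (fextend2 (wglue B i j) x' y') z' =
      fextend2 (wglue B i ?b) x' (fextend2 (wglue B k l) y' z')"
  proof (rule bilin_ext[where L = "\<lambda>x y. fextend2 (wglue B ?a l) (fextend2 (wglue B i j) x y) z'" and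
        M = "\<lambda>x y. fextend2 (wglue B i ?b) x (fextend2 (wglue B k l) y z')", OF _ _ _ _ _ x(2) y(2)])
    fix w u assume wu: "w \<in> words V n d" "u \<in> words V m e"
    show "fextend2 (wglue B ?a l) (fextend2 (wglue B i j) (Poly_Mapping.single w 1) (Poly_Mapping.single u 1)) z' =
      fextend2 (wglue B i ?b) (Poly_Mapping.single w 1) (fextend2 (wglue B k l) (Poly_Mapping.single u 1) z')"
      using z(2) by - (rule flin_ext[where x = z' and
          L = "\<lambda>z. fextend2 (wglue B ?a l) (fextend2 (wglue B i j) (Poly_Mapping.single w 1) (Poly_Mapping.single u 1)) z" and
          M = "\<lambda>z. fextend2 (wglue B i ?b) (Poly_Mapping.single w 1) (fextend2 (wglue B k l) (Poly_Mapping.single u 1) z)"];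
        (rule flinI)?; auto simp: lin_simps wglue_assoc[OF wu _ ij, unfolded add.commute[of "n - 1"]] frees_def)
  qed ((rule flinI)?; simp add: lin_simps)+
  moreover have "?a < n + m - 2" "?b < m + p - 2" "n + m - 2 + p - 2 = n + (m + p - 2) - 2" "d + e + f = d + (e + f)"
    using ij k' by auto
  ultimately show "ccomp (End_cyc V B) (n + m - 2) ?a p l (d + e) f (ccomp (End_cyc V B) n i m j d e x y) z =
      ccomp (End_cyc V B) n i (m + p - 2) ?b d (e + f) x (ccomp (End_cyc V B) m k p l e f y z)"
    using x y z ij by (simp add: End_cyc_ops End_cyc_frees) (simp add: add.assoc)
qed

end

section \<open>The double of a dg vector space\<close>

lemma ground_simps [simp]:
  "carrier ground = UNIV" "x \<oplus>\<^bsub>ground\<^esub> y = x + y" "c \<odot>\<^bsub>ground\<^esub> x = c * x"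
  by (simp_all add: ground_def)

lemma dual_simps:
  "el (dual V) d = {f \<in> extensional (el V (- d)). linear_on (gr V (- d)) ground f}"
  "\<zero>\<^bsub>gr (dual V) d\<^esub> = (\<lambda>x\<in>el V (- d). 0)"
  "f \<oplus>\<^bsub>gr (dual V) d\<^esub> g = (\<lambda>x\<in>el V (- d). f x + g x)"
  "c \<odot>\<^bsub>gr (dual V) d\<^esub> f = (\<lambda>x\<in>el V (- d). c * f x)"
  "dif (dual V) d f = (\<lambda>x\<in>el V (- (d + 1)). - ksign d * f (dif V (- (d + 1)) x))"
  by (simp_all add: dual_def)

lemma dsum_simps:
  "el (dsum V W) d = el V d \<times> el W d"
  "\<zero>\<^bsub>gr (dsum V W) d\<^esub> = (\<zero>\<^bsub>gr V d\<^esub>, \<zero>\<^bsub>gr W d\<^esub>)"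
  "x \<oplus>\<^bsub>gr (dsum V W) d\<^esub> y = (fst x \<oplus>\<^bsub>gr V d\<^esub> fst y, snd x \<oplus>\<^bsub>gr W d\<^esub> snd y)"
  "c \<odot>\<^bsub>gr (dsum V W) d\<^esub> x = (c \<odot>\<^bsub>gr V d\<^esub> fst x, c \<odot>\<^bsub>gr W d\<^esub> snd x)"
  "dif (dsum V W) d x = (dif V d (fst x), dif W d (snd x))"
  by (simp_all add: dsum_def case_prod_unfold)

context dg_vector_space
begin

lemma add_closed: "x \<in> el V d \<Longrightarrow> y \<in> el V d \<Longrightarrow> x \<oplus>\<^bsub>gr V d\<^esub> y \<in> el V d"
proof -
  interpret Module.module kring "gr V d" by (rule vector_space)
  show "x \<in> el V d \<Longrightarrow> y \<in> el V d \<Longrightarrow> x \<oplus>\<^bsub>gr V d\<^esub> y \<in> el V d" by (rule M.add.m_closed)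
qed

lemma smult_closed: "x \<in> el V d \<Longrightarrow> c \<odot>\<^bsub>gr V d\<^esub> x \<in> el V d"
proof -
  interpret Module.module kring "gr V d" by (rule vector_space)
  show "x \<in> el V d \<Longrightarrow> c \<odot>\<^bsub>gr V d\<^esub> x \<in> el V d" by (simp add: smult_closed)
qed

lemma smult_add: "x \<in> el V d \<Longrightarrow> y \<in> el V d \<Longrightarrow>
  c \<odot>\<^bsub>gr V d\<^esub> (x \<oplus>\<^bsub>gr V d\<^esub> y) = c \<odot>\<^bsub>gr V d\<^esub> x \<oplus>\<^bsub>gr V d\<^esub> c \<odot>\<^bsub>gr V d\<^esub> y"
proof -
  interpret Module.module kring "gr V d" by (rule vector_space)
  show "x \<in> el V d \<Longrightarrow> y \<in> el V d \<Longrightarrow>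
    c \<odot>\<^bsub>gr V d\<^esub> (x \<oplus>\<^bsub>gr V d\<^esub> y) = c \<odot>\<^bsub>gr V d\<^esub> x \<oplus>\<^bsub>gr V d\<^esub> c \<odot>\<^bsub>gr V d\<^esub> y"
    by (simp add: smult_r_distr)
qed

lemma dif_zero: "dif V d \<zero>\<^bsub>gr V d\<^esub> = \<zero>\<^bsub>gr V (d + 1)\<^esub>"
  by (rule linear_on_zero[OF dif_linear vector_space vector_space])

lemma dif_closed_minus: "x \<in> el V (- (d + 1)) \<Longrightarrow> dif V (- (d + 1)) x \<in> el V (- d)"
  using dif_closed[of x "- (d + 1)"] by simp

lemma dif_linear_minus: "linear_on (gr V (- (d + 1))) (gr V (- d)) (dif V (- (d + 1)))"
  using dif_linear[of "- (d + 1)"] by simp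

lemma dual_add: "f \<in> el (dual V) d \<Longrightarrow> x \<in> el V (- d) \<Longrightarrow> y \<in> el V (- d) \<Longrightarrow> f (x \<oplus>\<^bsub>gr V (- d)\<^esub> y) = f x + f y"
  and dual_smult: "f \<in> el (dual V) d \<Longrightarrow> x \<in> el V (- d) \<Longrightarrow> f (c \<odot>\<^bsub>gr V (- d)\<^esub> x) = c * f x"
  by (auto simp: dual_simps linear_on_def)

lemma dual_zero: "f \<in> el (dual V) d \<Longrightarrow> f \<zero>\<^bsub>gr V (- d)\<^esub> = 0"
  using dual_add[of f d "\<zero>\<^bsub>gr V (- d)\<^esub>" "\<zero>\<^bsub>gr V (- d)\<^esub>"] zero_closed[of "- d"]
proof -
  assume f: "f \<in> el (dual V) d"
  interpret Module.module kring "gr V (- d)" by (rule vector_space)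
  show "f \<zero>\<^bsub>gr V (- d)\<^esub> = 0"
    using dual_add[OF f zero_closed zero_closed] by simp
qed

lemma dual_memI:
  assumes "f \<in> extensional (el V (- d))"
    and "\<And>x y. x \<in> el V (- d) \<Longrightarrow> y \<in> el V (- d) \<Longrightarrow> f (x \<oplus>\<^bsub>gr V (- d)\<^esub> y) = f x + f y"
    and "\<And>c x. x \<in> el V (- d) \<Longrightarrow> f (c \<odot>\<^bsub>gr V (- d)\<^esub> x) = c * f x"
  shows "f \<in> el (dual V) d"
  using assms by (simp add: dual_simps linear_on_def)

text \<open>Functionals are extensional, so only their values on the homogeneous piece have to be
  compared.\<close>

lemma dual_eqI:
  assumes "f \<in> el (dual V) d" "g \<in> el (dual V) d" "\<And>x. x \<in> el V (- d) \<Longrightarrow> f x = g x"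
  shows "f = g"
  using assms by (intro extensionalityI[of f "el V (- d)" g]) (auto simp: dual_simps)

lemma dual_closed:
  "\<zero>\<^bsub>gr (dual V) d\<^esub> \<in> el (dual V) d"
  "f \<in> el (dual V) d \<Longrightarrow> g \<in> el (dual V) d \<Longrightarrow> f \<oplus>\<^bsub>gr (dual V) d\<^esub> g \<in> el (dual V) d"
  "f \<in> el (dual V) d \<Longrightarrow> c \<odot>\<^bsub>gr (dual V) d\<^esub> f \<in> el (dual V) d"
  "f \<in> el (dual V) d \<Longrightarrow> dif (dual V) d f \<in> el (dual V) (d + 1)"
proof -
  show "\<zero>\<^bsub>gr (dual V) d\<^esub> \<in> el (dual V) d"
    by (rule dual_memI) (auto simp: dual_simps(2) add_closed smult_closed)
  show "f \<in> el (dual V) d \<Longrightarrow> g \<in> el (dual V) d \<Longrightarrow> f \<oplus>\<^bsub>gr (dual V) d\<^esub> g \<in> el (dual V) d"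
    by (rule dual_memI) (auto simp: dual_simps(3) add_closed smult_closed dual_add dual_smult distrib_left)
  show "f \<in> el (dual V) d \<Longrightarrow> c \<odot>\<^bsub>gr (dual V) d\<^esub> f \<in> el (dual V) d"
    by (rule dual_memI) (auto simp: dual_simps(4) add_closed smult_closed dual_add dual_smult distrib_left mult_ac)
  assume f: "f \<in> el (dual V) d"
  show "dif (dual V) d f \<in> el (dual V) (d + 1)"
  proof (rule dual_memI)
    fix x y assume "x \<in> el V (- (d + 1))" "y \<in> el V (- (d + 1))"
    then show "dif (dual V) d f (x \<oplus>\<^bsub>gr V (- (d + 1))\<^esub> y) = dif (dual V) d f x + dif (dual V) d f y"
      using dif_linear_minus[of d] dual_add[OF f dif_closed_minus dif_closed_minus, of x y]
      unfolding linear_on_def dual_simps(5) by (simp only: restrict_apply add_closed if_True distrib_left)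
  next
    fix c x assume "x \<in> el V (- (d + 1))"
    then show "dif (dual V) d f (c \<odot>\<^bsub>gr V (- (d + 1))\<^esub> x) = c * dif (dual V) d f x"
      using dif_linear_minus[of d] dual_smult[OF f dif_closed_minus, of x]
      unfolding linear_on_def dual_simps(5) by (simp only: restrict_apply smult_closed if_True mult_ac)
  qed (simp add: dual_simps(5) restrict_extensional)
qed

lemma dual_dg: "dg_vector_space (dual V)"
proof (rule dg_vector_space.intro)
  fix d
  show "Module.module (kring :: 'k ring) (gr (dual V) d)"
  proof (rule moduleI)
    show "cring (kring :: 'k ring)" by (rule cring_from_type_algebra)
    show "abelian_group (gr (dual V) d)"
    proof (rule abelian_groupI)
      fix f assume f: "f \<in> el (dual V) d"
      have "(- 1) \<odot>\<^bsub>gr (dual V) d\<^esub> f \<oplus>\<^bsub>gr (dual V) d\<^esub> f = \<zero>\<^bsub>gr (dual V) d\<^esub>"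
        by (auto simp: dual_simps(2-4) fun_eq_iff)
      then show "\<exists>g\<in>el (dual V) d. g \<oplus>\<^bsub>gr (dual V) d\<^esub> f = \<zero>\<^bsub>gr (dual V) d\<^esub>"
        using dual_closed(3)[OF f, of "- 1"] by blast
      show "\<zero>\<^bsub>gr (dual V) d\<^esub> \<oplus>\<^bsub>gr (dual V) d\<^esub> f = f"
        using f by (intro dual_eqI[OF dual_closed(2)[OF dual_closed(1) f] f]) (simp add: dual_simps(2,3))
    qed (auto simp: dual_closed, auto simp: dual_simps(3) fun_eq_iff)
    fix f assume f: "f \<in> el (dual V) d"
    show "\<one>\<^bsub>kring\<^esub> \<odot>\<^bsub>gr (dual V) d\<^esub> f = f"
      by (intro dual_eqI[OF dual_closed(3)[OF f] f]) (simp add: dual_simps(4))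
  qed (auto simp: dual_closed, auto simp: dual_simps(3,4) fun_eq_iff algebra_simps)
next
  fix d
  show "linear_on (gr (dual V) d) (gr (dual V) (d + 1)) (dif (dual V) d)"
    unfolding linear_on_def
  proof (intro conjI ballI allI)
    fix f g assume "f \<in> el (dual V) d" "g \<in> el (dual V) d"
    show "dif (dual V) d (f \<oplus>\<^bsub>gr (dual V) d\<^esub> g) = dif (dual V) d f \<oplus>\<^bsub>gr (dual V) (d + 1)\<^esub> dif (dual V) d g"
      using dif_closed_minus[of _ d] by (auto simp only: dual_simps(3,5) fun_eq_iff restrict_apply distrib_left if_True split: if_splits)
  next
    fix c f assume "f \<in> el (dual V) d"
    show "dif (dual V) d (c \<odot>\<^bsub>gr (dual V) d\<^esub> f) = c \<odot>\<^bsub>gr (dual V) (d + 1)\<^esub> dif (dual V) d f"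
      using dif_closed_minus[of _ d] by (auto simp only: dual_simps(4,5) fun_eq_iff restrict_apply mult_ac if_True split: if_splits)
  qed (rule dual_closed)
next
  fix d f assume f: "f \<in> el (dual V) d"
  have "dif (dual V) (d + 1) (dif (dual V) d f) \<in> el (dual V) (d + 2)"
    using dual_closed(4)[OF dual_closed(4)[OF f]] by (simp add: add.assoc)
  then show "dif (dual V) (d + 1) (dif (dual V) d f) = \<zero>\<^bsub>gr (dual V) (d + 2)\<^esub>"
  proof (rule dual_eqI[OF _ dual_closed(1)])
    fix x assume x: "x \<in> el V (- (d + 2))"
    have x': "x \<in> el V (- (d + 1 + 1))" using x by (simp add: add.assoc)
    have "dif V (- (d + 1)) (dif V (- (d + 1 + 1)) x) = \<zero>\<^bsub>gr V (- d)\<^esub>"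
    proof -
      have e: "- (d + 1 + 1) + 1 = - (d + 1)" "- (d + 1 + 1) + 2 = - d" by simp_all
      show ?thesis using dif_dif[OF x'] unfolding e .
    qed
    then show "dif (dual V) (d + 1) (dif (dual V) d f) x = \<zero>\<^bsub>gr (dual V) (d + 2)\<^esub> x"
      using x x' dif_closed_minus[OF x'] unfolding dual_simps(2,5)
      by (simp only: restrict_apply if_True dual_zero[OF f] mult_zero_right)
  qed
qed

end

lemma dsum_dg:
  assumes "dg_vector_space V" "dg_vector_space W"
  shows "dg_vector_space (dsum V W)"
proof (rule dg_vector_space.intro)
  interpret V: dg_vector_space V by fact
  interpret W: dg_vector_space W by fact
  fix d
  interpret MV: Module.module kring "gr V d" by (rule V.vector_space)
  interpret MW: Module.module kring "gr W d" by (rule W.vector_space)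
  show "Module.module (kring :: 'a ring) (gr (dsum V W) d)"
  proof (rule moduleI)
    show "cring (kring :: 'a ring)" by (rule cring_from_type_algebra)
    show "abelian_group (gr (dsum V W) d)"
    proof (rule abelian_groupI)
      fix x assume x: "x \<in> el (dsum V W) d"
      then show "\<exists>y\<in>el (dsum V W) d. y \<oplus>\<^bsub>gr (dsum V W) d\<^esub> x = \<zero>\<^bsub>gr (dsum V W) d\<^esub>"
        by (intro bexI[of _ "(\<ominus>\<^bsub>gr V d\<^esub> fst x, \<ominus>\<^bsub>gr W d\<^esub> snd x)"]) (auto simp: dsum_simps MV.M.l_neg MW.M.l_neg)
    qed (auto simp: dsum_simps MV.M.a_ac MW.M.a_ac)
  qed (auto simp: dsum_simps V.smult_closed W.smult_closed MV.smult_l_distr[simplified] MW.smult_l_distr[simplified] V.smult_add W.smult_add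
      MV.smult_assoc1[simplified] MW.smult_assoc1[simplified] MV.smult_one[simplified] MW.smult_one[simplified])
next
  interpret V: dg_vector_space V by fact
  interpret W: dg_vector_space W by fact
  fix d
  show "linear_on (gr (dsum V W) d) (gr (dsum V W) (d + 1)) (dif (dsum V W) d)"
    using V.dif_linear[of d] W.dif_linear[of d] by (auto simp: linear_on_def dsum_simps)
  fix x assume "x \<in> el (dsum V W) d"
  then show "dif (dsum V W) (d + 1) (dif (dsum V W) d x) = \<zero>\<^bsub>gr (dsum V W) (d + 2)\<^esub>"
    by (auto simp: dsum_simps V.dif_dif W.dif_dif)
qed

section \<open>The evaluation form on the double\<close>

context dg_vector_space
begin

lemma double_dg: "dg_vector_space (double V)"
  unfolding double_def by (rule dsum_dg[OF dg_vector_space_axioms dual_dg])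

text \<open>For the chain map property only degrees with \<open>p + q + 1 = 0\<close> matter, since
  elsewhere both pairings vanish. There the sign in the differential of the dual makes the
  evaluations of \<eta> cancel each other, and likewise those of \<xi>.\<close>

lemma double_dg_form: "dg_form (double V) (double_form V)"
proof (rule dg_form.intro[OF double_dg dg_form_axioms.intro])
  fix b q p assume b: "b \<in> el (double V) q"
  obtain b1 \<xi> where b': "b = (b1, \<xi>)" "b1 \<in> el V q" "\<xi> \<in> el (dual V) q" using b by (auto simp: double_def dsum_simps)
  show "linear_on (gr (double V) p) ground (\<lambda>a. double_form V p q a b)"
  proof (cases "p + q = 0")
    case True
    then have p: "p = - q" by simp
    show ?thesis
      using b' dual_add[OF b'(3)] dual_smult[OF b'(3)] unfolding p
      by (auto simp: linear_on_def double_form_def double_def dsum_simps dual_simps(3,4) distrib_left mult_ac)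
  qed (auto simp: linear_on_def double_form_def)
next
  fix a p q assume a: "a \<in> el (double V) p"
  obtain a1 \<eta> where a': "a = (a1, \<eta>)" "a1 \<in> el V p" "\<eta> \<in> el (dual V) p" using a by (auto simp: double_def dsum_simps)
  show "linear_on (gr (double V) q) ground (double_form V p q a)"
  proof (cases "p + q = 0")
    case True
    then have q: "q = - p" by simp
    show ?thesis
      using a' dual_add[OF a'(3)] dual_smult[OF a'(3)] unfolding q
      by (auto simp: linear_on_def double_form_def double_def dsum_simps dual_simps(3,4) distrib_left mult_ac)
  qed (auto simp: linear_on_def double_form_def)
next
  fix a p b q assume "a \<in> el (double V) p" "b \<in> el (double V) q"
  show "double_form V p q a b = ksign (p * q) * double_form V q p b a"
    by (auto simp: double_form_def case_prod_unfold distrib_left mult.commute[of p q] add.commute[of p q])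
next
  fix p q :: int and a b assume "p + q \<noteq> 0"
  then show "double_form V p q a b = 0" by (simp add: double_form_def case_prod_unfold)
next
  fix a p b q assume ab: "a \<in> el (double V) p" "b \<in> el (double V) q"
  obtain a1 \<eta> where a: "a = (a1, \<eta>)" "a1 \<in> el V p" "\<eta> \<in> el (dual V) p" using ab by (auto simp: double_def dsum_simps)
  obtain b1 \<xi> where b: "b = (b1, \<xi>)" "b1 \<in> el V q" "\<xi> \<in> el (dual V) q" using ab by (auto simp: double_def dsum_simps)
  show "double_form V (p + 1) q (dif (double V) p a) b + ksign p * double_form V p (q + 1) a (dif (double V) q b) = 0"
  proof (cases "p + q + 1 = 0")
    case True
    \<comment> \<open>With the degrees in this form the vectors are seen to lie in the domains of
      the restricted functionals.\<close>
    have pq: "q = - (p + 1)" "p = - (q + 1)" using True by simp_all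
    have 1: "dif (dual V) p \<eta> b1 = - ksign p * \<eta> (dif V q b1)"
      unfolding dual_simps(5) pq(1)[symmetric] using b(2) by simp
    have 2: "dif (dual V) q \<xi> a1 = - ksign q * \<xi> (dif V p a1)"
      unfolding dual_simps(5) pq(2)[symmetric] using a(2) by simp
    have "p + 1 + q = 0" "p + (q + 1) = 0" using True by simp_all
    moreover have "ksign ((p + 1) * q) = (ksign p * ksign (p * (q + 1)) * ksign q :: 'k)"
      by (auto simp: ksign_def)
    ultimately show ?thesis
      by (simp add: double_form_def double_def dsum_simps a(1) b(1) 1 2 distrib_left right_diff_distrib mult_ac)
  next
    case False
    then have "p + 1 + q \<noteq> 0" "p + (q + 1) \<noteq> 0" by simp_all
    then show ?thesis by (simp add: double_form_def case_prod_unfold)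
  qed
qed

end

section \<open>Dioperads inside cyclic operads\<close>

lemma unskip_block_swap_skip:
  "unskip (block_swap c p q t) (block_swap c p q (skip t l)) =
    block_swap (if t < c then c - 1 else c) (if c \<le> t \<and> t < c + p then p - 1 else p)
      (if c + p \<le> t \<and> t < c + p + q then q - 1 else q) l"
proof -
  consider "t < c" | "c \<le> t" "t < c + p" | "c + p \<le> t" "t < c + p + q" | "c + p + q \<le> t" by linarith
  then show ?thesis
  proof cases
    case 1
    then obtain c' where c: "c = Suc c'" by (cases c) auto
    have b: "block_swap c p q t = t" using 1 by (simp add: block_swap_def)
    show ?thesis unfolding b using 1 c
      by (cases "l < t"; cases "l < c' + p") (auto simp: block_swap_def unskip_def skip_def)
  next
    case 2
    then have b: "block_swap c p q t = t + q" by (simp add: block_swap_def)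
    show ?thesis unfolding b using 2
      by (cases "l < t") (auto simp: block_swap_def unskip_def skip_def)
  next
    case 3
    then have b: "block_swap c p q t = t - p" by (simp add: block_swap_def)
    show ?thesis unfolding b using 3
      by (cases "l < t") (auto simp: block_swap_def unskip_def skip_def)
  next
    case 4
    then have b: "block_swap c p q t = t" by (simp add: block_swap_def)
    show ?thesis unfolding b using 4
      by (cases "l < t") (auto simp: block_swap_def unskip_def skip_def)
  qed
qed

lemma block_swap_shift: "n \<le> l \<Longrightarrow> n + block_swap c p q (l - n) = block_swap (n + c) p q l"
  by (auto simp: block_swap_def)

lemma block_swap_fix: "l < c \<Longrightarrow> block_swap c p q l = l" "c + p + q \<le> l \<Longrightarrow> block_swap c p q l = l"
  by (auto simp: block_swap_def)

lemma block_swap_comp: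
  "block_swap 0 (a + b) q \<circ> block_swap a q b = block_swap 0 a q"
  "block_swap 0 a (b + q) \<circ> block_swap 0 b a = block_swap b a q"
  by (auto simp: block_swap_def fun_eq_iff)

text \<open>The permutation identities below compare piecewise translations with symbolic block
  lengths. On each of the consecutive blocks of lengths \<open>a\<close> to \<open>f\<close> only
  linear arithmetic remains.\<close>

lemma block_cases:
  fixes l :: nat
  obtains "l < a" | x where "l = a + x" "x < b" | x where "l = a + b + x" "x < c" | x where "l = a + b + c + x" "x < d" |
    x where "l = a + b + c + d + x" "x < e" | x where "l = a + b + c + d + e + x" "x < f" | x where "l = a + b + c + d + e + f + x"
proof -
  have "l < a \<or> (a \<le> l \<and> l - a < b) \<or> (a + b \<le> l \<and> l - (a + b) < c) \<or> (a + b + c \<le> l \<and> l - (a + b + c) < d) \<or>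
    (a + b + c + d \<le> l \<and> l - (a + b + c + d) < e) \<or> (a + b + c + d + e \<le> l \<and> l - (a + b + c + d + e) < f) \<or>
    a + b + c + d + e + f \<le> l" by linarith
  then show thesis
    using that(1) that(2)[of "l - a"] that(3)[of "l - (a + b)"] that(4)[of "l - (a + b + c)"]
      that(5)[of "l - (a + b + c + d)"] that(6)[of "l - (a + b + c + d + e)"] that(7)[of "l - (a + b + c + d + e + f)"]
    by (elim disjE conjE) (simp_all only: le_add_diff_inverse)
qed

text \<open>For corollas glued in a chain x, y, z, from outputs to inputs: \<open>a\<close>,
  \<open>b\<close> count the free outputs and inputs of x, \<open>c\<close>, \<open>d\<close> those
  of y, and \<open>e\<close> the outputs of z, whose remaining inputs stay at the end. Both sides
  carry the order x, y, z of the flags to the order with all outputs first.\<close>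

lemma block_swap_chain:
  "block_swap (a + c) (b + d) e \<circ> block_swap a b c = block_swap a b (c + e) \<circ> block_swap (a + b + c) d e"
proof
  fix l
  show "(block_swap (a + c) (b + d) e \<circ> block_swap a b c) l = (block_swap a b (c + e) \<circ> block_swap (a + b + c) d e) l"
    by (rule block_cases[where l = l and a = a and b = b and c = c and d = d and e = e and f = 0]) (simp_all add: block_swap_def block_sum_def)
qed

text \<open>For x and z whose outputs are glued to two inputs of y: \<open>a\<close>,
  \<open>b\<close> count the free outputs and inputs of x, \<open>c\<close>, \<open>d\<close> those
  of z and \<open>e\<close>, \<open>f\<close> those of y. The block sum exchanges x and z,
  separately among the outputs and among the inputs.\<close>

lemma block_swap_inputs:
  "block_swap c d (a + e) \<circ> block_swap (c + d + a) b e \<circ> block_swap 0 (a + b) (c + d) =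
   block_sum (a + c + e) (b + d + f) (block_swap 0 a c) (block_swap 0 b d) \<circ>
     (block_swap a b (c + e) \<circ> block_swap (a + b + c) d e)"
proof
  fix l
  show "(block_swap c d (a + e) \<circ> block_swap (c + d + a) b e \<circ> block_swap 0 (a + b) (c + d)) l =
   (block_sum (a + c + e) (b + d + f) (block_swap 0 a c) (block_swap 0 b d) \<circ>
     (block_swap a b (c + e) \<circ> block_swap (a + b + c) d e)) l"
    by (rule block_cases[where l = l and a = a and b = b and c = c and d = d and e = e and f = f]) (simp_all add: block_swap_def block_sum_def)
qed

text \<open>For x and z whose inputs are glued to two outputs of y: \<open>a\<close>,
  \<open>b\<close> count the free outputs and inputs of y, \<open>c\<close>, \<open>d\<close> those
  of x and \<open>e\<close>, \<open>f\<close> those of z.\<close>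

lemma block_swap_outputs:
  "block_swap (a + e) (b + f) c \<circ> block_swap a b e \<circ> block_swap (a + b) (c + d) (e + f) =
   block_sum (a + c + e) (b + d + f) (block_swap a c e) (block_swap b d f) \<circ>
     (block_swap (a + c) (b + d) e \<circ> block_swap a b c)"
proof
  fix l
  show "(block_swap (a + e) (b + f) c \<circ> block_swap a b e \<circ> block_swap (a + b) (c + d) (e + f)) l =
   (block_sum (a + c + e) (b + d + f) (block_swap a c e) (block_swap b d f) \<circ>
     (block_swap (a + c) (b + d) e \<circ> block_swap a b c)) l"
    by (rule block_cases[where l = l and a = a and b = b and c = c and d = d and e = e and f = f]) (simp_all add: block_swap_def block_sum_def)
qed

lemma comp_perm_eq_block_sum:
  assumes "\<sigma> permutes {..<n}" "\<tau> permutes {..<m}" "i < n" "j < m"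
  shows "perm_upto (n + m - 2) (cpos n (\<sigma> i) (\<tau> j) \<circ> map_sum \<sigma> \<tau> \<circ> cflag n i j) =
    block_sum (n - 1) (m - 1) (del_perm n i \<sigma>) (del_perm m j \<tau>)"
  using assms(3,4) by (auto simp: fun_eq_iff perm_upto_def block_sum_def cpos_def cflag_def del_perm_def)

lemma block_sum_left: "l < r \<Longrightarrow> block_sum r s \<sigma> \<tau> l = \<sigma> l"
  and block_sum_right: "a < s \<Longrightarrow> block_sum r s \<sigma> \<tau> (r + a) = r + \<tau> a"
  by (simp_all add: block_sum_def)

lemma block_swap_eval:
  "a < p \<Longrightarrow> block_swap c p q (c + a) = c + q + a"
  "a < q \<Longrightarrow> block_swap c p q (c + p + a) = c + a"
  by (simp_all add: block_swap_def)

text \<open>Sorting outputs before inputs commutes with relabelling. \<open>A\<close> and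
  \<open>B\<close> are the cyclic relabellings of the remaining flags, \<open>\<alpha>\<close> and
  \<open>\<beta>\<close> the dioperadic ones of the outputs and of the inputs; the identity is read
  off block by block.\<close>

lemma block_sum_equivariance:
  assumes \<sigma>: "\<sigma> permutes {..<r}" and \<tau>: "\<tau> permutes {..<s}" and \<sigma>': "\<sigma>' permutes {..<r'}" and \<tau>': "\<tau>' permutes {..<s'}"
    and ij: "i < r" "j < s'"
  shows "block_swap (r - 1) s r' \<circ> block_sum (r + s - 1) (r' + s' - 1)
      (del_perm (r + s) i (block_sum r s \<sigma> \<tau>)) (del_perm (r' + s') (r' + j) (block_sum r' s' \<sigma>' \<tau>')) =
    block_sum (r + r' - 1) (s + s' - 1)
      (perm_upto (r + r' - 1) (opos r (\<sigma> i) \<circ> map_sum \<sigma> \<sigma>' \<circ> oflag r i))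
      (perm_upto (s + s' - 1) (ipos s (\<tau>' j) \<circ> map_sum \<tau> \<tau>' \<circ> iflag s j)) \<circ> block_swap (r - 1) s r'"
proof -
  obtain r0 s0 where r: "r = Suc r0" and s': "s' = Suc s0"
    using ij by (cases r; cases s') auto
  define A where "A = del_perm (r + s) i (block_sum r s \<sigma> \<tau>)"
  define B where "B = del_perm (r' + s') (r' + j) (block_sum r' s' \<sigma>' \<tau>')"
  define \<alpha> where "\<alpha> = perm_upto (r + r' - 1) (opos r (\<sigma> i) \<circ> map_sum \<sigma> \<sigma>' \<circ> oflag r i)"
  define \<beta> where "\<beta> = perm_upto (s + s' - 1) (ipos s (\<tau>' j) \<circ> map_sum \<tau> \<tau>' \<circ> iflag s j)"
  \<comment> \<open>\<open>u\<close> and \<open>v\<close> are \<open>\<sigma>\<close> with the glued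
    output removed and \<open>\<tau>'\<close> with the glued input removed; in terms of these all
    four permutations are explicit on blocks.\<close>
  define u where "u a = unskip (\<sigma> i) (\<sigma> (skip i a))" for a
  define v where "v a = unskip (\<tau>' j) (\<tau>' (skip j a))" for a
  have u: "u a < r0" if "a < r0" for a
    using unskip_less[of "\<sigma> (skip i a)" r "\<sigma> i"] skip_less[of a r i] that ij \<sigma> permutes_eq_iff[OF \<sigma>, of "skip i a" i]
    by (simp add: u_def r)
  have v: "v a < s0" if "a < s0" for a
    using unskip_less[of "\<tau>' (skip j a)" s' "\<tau>' j"] skip_less[of a s' j] that ij \<tau>' permutes_eq_iff[OF \<tau>', of "skip j a" j]
    by (simp add: v_def s')
  have bi: "block_sum r s \<sigma> \<tau> i = \<sigma> i" "block_sum r' s' \<sigma>' \<tau>' (r' + j) = r' + \<tau>' j"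
    using ij by (auto simp: block_sum_left block_sum_right)
  have A1: "A a = u a" if "a < r0" for a
    using that skip_less[of a r i] by (simp add: A_def del_perm_def perm_upto_def u_def bi[unfolded r] block_sum_left r)
  have A2: "A (r0 + a) = r0 + \<tau> a" if "a < s" for a
  proof -
    have sk: "skip i (r0 + a) = r + a" "\<sigma> i < r" using that ij \<sigma> by (auto simp: skip_def r)
    have "A (r0 + a) = unskip (block_sum r s \<sigma> \<tau> i) (block_sum r s \<sigma> \<tau> (skip i (r0 + a)))"
      using that by (simp add: A_def del_perm_def perm_upto_def r)
    also have "\<dots> = unskip (\<sigma> i) (r + \<tau> a)" unfolding sk bi block_sum_right[OF that] ..
    also have "\<dots> = r0 + \<tau> a" using sk by (simp add: unskip_def r)
    finally show ?thesis .
  qed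
  have B1: "B a = \<sigma>' a" if "a < r'" for a
  proof -
    have sk: "skip (r' + j) a = a" "\<sigma>' a < r'" using that \<sigma>' by (auto simp: skip_def)
    have "B a = unskip (block_sum r' s' \<sigma>' \<tau>' (r' + j)) (block_sum r' s' \<sigma>' \<tau>' (skip (r' + j) a))"
      using that by (simp add: B_def del_perm_def perm_upto_def s')
    also have "\<dots> = unskip (r' + \<tau>' j) (\<sigma>' a)" unfolding sk bi block_sum_left[OF that] ..
    also have "\<dots> = \<sigma>' a" using sk by (simp add: unskip_def)
    finally show ?thesis .
  qed
  have B2: "B (r' + a) = r' + v a" if "a < s0" for a
  proof -
    have sk: "skip (r' + j) (r' + a) = r' + skip j a" "skip j a < s'"
      using that by (auto simp: skip_def s')
    have "B (r' + a) = unskip (block_sum r' s' \<sigma>' \<tau>' (r' + j)) (block_sum r' s' \<sigma>' \<tau>' (skip (r' + j) (r' + a)))"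
      using that by (simp add: B_def del_perm_def perm_upto_def s')
    also have "\<dots> = unskip (r' + \<tau>' j) (r' + \<tau>' (skip j a))" unfolding sk bi block_sum_right[OF sk(2)] ..
    also have "\<dots> = r' + v a"
      using permutes_eq_iff[OF \<tau>', of "skip j a" j] by (auto simp: unskip_def v_def)
    finally show ?thesis .
  qed
  have \<alpha>1: "\<alpha> a = u a" if "a < r0" for a
    using that by (simp add: \<alpha>_def perm_upto_def opos_def oflag_def u_def r)
  have \<alpha>2: "\<alpha> (r0 + a) = r0 + \<sigma>' a" if "a < r'" for a
    using that by (simp add: \<alpha>_def perm_upto_def opos_def oflag_def r)
  have \<beta>1: "\<beta> a = \<tau> a" if "a < s" for a
    using that by (simp add: \<beta>_def perm_upto_def ipos_def iflag_def s')
  have \<beta>2: "\<beta> (s + a) = s + v a" if "a < s0" for a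
    using that by (simp add: \<beta>_def perm_upto_def ipos_def iflag_def v_def s')
  have "block_swap r0 s r' (block_sum (r0 + s) (r' + s0) A B l) = block_sum (r0 + r') (s + s0) \<alpha> \<beta> (block_swap r0 s r' l)" for l
  proof (rule block_cases[where l = l and a = r0 and b = s and c = r' and d = s0 and e = 0 and f = 0])
    assume l: "l < r0"
    then show ?thesis using u[OF l] by (simp add: block_sum_left block_swap_fix A1 \<alpha>1)
  next
    fix a assume a: "l = r0 + a" "a < s"
    have "\<tau> a < s" using a \<tau> by simp
    then show ?thesis
      using a block_sum_right[of a "s + s0" "r0 + r'" \<alpha> \<beta>]
      by (simp add: block_sum_left A2 block_swap_eval \<beta>1)
  next
    fix a assume a: "l = r0 + s + a" "a < r'"
    have "\<sigma>' a < r'" using a \<sigma>' by simp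
    then show ?thesis
      using a block_sum_right[of a "r' + s0" "r0 + s" A B]
      by (simp add: block_sum_left B1 block_swap_eval \<alpha>2)
  next
    fix a assume a: "l = r0 + s + r' + a" "a < s0"
    have l: "l = (r0 + s) + (r' + a)" "l = (r0 + r') + (s + a)" using a by simp_all
    have "block_swap r0 s r' l = l" by (rule block_swap_fix(2)) (simp add: a)
    moreover have "block_sum (r0 + s) (r' + s0) A B l = (r0 + s) + (r' + v a)"
      unfolding l(1) by (subst block_sum_right) (use a in \<open>simp_all add: B2\<close>)
    moreover have "block_sum (r0 + r') (s + s0) \<alpha> \<beta> l = (r0 + r') + (s + v a)"
      unfolding l(2) by (subst block_sum_right) (use a in \<open>simp_all add: \<beta>2\<close>)
    moreover have "block_swap r0 s r' ((r0 + s) + (r' + v a)) = (r0 + s) + (r' + v a)"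
      by (rule block_swap_fix(2)) simp
    ultimately show ?thesis by simp
  qed (simp_all add: block_sum_def block_swap_def)
  then show ?thesis
    unfolding A_def[symmetric] B_def[symmetric] \<alpha>_def[symmetric] \<beta>_def[symmetric] by (auto simp: r s' fun_eq_iff)
qed

section \<open>Consequences of the cyclic operad axioms\<close>

context cyclic_operad
begin

lemma act_closed: "1 \<le> n \<Longrightarrow> \<sigma> permutes {..<n} \<Longrightarrow> x \<in> el (cobj C n) d \<Longrightarrow> cact C n \<sigma> d x \<in> el (cobj C n) d"
  using act_linear unfolding linear_on_def by blast

lemma act_add: "1 \<le> n \<Longrightarrow> \<sigma> permutes {..<n} \<Longrightarrow> x \<in> el (cobj C n) d \<Longrightarrow> y \<in> el (cobj C n) d \<Longrightarrow>
  cact C n \<sigma> d (x \<oplus>\<^bsub>gr (cobj C n) d\<^esub> y) = cact C n \<sigma> d x \<oplus>\<^bsub>gr (cobj C n) d\<^esub> cact C n \<sigma> d y"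
  using act_linear unfolding linear_on_def by blast

lemma act_smult: "1 \<le> n \<Longrightarrow> \<sigma> permutes {..<n} \<Longrightarrow> x \<in> el (cobj C n) d \<Longrightarrow>
  cact C n \<sigma> d (c \<odot>\<^bsub>gr (cobj C n) d\<^esub> x) = c \<odot>\<^bsub>gr (cobj C n) d\<^esub> cact C n \<sigma> d x"
  using act_linear unfolding linear_on_def by blast

lemma act_inj:
  assumes "1 \<le> n" "\<sigma> permutes {..<n}" "x \<in> el (cobj C n) d" "y \<in> el (cobj C n) d"
    and "cact C n \<sigma> d x = cact C n \<sigma> d y"
  shows "x = y"
proof -
  have "cact C n (pinv \<sigma>) d (cact C n \<sigma> d x) = x" if "x \<in> el (cobj C n) d" for x
    using act_comp[OF assms(1,2) permutes_inv[OF assms(2)] that] permutes_inv_o(1)[OF assms(2)]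
      act_id[OF assms(1) that] by simp
  then show ?thesis using assms by metis
qed

lemma comp_closed:
  assumes "3 \<le> n + m" "i < n" "j < m" "x \<in> el (cobj C n) d" "y \<in> el (cobj C m) e"
  shows "ccomp C n i m j d e x y \<in> el (cobj C (n + m - 2)) (d + e)"
  using comp_bilinear[OF assms(1-3), of d e] assms(4,5) unfolding bilinear_on_def linear_on_def by blast

lemma comp_smult_right:
  assumes "3 \<le> n + m" "i < n" "j < m" "x \<in> el (cobj C n) d" "y \<in> el (cobj C m) e"
  shows "ccomp C n i m j d e x (c \<odot>\<^bsub>gr (cobj C m) e\<^esub> y) = c \<odot>\<^bsub>gr (cobj C (n + m - 2)) (d + e)\<^esub> ccomp C n i m j d e x y"
  using comp_bilinear[OF assms(1-3), of d e] assms(4,5) unfolding bilinear_on_def linear_on_def by blast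

lemma comp_smult_left:
  assumes "3 \<le> n + m" "i < n" "j < m" "x \<in> el (cobj C n) d" "y \<in> el (cobj C m) e"
  shows "ccomp C n i m j d e (c \<odot>\<^bsub>gr (cobj C n) d\<^esub> x) y = c \<odot>\<^bsub>gr (cobj C (n + m - 2)) (d + e)\<^esub> ccomp C n i m j d e x y"
  using comp_bilinear[OF assms(1-3), of d e] assms(4,5) unfolding bilinear_on_def linear_on_def by blast

lemma smult_smult: "1 \<le> n \<Longrightarrow> x \<in> el (cobj C n) d \<Longrightarrow>
  a \<odot>\<^bsub>gr (cobj C n) d\<^esub> (b \<odot>\<^bsub>gr (cobj C n) d\<^esub> x) = (a * b) \<odot>\<^bsub>gr (cobj C n) d\<^esub> x"
proof -
  assume n: "1 \<le> n" and "x \<in> el (cobj C n) d"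
  interpret Module.module kring "gr (cobj C n) d" by (rule dg_vector_space.vector_space[OF dg[OF n]])
  show ?thesis using smult_assoc1[of a b x] \<open>x \<in> el (cobj C n) d\<close> by simp
qed

lemma smult_closed: "1 \<le> n \<Longrightarrow> x \<in> el (cobj C n) d \<Longrightarrow> a \<odot>\<^bsub>gr (cobj C n) d\<^esub> x \<in> el (cobj C n) d"
  by (rule dg_vector_space.smult_closed[OF dg])

text \<open>A block swap of one factor survives as a block swap of the composite, in which the block
  that contained the glued flag is one shorter; this may also be the fixed initial block.\<close>

lemma comp_block_swap_left:
  assumes "3 \<le> n + m" "t < n" "j < m" "c + p + q \<le> n" "x \<in> el (cobj C n) d" "y \<in> el (cobj C m) e"
  shows "ccomp C n t m j d e (cact C n (block_swap c p q) d x) y =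
    cact C (n + m - 2)
      (block_swap (if t < c then c - 1 else c) (if c \<le> t \<and> t < c + p then p - 1 else p)
        (if c + p \<le> t \<and> t < c + p + q then q - 1 else q)) (d + e)
      (ccomp C n (block_swap c p q t) m j d e x y)"
proof -
  have y: "y = cact C m id e y" using act_id assms by simp
  have "ccomp C n t m j d e (cact C n (block_swap c p q) d x) (cact C m id e y) =
    cact C (n + m - 2) (perm_upto (n + m - 2)
       (cpos n (block_swap c p q t) (id j) \<circ> map_sum (block_swap c p q) id \<circ> cflag n t j)) (d + e)
      (ccomp C n (block_swap c p q t) m (id j) d e x y)"
    using assms by (intro equivariance) (auto simp: block_swap_permutes permutes_id)
  moreover have "perm_upto (n + m - 2)
       (cpos n (block_swap c p q t) (id j) \<circ> map_sum (block_swap c p q) id \<circ> cflag n t j) =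
    block_swap (if t < c then c - 1 else c) (if c \<le> t \<and> t < c + p then p - 1 else p)
        (if c + p \<le> t \<and> t < c + p + q then q - 1 else q)" (is "?L = ?R")
  proof
    fix l
    consider "l < n - 1" | "n - 1 \<le> l" "l < n + m - 2" | "n + m - 2 \<le> l" by linarith
    then show "?L l = ?R l"
    proof cases
      case 1
      then have "l < n + m - 2" using assms by linarith
      with 1 have "?L l = unskip (block_swap c p q t) (block_swap c p q (skip t l))"
        using assms by (simp add: perm_upto_def cpos_def cflag_def)
      also have "\<dots> = ?R l"
        by (rule unskip_block_swap_skip)
      finally show ?thesis .
    next
      case 2
      then have "?L l = l" using assms by (simp add: perm_upto_def cpos_def cflag_def)
      moreover have "?R l = l" using 2 assms(2,4) by (intro block_swap_fix(2)) auto
      ultimately show ?thesis by simp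
    next
      case 3
      then have "?L l = l" by (simp add: perm_upto_def)
      moreover have "?R l = l" using 3 assms(2,3,4) by (intro block_swap_fix(2)) auto
      ultimately show ?thesis by simp
    qed
  qed
  ultimately show ?thesis using y by simp
qed

lemma comp_block_swap_right:
  assumes "3 \<le> n + m" "i < n" "t < m" "c + p + q \<le> m" "x \<in> el (cobj C n) d" "y \<in> el (cobj C m) e"
  shows "ccomp C n i m t d e x (cact C m (block_swap c p q) e y) =
    cact C (n + m - 2)
      (block_swap (n - 1 + (if t < c then c - 1 else c)) (if c \<le> t \<and> t < c + p then p - 1 else p)
        (if c + p \<le> t \<and> t < c + p + q then q - 1 else q)) (d + e)
      (ccomp C n i m (block_swap c p q t) d e x y)"
proof -
  have x: "x = cact C n id d x" using act_id assms by simp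
  have "ccomp C n i m t d e (cact C n id d x) (cact C m (block_swap c p q) e y) =
    cact C (n + m - 2) (perm_upto (n + m - 2)
       (cpos n (id i) (block_swap c p q t) \<circ> map_sum id (block_swap c p q) \<circ> cflag n i t)) (d + e)
      (ccomp C n (id i) m (block_swap c p q t) d e x y)"
    using assms by (intro equivariance) (auto simp: block_swap_permutes permutes_id)
  moreover have "perm_upto (n + m - 2)
       (cpos n (id i) (block_swap c p q t) \<circ> map_sum id (block_swap c p q) \<circ> cflag n i t) =
    block_swap (n - 1 + (if t < c then c - 1 else c)) (if c \<le> t \<and> t < c + p then p - 1 else p)
        (if c + p \<le> t \<and> t < c + p + q then q - 1 else q)" (is "?L = ?R")
  proof
    fix l
    consider "l < n - 1" | "n - 1 \<le> l" "l < n + m - 2" | "n + m - 2 \<le> l" by linarith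
    then show "?L l = ?R l"
    proof cases
      case 1
      then have "l < n + m - 2" using assms by linarith
      with 1 have "?L l = l" using assms by (simp add: perm_upto_def cpos_def cflag_def)
      moreover have "?R l = l" using 1 by (intro block_swap_fix(1)) auto
      ultimately show ?thesis by simp
    next
      case 2
      then have "?L l = n - 1 + unskip (block_swap c p q t) (block_swap c p q (skip t (l - (n - 1))))"
        using assms by (simp add: perm_upto_def cpos_def cflag_def)
      also have "\<dots> = n - 1 + block_swap (if t < c then c - 1 else c) (if c \<le> t \<and> t < c + p then p - 1 else p)
        (if c + p \<le> t \<and> t < c + p + q then q - 1 else q) (l - (n - 1))"
        by (simp only: unskip_block_swap_skip)
      also have "\<dots> = ?R l" using 2 by (simp only: block_swap_shift)
      finally show ?thesis .
    next
      case 3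
      then have "?L l = l" by (simp add: perm_upto_def)
      moreover have "?R l = l" using 3 assms(2,3,4) by (intro block_swap_fix(2)) auto
      ultimately show ?thesis by simp
    qed
  qed
  ultimately show ?thesis using x by simp
qed

lemma comp_symmetric:
  assumes "3 \<le> n + m" "i < n" "j < m" "x \<in> el (cobj C n) d" "y \<in> el (cobj C m) e"
  shows "ccomp C n i m j d e x y =
    ksign (d * e) \<odot>\<^bsub>gr (cobj C (n + m - 2)) (d + e)\<^esub>
      cact C (n + m - 2) (block_swap 0 (n - 1) (m - 1)) (d + e) (ccomp C m j n i e d y x)"
proof -
  have "perm_upto (n + m - 2) (cpos m j i \<circ> case_sum Inr Inl \<circ> cflag n i j) = block_swap 0 (n - 1) (m - 1)"
    using assms by (auto simp: fun_eq_iff perm_upto_def block_swap_def cpos_def cflag_def)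
  then show ?thesis using symmetry[OF assms] by simp
qed

text \<open>The axiom \<open>assoc\<close> treats y as the middle factor. If x and z both stand to
  the left of y, then z and y are exchanged by symmetry, \<open>assoc\<close> applies, and a second
  exchange brings z to the front. This is the cyclic counterpart of
  \<open>assoc_inputs\<close>.\<close>

lemma comp_middle_right:
  assumes n: "i < n" "a < m" "b < m" "a \<noteq> b" "k < p" "5 \<le> n + m + p"
    and x: "x \<in> el (cobj C n) d" and y: "y \<in> el (cobj C m) e" and z: "z \<in> el (cobj C p) f"
  shows "ccomp C n i (p + m - 2) (p - 1 + unskip b a) d (f + e) x (ccomp C p k m b f e z y) =
    ksign (d * f) \<odot>\<^bsub>gr (cobj C (n + m + p - 4)) (d + e + f)\<^esub>
      cact C (n + m + p - 4) (block_swap 0 (n - 1) (p - 1)) (d + e + f)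
        (ccomp C p k (n + m - 2) (n - 1 + unskip a b) f (d + e) z (ccomp C n i m a d e x y))"
proof -
  let ?t = "p - 1 + unskip b a" and ?xy = "ccomp C n i m a d e x y" and ?yz = "ccomp C m b p k e f y z"
  let ?N = "n + m + p - 4" and ?D = "d + e + f"
  have u: "unskip b a < m - 1" "unskip a b < m - 1"
    using n by (metis unskip_less)+
  have ar: "m + p - 2 = p + m - 2" "p + m - 2 = m + p - 2" "n + (m + p - 2) - 2 = ?N" "p + (n + m - 2) - 2 = ?N" "n + m - 2 + p - 2 = ?N"
    "f + e = e + f" "d + (e + f) = ?D" "f + (d + e) = ?D" "3 \<le> p + m" "3 \<le> n + m" "3 \<le> m + p" "3 \<le> n + (m + p - 2)" "3 \<le> p + (n + m - 2)"
    "3 \<le> n + m - 2 + p" "1 \<le> ?N" "1 \<le> m + p - 2"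
    using n by auto
  have xy: "?xy \<in> el (cobj C (n + m - 2)) (d + e)"
    using n x y by (intro comp_closed) auto
  have yz: "?yz \<in> el (cobj C (m + p - 2)) (e + f)"
    using n y z by (intro comp_closed) auto
  have zxy: "ccomp C p k (n + m - 2) (n - 1 + unskip a b) f (d + e) z ?xy \<in> el (cobj C ?N) ?D"
    using comp_closed[OF ar(13) n(5) _ z xy, of "n - 1 + unskip a b"] n u unfolding ar(2-8) by simp
  have yz': "cact C (m + p - 2) (block_swap 0 (p - 1) (m - 1)) (e + f) ?yz \<in> el (cobj C (m + p - 2)) (e + f)"
    using n by (intro act_closed yz block_swap_permutes) auto
  have "ccomp C p k m b f e z y = ksign (f * e) \<odot>\<^bsub>gr (cobj C (m + p - 2)) (e + f)\<^esub>
      cact C (m + p - 2) (block_swap 0 (p - 1) (m - 1)) (e + f) ?yz"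
    using comp_symmetric[OF ar(9) n(5,3) z y] unfolding ar(6) ar(2) .
  then have "ccomp C n i (p + m - 2) ?t d (f + e) x (ccomp C p k m b f e z y) =
      ksign (f * e) \<odot>\<^bsub>gr (cobj C ?N) ?D\<^esub>
        ccomp C n i (m + p - 2) ?t d (e + f) x (cact C (m + p - 2) (block_swap 0 (p - 1) (m - 1)) (e + f) ?yz)"
    unfolding ar(2,6) using comp_smult_right[OF ar(12) n(1) _ x yz', of ?t] u n unfolding ar(3,7) by simp
  also have "ccomp C n i (m + p - 2) ?t d (e + f) x (cact C (m + p - 2) (block_swap 0 (p - 1) (m - 1)) (e + f) ?yz) =
      cact C ?N (block_swap (n - 1) (p - 1) (m - 2)) ?D (ccomp C n i (m + p - 2) (unskip b a) d (e + f) x ?yz)"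
  proof -
    have "block_swap 0 (p - 1) (m - 1) ?t = unskip b a" "m - 1 - 1 = m - 2"
      using u by (auto simp: block_swap_def)
    then show ?thesis
      using comp_block_swap_right[OF ar(12) n(1) _ _ x yz, of ?t 0 "p - 1" "m - 1"] u n unfolding ar(3,7) by simp
  qed
  also have "ccomp C n i (m + p - 2) (unskip b a) d (e + f) x ?yz =
      ccomp C (n + m - 2) (n - 1 + unskip a b) p k (d + e) f ?xy z"
    using assoc[OF n(6,1,2,3,4,5) x y z] by simp
  also have "\<dots> = ksign ((d + e) * f) \<odot>\<^bsub>gr (cobj C ?N) ?D\<^esub>
      cact C ?N (block_swap 0 (n + m - 3) (p - 1)) ?D (ccomp C p k (n + m - 2) (n - 1 + unskip a b) f (d + e) z ?xy)"
  proof -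
    have "n + m - 2 - 1 = n + m - 3" by simp
    then show ?thesis using comp_symmetric[OF ar(14) _ n(5) xy z, of "n - 1 + unskip a b"] u n unfolding ar(2-8) by simp
  qed
  finally have "ccomp C n i (p + m - 2) ?t d (f + e) x (ccomp C p k m b f e z y) =
      ksign (f * e) \<odot>\<^bsub>gr (cobj C ?N) ?D\<^esub> (ksign ((d + e) * f) \<odot>\<^bsub>gr (cobj C ?N) ?D\<^esub>
        cact C ?N (block_swap (n - 1) (p - 1) (m - 2)) ?D (cact C ?N (block_swap 0 (n + m - 3) (p - 1)) ?D
          (ccomp C p k (n + m - 2) (n - 1 + unskip a b) f (d + e) z ?xy)))"
    using act_smult[OF ar(15) _ act_closed[OF ar(15) _ zxy]] n by (simp add: block_swap_permutes)
  moreover have "block_swap 0 (n + m - 3) (p - 1) \<circ> block_swap (n - 1) (p - 1) (m - 2) = block_swap 0 (n - 1) (p - 1)"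
  proof -
    have "n + m - 3 = (n - 1) + (m - 2)" using n by linarith
    then show ?thesis by (simp only: block_swap_comp)
  qed
  \<comment> \<open>Moving z past y, and moving it past both x and y, together leave the sign of
    moving it past x.\<close>
  moreover have "ksign (f * e) * ksign ((d + e) * f) = (ksign (d * f) :: 'k)"
    by (auto simp: ksign_def)
  moreover have "block_swap (n - 1) (p - 1) (m - 2) permutes {..<?N}" "block_swap 0 (n + m - 3) (p - 1) permutes {..<?N}"
      "block_swap 0 (n - 1) (p - 1) permutes {..<?N}"
    using n by (auto intro!: block_swap_permutes)
  ultimately show ?thesis
    using act_closed[OF ar(15) _ zxy] by (simp add: act_comp[OF ar(15) _ _ zxy, symmetric] smult_smult[OF ar(15)])
qed

text \<open>The mirror argument for y as first factor, the counterpart of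
  \<open>assoc_outputs\<close>: y and x are exchanged, \<open>assoc\<close> applies, and x is moved
  to the end.\<close>

lemma comp_middle_left:
  assumes n: "i < n" "a < m" "b < m" "a \<noteq> b" "k < p" "5 \<le> n + m + p"
    and x: "x \<in> el (cobj C n) d" and y: "y \<in> el (cobj C m) e" and z: "z \<in> el (cobj C p) f"
  shows "ccomp C (m + n - 2) (unskip a b) p k (e + d) f (ccomp C m a n i e d y x) z =
    ksign (d * f) \<odot>\<^bsub>gr (cobj C (n + m + p - 4)) (d + e + f)\<^esub>
      cact C (n + m + p - 4) (block_swap (m - 2) (n - 1) (p - 1)) (d + e + f)
        (ccomp C (m + p - 2) (unskip b a) n i (e + f) d (ccomp C m b p k e f y z) x)"
proof -
  let ?t = "unskip a b" and ?xy = "ccomp C n i m a d e x y" and ?yz = "ccomp C m b p k e f y z"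
  let ?N = "n + m + p - 4" and ?D = "d + e + f"
  have u: "unskip b a < m - 1" "unskip a b < m - 1"
    using n by (metis unskip_less)+
  have ar: "m + n - 2 = n + m - 2" "m + p - 2 + n - 2 = ?N" "n + (m + p - 2) - 2 = ?N" "n + m - 2 + p - 2 = ?N"
    "e + d = d + e" "d + (e + f) = ?D" "3 \<le> m + n" "3 \<le> n + m" "3 \<le> m + p" "3 \<le> n + (m + p - 2)" "3 \<le> m + p - 2 + n"
    "3 \<le> n + m - 2 + p" "1 \<le> ?N" "1 \<le> n + m - 2" "e + f + d = ?D"
    using n by auto
  have xy: "?xy \<in> el (cobj C (n + m - 2)) (d + e)"
    using n x y by (intro comp_closed) auto
  have yz: "?yz \<in> el (cobj C (m + p - 2)) (e + f)"
    using n y z by (intro comp_closed) auto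
  have yzx: "ccomp C (m + p - 2) (unskip b a) n i (e + f) d ?yz x \<in> el (cobj C ?N) ?D"
    using comp_closed[OF ar(11) _ n(1) yz x, of "unskip b a"] n u unfolding ar(1-6,15) by simp
  have xy': "cact C (n + m - 2) (block_swap 0 (m - 1) (n - 1)) (d + e) ?xy \<in> el (cobj C (n + m - 2)) (d + e)"
    using n by (intro act_closed xy block_swap_permutes) auto
  have "ccomp C m a n i e d y x = ksign (e * d) \<odot>\<^bsub>gr (cobj C (n + m - 2)) (d + e)\<^esub>
      cact C (n + m - 2) (block_swap 0 (m - 1) (n - 1)) (d + e) ?xy"
    using comp_symmetric[OF ar(7) n(2,1) y x] unfolding ar(1,5) .
  then have "ccomp C (m + n - 2) ?t p k (e + d) f (ccomp C m a n i e d y x) z =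
      ksign (e * d) \<odot>\<^bsub>gr (cobj C ?N) ?D\<^esub>
        ccomp C (n + m - 2) ?t p k (d + e) f (cact C (n + m - 2) (block_swap 0 (m - 1) (n - 1)) (d + e) ?xy) z"
    unfolding ar(1,5) using comp_smult_left[OF ar(12) _ n(5) xy' z, of ?t] u n unfolding ar(4) by simp
  also have "ccomp C (n + m - 2) ?t p k (d + e) f (cact C (n + m - 2) (block_swap 0 (m - 1) (n - 1)) (d + e) ?xy) z =
      cact C ?N (block_swap 0 (m - 2) (n - 1)) ?D (ccomp C (n + m - 2) (n - 1 + unskip a b) p k (d + e) f ?xy z)"
  proof -
    have "block_swap 0 (m - 1) (n - 1) ?t = n - 1 + unskip a b" "m - 1 - 1 = m - 2"
      using u by (auto simp: block_swap_def)
    then show ?thesis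
      using comp_block_swap_left[OF ar(12) _ n(5) _ xy z, of ?t 0 "m - 1" "n - 1"] u n unfolding ar(4) by simp
  qed
  also have "ccomp C (n + m - 2) (n - 1 + unskip a b) p k (d + e) f ?xy z =
      ccomp C n i (m + p - 2) (unskip b a) d (e + f) x ?yz"
    using assoc[OF n(6,1,2,3,4,5) x y z] by simp
  also have "\<dots> = ksign (d * (e + f)) \<odot>\<^bsub>gr (cobj C ?N) ?D\<^esub>
      cact C ?N (block_swap 0 (n - 1) (m + p - 3)) ?D (ccomp C (m + p - 2) (unskip b a) n i (e + f) d ?yz x)"
  proof -
    have "m + p - 2 - 1 = m + p - 3" by simp
    then show ?thesis using comp_symmetric[OF ar(10) n(1) _ x yz, of "unskip b a"] u n unfolding ar(1-6,15) by simp
  qed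
  finally have "ccomp C (m + n - 2) ?t p k (e + d) f (ccomp C m a n i e d y x) z =
      ksign (e * d) \<odot>\<^bsub>gr (cobj C ?N) ?D\<^esub> (ksign (d * (e + f)) \<odot>\<^bsub>gr (cobj C ?N) ?D\<^esub>
        cact C ?N (block_swap 0 (m - 2) (n - 1)) ?D (cact C ?N (block_swap 0 (n - 1) (m + p - 3)) ?D
          (ccomp C (m + p - 2) (unskip b a) n i (e + f) d ?yz x)))"
    using act_smult[OF ar(13) _ act_closed[OF ar(13) _ yzx]] n by (simp add: block_swap_permutes)
  moreover have "block_swap 0 (n - 1) (m + p - 3) \<circ> block_swap 0 (m - 2) (n - 1) = block_swap (m - 2) (n - 1) (p - 1)"
  proof -
    have "m + p - 3 = (m - 2) + (p - 1)" using n by linarith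
    then show ?thesis by (simp only: block_swap_comp)
  qed
  moreover have "ksign (e * d) * ksign (d * (e + f)) = (ksign (d * f) :: 'k)"
    by (auto simp: ksign_def)
  moreover have "block_swap 0 (m - 2) (n - 1) permutes {..<?N}" "block_swap 0 (n - 1) (m + p - 3) permutes {..<?N}"
      "block_swap (m - 2) (n - 1) (p - 1) permutes {..<?N}"
    using n by (auto intro!: block_swap_permutes)
  ultimately show ?thesis
    using act_closed[OF ar(13) _ yzx] by (simp add: act_comp[OF ar(13) _ _ yzx, symmetric] smult_smult[OF ar(13)])
qed

text \<open>Both \<open>\<iota>\<close> and the action of a permutation are injective, so each
  identity may be checked after embedding, where it is an instance of the cyclic axioms up to
  relabelling. The block swap in \<open>\<iota>_comp\<close> is there because the cyclic composite
  lists the inputs of the first corolla before the outputs of the second.\<close>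

lemma dioperad_by_embedding:
  fixes P :: "('k, 'y) dioperad_data" and \<iota> :: "nat \<Rightarrow> nat \<Rightarrow> int \<Rightarrow> 'y \<Rightarrow> 'x"
  assumes module: "\<And>r s d. 1 \<le> r + s \<Longrightarrow> Module.module (kring :: 'k ring) (gr (dobj P r s) d)"
    and P_dif_linear: "\<And>r s d. 1 \<le> r + s \<Longrightarrow> linear_on (gr (dobj P r s) d) (gr (dobj P r s) (d + 1)) (dif (dobj P r s) d)"
    and P_act_linear: "\<And>r s \<sigma> \<tau> d. \<lbrakk>1 \<le> r + s; \<sigma> permutes {..<r}; \<tau> permutes {..<s}\<rbrakk> \<Longrightarrow>
      linear_on (gr (dobj P r s) d) (gr (dobj P r s) d) (dact P r s \<sigma> \<tau> d)"
    and P_comp_bilinear: "\<And>r s r' s' i j d e. \<lbrakk>3 \<le> r + s + r' + s'; i < r; j < s'\<rbrakk> \<Longrightarrow>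
      bilinear_on (gr (dobj P r s) d) (gr (dobj P r' s') e)
        (gr (dobj P (r + r' - 1) (s + s' - 1)) (d + e)) (dcomp P r s i r' s' j d e)"
    and \<iota>_linear: "\<And>r s d. 1 \<le> r + s \<Longrightarrow> linear_on (gr (dobj P r s) d) (gr (cobj C (r + s)) d) (\<iota> r s d)"
    and \<iota>_inj: "\<And>r s d. 1 \<le> r + s \<Longrightarrow> inj_on (\<iota> r s d) (el (dobj P r s) d)"
    and \<iota>_dif: "\<And>r s d x. \<lbrakk>1 \<le> r + s; x \<in> el (dobj P r s) d\<rbrakk> \<Longrightarrow>
      \<iota> r s (d + 1) (dif (dobj P r s) d x) = dif (cobj C (r + s)) d (\<iota> r s d x)"
    and \<iota>_act: "\<And>r s \<sigma> \<tau> d x. \<lbrakk>1 \<le> r + s; \<sigma> permutes {..<r}; \<tau> permutes {..<s}; x \<in> el (dobj P r s) d\<rbrakk> \<Longrightarrow>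
      \<iota> r s d (dact P r s \<sigma> \<tau> d x) = cact C (r + s) (block_sum r s \<sigma> \<tau>) d (\<iota> r s d x)"
    and \<iota>_comp: "\<And>r s r' s' i j d e x y. \<lbrakk>3 \<le> r + s + r' + s'; i < r; j < s'; x \<in> el (dobj P r s) d; y \<in> el (dobj P r' s') e\<rbrakk> \<Longrightarrow>
      cact C (r + s + (r' + s') - 2) (block_swap (r - 1) s r') (d + e)
        (\<iota> (r + r' - 1) (s + s' - 1) (d + e) (dcomp P r s i r' s' j d e x y)) =
      ccomp C (r + s) i (r' + s') (r' + j) d e (\<iota> r s d x) (\<iota> r' s' e y)"
  shows "dioperad P"
proof (rule dioperad.intro)
  note [simp] = \<iota>_act \<iota>_dif
  have dif_cl: "dif (dobj P r s) d x \<in> el (dobj P r s) (d + 1)" if "1 \<le> r + s" "x \<in> el (dobj P r s) d" for r s d x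
    using P_dif_linear[OF that(1), of d] that(2) unfolding linear_on_def by blast
  have act_cl: "dact P r s \<sigma> \<tau> d x \<in> el (dobj P r s) d"
    if "1 \<le> r + s" "\<sigma> permutes {..<r}" "\<tau> permutes {..<s}" "x \<in> el (dobj P r s) d" for r s \<sigma> \<tau> d x
    using P_act_linear[OF that(1-3), of d] that(4) unfolding linear_on_def by blast
  have comp_cl: "dcomp P r s i r' s' j d e x y \<in> el (dobj P (r + r' - 1) (s + s' - 1)) (d + e)"
    if "3 \<le> r + s + r' + s'" "i < r" "j < s'" "x \<in> el (dobj P r s) d" "y \<in> el (dobj P r' s') e" for r s i r' s' j d e x y
    using P_comp_bilinear[OF that(1-3), of d e] that(4,5) unfolding bilinear_on_def linear_on_def by blast
  have \<iota>_cl: "\<iota> r s d x \<in> el (cobj C (r + s)) d" if "1 \<le> r + s" "x \<in> el (dobj P r s) d" for r s d x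
    using \<iota>_linear[OF that(1), of d] that(2) unfolding linear_on_def by blast
  have \<iota>_add: "\<iota> r s d (x \<oplus>\<^bsub>gr (dobj P r s) d\<^esub> y) = \<iota> r s d x \<oplus>\<^bsub>gr (cobj C (r + s)) d\<^esub> \<iota> r s d y"
    if "1 \<le> r + s" "x \<in> el (dobj P r s) d" "y \<in> el (dobj P r s) d" for r s d x y
    using \<iota>_linear[OF that(1), of d] that(2,3) unfolding linear_on_def by blast
  have \<iota>_smult: "\<iota> r s d (c \<odot>\<^bsub>gr (dobj P r s) d\<^esub> x) = c \<odot>\<^bsub>gr (cobj C (r + s)) d\<^esub> \<iota> r s d x"
    if "1 \<le> r + s" "x \<in> el (dobj P r s) d" for r s d x c
    using \<iota>_linear[OF that(1), of d] that(2) unfolding linear_on_def by blast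
  have \<iota>_eqD: "x = y" if "1 \<le> r + s" "x \<in> el (dobj P r s) d" "y \<in> el (dobj P r s) d" "\<iota> r s d x = \<iota> r s d y" for r s d x y
    using \<iota>_inj[OF that(1)] that(2-4) by (auto dest: inj_onD)
  have add_cl: "x \<oplus>\<^bsub>gr (dobj P r s) d\<^esub> y \<in> el (dobj P r s) d"
    if "1 \<le> r + s" "x \<in> el (dobj P r s) d" "y \<in> el (dobj P r s) d" for r s d x y
  proof -
    interpret Module.module kring "gr (dobj P r s) d" by (rule module[OF that(1)])
    show ?thesis using that by (simp add: M.add.m_closed)
  qed
  have smult_cl: "c \<odot>\<^bsub>gr (dobj P r s) d\<^esub> x \<in> el (dobj P r s) d"
    if "1 \<le> r + s" "x \<in> el (dobj P r s) d" for r s d x c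
  proof -
    interpret Module.module kring "gr (dobj P r s) d" by (rule module[OF that(1)])
    show ?thesis using that by simp
  qed
  have cdif_cl: "dif (cobj C n) d x \<in> el (cobj C n) (d + 1)" if "1 \<le> n" "x \<in> el (cobj C n) d" for n d x
    by (rule dg_vector_space.dif_closed[OF dg[OF that(1)] that(2)])
  \<comment> \<open>The defining property of \<open>\<iota>\<close> with the arithmetic of arities normalized.\<close>
  have comp: "ccomp C n i m b d e (\<iota> r s d x) (\<iota> r' s' e y) =
      cact C N (block_swap (r - 1) s r') D (\<iota> R S D (dcomp P r s i r' s' j d e x y))"
    if "3 \<le> n + m" "i < r" "j < s'" "x \<in> el (dobj P r s) d" "y \<in> el (dobj P r' s') e"
      "n = r + s" "m = r' + s'" "b = r' + j" "N = n + m - 2" "D = d + e" "R = r + r' - 1" "S = s + s' - 1"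
    for r s r' s' i j d e x y n m b N D R S
    using \<iota>_comp[OF _ that(2-5)] that by (simp add: add.assoc)
  show "dg_vector_space (dobj P r s)" if rs: "1 \<le> r + s" for r s
  proof (rule dg_vector_space.intro)
    fix d x assume x: "x \<in> el (dobj P r s) d"
    interpret Cn: dg_vector_space "cobj C (r + s)" by (rule dg[OF rs])
    have z: "\<zero>\<^bsub>gr (dobj P r s) (d + 2)\<^esub> \<in> el (dobj P r s) (d + 2)"
    proof -
      interpret Module.module kring "gr (dobj P r s) (d + 2)" by (rule module[OF rs])
      show ?thesis by (rule M.zero_closed)
    qed
    have d: "d + 1 + 1 = d + 2" by simp
    have "\<iota> r s (d + 1 + 1) (dif (dobj P r s) (d + 1) (dif (dobj P r s) d x)) =
        dif (cobj C (r + s)) (d + 1) (dif (cobj C (r + s)) d (\<iota> r s d x))"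
      by (simp only: \<iota>_dif[OF rs dif_cl[OF rs x]] \<iota>_dif[OF rs x])
    also have "\<dots> = \<zero>\<^bsub>gr (cobj C (r + s)) (d + 2)\<^esub>" by (rule Cn.dif_dif[OF \<iota>_cl[OF rs x]])
    also have "\<dots> = \<iota> r s (d + 2) \<zero>\<^bsub>gr (dobj P r s) (d + 2)\<^esub>"
      by (rule linear_on_zero[OF \<iota>_linear[OF rs] module[OF rs] Cn.vector_space, symmetric])
    finally show "dif (dobj P r s) (d + 1) (dif (dobj P r s) d x) = \<zero>\<^bsub>gr (dobj P r s) (d + 2)\<^esub>"
      using \<iota>_eqD[OF rs _ z] dif_cl[OF rs dif_cl[OF rs x]] unfolding d by blast
  qed (use module P_dif_linear rs in blast)+
  show "dact P r s \<sigma> \<tau> (d + 1) (dif (dobj P r s) d x) = dif (dobj P r s) d (dact P r s \<sigma> \<tau> d x)"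
    if rs: "1 \<le> r + s" "\<sigma> permutes {..<r}" "\<tau> permutes {..<s}" and x: "x \<in> el (dobj P r s) d" for r s \<sigma> \<tau> d x
  proof (rule \<iota>_eqD[OF rs(1) act_cl[OF rs dif_cl[OF rs(1) x]] dif_cl[OF rs(1) act_cl[OF rs x]]])
    show "\<iota> r s (d + 1) (dact P r s \<sigma> \<tau> (d + 1) (dif (dobj P r s) d x)) = \<iota> r s (d + 1) (dif (dobj P r s) d (dact P r s \<sigma> \<tau> d x))"
      using act_dif[OF rs(1) block_sum_permutes[OF rs(2,3)] \<iota>_cl[OF rs(1) x]]
      by (simp only: \<iota>_act[OF rs dif_cl[OF rs(1) x]] \<iota>_act[OF rs x] \<iota>_dif[OF rs(1) x] \<iota>_dif[OF rs(1) act_cl[OF rs x]])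
  qed
  show "dact P r s id id d x = x" if rs: "1 \<le> r + s" and x: "x \<in> el (dobj P r s) d" for r s d x
  proof (rule \<iota>_eqD[OF rs])
    have "block_sum r s id id = id" by (auto simp: block_sum_def fun_eq_iff)
    then show "\<iota> r s d (dact P r s id id d x) = \<iota> r s d x"
      using rs x act_id[OF rs \<iota>_cl[OF rs x]] by (simp add: permutes_id)
  qed (use rs x act_cl permutes_id in blast)+
  show "dact P r s (\<sigma> \<circ> \<sigma>') (\<tau> \<circ> \<tau>') d x = dact P r s \<sigma>' \<tau>' d (dact P r s \<sigma> \<tau> d x)"
    if rs: "1 \<le> r + s" and p: "\<sigma> permutes {..<r}" "\<tau> permutes {..<s}" "\<sigma>' permutes {..<r}" "\<tau>' permutes {..<s}"
      and x: "x \<in> el (dobj P r s) d" for r s \<sigma> \<tau> \<sigma>' \<tau>' d x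
  proof (rule \<iota>_eqD[OF rs])
    have "block_sum r s \<sigma> \<tau> \<circ> block_sum r s \<sigma>' \<tau>' = block_sum r s (\<sigma> \<circ> \<sigma>') (\<tau> \<circ> \<tau>')"
      using p permutes_lessThan[OF p(3)] by (auto simp: block_sum_def fun_eq_iff)
    moreover have p': "(\<sigma> \<circ> \<sigma>') permutes {..<r}" "(\<tau> \<circ> \<tau>') permutes {..<s}" using p by (auto intro: permutes_compose)
    ultimately show "\<iota> r s d (dact P r s (\<sigma> \<circ> \<sigma>') (\<tau> \<circ> \<tau>') d x) = \<iota> r s d (dact P r s \<sigma>' \<tau>' d (dact P r s \<sigma> \<tau> d x))"
      using rs p x act_cl[OF rs p(1,2) x] act_comp[OF rs block_sum_permutes[OF p(1,2)] block_sum_permutes[OF p(3,4)] \<iota>_cl[OF rs x]]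
      by simp
    show "dact P r s (\<sigma> \<circ> \<sigma>') (\<tau> \<circ> \<tau>') d x \<in> el (dobj P r s) d" using act_cl[OF rs p' x] .
    show "dact P r s \<sigma>' \<tau>' d (dact P r s \<sigma> \<tau> d x) \<in> el (dobj P r s) d" using act_cl[OF rs p(3,4) act_cl[OF rs p(1,2) x]] .
  qed
  show "dif (dobj P (r + r' - 1) (s + s' - 1)) (d + e) (dcomp P r s i r' s' j d e x y) =
        dcomp P r s i r' s' j (d + 1) e (dif (dobj P r s) d x) y
          \<oplus>\<^bsub>gr (dobj P (r + r' - 1) (s + s' - 1)) (d + e + 1)\<^esub>
        ksign d \<odot>\<^bsub>gr (dobj P (r + r' - 1) (s + s' - 1)) (d + e + 1)\<^esub>
          dcomp P r s i r' s' j d (e + 1) x (dif (dobj P r' s') e y)"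
    if n: "3 \<le> r + s + r' + s'" "i < r" "j < s'" and x: "x \<in> el (dobj P r s) d" and y: "y \<in> el (dobj P r' s') e"
    for r s i r' s' j d e x y
  proof -
    let ?R = "r + r' - 1" and ?S = "s + s' - 1" and ?n = "r + s" and ?m = "r' + s'" and ?N = "r + s + (r' + s') - 2"
    have ar: "1 \<le> ?n" "1 \<le> ?m" "3 \<le> ?n + ?m" "1 \<le> ?N" "?R + ?S = ?N" "1 \<le> ?R + ?S" "r' + j < ?m" "i < ?n"
      "d + 1 + e = d + e + 1" "d + (e + 1) = d + e + 1"
      using n by auto
    let ?b = "block_swap (r - 1) s r'"
    have b: "?b permutes {..<?N}" using n by (intro block_swap_permutes) auto
    let ?xy = "dcomp P r s i r' s' j d e x y" and ?dxy = "dcomp P r s i r' s' j (d + 1) e (dif (dobj P r s) d x) y"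
      and ?xdy = "dcomp P r s i r' s' j d (e + 1) x (dif (dobj P r' s') e y)"
    have cl: "?xy \<in> el (dobj P ?R ?S) (d + e)" "?dxy \<in> el (dobj P ?R ?S) (d + e + 1)" "?xdy \<in> el (dobj P ?R ?S) (d + e + 1)"
      using comp_cl[OF n x y] comp_cl[OF n dif_cl[OF ar(1) x] y] comp_cl[OF n x dif_cl[OF ar(2) y]] unfolding ar by auto
    have icl: "\<iota> ?R ?S (d + e) ?xy \<in> el (cobj C ?N) (d + e)" "\<iota> ?R ?S (d + e + 1) ?dxy \<in> el (cobj C ?N) (d + e + 1)"
      "\<iota> ?R ?S (d + e + 1) ?xdy \<in> el (cobj C ?N) (d + e + 1)"
      using \<iota>_cl[OF ar(6) cl(1)] \<iota>_cl[OF ar(6) cl(2)] \<iota>_cl[OF ar(6) cl(3)] unfolding ar(5) by auto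
    \<comment> \<open>Both sides are compared after \<open>\<iota>\<close> and the block swap, which
      are cancelled at the end by \<open>act_inj\<close> and \<open>\<iota>_eqD\<close>.\<close>
    have "cact C ?N ?b (d + e + 1) (\<iota> ?R ?S (d + e + 1) (dif (dobj P ?R ?S) (d + e) ?xy)) =
        dif (cobj C ?N) (d + e) (cact C ?N ?b (d + e) (\<iota> ?R ?S (d + e) ?xy))"
      using act_dif[OF ar(4) b icl(1)] \<iota>_dif[OF ar(6) cl(1)] unfolding ar(5) by simp
    also have "\<dots> = dif (cobj C ?N) (d + e) (ccomp C ?n i ?m (r' + j) d e (\<iota> r s d x) (\<iota> r' s' e y))"
      using \<iota>_comp[OF n x y] by simp
    also have "\<dots> = ccomp C ?n i ?m (r' + j) (d + 1) e (dif (cobj C ?n) d (\<iota> r s d x)) (\<iota> r' s' e y)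
          \<oplus>\<^bsub>gr (cobj C ?N) (d + e + 1)\<^esub> ksign d \<odot>\<^bsub>gr (cobj C ?N) (d + e + 1)\<^esub>
          ccomp C ?n i ?m (r' + j) d (e + 1) (\<iota> r s d x) (dif (cobj C ?m) e (\<iota> r' s' e y))"
      by (rule comp_dif[OF ar(3,8,7) \<iota>_cl[OF ar(1) x] \<iota>_cl[OF ar(2) y]])
    also have "\<dots> = cact C ?N ?b (d + e + 1) (\<iota> ?R ?S (d + e + 1) ?dxy)
          \<oplus>\<^bsub>gr (cobj C ?N) (d + e + 1)\<^esub> ksign d \<odot>\<^bsub>gr (cobj C ?N) (d + e + 1)\<^esub>
          cact C ?N ?b (d + e + 1) (\<iota> ?R ?S (d + e + 1) ?xdy)"
      using \<iota>_comp[OF n dif_cl[OF ar(1) x] y] \<iota>_comp[OF n x dif_cl[OF ar(2) y]] \<iota>_dif[OF ar(1) x] \<iota>_dif[OF ar(2) y]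
      unfolding ar(9,10) by simp
    also have "\<dots> = cact C ?N ?b (d + e + 1) (\<iota> ?R ?S (d + e + 1)
        (?dxy \<oplus>\<^bsub>gr (dobj P ?R ?S) (d + e + 1)\<^esub> ksign d \<odot>\<^bsub>gr (dobj P ?R ?S) (d + e + 1)\<^esub> ?xdy))"
      using \<iota>_add[OF ar(6) cl(2) smult_cl[OF ar(6) cl(3)]] \<iota>_smult[OF ar(6) cl(3)]
        act_add[OF ar(4) b icl(2) smult_closed[OF ar(4) icl(3)]] act_smult[OF ar(4) b icl(3)]
      unfolding ar(5) by simp
    finally have "\<iota> ?R ?S (d + e + 1) (dif (dobj P ?R ?S) (d + e) ?xy) = \<iota> ?R ?S (d + e + 1)
        (?dxy \<oplus>\<^bsub>gr (dobj P ?R ?S) (d + e + 1)\<^esub> ksign d \<odot>\<^bsub>gr (dobj P ?R ?S) (d + e + 1)\<^esub> ?xdy)"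
      using act_inj[OF ar(4) b] \<iota>_cl[OF ar(6) dif_cl[OF ar(6) cl(1)]] \<iota>_cl[OF ar(6) add_cl[OF ar(6) cl(2) smult_cl[OF ar(6) cl(3)]]]
      unfolding ar(5) by blast
    then show ?thesis
      by (rule \<iota>_eqD[OF ar(6) dif_cl[OF ar(6) cl(1)] add_cl[OF ar(6) cl(2) smult_cl[OF ar(6) cl(3)]]])
  qed
  show "dcomp P r s i r' s' j d e (dact P r s \<sigma> \<tau> d x) (dact P r' s' \<sigma>' \<tau>' e y) =
        dact P (r + r' - 1) (s + s' - 1)
          (perm_upto (r + r' - 1) (opos r (\<sigma> i) \<circ> map_sum \<sigma> \<sigma>' \<circ> oflag r i))
          (perm_upto (s + s' - 1) (ipos s (\<tau>' j) \<circ> map_sum \<tau> \<tau>' \<circ> iflag s j)) (d + e)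
          (dcomp P r s (\<sigma> i) r' s' (\<tau>' j) d e x y)"
    if n: "3 \<le> r + s + r' + s'" "i < r" "j < s'"
      and p: "\<sigma> permutes {..<r}" "\<tau> permutes {..<s}" "\<sigma>' permutes {..<r'}" "\<tau>' permutes {..<s'}"
      and x: "x \<in> el (dobj P r s) d" and y: "y \<in> el (dobj P r' s') e"
    for r s i r' s' j d e \<sigma> \<tau> \<sigma>' \<tau>' x y
  proof -
    let ?R = "r + r' - 1" and ?S = "s + s' - 1" and ?n = "r + s" and ?m = "r' + s'" and ?N = "r + s + (r' + s') - 2"
    have ar: "1 \<le> ?n" "1 \<le> ?m" "3 \<le> ?n + ?m" "1 \<le> ?N" "?R + ?S = ?N" "1 \<le> ?R + ?S" "r' + j < ?m" "i < ?n" "?n - 1 + (?m - 1) = ?N"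
      using n by auto
    have ij: "\<sigma> i < r" "\<tau>' j < s'" using n p by simp_all
    let ?b = "block_swap (r - 1) s r'" and ?bs = "block_sum r s \<sigma> \<tau>" and ?bs' = "block_sum r' s' \<sigma>' \<tau>'"
    let ?\<rho> = "block_sum (?n - 1) (?m - 1) (del_perm ?n i ?bs) (del_perm ?m (r' + j) ?bs')"
    let ?\<alpha> = "perm_upto ?R (opos r (\<sigma> i) \<circ> map_sum \<sigma> \<sigma>' \<circ> oflag r i)"
    let ?\<beta> = "perm_upto ?S (ipos s (\<tau>' j) \<circ> map_sum \<tau> \<tau>' \<circ> iflag s j)"
    have b: "?b permutes {..<?N}" using n by (intro block_swap_permutes) auto
    have bs: "?bs permutes {..<?n}" "?bs' permutes {..<?m}" using p by (auto intro: block_sum_permutes)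
    have \<rho>: "?\<rho> permutes {..<?N}"
      using block_sum_permutes[OF del_perm_permutes[OF bs(1) ar(8)] del_perm_permutes[OF bs(2) ar(7)]] unfolding ar(9) .
    have \<alpha>: "?\<alpha> permutes {..<?R}"
    proof -
      have e: "?\<alpha> = block_sum (r - 1) r' (del_perm r i \<sigma>) \<sigma>'"
        using n p by (auto simp: fun_eq_iff perm_upto_def block_sum_def opos_def oflag_def del_perm_def)
      have "r - 1 + r' = ?R" using n by simp
      then show ?thesis using block_sum_permutes[OF del_perm_permutes[OF p(1) n(2)] p(3)] unfolding e by simp
    qed
    have \<beta>: "?\<beta> permutes {..<?S}"
    proof -
      have e: "?\<beta> = block_sum s (s' - 1) \<tau> (del_perm s' j \<tau>')"
        using n p by (auto simp: fun_eq_iff perm_upto_def block_sum_def ipos_def iflag_def del_perm_def)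
      have "s + (s' - 1) = ?S" using n by simp
      then show ?thesis using block_sum_permutes[OF p(2) del_perm_permutes[OF p(4) n(3)]] unfolding e by simp
    qed
    let ?xy = "dcomp P r s (\<sigma> i) r' s' (\<tau>' j) d e x y"
    have xy: "?xy \<in> el (dobj P ?R ?S) (d + e)" by (rule comp_cl[OF n(1) ij x y])
    have ixy: "\<iota> ?R ?S (d + e) ?xy \<in> el (cobj C ?N) (d + e)"
      using \<iota>_cl[OF ar(6) xy] unfolding ar(5) .
    have bsum: "block_sum ?R ?S ?\<alpha> ?\<beta> permutes {..<?N}"
      using block_sum_permutes[OF \<alpha> \<beta>] unfolding ar(5) .
    have lhs: "dcomp P r s i r' s' j d e (dact P r s \<sigma> \<tau> d x) (dact P r' s' \<sigma>' \<tau>' e y) \<in> el (dobj P ?R ?S) (d + e)"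
      by (rule comp_cl[OF n act_cl[OF ar(1) p(1,2) x] act_cl[OF ar(2) p(3,4) y]])
    have bi: "?bs i = \<sigma> i" "?bs' (r' + j) = r' + \<tau>' j" using n by (auto simp: block_sum_def)
    have "cact C ?N ?b (d + e) (\<iota> ?R ?S (d + e) (dcomp P r s i r' s' j d e (dact P r s \<sigma> \<tau> d x) (dact P r' s' \<sigma>' \<tau>' e y))) =
        ccomp C ?n i ?m (r' + j) d e (cact C ?n ?bs d (\<iota> r s d x)) (cact C ?m ?bs' e (\<iota> r' s' e y))"
      using \<iota>_comp[OF n act_cl[OF ar(1) p(1,2) x] act_cl[OF ar(2) p(3,4) y]] \<iota>_act[OF ar(1) p(1,2) x] \<iota>_act[OF ar(2) p(3,4) y] by simp
    also have "\<dots> = cact C ?N ?\<rho> (d + e) (ccomp C ?n (\<sigma> i) ?m (r' + \<tau>' j) d e (\<iota> r s d x) (\<iota> r' s' e y))"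
      using equivariance[OF ar(3,8,7) bs \<iota>_cl[OF ar(1) x] \<iota>_cl[OF ar(2) y]]
      unfolding comp_perm_eq_block_sum[OF bs ar(8,7)] unfolding bi .
    also have "\<dots> = cact C ?N ?\<rho> (d + e) (cact C ?N ?b (d + e) (\<iota> ?R ?S (d + e) ?xy))"
      using \<iota>_comp[OF n(1) ij x y] by simp
    also have "\<dots> = cact C ?N (?b \<circ> ?\<rho>) (d + e) (\<iota> ?R ?S (d + e) ?xy)"
      by (rule act_comp[OF ar(4) b \<rho> ixy, symmetric])
    \<comment> \<open>Pulling the sorting of the flags through turns the cyclic relabelling into a
      pair of dioperadic ones.\<close>
    also have "?b \<circ> ?\<rho> = block_sum ?R ?S ?\<alpha> ?\<beta> \<circ> ?b"
      by (rule block_sum_equivariance[OF p n(2,3)])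
    also have "cact C ?N (block_sum ?R ?S ?\<alpha> ?\<beta> \<circ> ?b) (d + e) (\<iota> ?R ?S (d + e) ?xy) =
        cact C ?N ?b (d + e) (\<iota> ?R ?S (d + e) (dact P ?R ?S ?\<alpha> ?\<beta> (d + e) ?xy))"
      using act_comp[OF ar(4) bsum b ixy] \<iota>_act[OF ar(6) \<alpha> \<beta> xy] unfolding ar(5) by simp
    finally have "\<iota> ?R ?S (d + e) (dcomp P r s i r' s' j d e (dact P r s \<sigma> \<tau> d x) (dact P r' s' \<sigma>' \<tau>' e y)) =
        \<iota> ?R ?S (d + e) (dact P ?R ?S ?\<alpha> ?\<beta> (d + e) ?xy)"
      using act_inj[OF ar(4) b] \<iota>_cl[OF ar(6) lhs] \<iota>_cl[OF ar(6) act_cl[OF ar(6) \<alpha> \<beta> xy]] unfolding ar(5) by blast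
    then show ?thesis by (rule \<iota>_eqD[OF ar(6) lhs act_cl[OF ar(6) \<alpha> \<beta> xy]])
  qed
  \<comment> \<open>Each associativity axiom is transported from \<open>C\<close> to \<open>P\<close> in this form.\<close>
  have transport: "u = c \<odot>\<^bsub>gr (dobj P R S) D\<^esub> dact P R S \<alpha> \<beta> D v"
    if u: "u \<in> el (dobj P R S) D" and v: "v \<in> el (dobj P R S) D" and RS: "1 \<le> R + S"
      and p: "\<alpha> permutes {..<R}" "\<beta> permutes {..<S}" "\<rho> permutes {..<R + S}" "\<rho>1 permutes {..<R + S}" "\<rho>2 permutes {..<R + S}"
      and eq: "cact C (R + S) \<rho> D (\<iota> R S D u) =
        c \<odot>\<^bsub>gr (cobj C (R + S)) D\<^esub> cact C (R + S) \<rho>2 D (cact C (R + S) \<rho>1 D (\<iota> R S D v))"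
      and \<rho>: "\<rho>1 \<circ> \<rho>2 = block_sum R S \<alpha> \<beta> \<circ> \<rho>"
    for R S D u v c \<alpha> \<beta> \<rho> \<rho>1 \<rho>2
  proof -
    have iv: "\<iota> R S D v \<in> el (cobj C (R + S)) D" by (rule \<iota>_cl[OF RS v])
    have av: "dact P R S \<alpha> \<beta> D v \<in> el (dobj P R S) D" by (rule act_cl[OF RS p(1,2) v])
    have cv: "c \<odot>\<^bsub>gr (dobj P R S) D\<^esub> dact P R S \<alpha> \<beta> D v \<in> el (dobj P R S) D" by (rule smult_cl[OF RS av])
    note bs = block_sum_permutes[OF p(1,2)]
    have "cact C (R + S) \<rho> D (\<iota> R S D u) = c \<odot>\<^bsub>gr (cobj C (R + S)) D\<^esub> cact C (R + S) (block_sum R S \<alpha> \<beta> \<circ> \<rho>) D (\<iota> R S D v)"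
      unfolding eq \<rho>[symmetric] act_comp[OF RS p(4,5) iv] ..
    also have "\<dots> = cact C (R + S) \<rho> D (\<iota> R S D (c \<odot>\<^bsub>gr (dobj P R S) D\<^esub> dact P R S \<alpha> \<beta> D v))"
      unfolding act_comp[OF RS bs p(3) iv] \<iota>_smult[OF RS av] \<iota>_act[OF RS p(1,2) v]
        act_smult[OF RS p(3) act_closed[OF RS bs iv]] ..
    finally have "\<iota> R S D u = \<iota> R S D (c \<odot>\<^bsub>gr (dobj P R S) D\<^esub> dact P R S \<alpha> \<beta> D v)"
      by (rule act_inj[OF RS p(3) \<iota>_cl[OF RS u] \<iota>_cl[OF RS cv]])
    then show ?thesis by (rule \<iota>_eqD[OF RS u cv])
  qed
  show "dcomp P (r + r' - 1) (s + s' - 1) (r - 1 + k) r'' s'' l (d + e) f (dcomp P r s i r' s' j d e x y) z =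
        dcomp P r s i (r' + r'' - 1) (s' + s'' - 1) j d (e + f) x (dcomp P r' s' k r'' s'' l e f y z)"
    if n: "5 \<le> r + s + r' + s' + r'' + s''" "i < r" "j < s'" "k < r'" "l < s''"
      and x: "x \<in> el (dobj P r s) d" and y: "y \<in> el (dobj P r' s') e" and z: "z \<in> el (dobj P r'' s'') f"
    for r s r' s' r'' s'' i j k l d e f x y z
  proof -
    let ?nx = "r + s" and ?ny = "r' + s'" and ?nz = "r'' + s''"
    let ?R = "r + r' + r'' - 2" and ?S = "s + s' + s'' - 2" and ?D = "d + e + f"
    let ?N = "?R + ?S"
    let ?xy = "dcomp P r s i r' s' j d e x y" and ?yz = "dcomp P r' s' k r'' s'' l e f y z"
    let ?L = "dcomp P (r + r' - 1) (s + s' - 1) (r - 1 + k) r'' s'' l (d + e) f ?xy z"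
    let ?T = "dcomp P r s i (r' + r'' - 1) (s' + s'' - 1) j d (e + f) x ?yz"
    let ?ix = "\<iota> r s d x" and ?iy = "\<iota> r' s' e y" and ?iz = "\<iota> r'' s'' f z"
    let ?ixy = "\<iota> (r + r' - 1) (s + s' - 1) (d + e) ?xy" and ?iyz = "\<iota> (r' + r'' - 1) (s' + s'' - 1) (e + f) ?yz"
    have ix: "?ix \<in> el (cobj C ?nx) d" and iy: "?iy \<in> el (cobj C ?ny) e" and iz: "?iz \<in> el (cobj C ?nz) f"
      using n by (auto intro!: \<iota>_cl x y z)
    have xy: "?xy \<in> el (dobj P (r + r' - 1) (s + s' - 1)) (d + e)" using n by (intro comp_cl x y) auto
    have yz: "?yz \<in> el (dobj P (r' + r'' - 1) (s' + s'' - 1)) (e + f)" using n by (intro comp_cl y z) auto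
    have RS: "r + r' - 1 + r'' - 1 = ?R" "s + s' - 1 + s'' - 1 = ?S" "r + (r' + r'' - 1) - 1 = ?R" "s + (s' + s'' - 1) - 1 = ?S"
      "d + (e + f) = ?D" "1 \<le> ?N" "r + r' - 1 + (s + s' - 1) = ?nx + ?ny - 2" "r' + r'' - 1 + (s' + s'' - 1) = ?ny + ?nz - 2"
      "?nx + ?ny - 2 + ?nz - 2 = ?N" "?nx + (?ny + ?nz - 2) - 2 = ?N" "1 \<le> ?nx + ?ny - 2" "1 \<le> ?ny + ?nz - 2"
      "3 \<le> ?nx + ?ny - 2 + ?nz" "3 \<le> ?nx + (?ny + ?nz - 2)"
      using n by auto
    have ixy: "?ixy \<in> el (cobj C (?nx + ?ny - 2)) (d + e)" and iyz: "?iyz \<in> el (cobj C (?ny + ?nz - 2)) (e + f)"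
      using \<iota>_cl[OF _ xy] \<iota>_cl[OF _ yz] RS(11,12) unfolding RS(7,8) by auto
    have L: "?L \<in> el (dobj P ?R ?S) ?D"
      using comp_cl[of "r + r' - 1" "s + s' - 1" r'' s'' "r - 1 + k" l, OF _ _ n(5) xy z] n unfolding RS by auto
    have T: "?T \<in> el (dobj P ?R ?S) ?D"
      using comp_cl[of r s "r' + r'' - 1" "s' + s'' - 1" i j, OF _ n(2) _ x yz] n unfolding RS by auto
    \<comment> \<open>In \<open>C\<close> the glued flags of y are the output \<open>k\<close> and
      the input \<open>r' + j\<close>. Deleting the earlier one shifts the later one to
      \<open>r' + j - 1\<close> and not conversely.\<close>
    have "ccomp C (?nx + ?ny - 2) (?nx - 1 + k) ?nz (r'' + l) (d + e) f (ccomp C ?nx i ?ny (r' + j) d e ?ix ?iy) ?iz =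
        ccomp C ?nx i (?ny + ?nz - 2) (r' + j - 1) d (e + f) ?ix (ccomp C ?ny k ?nz (r'' + l) e f ?iy ?iz)"
      using assoc[of ?nx ?ny ?nz i "r' + j" k "r'' + l", OF _ _ _ _ _ _ ix iy iz] n
      by (auto simp: unskip_def)
    also have "ccomp C ?nx i ?ny (r' + j) d e ?ix ?iy = cact C (?nx + ?ny - 2) (block_swap (r - 1) s r') (d + e) ?ixy"
      using n by (intro comp x y) auto
    also have "ccomp C ?ny k ?nz (r'' + l) e f ?iy ?iz = cact C (?ny + ?nz - 2) (block_swap (r' - 1) s' r'') (e + f) ?iyz"
      using n by (intro comp y z) auto
    also have "ccomp C (?nx + ?ny - 2) (?nx - 1 + k) ?nz (r'' + l) (d + e) f
        (cact C (?nx + ?ny - 2) (block_swap (r - 1) s r') (d + e) ?ixy) ?iz =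
        cact C ?N (block_swap (r - 1) s (r' - 1)) ?D (ccomp C (?nx + ?ny - 2) (r - 1 + k) ?nz (r'' + l) (d + e) f ?ixy ?iz)"
    proof -
      \<comment> \<open>In the cyclic composite output \<open>k\<close> of y comes after all
        remaining flags of x; in the sorted one it comes directly after the remaining outputs of
        x.\<close>
      have t: "block_swap (r - 1) s r' (?nx - 1 + k) = r - 1 + k" "\<not> ?nx - 1 + k < r - 1" "\<not> ?nx - 1 + k < r - 1 + s"
        "?nx - 1 + k < r - 1 + s + r'" "r - 1 + s \<le> ?nx - 1 + k" "?nx - 1 + k < ?nx + ?ny - 2" "r'' + l < ?nz" "r - 1 + s + r' \<le> ?nx + ?ny - 2"
        using n by (auto simp: block_swap_def)
      show ?thesis
        using comp_block_swap_left[OF RS(13) t(6,7,8) ixy iz] unfolding t(1) RS(9) using t by simp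
    qed
    also have "ccomp C (?nx + ?ny - 2) (r - 1 + k) ?nz (r'' + l) (d + e) f ?ixy ?iz =
        cact C ?N (block_swap (r + r' - 1 - 1) (s + s' - 1) r'') ?D (\<iota> ?R ?S ?D ?L)"
      using n by (intro comp xy z) auto
    also have "ccomp C ?nx i (?ny + ?nz - 2) (r' + j - 1) d (e + f) ?ix
        (cact C (?ny + ?nz - 2) (block_swap (r' - 1) s' r'') (e + f) ?iyz) =
        cact C ?N (block_swap (?nx - 1 + (r' - 1)) (s' - 1) r'') ?D (ccomp C ?nx i (?ny + ?nz - 2) (r' + r'' - 1 + j) d (e + f) ?ix ?iyz)"
    proof -
      have t: "block_swap (r' - 1) s' r'' (r' + j - 1) = r' + r'' - 1 + j" "\<not> r' + j - 1 < r' - 1" "r' + j - 1 < r' - 1 + s'"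
        "r' - 1 \<le> r' + j - 1" "\<not> r' - 1 + s' \<le> r' + j - 1" "i < ?nx" "r' + j - 1 < ?ny + ?nz - 2" "r' - 1 + s' + r'' \<le> ?ny + ?nz - 2"
        using n by (auto simp: block_swap_def)
      show ?thesis
        using comp_block_swap_right[OF RS(14) t(6,7,8) ix iyz] unfolding t(1) RS(10,5) using t by simp
    qed
    also have "ccomp C ?nx i (?ny + ?nz - 2) (r' + r'' - 1 + j) d (e + f) ?ix ?iyz =
        cact C ?N (block_swap (r - 1) s (r' + r'' - 1)) ?D (\<iota> ?R ?S ?D ?T)"
      using n by (intro comp x yz) auto
    finally have eq: "cact C ?N (block_swap (r - 1) s (r' - 1)) ?D (cact C ?N (block_swap (r + r' - 1 - 1) (s + s' - 1) r'') ?D (\<iota> ?R ?S ?D ?L)) =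
      cact C ?N (block_swap (?nx - 1 + (r' - 1)) (s' - 1) r'') ?D (cact C ?N (block_swap (r - 1) s (r' + r'' - 1)) ?D (\<iota> ?R ?S ?D ?T))" .
    have iL: "\<iota> ?R ?S ?D ?L \<in> el (cobj C ?N) ?D" and iT: "\<iota> ?R ?S ?D ?T \<in> el (cobj C ?N) ?D"
      by (rule \<iota>_cl[OF RS(6) L], rule \<iota>_cl[OF RS(6) T])
    have p: "block_swap (r - 1) s (r' - 1) permutes {..<?N}" "block_swap (r + r' - 1 - 1) (s + s' - 1) r'' permutes {..<?N}"
      "block_swap (?nx - 1 + (r' - 1)) (s' - 1) r'' permutes {..<?N}" "block_swap (r - 1) s (r' + r'' - 1) permutes {..<?N}"
      using n by (auto intro!: block_swap_permutes)
    have "block_swap (r - 1) s (r' + r'' - 1) \<circ> block_swap (?nx - 1 + (r' - 1)) (s' - 1) r'' =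
        block_swap (r + r' - 1 - 1) (s + s' - 1) r'' \<circ> block_swap (r - 1) s (r' - 1)"
    proof -
      have "r + r' - 1 - 1 = (r - 1) + (r' - 1)" "s + s' - 1 = s + (s' - 1)" "r' + r'' - 1 = (r' - 1) + r''" "?nx - 1 + (r' - 1) = (r - 1) + s + (r' - 1)"
        using n by auto
      then show ?thesis by (simp only: block_swap_chain)
    qed
    then have "cact C ?N (block_swap (r + r' - 1 - 1) (s + s' - 1) r'' \<circ> block_swap (r - 1) s (r' - 1)) ?D (\<iota> ?R ?S ?D ?L) =
        cact C ?N (block_swap (r + r' - 1 - 1) (s + s' - 1) r'' \<circ> block_swap (r - 1) s (r' - 1)) ?D (\<iota> ?R ?S ?D ?T)"
      using eq act_comp[OF RS(6) p(2,1) iL] act_comp[OF RS(6) p(4,3) iT] by simp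
    then have "\<iota> ?R ?S ?D ?L = \<iota> ?R ?S ?D ?T"
      by (rule act_inj[OF RS(6) permutes_compose[OF p(1,2)] iL iT])
    then show ?thesis by (rule \<iota>_eqD[OF RS(6) L T])
  qed
  show "dcomp P r s i (r'' + r' - 1) (s'' + s' - 1) (s'' + unskip l j) d (f + e) x
          (dcomp P r'' s'' k r' s' l f e z y) =
        ksign (d * f) \<odot>\<^bsub>gr (dobj P (r + r' + r'' - 2) (s + s' + s'' - 2)) (d + e + f)\<^esub>
          dact P (r + r' + r'' - 2) (s + s' + s'' - 2)
            (block_swap 0 (r - 1) (r'' - 1)) (block_swap 0 s s'') (d + e + f)
            (dcomp P r'' s'' k (r + r' - 1) (s + s' - 1) (s + unskip j l) f (d + e) z
              (dcomp P r s i r' s' j d e x y))"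
    if n: "5 \<le> r + s + r' + s' + r'' + s''" "i < r" "j < s'" "k < r''" "l < s'" "j \<noteq> l"
      and x: "x \<in> el (dobj P r s) d" and y: "y \<in> el (dobj P r' s') e" and z: "z \<in> el (dobj P r'' s'') f"
    for r s r' s' r'' s'' i j k l d e f x y z
  proof -
    let ?nx = "r + s" and ?ny = "r' + s'" and ?nz = "r'' + s''"
    let ?R = "r + r' + r'' - 2" and ?S = "s + s' + s'' - 2" and ?D = "d + e + f"
    let ?N = "?R + ?S"
    let ?xy = "dcomp P r s i r' s' j d e x y" and ?zy = "dcomp P r'' s'' k r' s' l f e z y"
    let ?L = "dcomp P r s i (r'' + r' - 1) (s'' + s' - 1) (s'' + unskip l j) d (f + e) x ?zy"
    let ?T = "dcomp P r'' s'' k (r + r' - 1) (s + s' - 1) (s + unskip j l) f (d + e) z ?xy"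
    let ?ix = "\<iota> r s d x" and ?iy = "\<iota> r' s' e y" and ?iz = "\<iota> r'' s'' f z"
    let ?ixy = "\<iota> (r + r' - 1) (s + s' - 1) (d + e) ?xy" and ?izy = "\<iota> (r'' + r' - 1) (s'' + s' - 1) (f + e) ?zy"
    have ix: "?ix \<in> el (cobj C ?nx) d" and iy: "?iy \<in> el (cobj C ?ny) e" and iz: "?iz \<in> el (cobj C ?nz) f"
      using n by (auto intro!: \<iota>_cl x y z)
    have u: "unskip l j < s' - 1" "unskip j l < s' - 1" using n by (metis unskip_less)+
    \<comment> \<open>Both glued flags of y are inputs, so the offset \<open>r'\<close> passes
      through the renumbering.\<close>
    have u': "unskip (r' + l) (r' + j) = r' + unskip l j" "unskip (r' + j) (r' + l) = r' + unskip j l"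
      using n by (auto simp: unskip_def)
    have xy: "?xy \<in> el (dobj P (r + r' - 1) (s + s' - 1)) (d + e)" using n by (intro comp_cl x y) auto
    have zy: "?zy \<in> el (dobj P (r'' + r' - 1) (s'' + s' - 1)) (f + e)" using n by (intro comp_cl y z) auto
    have RS: "r + (r'' + r' - 1) - 1 = ?R" "s + (s'' + s' - 1) - 1 = ?S" "r'' + (r + r' - 1) - 1 = ?R" "s'' + (s + s' - 1) - 1 = ?S"
      "d + (f + e) = ?D" "1 \<le> ?N" "r + r' - 1 + (s + s' - 1) = ?nx + ?ny - 2" "r'' + r' - 1 + (s'' + s' - 1) = ?nz + ?ny - 2"
      "?nx + (?nz + ?ny - 2) - 2 = ?N" "?nz + (?nx + ?ny - 2) - 2 = ?N" "1 \<le> ?nx + ?ny - 2" "1 \<le> ?nz + ?ny - 2"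
      "3 \<le> ?nx + (?nz + ?ny - 2)" "3 \<le> ?nz + (?nx + ?ny - 2)" "f + (d + e) = ?D" "?nx + ?ny + ?nz - 4 = ?N"
      using n by auto
    have ixy: "?ixy \<in> el (cobj C (?nx + ?ny - 2)) (d + e)" and izy: "?izy \<in> el (cobj C (?nz + ?ny - 2)) (f + e)"
      using \<iota>_cl[OF _ xy] \<iota>_cl[OF _ zy] RS(11,12) unfolding RS(7,8) by auto
    have L: "?L \<in> el (dobj P ?R ?S) ?D"
      using comp_cl[of r s "r'' + r' - 1" "s'' + s' - 1" i "s'' + unskip l j", OF _ n(2) _ x zy] n u unfolding RS by auto
    have T: "?T \<in> el (dobj P ?R ?S) ?D"
      using comp_cl[of r'' s'' "r + r' - 1" "s + s' - 1" k "s + unskip j l", OF _ n(4) _ z xy] n u unfolding RS by auto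
    have main: "ccomp C ?nx i (?nz + ?ny - 2) (?nz - 1 + (r' + unskip l j)) d (f + e) ?ix (ccomp C ?nz k ?ny (r' + l) f e ?iz ?iy) =
        ksign (d * f) \<odot>\<^bsub>gr (cobj C ?N) ?D\<^esub> cact C ?N (block_swap 0 (?nx - 1) (?nz - 1)) ?D
          (ccomp C ?nz k (?nx + ?ny - 2) (?nx - 1 + (r' + unskip j l)) f (d + e) ?iz (ccomp C ?nx i ?ny (r' + j) d e ?ix ?iy))"
      using comp_middle_right[of i ?nx "r' + j" ?ny "r' + l" k ?nz, OF _ _ _ _ _ _ ix iy iz] n unfolding u' RS(16) by auto
    have c1: "ccomp C ?nx i ?ny (r' + j) d e ?ix ?iy = cact C (?nx + ?ny - 2) (block_swap (r - 1) s r') (d + e) ?ixy"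
      using n by (intro comp x y) auto
    have c2: "ccomp C ?nz k ?ny (r' + l) f e ?iz ?iy = cact C (?nz + ?ny - 2) (block_swap (r'' - 1) s'' r') (f + e) ?izy"
      using n by (intro comp y z) auto
    have c3: "ccomp C ?nx i (?nz + ?ny - 2) (?nz - 1 + (r' + unskip l j)) d (f + e) ?ix
        (cact C (?nz + ?ny - 2) (block_swap (r'' - 1) s'' r') (f + e) ?izy) =
        cact C ?N (block_swap (?nx - 1 + (r'' - 1)) s'' r') ?D (ccomp C ?nx i (?nz + ?ny - 2) (r'' + r' - 1 + (s'' + unskip l j)) d (f + e) ?ix ?izy)"
    proof -
      have t: "block_swap (r'' - 1) s'' r' (?nz - 1 + (r' + unskip l j)) = r'' + r' - 1 + (s'' + unskip l j)"
        "\<not> ?nz - 1 + (r' + unskip l j) < r'' - 1" "\<not> ?nz - 1 + (r' + unskip l j) < r'' - 1 + s''"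
        "\<not> ?nz - 1 + (r' + unskip l j) < r'' - 1 + s'' + r'" "i < ?nx" "?nz - 1 + (r' + unskip l j) < ?nz + ?ny - 2" "r'' - 1 + s'' + r' \<le> ?nz + ?ny - 2"
        using n u by (auto simp: block_swap_def)
      show ?thesis
        using comp_block_swap_right[OF RS(13) t(5,6,7) ix izy] unfolding t(1) RS(9,5) using t by simp
    qed
    have c4: "ccomp C ?nx i (?nz + ?ny - 2) (r'' + r' - 1 + (s'' + unskip l j)) d (f + e) ?ix ?izy =
        cact C ?N (block_swap (r - 1) s (r'' + r' - 1)) ?D (\<iota> ?R ?S ?D ?L)"
      using n u by (intro comp x zy) auto
    have c5: "ccomp C ?nz k (?nx + ?ny - 2) (?nx - 1 + (r' + unskip j l)) f (d + e) ?iz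
        (cact C (?nx + ?ny - 2) (block_swap (r - 1) s r') (d + e) ?ixy) =
        cact C ?N (block_swap (?nz - 1 + (r - 1)) s r') ?D (ccomp C ?nz k (?nx + ?ny - 2) (r + r' - 1 + (s + unskip j l)) f (d + e) ?iz ?ixy)"
    proof -
      have t: "block_swap (r - 1) s r' (?nx - 1 + (r' + unskip j l)) = r + r' - 1 + (s + unskip j l)"
        "\<not> ?nx - 1 + (r' + unskip j l) < r - 1" "\<not> ?nx - 1 + (r' + unskip j l) < r - 1 + s"
        "\<not> ?nx - 1 + (r' + unskip j l) < r - 1 + s + r'" "k < ?nz" "?nx - 1 + (r' + unskip j l) < ?nx + ?ny - 2" "r - 1 + s + r' \<le> ?nx + ?ny - 2"
        using n u by (auto simp: block_swap_def)
      show ?thesis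
        using comp_block_swap_right[OF RS(14) t(5,6,7) iz ixy] unfolding t(1) RS(10,15) using t by simp
    qed
    have c6: "ccomp C ?nz k (?nx + ?ny - 2) (r + r' - 1 + (s + unskip j l)) f (d + e) ?iz ?ixy =
        cact C ?N (block_swap (r'' - 1) s'' (r + r' - 1)) ?D (\<iota> ?R ?S ?D ?T)"
      using n u by (intro comp z xy) auto
    let ?p1 = "block_swap (?nx - 1 + (r'' - 1)) s'' r'" and ?p2 = "block_swap (r - 1) s (r'' + r' - 1)"
    let ?p3 = "block_swap (?nz - 1 + (r - 1)) s r'" and ?p4 = "block_swap (r'' - 1) s'' (r + r' - 1)"
    let ?p5 = "block_swap 0 (?nx - 1) (?nz - 1)"
    have p: "?p1 permutes {..<?N}" "?p2 permutes {..<?N}" "?p3 permutes {..<?N}" "?p4 permutes {..<?N}" "?p5 permutes {..<?N}"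
      using n by (auto intro!: block_swap_permutes)
    have iL: "\<iota> ?R ?S ?D ?L \<in> el (cobj C ?N) ?D" and iT: "\<iota> ?R ?S ?D ?T \<in> el (cobj C ?N) ?D"
      by (rule \<iota>_cl[OF RS(6) L], rule \<iota>_cl[OF RS(6) T])
    show ?thesis
    proof (rule transport[OF L T RS(6) _ _ permutes_compose[OF p(1,2)] permutes_compose[OF p(3,4)] p(5)])
      show "cact C ?N (?p2 \<circ> ?p1) ?D (\<iota> ?R ?S ?D ?L) =
        ksign (d * f) \<odot>\<^bsub>gr (cobj C ?N) ?D\<^esub> cact C ?N ?p5 ?D (cact C ?N (?p4 \<circ> ?p3) ?D (\<iota> ?R ?S ?D ?T))"
        using main unfolding c1 c2 c3 c4 c5 c6 act_comp[OF RS(6) p(2,1) iL] act_comp[OF RS(6) p(4,3) iT] .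
      have "r'' + r' - 1 = (r'' - 1) + r'" "r + r' - 1 = (r - 1) + r'" "?nx - 1 + (r'' - 1) = (r - 1) + s + (r'' - 1)"
        "?nz - 1 + (r - 1) = (r'' - 1) + s'' + (r - 1)" "?nx - 1 = (r - 1) + s" "?nz - 1 = (r'' - 1) + s''"
        "?R = (r - 1) + (r'' - 1) + r'" "?S = s + s'' + (s' - 2)"
        using n by auto
      then show "?p4 \<circ> ?p3 \<circ> ?p5 = block_sum ?R ?S (block_swap 0 (r - 1) (r'' - 1)) (block_swap 0 s s'') \<circ> (?p2 \<circ> ?p1)"
        by (simp only: block_swap_inputs)
    qed (use n in \<open>auto intro!: block_swap_permutes\<close>)
  qed
  show "dcomp P (r' + r - 1) (s' + s - 1) (unskip i k) r'' s'' l (e + d) f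
          (dcomp P r' s' i r s j e d y x) z =
        ksign (d * f) \<odot>\<^bsub>gr (dobj P (r + r' + r'' - 2) (s + s' + s'' - 2)) (d + e + f)\<^esub>
          dact P (r + r' + r'' - 2) (s + s' + s'' - 2)
            (block_swap (r' - 2) r r'') (block_swap s' (s - 1) (s'' - 1)) (d + e + f)
            (dcomp P (r' + r'' - 1) (s' + s'' - 1) (unskip k i) r s j (e + f) d
              (dcomp P r' s' k r'' s'' l e f y z) x)"
    if n: "5 \<le> r + s + r' + s' + r'' + s''" "i < r'" "j < s" "k < r'" "l < s''" "i \<noteq> k"
      and x: "x \<in> el (dobj P r s) d" and y: "y \<in> el (dobj P r' s') e" and z: "z \<in> el (dobj P r'' s'') f"
    for r s r' s' r'' s'' i j k l d e f x y z
  proof -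
    let ?nx = "r + s" and ?ny = "r' + s'" and ?nz = "r'' + s''"
    let ?R = "r + r' + r'' - 2" and ?S = "s + s' + s'' - 2" and ?D = "d + e + f"
    let ?N = "?R + ?S"
    let ?yx = "dcomp P r' s' i r s j e d y x" and ?yz = "dcomp P r' s' k r'' s'' l e f y z"
    let ?L = "dcomp P (r' + r - 1) (s' + s - 1) (unskip i k) r'' s'' l (e + d) f ?yx z"
    let ?T = "dcomp P (r' + r'' - 1) (s' + s'' - 1) (unskip k i) r s j (e + f) d ?yz x"
    let ?ix = "\<iota> r s d x" and ?iy = "\<iota> r' s' e y" and ?iz = "\<iota> r'' s'' f z"
    let ?iyx = "\<iota> (r' + r - 1) (s' + s - 1) (e + d) ?yx" and ?iyz = "\<iota> (r' + r'' - 1) (s' + s'' - 1) (e + f) ?yz"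
    have ix: "?ix \<in> el (cobj C ?nx) d" and iy: "?iy \<in> el (cobj C ?ny) e" and iz: "?iz \<in> el (cobj C ?nz) f"
      using n by (auto intro!: \<iota>_cl x y z)
    have u: "unskip i k < r' - 1" "unskip k i < r' - 1" using n by (metis unskip_less)+
    have yx: "?yx \<in> el (dobj P (r' + r - 1) (s' + s - 1)) (e + d)" using n by (intro comp_cl x y) auto
    have yz: "?yz \<in> el (dobj P (r' + r'' - 1) (s' + s'' - 1)) (e + f)" using n by (intro comp_cl y z) auto
    have RS: "r' + r - 1 + r'' - 1 = ?R" "s' + s - 1 + s'' - 1 = ?S" "r' + r'' - 1 + r - 1 = ?R" "s' + s'' - 1 + s - 1 = ?S"
      "e + d + f = ?D" "1 \<le> ?N" "r' + r - 1 + (s' + s - 1) = ?ny + ?nx - 2" "r' + r'' - 1 + (s' + s'' - 1) = ?ny + ?nz - 2"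
      "?ny + ?nx - 2 + ?nz - 2 = ?N" "?ny + ?nz - 2 + ?nx - 2 = ?N" "1 \<le> ?ny + ?nx - 2" "1 \<le> ?ny + ?nz - 2"
      "3 \<le> ?ny + ?nx - 2 + ?nz" "3 \<le> ?ny + ?nz - 2 + ?nx" "e + f + d = ?D" "?nx + ?ny + ?nz - 4 = ?N"
      using n by auto
    have iyx: "?iyx \<in> el (cobj C (?ny + ?nx - 2)) (e + d)" and iyz: "?iyz \<in> el (cobj C (?ny + ?nz - 2)) (e + f)"
      using \<iota>_cl[OF _ yx] \<iota>_cl[OF _ yz] RS(11,12) unfolding RS(7,8) by auto
    have L: "?L \<in> el (dobj P ?R ?S) ?D"
      using comp_cl[of "r' + r - 1" "s' + s - 1" r'' s'' "unskip i k" l, OF _ _ n(5) yx z] n u unfolding RS by auto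
    have T: "?T \<in> el (dobj P ?R ?S) ?D"
      using comp_cl[of "r' + r'' - 1" "s' + s'' - 1" r s "unskip k i" j, OF _ _ n(3) yz x] n u unfolding RS by auto
    have main: "ccomp C (?ny + ?nx - 2) (unskip i k) ?nz (r'' + l) (e + d) f (ccomp C ?ny i ?nx (r + j) e d ?iy ?ix) ?iz =
        ksign (d * f) \<odot>\<^bsub>gr (cobj C ?N) ?D\<^esub> cact C ?N (block_swap (?ny - 2) (?nx - 1) (?nz - 1)) ?D
          (ccomp C (?ny + ?nz - 2) (unskip k i) ?nx (r + j) (e + f) d (ccomp C ?ny k ?nz (r'' + l) e f ?iy ?iz) ?ix)"
      using comp_middle_left[of "r + j" ?nx i ?ny k "r'' + l" ?nz, OF _ _ _ _ _ _ ix iy iz] n unfolding RS(16) by auto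
    have c1: "ccomp C ?ny i ?nx (r + j) e d ?iy ?ix = cact C (?ny + ?nx - 2) (block_swap (r' - 1) s' r) (e + d) ?iyx"
      using n by (intro comp x y) auto
    have c2: "ccomp C ?ny k ?nz (r'' + l) e f ?iy ?iz = cact C (?ny + ?nz - 2) (block_swap (r' - 1) s' r'') (e + f) ?iyz"
      using n by (intro comp y z) auto
    \<comment> \<open>The glued flags of y are now outputs and lie in front of the swapped blocks;
      only the fixed initial block becomes shorter.\<close>
    have c3: "ccomp C (?ny + ?nx - 2) (unskip i k) ?nz (r'' + l) (e + d) f
        (cact C (?ny + ?nx - 2) (block_swap (r' - 1) s' r) (e + d) ?iyx) ?iz =
        cact C ?N (block_swap (r' - 1 - 1) s' r) ?D (ccomp C (?ny + ?nx - 2) (unskip i k) ?nz (r'' + l) (e + d) f ?iyx ?iz)"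
    proof -
      have t: "block_swap (r' - 1) s' r (unskip i k) = unskip i k" "unskip i k < r' - 1"
        "\<not> r' - 1 \<le> unskip i k" "\<not> r' - 1 + s' \<le> unskip i k"
        "unskip i k < ?ny + ?nx - 2" "r'' + l < ?nz" "r' - 1 + s' + r \<le> ?ny + ?nx - 2"
        using n u by (auto simp: block_swap_def)
      show ?thesis
        using comp_block_swap_left[OF RS(13) t(5,6,7) iyx iz] unfolding t(1) RS(9,5) using t by simp
    qed
    have c4: "ccomp C (?ny + ?nx - 2) (unskip i k) ?nz (r'' + l) (e + d) f ?iyx ?iz =
        cact C ?N (block_swap (r' + r - 1 - 1) (s' + s - 1) r'') ?D (\<iota> ?R ?S ?D ?L)"
      using n u by (intro comp yx z) auto
    have c5: "ccomp C (?ny + ?nz - 2) (unskip k i) ?nx (r + j) (e + f) d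
        (cact C (?ny + ?nz - 2) (block_swap (r' - 1) s' r'') (e + f) ?iyz) ?ix =
        cact C ?N (block_swap (r' - 1 - 1) s' r'') ?D (ccomp C (?ny + ?nz - 2) (unskip k i) ?nx (r + j) (e + f) d ?iyz ?ix)"
    proof -
      have t: "block_swap (r' - 1) s' r'' (unskip k i) = unskip k i" "unskip k i < r' - 1"
        "\<not> r' - 1 \<le> unskip k i" "\<not> r' - 1 + s' \<le> unskip k i"
        "unskip k i < ?ny + ?nz - 2" "r + j < ?nx" "r' - 1 + s' + r'' \<le> ?ny + ?nz - 2"
        using n u by (auto simp: block_swap_def)
      show ?thesis
        using comp_block_swap_left[OF RS(14) t(5,6,7) iyz ix] unfolding t(1) RS(10,15) using t by simp
    qed
    have c6: "ccomp C (?ny + ?nz - 2) (unskip k i) ?nx (r + j) (e + f) d ?iyz ?ix =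
        cact C ?N (block_swap (r' + r'' - 1 - 1) (s' + s'' - 1) r) ?D (\<iota> ?R ?S ?D ?T)"
      using n u by (intro comp yz x) auto
    let ?p1 = "block_swap (r' - 1 - 1) s' r" and ?p2 = "block_swap (r' + r - 1 - 1) (s' + s - 1) r''"
    let ?p3 = "block_swap (r' - 1 - 1) s' r''" and ?p4 = "block_swap (r' + r'' - 1 - 1) (s' + s'' - 1) r"
    let ?p5 = "block_swap (?ny - 2) (?nx - 1) (?nz - 1)"
    have p: "?p1 permutes {..<?N}" "?p2 permutes {..<?N}" "?p3 permutes {..<?N}" "?p4 permutes {..<?N}" "?p5 permutes {..<?N}"
      using n by (auto intro!: block_swap_permutes)
    have iL: "\<iota> ?R ?S ?D ?L \<in> el (cobj C ?N) ?D" and iT: "\<iota> ?R ?S ?D ?T \<in> el (cobj C ?N) ?D"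
      by (rule \<iota>_cl[OF RS(6) L], rule \<iota>_cl[OF RS(6) T])
    show ?thesis
    proof (rule transport[OF L T RS(6) _ _ permutes_compose[OF p(1,2)] permutes_compose[OF p(3,4)] p(5)])
      show "cact C ?N (?p2 \<circ> ?p1) ?D (\<iota> ?R ?S ?D ?L) =
        ksign (d * f) \<odot>\<^bsub>gr (cobj C ?N) ?D\<^esub> cact C ?N ?p5 ?D (cact C ?N (?p4 \<circ> ?p3) ?D (\<iota> ?R ?S ?D ?T))"
        using main unfolding c1 c2 c3 c4 c5 c6 act_comp[OF RS(6) p(2,1) iL] act_comp[OF RS(6) p(4,3) iT] .
      have "r' - 1 - 1 = r' - 2" "r' + r - 1 - 1 = (r' - 2) + r" "r' + r'' - 1 - 1 = (r' - 2) + r''" "s' + s - 1 = s' + (s - 1)" "s' + s'' - 1 = s' + (s'' - 1)"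
        "?ny - 2 = (r' - 2) + s'" "?nx - 1 = r + (s - 1)" "?nz - 1 = r'' + (s'' - 1)"
        "?R = (r' - 2) + r + r''" "?S = s' + (s - 1) + (s'' - 1)"
        using n by auto
      then show "?p4 \<circ> ?p3 \<circ> ?p5 = block_sum ?R ?S (block_swap (r' - 2) r r'') (block_swap s' (s - 1) (s'' - 1)) \<circ> (?p2 \<circ> ?p1)"
        by (simp only: block_swap_outputs)
    qed (use n in \<open>auto intro!: block_swap_permutes\<close>)
  qed
qed (rule P_act_linear P_comp_bilinear; assumption)+

end

section \<open>Embeddings of presentations\<close>

text \<open>The last condition is injectivity of the induced map. Equations, and even the
  compatibility of a map with relations, can therefore be decided in the target
  presentation.\<close>

definition rel_embed ::
  "'g set \<Rightarrow> ('g \<Rightarrow>\<^sub>0 'k::field) set \<Rightarrow> 'h set \<Rightarrow> ('h \<Rightarrow>\<^sub>0 'k) set \<Rightarrow> ('g \<Rightarrow> ('h \<Rightarrow>\<^sub>0 'k)) \<Rightarrow> bool" where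
  "rel_embed G R H S E \<longleftrightarrow> presentation G R \<and> rel_map G R H S E \<and>
     (\<forall>x\<in>frees G. fextend E x \<in> free.span S \<longrightarrow> x \<in> free.span R)"

lemma rel_embed_cls_iff:
  assumes "rel_embed G R H S E" "x \<in> frees G" "y \<in> frees G"
  shows "cls S (fextend E x) = cls S (fextend E y) \<longleftrightarrow> cls R x = cls R y"
proof
  assume "cls S (fextend E x) = cls S (fextend E y)"
  then have "fextend E (x - y) \<in> free.span S" by (simp add: cls_eq_iff fextend_diff)
  then show "cls R x = cls R y"
    using assms frees_diff[of x G y] unfolding rel_embed_def cls_eq_iff by blast
qed (use assms rel_map_cls[of G R H S E x y] in \<open>auto simp: rel_embed_def\<close>)

lemma rel_embed_inj:
  assumes "rel_embed G R H S E"
  shows "inj_on (induced S E) (carrier (presented G R))"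
proof (rule inj_onI)
  fix x y assume "x \<in> carrier (presented G R)" "y \<in> carrier (presented G R)" and eq: "induced S E x = induced S E y"
  then obtain x' y' where *: "x = cls R x'" "x' \<in> frees G" "y = cls R y'" "y' \<in> frees G" by auto
  have "rel_map G R H S E" using assms by (simp add: rel_embed_def)
  then show "x = y"
    using eq rel_embed_cls_iff[OF assms *(2,4)] by (simp add: * induced_cls)
qed

text \<open>If the image of \<open>x\<close> is a relation, then so is its image under the left
  inverse, and that is \<open>x\<close> itself modulo relations.\<close>

lemma rel_embed_left_inverse:
  assumes "presentation G R" "rel_map G R H S E" "rel_map H S G R F"
    and "\<And>g. g \<in> G \<Longrightarrow> cls R (fextend F (E g)) = cls R (Poly_Mapping.single g 1)"
  shows "rel_embed G R H S E"
  unfolding rel_embed_def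
proof (intro conjI ballI impI assms)
  fix x assume x: "x \<in> frees G" "fextend E x \<in> free.span S"
  have "cls R (fextend F (fextend E x)) = cls R x"
    by (rule flin_cls_ext[where L = "\<lambda>x. fextend F (fextend E x)" and M = "\<lambda>x. x" and G = G];
      (rule flinI)?; use x(1) assms(4) in \<open>simp add: lin_simps frees_def\<close>)
  moreover have "cls R (fextend F (fextend E x)) = cls R (fextend F 0)"
    using x(2) by (intro rel_map_cls[OF assms(3)]) (simp add: cls_eq_iff)
  ultimately have "cls R x = cls R 0" by simp
  then show "x \<in> free.span R" by (simp only: cls_eq_0_iff)
qed

text \<open>A relation of the source goes to 0 along \<open>E1\<close> and \<open>h\<close>; so its
  image under \<open>f\<close> is killed by the embedding and must be a relation. Apart from its
  support, \<open>f\<close> needs only the intertwining property on generators.\<close>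

lemma rel_map_pullback:
  assumes E2: "rel_embed G2 R2 H2 S2 E2" and G1: "presentation G1 R1" and E1: "rel_map G1 R1 H1 S1 E1"
    and h: "rel_map H1 S1 H2 S2 h" and f: "\<And>g. g \<in> G1 \<Longrightarrow> f g \<in> frees G2"
    and eq: "\<And>g. g \<in> G1 \<Longrightarrow> cls S2 (fextend E2 (f g)) = cls S2 (fextend h (E1 g))"
  shows "rel_map G1 R1 G2 R2 f"
    and "x \<in> frees G1 \<Longrightarrow> cls S2 (fextend E2 (fextend f x)) = cls S2 (fextend h (fextend E1 x))"
proof -
  have *: "cls S2 (fextend E2 (fextend f x)) = cls S2 (fextend h (fextend E1 x))" if "x \<in> frees G1" for x
    by (rule flin_cls_ext[where L = "\<lambda>x. fextend E2 (fextend f x)" and M = "\<lambda>x. fextend h (fextend E1 x)" and G = G1];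
      (rule flinI)?; use that eq in \<open>simp add: lin_simps frees_def\<close>)
  then show "x \<in> frees G1 \<Longrightarrow> cls S2 (fextend E2 (fextend f x)) = cls S2 (fextend h (fextend E1 x))" .
  show "rel_map G1 R1 G2 R2 f"
    unfolding rel_map_def
  proof (intro conjI ballI f)
    fix r assume r: "r \<in> R1"
    then have "r \<in> frees G1" using G1 by (auto simp: presentation_def)
    moreover have "fextend E1 r \<in> free.span S1" using E1 r by (simp add: rel_map_def)
    then have "cls S2 (fextend h (fextend E1 r)) = cls S2 (fextend h 0)"
      by (intro rel_map_cls[OF h]) (simp add: cls_eq_iff)
    ultimately have "cls S2 (fextend E2 (fextend f r)) = cls S2 0" using * by simp
    then have "fextend E2 (fextend f r) \<in> free.span S2" by (simp only: cls_eq_0_iff)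
    moreover have "fextend f r \<in> frees G2" using \<open>r \<in> frees G1\<close> f by (rule frees_fextend)
    ultimately show "fextend f r \<in> free.span R2" using E2 by (simp add: rel_embed_def)
  qed auto
qed

text \<open>Allows an arbitrary vector as the fixed argument, because the pullback feeds
  \<open>h\<close> with embedded generators, which are vectors.\<close>

lemma rel_map2_fix_right:
  assumes "rel_map2 G R G' R' H S f" "y \<in> frees G'"
  shows "rel_map G R H S (\<lambda>g. fextend (f g) y)"
  unfolding rel_map_def
proof (intro conjI ballI)
  fix g assume "g \<in> G"
  then show "fextend (f g) y \<in> frees H"
    using rel_map2_frees[OF assms(1) frees_single[of g G 1] assms(2)] by (simp add: fextend2_def)
next
  fix r assume "r \<in> R"
  then have "cls R r = cls R 0" "r \<in> frees G" using assms(1) by (auto simp: cls_eq_iff free.span_base rel_map2_def presentation_def)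
  from rel_map2_cls[OF assms(1) this(2) assms(2) this(1) refl]
  show "fextend (\<lambda>g. fextend (f g) y) r \<in> free.span S"
    by (simp add: cls_eq_iff fextend2_def)
qed

lemma rel_map2_pullback:
  assumes E2: "rel_embed G2 R2 H2 S2 E2" and E1: "rel_map G1 R1 H1 S1 E1" and E1': "rel_map G1' R1' H1' S1' E1'"
    and G1: "presentation G1 R1" and G1': "presentation G1' R1'"
    and h: "rel_map2 H1 S1 H1' S1' H2 S2 h" and f: "\<And>g g'. g \<in> G1 \<Longrightarrow> g' \<in> G1' \<Longrightarrow> f g g' \<in> frees G2"
    and eq: "\<And>g g'. g \<in> G1 \<Longrightarrow> g' \<in> G1' \<Longrightarrow> cls S2 (fextend E2 (f g g')) = cls S2 (fextend2 h (E1 g) (E1' g'))"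
  shows "rel_map2 G1 R1 G1' R1' G2 R2 f"
    and "x \<in> frees G1 \<Longrightarrow> y \<in> frees G1' \<Longrightarrow>
      cls S2 (fextend E2 (fextend2 f x y)) = cls S2 (fextend2 h (fextend E1 x) (fextend E1' y))"
proof -
  have E: "E1 g \<in> frees H1" "E1' g' \<in> frees H1'" if "g \<in> G1" "g' \<in> G1'" for g g'
    using E1 E1' that by (auto simp: rel_map_def)
  show "rel_map2 G1 R1 G1' R1' G2 R2 f"
    unfolding rel_map2_def
  proof (intro conjI ballI G1 G1')
    fix g assume g: "g \<in> G1"
    have "E1 g \<in> frees H1" using E1 g by (simp add: rel_map_def)
    from rel_map2_fix_right[OF rel_map2_swap[OF h] this]
    show "rel_map G1' R1' G2 R2 (f g)"
      by (rule rel_map_pullback(1)[OF E2 G1' E1']) (use f eq g in \<open>auto simp: fextend2_def fextend2_swap[of h "E1 g", unfolded fextend2_def]\<close>)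
  next
    fix g' assume g': "g' \<in> G1'"
    have "E1' g' \<in> frees H1'" using E1' g' by (simp add: rel_map_def)
    from rel_map2_fix_right[OF h this]
    show "rel_map G1 R1 G2 R2 (\<lambda>g. f g g')"
      by (rule rel_map_pullback(1)[OF E2 G1 E1]) (use f eq g' in \<open>auto simp: fextend2_def\<close>)
  qed
  assume x: "x \<in> frees G1" and y: "y \<in> frees G1'"
  show "cls S2 (fextend E2 (fextend2 f x y)) = cls S2 (fextend2 h (fextend E1 x) (fextend E1' y))"
  proof (rule flin_cls_ext[where L = "\<lambda>x. fextend E2 (fextend2 f x y)" and
        M = "\<lambda>x. fextend2 h (fextend E1 x) (fextend E1' y)" and G = G1])
    fix g assume g: "g \<in> G1"
    show "cls S2 (fextend E2 (fextend2 f (Poly_Mapping.single g 1) y)) =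
        cls S2 (fextend2 h (fextend E1 (Poly_Mapping.single g 1)) (fextend E1' y))"
      by (rule flin_cls_ext[where L = "\<lambda>y. fextend E2 (fextend2 f (Poly_Mapping.single g 1) y)" and
        M = "\<lambda>y. fextend2 h (fextend E1 (Poly_Mapping.single g 1)) (fextend E1' y)" and G = G1'];
        (rule flinI)?; use y eq[OF g] in \<open>simp add: lin_simps frees_def\<close>)
  qed (use x in \<open>auto intro!: flinI simp: lin_simps frees_def\<close>)
qed

section \<open>The endomorphism dioperad\<close>

definition inl_letter :: "('k::field_char_0, 'a) dg \<Rightarrow> int \<times> 'a \<Rightarrow> int \<times> ('a \<times> ('a \<Rightarrow> 'k))" where
  "inl_letter V x = (fst x, (snd x, \<zero>\<^bsub>gr (dual V) (fst x)\<^esub>))"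

definition inr_letter :: "('k::field_char_0, 'a) dg \<Rightarrow> int \<times> ('a \<Rightarrow> 'k) \<Rightarrow> int \<times> ('a \<times> ('a \<Rightarrow> 'k))" where
  "inr_letter V x = (fst x, (\<zero>\<^bsub>gr V (fst x)\<^esub>, snd x))"

definition emb :: "('k::field_char_0, 'a) dg \<Rightarrow> ('k, 'a) di_word \<Rightarrow> (int \<times> ('a \<times> ('a \<Rightarrow> 'k))) list" where
  "emb V g = map (inl_letter V) (fst g) @ map (inr_letter V) (snd g)"

text \<open>Defined on all words: the first \<open>r\<close> letters keep only their component in
  the vector space, the others only their component in the dual. This projection is multilinear and
  a left inverse of \<open>emb\<close>.\<close>

definition unemb :: "nat \<Rightarrow> (int \<times> ('a \<times> ('a \<Rightarrow> 'k))) list \<Rightarrow> ('k::field_char_0, 'a) di_word" where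
  "unemb r w = (map (\<lambda>x. (fst x, fst (snd x))) (take r w), map (\<lambda>x. (fst x, snd (snd x))) (drop r w))"

lemma fst_letter [simp]: "fst (inl_letter V x) = fst x" "fst (inr_letter V y) = fst y"
  by (simp_all add: inl_letter_def inr_letter_def)

lemma map_fst_letters [simp]:
  "map fst (map (inl_letter V) u) = map fst u" "map fst (map (inr_letter V) w) = map fst w"
  by simp_all

lemma wdeg_letters [simp]:
  "wdeg (map (inl_letter V) u) = wdeg u" "wdeg (map (inr_letter V) w) = wdeg w"
  by (auto intro: wdeg_cong)

lemma unemb_emb: "length (fst g) = r \<Longrightarrow> unemb r (emb V g) = g"
  by (cases g) (simp add: unemb_def emb_def inl_letter_def inr_letter_def comp_def)

lemma di_words_iff:
  "(u, w) \<in> di_words V r s d \<longleftrightarrow> u \<in> words V r (wdeg u) \<and> w \<in> words (dual V) s (wdeg w) \<and> wdeg u + wdeg w = d"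
  by (auto simp: di_words_def words_iff)

lemma di_wordsI: "u \<in> words V r p \<Longrightarrow> w \<in> words (dual V) s q \<Longrightarrow> p + q = d \<Longrightarrow> (u, w) \<in> di_words V r s d"
  by (auto simp: di_words_def)

definition di_dif :: "('k::field_char_0, 'a) dg \<Rightarrow> ('k, 'a) di_word \<Rightarrow> (('k, 'a) di_word \<Rightarrow>\<^sub>0 'k)" where
  "di_dif V = (\<lambda>(u, w). fextend (\<lambda>u'. Poly_Mapping.single (u', w) 1) (wdif V u) +
         fextend (\<lambda>w'. Poly_Mapping.single (u, w') (ksign (wdeg u))) (wdif (dual V) w))"

definition di_act :: "(nat \<Rightarrow> nat) \<Rightarrow> (nat \<Rightarrow> nat) \<Rightarrow> ('k, 'a) di_word \<Rightarrow> (('k, 'a) di_word \<Rightarrow>\<^sub>0 'k::field_char_0)" where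
  "di_act \<sigma> \<tau> = (\<lambda>(u, w). Poly_Mapping.single (wperm \<sigma> u, wperm \<tau> w) (wsign \<sigma> u * wsign \<tau> w))"

lemma End_di_simps:
  "gr (dobj (End_di V) r s) d = presented (di_words V r s d) (di_rels V r s d)"
  "dif (dobj (End_di V) r s) d = induced (di_rels V r s (d + 1)) (di_dif V)"
  "dact (End_di V) r s \<sigma> \<tau> d = induced (di_rels V r s d) (di_act \<sigma> \<tau>)"
  "dcomp (End_di V) r s i r' s' j d e = induced2 (di_rels V (r + r' - 1) (s + s' - 1) (d + e)) (di_glue i j)"
  by (simp_all add: End_di_def di_dif_def di_act_def)

lemma wperm_map: "\<sigma> permutes {..<length u} \<Longrightarrow> wperm \<sigma> (map f u) = map f (wperm \<sigma> u)"
  by (rule nth_equalityI) auto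

lemma del_nth_map: "del_nth i (map f u) = map f (del_nth i u)"
  by (simp add: del_nth_def take_map drop_map)

section \<open>The embedding of pairs of words into words in the double\<close>

locale dg_double = dg_vector_space V + dual: dg_vector_space "dual V" + double: dg_form "double V" "double_form V"
  for V :: "('k::field_char_0, 'a) dg"
begin

abbreviation "D \<equiv> double V"
abbreviation "Drels n d \<equiv> multilin_rels (double V) n d id"

lemma inl_linear: "linear_on (gr V e) (gr D e) (\<lambda>v. (v, \<zero>\<^bsub>gr (dual V) e\<^esub>))"
  using dual.zero_closed[of e] by (auto simp: linear_on_def double_def dsum_simps dual_simps(2-4) fun_eq_iff)

lemma inr_linear: "linear_on (gr (dual V) e) (gr D e) (\<lambda>v. (\<zero>\<^bsub>gr V e\<^esub>, v))"
proof -
  interpret Module.module kring "gr V e" by (rule vector_space)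
  have "c \<odot>\<^bsub>gr V e\<^esub> \<zero>\<^bsub>gr V e\<^esub> = \<zero>\<^bsub>gr V e\<^esub>" for c using smult_r_null[of c] by simp
  then show ?thesis by (auto simp: linear_on_def double_def dsum_simps zero_closed)
qed

lemma fst_linear: "linear_on (gr D e) (gr V e) fst" and snd_linear: "linear_on (gr D e) (gr (dual V) e) snd"
  by (auto simp: linear_on_def double_def dsum_simps)

lemma emb_words: "(u, w) \<in> di_words V r s d \<Longrightarrow> emb V (u, w) \<in> words D (r + s) d"
  by (auto simp: di_words_iff words_iff emb_def nth_append inl_letter_def inr_letter_def double_def dsum_simps zero_closed dual.zero_closed)

lemma unemb_words:
  assumes "w \<in> words D (r + s) d"
  shows "unemb r w \<in> di_words V r s d"
proof -
  have len: "length w = r + s" using assms by (simp add: words_iff)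
  have "wdeg (map (\<lambda>x. (fst x, fst (snd x))) (take r w)) = wdeg (take r w)"
    "wdeg (map (\<lambda>x. (fst x, snd (snd x))) (drop r w)) = wdeg (drop r w)"
    by (rule wdeg_cong, simp)+
  moreover have "wdeg (take r w) + wdeg (drop r w) = d" using wdeg_take_drop[of r w] assms by (simp add: words_iff)
  ultimately show ?thesis
    using assms len by (auto simp: unemb_def di_words_iff words_iff double_def dsum_simps mem_Times_iff)
qed

lemma di_lin_left:
  assumes "(u, w) \<in> di_words V r s d" "k < r" "fst (u ! k) = e"
  shows "lin_mod (gr V e) (di_rels V r s d) (\<lambda>v. Poly_Mapping.single (u[k := (e, v)], w) c)"
proof -
  have *: "u \<in> words V r (wdeg u)" "w \<in> words (dual V) s (wdeg w)" "wdeg u + wdeg w = d"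
    using assms(1) by (auto simp: di_words_iff)
  have "multilin_rels V r (wdeg u) (\<lambda>u. (u, w)) \<subseteq> di_rels V r s d"
    unfolding di_rels_def using * by blast
  then have "multilin_rels V r (wdeg u) (\<lambda>u. (u, w)) \<subseteq> free.span (di_rels V r s d)"
    using free.span_superset by blast
  from lin_mod_letter[OF *(1) assms(2) zero_closed this] show ?thesis using assms(3) by simp
qed

lemma di_lin_right:
  assumes "(u, w) \<in> di_words V r s d" "k < s" "fst (w ! k) = e"
  shows "lin_mod (gr (dual V) e) (di_rels V r s d) (\<lambda>v. Poly_Mapping.single (u, w[k := (e, v)]) c)"
proof -
  have *: "u \<in> words V r (wdeg u)" "w \<in> words (dual V) s (wdeg w)" "wdeg u + wdeg w = d"
    using assms(1) by (auto simp: di_words_iff)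
  have "multilin_rels (dual V) s (wdeg w) (\<lambda>w. (u, w)) \<subseteq> di_rels V r s d"
    unfolding di_rels_def using * by blast
  then have "multilin_rels (dual V) s (wdeg w) (\<lambda>w. (u, w)) \<subseteq> free.span (di_rels V r s d)"
    using free.span_superset by blast
  from lin_mod_letter[OF *(2) assms(2) dual.zero_closed this] show ?thesis using assms(3) by simp
qed

lemma di_rels_cases:
  assumes "x \<in> di_rels V r s d"
  obtains (left) u w k where "(u, w) \<in> di_words V r s d" "k < r"
    "x \<in> lin_rels (gr V (fst (u ! k))) (\<lambda>v. (u[k := (fst (u ! k), v)], w))"
  | (right) u w k where "(u, w) \<in> di_words V r s d" "k < s"
    "x \<in> lin_rels (gr (dual V) (fst (w ! k))) (\<lambda>v. (u, w[k := (fst (w ! k), v)]))"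
proof -
  from assms consider
    p q w where "x \<in> multilin_rels V r p (\<lambda>u. (u, w))" "w \<in> words (dual V) s q" "p + q = d" |
    p q u where "x \<in> multilin_rels (dual V) s q (\<lambda>w. (u, w))" "u \<in> words V r p" "p + q = d"
    unfolding di_rels_def by blast
  then show thesis
  proof cases
    case (1 p q w)
    from 1(1) obtain u k where "u \<in> words V r p" "k < r" "x \<in> lin_rels (gr V (fst (u ! k))) (\<lambda>v. (u[k := (fst (u ! k), v)], w))"
      by (rule multilin_rels_cases)
    then show thesis using 1 by (intro left[of u w k]) (auto simp: di_words_def)
  next
    case (2 p q u)
    from 2(1) obtain w k where "w \<in> words (dual V) s q" "k < s" "x \<in> lin_rels (gr (dual V) (fst (w ! k))) (\<lambda>v. (u, w[k := (fst (w ! k), v)]))"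
      by (rule multilin_rels_cases)
    then show thesis using 2 by (intro right[of u w k]) (auto simp: di_words_def)
  qed
qed

lemma di_words_update:
  "(u, w) \<in> di_words V r s d \<Longrightarrow> k < r \<Longrightarrow> v \<in> el V (fst (u ! k)) \<Longrightarrow> (u[k := (fst (u ! k), v)], w) \<in> di_words V r s d"
  "(u, w) \<in> di_words V r s d \<Longrightarrow> k < s \<Longrightarrow> v' \<in> el (dual V) (fst (w ! k)) \<Longrightarrow> (u, w[k := (fst (w ! k), v')]) \<in> di_words V r s d"
  using words_update_fst[of u V r "wdeg u" k v] words_update_fst[of w "dual V" s "wdeg w" k v'] by (auto simp: di_words_iff)

lemma di_presentation: "presentation (di_words V r s d) (di_rels V r s d)"
  unfolding presentation_def
proof
  fix x assume "x \<in> di_rels V r s d"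
  then show "x \<in> frees (di_words V r s d)"
  proof (cases rule: di_rels_cases)
    case (left u w k)
    then show ?thesis
      using lin_rels_frees[OF vector_space[of "fst (u ! k)"], of "\<lambda>v. (u[k := (fst (u ! k), v)], w)" "di_words V r s d"]
        di_words_update(1) by blast
  next
    case (right u w k)
    then show ?thesis
      using lin_rels_frees[OF dual.vector_space[of "fst (w ! k)"], of "\<lambda>v. (u, w[k := (fst (w ! k), v)])" "di_words V r s d"]
        di_words_update(2) by blast
  qed
qed

definition E :: "('k, 'a) di_word \<Rightarrow> ((int \<times> ('a \<times> ('a \<Rightarrow> 'k))) list \<Rightarrow>\<^sub>0 'k)" where
  "E g = Poly_Mapping.single (emb V g) 1"

lemma emb_update:
  "k < length u \<Longrightarrow> emb V (u[k := (e, v)], w) = (emb V (u, w))[k := (e, (v, \<zero>\<^bsub>gr (dual V) e\<^esub>))]"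
  "k < length w \<Longrightarrow> emb V (u, w[k := (e, \<eta>)]) = (emb V (u, w))[length u + k := (e, (\<zero>\<^bsub>gr V e\<^esub>, \<eta>))]"
  by (simp_all add: emb_def map_update inl_letter_def inr_letter_def list_update_append)

lemma fst_nth_emb:
  "k < length u \<Longrightarrow> fst (emb V (u, w) ! k) = fst (u ! k)"
  "k < length w \<Longrightarrow> fst (emb V (u, w) ! (length u + k)) = fst (w ! k)"
  by (simp_all add: emb_def nth_append)

lemma E_rel_map: "rel_map (di_words V r s d) (di_rels V r s d) (words D (r + s) d) (Drels (r + s) d) E"
  unfolding rel_map_def
proof (intro conjI ballI)
  fix g assume "g \<in> di_words V r s d"
  then show "E g \<in> frees (words D (r + s) d)"
    by (cases g) (auto simp: E_def intro!: frees_single emb_words)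
next
  fix x assume "x \<in> di_rels V r s d"
  then show "fextend E x \<in> free.span (Drels (r + s) d)"
  proof (cases rule: di_rels_cases)
    case (left u w k)
    have len: "length u = r" "length w = s" using left by (auto simp: di_words_iff words_iff)
    have "lin_mod (gr D (fst (u ! k))) (Drels (r + s) d) (\<lambda>v. Poly_Mapping.single ((emb V (u, w))[k := (fst (u ! k), v)]) 1)"
      using left len by (intro double.lin_mod_word emb_words) (auto simp: fst_nth_emb)
    from lin_mod_compose[OF inl_linear this]
    have "lin_mod (gr V (fst (u ! k))) (Drels (r + s) d) (\<lambda>v. E (u[k := (fst (u ! k), v)], w))"
      using left len by (simp add: E_def emb_update)
    from lin_mod_fextend_rels[OF this left(3)] show ?thesis .
  next
    case (right u w k)
    have len: "length u = r" "length w = s" using right by (auto simp: di_words_iff words_iff)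
    have "lin_mod (gr D (fst (w ! k))) (Drels (r + s) d) (\<lambda>v. Poly_Mapping.single ((emb V (u, w))[r + k := (fst (w ! k), v)]) 1)"
      using right len fst_nth_emb(2)[of k w u] by (intro double.lin_mod_word emb_words) auto
    from lin_mod_compose[OF inr_linear this]
    have "lin_mod (gr (dual V) (fst (w ! k))) (Drels (r + s) d) (\<lambda>v. E (u, w[k := (fst (w ! k), v)]))"
      using right len by (simp add: E_def emb_update)
    from lin_mod_fextend_rels[OF this right(3)] show ?thesis .
  qed
qed

lemma unemb_update:
  assumes "length w = r + s" "k < r + s"
  shows "unemb r (w[k := (e, x)]) =
    (if k < r then ((fst (unemb r w))[k := (e, fst x)], snd (unemb r w))
     else (fst (unemb r w), (snd (unemb r w))[k - r := (e, snd x)]))"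
  using assms by (auto simp: unemb_def take_update_swap drop_update_swap map_update list_update_beyond)

lemma unemb_lin:
  assumes w: "w \<in> words D (r + s) d" and k: "k < r + s"
  shows "lin_mod (gr D (fst (w ! k))) (di_rels V r s d) (\<lambda>v. Poly_Mapping.single (unemb r (w[k := (fst (w ! k), v)])) c)"
proof -
  have len: "length w = r + s" using w by (simp add: words_iff)
  have g: "(fst (unemb r w), snd (unemb r w)) \<in> di_words V r s d" using unemb_words[OF w] by simp
  show ?thesis
  proof (cases "k < r")
    case True
    then have "fst (fst (unemb r w) ! k) = fst (w ! k)" using len by (simp add: unemb_def)
    from lin_mod_compose[OF fst_linear di_lin_left[OF g True this]] show ?thesis
      using True len by (simp add: unemb_update)
  next
    case False
    then have "drop r w ! (k - r) = w ! k" using len k by (subst nth_drop) auto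
    then have "fst (snd (unemb r w) ! (k - r)) = fst (w ! k)" using len k False by (simp add: unemb_def)
    from lin_mod_compose[OF snd_linear di_lin_right[OF g _ this]] show ?thesis
      using False len k by (simp add: unemb_update)
  qed
qed

lemma unemb_rel_map:
  "rel_map (words D (r + s) d) (Drels (r + s) d) (di_words V r s d) (di_rels V r s d) (\<lambda>w. Poly_Mapping.single (unemb r w) 1)"
  by (rule double.words_rel_mapI) (auto intro!: frees_single unemb_words unemb_lin)

lemma E_embed: "rel_embed (di_words V r s d) (di_rels V r s d) (words D (r + s) d) (Drels (r + s) d) E"
proof (rule rel_embed_left_inverse[OF di_presentation E_rel_map unemb_rel_map])
  fix g assume "g \<in> di_words V r s d"
  then have "length (fst g) = r" by (cases g) (auto simp: di_words_iff words_iff)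
  then show "cls (di_rels V r s d) (fextend (\<lambda>w. Poly_Mapping.single (unemb r w) 1) (E g)) = cls (di_rels V r s d) (Poly_Mapping.single g 1)"
    by (simp add: E_def unemb_emb)
qed

text \<open>Composition of pairs of words matches the gluing of words only after a block swap, so it
  has to be pulled back along \<open>E\<close> followed by a permutation. The inverse permutation
  shows that this is still an embedding.\<close>

lemma wact_embed:
  assumes E: "rel_embed G R (words D n d) (Drels n d) F" and \<rho>: "\<rho> permutes {..<n}"
  shows "rel_embed G R (words D n d) (Drels n d) (\<lambda>g. fextend (wact \<rho>) (F g))"
  unfolding rel_embed_def
proof (intro conjI ballI impI)
  have F: "rel_map G R (words D n d) (Drels n d) F" using E by (simp add: rel_embed_def)
  have c: "fextend (\<lambda>g. fextend (wact \<rho>) (F g)) x = fextend (wact \<rho>) (fextend F x)" for x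
    by (rule flin_fextend_compose[OF flin_fextend, symmetric])
  note w = double.wact_rel_map[OF \<rho>] and w' = double.wact_rel_map[OF permutes_inv[OF \<rho>]]
  show "presentation G R" using E by (simp add: rel_embed_def)
  show "rel_map G R (words D n d) (Drels n d) (\<lambda>g. fextend (wact \<rho>) (F g))"
    unfolding rel_map_def c
  proof (intro conjI ballI)
    fix g assume "g \<in> G"
    then show "fextend (wact \<rho>) (F g) \<in> frees (words D n d)"
      using F by (intro rel_map_frees[OF w]) (simp add: rel_map_def)
  next
    fix x assume "x \<in> R"
    then have "fextend F x \<in> free.span (Drels n d)" using F by (simp add: rel_map_def)
    then have "cls (Drels n d) (fextend (wact \<rho>) (fextend F x)) = cls (Drels n d) (fextend (wact \<rho>) 0)"
      by (intro rel_map_cls[OF w]) (simp add: cls_eq_iff)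
    then show "fextend (wact \<rho>) (fextend F x) \<in> free.span (Drels n d)" by (simp add: cls_eq_iff)
  qed
  fix x assume x: "x \<in> frees G" "fextend (\<lambda>g. fextend (wact \<rho>) (F g)) x \<in> free.span (Drels n d)"
  have Fx: "fextend F x \<in> frees (words D n d)" using rel_map_frees[OF F x(1)] .
  \<comment> \<open>Exact before passing to classes: the vector is supported on words of length
    \<open>n\<close>, where the signs of \<open>\<rho>\<close> and its inverse cancel.\<close>
  have "fextend (wact (pinv \<rho>)) (fextend (wact \<rho>) (fextend F x)) = fextend F x"
  proof (rule flin_ext[where x = "fextend F x" and L = "\<lambda>x. fextend (wact (pinv \<rho>)) (fextend (wact \<rho>) x)" and M = "\<lambda>x. x"])
    fix g assume "g \<in> Poly_Mapping.keys (fextend F x)"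
    then have "length g = n" using double.length_word_key[OF Fx] by simp
    then have "fextend (wact (pinv \<rho>)) (wact \<rho> g) = wact id g"
      using \<rho> permutes_inv[OF \<rho>] permutes_inv_o(1)[OF \<rho>] by (simp add: wact_comp)
    then show "fextend (wact (pinv \<rho>)) (fextend (wact \<rho>) (Poly_Mapping.single g 1)) = Poly_Mapping.single g 1"
      by (simp add: wact_def)
  qed (auto intro!: flinI simp: lin_simps)
  moreover have "cls (Drels n d) (fextend (wact (pinv \<rho>)) (fextend (wact \<rho>) (fextend F x))) = cls (Drels n d) (fextend (wact (pinv \<rho>)) 0)"
    using x(2) unfolding c by (intro rel_map_cls[OF w']) (simp add: cls_eq_iff)
  ultimately show "x \<in> free.span R"
    using E x(1) by (simp add: cls_eq_iff rel_embed_def)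
qed

lemma dif_letters:
  "dif D e (v, \<zero>\<^bsub>gr (dual V) e\<^esub>) = (dif V e v, \<zero>\<^bsub>gr (dual V) (e + 1)\<^esub>)"
  "dif D e (\<zero>\<^bsub>gr V e\<^esub>, \<eta>) = (\<zero>\<^bsub>gr V (e + 1)\<^esub>, dif (dual V) e \<eta>)"
  by (simp_all add: double_def dsum_simps(5) dif_zero dual.dif_zero)

text \<open>The factor \<open>ksign (wdeg u)\<close> in \<open>di_dif\<close> is the sign of the
  letters of \<open>u\<close>, which precede the second word in the joined word.\<close>

lemma E_dif: 
  assumes "(u, w) \<in> di_words V r s d"
  shows "fextend E (di_dif V (u, w)) = wdif D (emb V (u, w))"
proof -
  have len: "length u = r" "length w = s" using assms by (auto simp: di_words_iff words_iff)
  let ?t = "\<lambda>k. (emb V (u, w))[k := (fst (emb V (u, w) ! k) + 1, dif D (fst (emb V (u, w) ! k)) (snd (emb V (u, w) ! k)))]"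
  let ?F = "\<lambda>k. Poly_Mapping.single (?t k) (ksign (wdeg (take k (emb V (u, w)))) :: 'k)"
  have 1: "?F k = Poly_Mapping.single (emb V (u[k := (fst (u ! k) + 1, dif V (fst (u ! k)) (snd (u ! k)))], w)) (ksign (wdeg (take k u)))" if "k < r" for k
  proof -
    have "emb V (u, w) ! k = (fst (u ! k), (snd (u ! k), \<zero>\<^bsub>gr (dual V) (fst (u ! k))\<^esub>))"
      using that len by (simp add: emb_def nth_append inl_letter_def)
    moreover have "wdeg (take k (emb V (u, w))) = wdeg (take k u)"
      using that len by (simp add: emb_def take_map)
    ultimately show ?thesis using that len by (simp add: emb_update dif_letters)
  qed
  have 2: "?F (r + k) = Poly_Mapping.single (emb V (u, w[k := (fst (w ! k) + 1, dif (dual V) (fst (w ! k)) (snd (w ! k)))])) (ksign (wdeg u) * ksign (wdeg (take k w)))" if "k < s" for k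
  proof -
    have "emb V (u, w) ! (r + k) = (fst (w ! k), (\<zero>\<^bsub>gr V (fst (w ! k))\<^esub>, snd (w ! k)))"
      using that len by (simp add: emb_def nth_append inr_letter_def)
    moreover have "wdeg (take (r + k) (emb V (u, w))) = wdeg u + wdeg (take k w)"
      using that len by (simp add: emb_def take_map)
    ultimately show ?thesis using that len by (simp add: emb_update dif_letters ksign_add)
  qed
  have "wdif D (emb V (u, w)) = (\<Sum>k<r + s. ?F k)"
    using len by (simp add: wdif_def emb_def)
  also have "\<dots> = (\<Sum>k<r. ?F k) + (\<Sum>k<s. ?F (r + k))" by (rule sum_lessThan_add)
  also have "\<dots> = fextend E (di_dif V (u, w))"
    using len 1 2 by (simp add: di_dif_def wdif_def fextend_add fextend_sum fscale_sum E_def mult.commute)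
  finally show ?thesis by simp
qed

lemma E_act:
  assumes "(u, w) \<in> di_words V r s d" "\<sigma> permutes {..<r}" "\<tau> permutes {..<s}"
  shows "fextend E (di_act \<sigma> \<tau> (u, w)) = wact (block_sum r s \<sigma> \<tau>) (emb V (u, w))"
proof -
  have len: "length u = r" "length w = s" using assms by (auto simp: di_words_iff words_iff)
  have "wperm (block_sum r s \<sigma> \<tau>) (emb V (u, w)) = emb V (wperm \<sigma> u, wperm \<tau> w)"
    using len assms by (simp add: emb_def wperm_block_sum wperm_map)
  moreover have "wsign (block_sum r s \<sigma> \<tau>) (emb V (u, w)) = (wsign \<sigma> u * wsign \<tau> w :: 'k)"
    using len assms
    by (simp add: emb_def wsign_block_sum wsign_cong[of "map (inl_letter V) u" u \<sigma> \<sigma>] wsign_cong[of "map (inr_letter V) w" w \<tau> \<tau>])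
  ultimately show ?thesis by (simp add: di_act_def E_def wact_def)
qed

text \<open>On one side the evaluated vector travels past everything up to its functional, and then
  \<open>w\<close> and \<open>u'\<close> are exchanged; on the other side it moves to the end of its
  word and the functional to the front of its own. The block swap undoes the exchange, and as the
  two degrees are opposite the remaining signs agree.\<close>

lemma E_comp:
  assumes g: "(u, w) \<in> di_words V r s d" and g': "(u', w') \<in> di_words V r' s' e" and ij: "i < r" "j < s'"
  shows "fextend (wact (block_swap (r - 1) s r')) (fextend E (di_glue i j (u, w) (u', w'))) =
    wglue (double_form V) i (r' + j) (emb V (u, w)) (emb V (u', w'))"
proof -
  have len: "length u = r" "length w = s" "length u' = r'" "length w' = s'"
    using g g' by (auto simp: di_words_iff words_iff)
  let ?l = "inl_letter V" and ?r = "inr_letter V"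
  let ?p = "fst (u ! i)" and ?a = "snd (u ! i)" and ?q = "fst (w' ! j)" and ?\<eta> = "snd (w' ! j)"
  let ?c = "(if ?p + ?q = 0 then ksign (?p * ?q) * ?\<eta> ?a else 0)"
  define c where "c = ?c"
  have glue: "di_glue i j (u, w) (u', w') = Poly_Mapping.single (del_nth i u @ u', w @ del_nth j w')
      (ksign (?p * (wdeg (drop (Suc i) u) + wdeg w + wdeg u' + wdeg (take j w'))) * c * ksign (wdeg w * wdeg u'))"
    by (simp add: di_glue_def Let_def c_def)
  have len': "length (map ?l (del_nth i u)) = r - 1" "length (map ?l u') = r'" "length (map ?r w) = s"
    using len ij by auto
  have emb: "emb V (del_nth i u @ u', w @ del_nth j w') = map ?l (del_nth i u) @ map ?l u' @ map ?r w @ map ?r (del_nth j w')"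
    by (simp add: emb_def)
  have del: "del_nth i (emb V (u, w)) @ del_nth (r' + j) (emb V (u', w')) =
      map ?l (del_nth i u) @ map ?r w @ map ?l u' @ map ?r (del_nth j w')"
    using len ij by (simp add: emb_def del_nth_append_left del_nth_append_right del_nth_map)
  have a: "emb V (u, w) ! i = (?p, (?a, \<zero>\<^bsub>gr (dual V) ?p\<^esub>))" "emb V (u', w') ! (r' + j) = (?q, (\<zero>\<^bsub>gr V ?q\<^esub>, ?\<eta>))"
    using len ij by (simp_all add: emb_def nth_append inl_letter_def inr_letter_def)
  have B: "double_form V ?p ?q (?a, \<zero>\<^bsub>gr (dual V) ?p\<^esub>) (\<zero>\<^bsub>gr V ?q\<^esub>, ?\<eta>) = ?c"
  proof (cases "?p + ?q = 0")
    case True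
    \<comment> \<open>The zero functional is a restricted function; it returns 0 only on its domain,
      the piece of degree \<open>- ?p\<close>.\<close>
    then have "- ?p = ?q" by simp
    then have "\<zero>\<^bsub>gr (dual V) ?p\<^esub> \<zero>\<^bsub>gr V ?q\<^esub> = 0"
      using zero_closed[of ?q] by (simp add: dual_simps(2))
    then show ?thesis by (simp add: double_form_def)
  qed (simp add: double_form_def)
  have "wdeg (drop (Suc i) (emb V (u, w))) = wdeg (drop (Suc i) u) + wdeg w"
    "wdeg (take (r' + j) (emb V (u', w'))) = wdeg u' + wdeg (take j w')"
    using len ij by (simp_all add: emb_def drop_map take_map)
  then have coef: "wcoef (double_form V) i (r' + j) (emb V (u, w)) (emb V (u', w')) =
      ksign (?p * (wdeg (drop (Suc i) u) + wdeg w) + ?q * (wdeg u' + wdeg (take j w'))) * c"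
    by (simp add: wcoef_def a B c_def)
  \<comment> \<open>The two signs of exchanging \<open>w\<close> and \<open>u'\<close>, one from
    \<open>di_glue\<close> and one from the block swap, cancel.\<close>
  have key: "ksign (?p * (wdeg (drop (Suc i) u) + wdeg w + wdeg u' + wdeg (take j w'))) * c * ksign (wdeg w * wdeg u') * ksign (wdeg u' * wdeg w) =
      ksign (?p * (wdeg (drop (Suc i) u) + wdeg w) + ?q * (wdeg u' + wdeg (take j w'))) * c"
  proof (cases "?p + ?q = 0")
    case True
    then have "?q = - ?p" by simp
    then show ?thesis by (simp add: distrib_left ksign_add ksign_diff mult.commute[of "wdeg u'"])
  qed (simp add: c_def)
  show ?thesis
    unfolding wglue_def coef del glue
    by (simp add: E_def wact_def emb wperm_block_swap[OF len'] wsign_block_swap[OF len'] key[symmetric])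
qed

section \<open>Operations on pairs of words, pulled back along the embedding\<close>

lemma di_dif_frees: 
  assumes "g \<in> di_words V r s d"
  shows "di_dif V g \<in> frees (di_words V r s (d + 1))"
proof -
  obtain u w where g: "g = (u, w)" by (cases g)
  have uw: "u \<in> words V r (wdeg u)" "w \<in> words (dual V) s (wdeg w)" "wdeg u + wdeg w = d"
    using assms by (auto simp: g di_words_iff)
  have "wdif V u \<in> frees (words V r (wdeg u + 1))" "wdif (dual V) w \<in> frees (words (dual V) s (wdeg w + 1))"
    using wdif_rel_map[of r "wdeg u"] dual.wdif_rel_map[of s "wdeg w"] uw by (auto simp: rel_map_def)
  moreover have "(u', w) \<in> di_words V r s (d + 1)" if "u' \<in> words V r (wdeg u + 1)" for u'
    by (rule di_wordsI[OF that uw(2)]) (use uw(3) in simp)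
  moreover have "(u, w') \<in> di_words V r s (d + 1)" if "w' \<in> words (dual V) s (wdeg w + 1)" for w'
    by (rule di_wordsI[OF uw(1) that]) (use uw(3) in simp)
  ultimately show ?thesis
    unfolding g di_dif_def prod.case by (intro frees_add) (auto intro!: frees_fextend frees_single)
qed

lemma di_act_frees:
  assumes "g \<in> di_words V r s d" "\<sigma> permutes {..<r}" "\<tau> permutes {..<s}"
  shows "di_act \<sigma> \<tau> g \<in> frees (di_words V r s d)"
proof -
  obtain u w where g: "g = (u, w)" by (cases g)
  show ?thesis
    using assms wperm_words[of u V r "wdeg u" \<sigma>] wperm_words[of w "dual V" s "wdeg w" \<tau>]
    by (auto simp: g di_words_iff di_act_def words_iff intro!: frees_single)
qed

lemma di_glue_frees:
  assumes "g \<in> di_words V r s d" "g' \<in> di_words V r' s' e" "i < r" "j < s'"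
  shows "di_glue i j g g' \<in> frees (di_words V (r + r' - 1) (s + s' - 1) (d + e))"
proof -
  obtain u w u' w' where g: "g = (u, w)" "g' = (u', w')" by (cases g, cases g')
  have uw: "u \<in> words V r (wdeg u)" "w \<in> words (dual V) s (wdeg w)" "wdeg u + wdeg w = d"
    "u' \<in> words V r' (wdeg u')" "w' \<in> words (dual V) s' (wdeg w')" "wdeg u' + wdeg w' = e"
    using assms by (auto simp: g di_words_iff)
  show ?thesis
  proof (cases "fst (u ! i) + fst (w' ! j) = 0")
    case True
    have "del_nth i u @ u' \<in> words V (r - 1 + r') (wdeg u - fst (u ! i) + wdeg u')"
      "w @ del_nth j w' \<in> words (dual V) (s + (s' - 1)) (wdeg w + (wdeg w' - fst (w' ! j)))"
      by (rule words_append[OF del_nth_words[OF uw(1) assms(3)] uw(4)], rule words_append[OF uw(2) del_nth_words[OF uw(5) assms(4)]])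
    moreover have *: "r - 1 + r' = r + r' - 1" "s + (s' - 1) = s + s' - 1"
      "wdeg u - fst (u ! i) + wdeg u' + (wdeg w + (wdeg w' - fst (w' ! j))) = d + e"
      using assms uw True by auto
    ultimately have "(del_nth i u @ u', w @ del_nth j w') \<in> di_words V (r + r' - 1) (s + s' - 1) (d + e)"
      unfolding *(1,2) by (intro di_wordsI[OF _ _ *(3)])
    then show ?thesis by (simp add: g di_glue_def Let_def frees_single)
  qed (simp add: g di_glue_def Let_def frees_0)
qed

text \<open>\<open>E_dif\<close> on generators is enough: compatibility with the relations and the
  identity for all vectors both follow by pullback.\<close>

lemma di_dif_rel_map: "rel_map (di_words V r s d) (di_rels V r s d) (di_words V r s (d + 1)) (di_rels V r s (d + 1)) (di_dif V)"
  and E_di_dif: "x \<in> frees (di_words V r s d) \<Longrightarrow>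
    cls (Drels (r + s) (d + 1)) (fextend E (fextend (di_dif V) x)) = cls (Drels (r + s) (d + 1)) (fextend (wdif D) (fextend E x))"
  by (rule rel_map_pullback[OF E_embed di_presentation E_rel_map double.wdif_rel_map];
    use di_dif_frees in \<open>force simp: E_def E_dif\<close>)+

lemma
  assumes "\<sigma> permutes {..<r}" "\<tau> permutes {..<s}"
  shows di_act_rel_map: "rel_map (di_words V r s d) (di_rels V r s d) (di_words V r s d) (di_rels V r s d) (di_act \<sigma> \<tau>)"
    and E_di_act: "x \<in> frees (di_words V r s d) \<Longrightarrow>
      cls (Drels (r + s) d) (fextend E (fextend (di_act \<sigma> \<tau>) x)) =
      cls (Drels (r + s) d) (fextend (wact (block_sum r s \<sigma> \<tau>)) (fextend E x))"
  by (rule rel_map_pullback[OF E_embed di_presentation E_rel_map double.wact_rel_map[OF block_sum_permutes[OF assms]]];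
    use di_act_frees[OF _ assms] assms in \<open>force simp: E_def E_act\<close>)+

lemma
  assumes "3 \<le> r + s + r' + s'" "i < r" "j < s'"
  shows di_glue_rel_map2: "rel_map2 (di_words V r s d) (di_rels V r s d) (di_words V r' s' e) (di_rels V r' s' e)
      (di_words V (r + r' - 1) (s + s' - 1) (d + e)) (di_rels V (r + r' - 1) (s + s' - 1) (d + e)) (di_glue i j)"
    and E_di_glue: "x \<in> frees (di_words V r s d) \<Longrightarrow> y \<in> frees (di_words V r' s' e) \<Longrightarrow>
      cls (Drels (r + s + (r' + s') - 2) (d + e)) (fextend (wact (block_swap (r - 1) s r')) (fextend E (fextend2 (di_glue i j) x y))) =
      cls (Drels (r + s + (r' + s') - 2) (d + e)) (fextend2 (wglue (double_form V) i (r' + j)) (fextend E x) (fextend E y))"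
proof -
  have n: "r + r' - 1 + (s + s' - 1) = r + s + (r' + s') - 2" using assms by simp
  have b: "block_swap (r - 1) s r' permutes {..<r + s + (r' + s') - 2}" using assms by (intro block_swap_permutes) auto
  note E' = wact_embed[OF E_embed[of "r + r' - 1" "s + s' - 1" "d + e", unfolded n] b]
  have eq: "cls (Drels (r + s + (r' + s') - 2) (d + e)) (fextend (\<lambda>g. fextend (wact (block_swap (r - 1) s r')) (E g)) (di_glue i j g g')) =
      cls (Drels (r + s + (r' + s') - 2) (d + e)) (fextend2 (wglue (double_form V) i (r' + j)) (E g) (E g'))"
    if "g \<in> di_words V r s d" "g' \<in> di_words V r' s' e" for g g'
  proof -
    obtain u w u' w' where g: "g = (u, w)" "g' = (u', w')" by (cases g, cases g')
    show ?thesis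
      using E_comp[of u w r s d u' w' r' s' e i j] that assms
      by (simp add: g flin_fextend_compose[OF flin_fextend, symmetric]) (simp add: E_def)
  qed
  have ij: "i < r + s" "r' + j < r' + s'" using assms by auto
  note pb = rel_map2_pullback[OF E' E_rel_map E_rel_map di_presentation di_presentation double.wglue_rel_map2[OF ij] di_glue_frees[OF _ _ assms(2,3)] eq]
  show "rel_map2 (di_words V r s d) (di_rels V r s d) (di_words V r' s' e) (di_rels V r' s' e)
      (di_words V (r + r' - 1) (s + s' - 1) (d + e)) (di_rels V (r + r' - 1) (s + s' - 1) (d + e)) (di_glue i j)"
    by (rule pb(1))
  show "x \<in> frees (di_words V r s d) \<Longrightarrow> y \<in> frees (di_words V r' s' e) \<Longrightarrow>
      cls (Drels (r + s + (r' + s') - 2) (d + e)) (fextend (wact (block_swap (r - 1) s r')) (fextend E (fextend2 (di_glue i j) x y))) =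
      cls (Drels (r + s + (r' + s') - 2) (d + e)) (fextend2 (wglue (double_form V) i (r' + j)) (fextend E x) (fextend E y))"
    using pb(2)[of x y] by (simp add: flin_fextend_compose[OF flin_fextend, symmetric])
qed

section \<open>The embedding on classes and the dioperad axioms\<close>

definition iota :: "nat \<Rightarrow> nat \<Rightarrow> int \<Rightarrow> (('k, 'a) di_word \<Rightarrow>\<^sub>0 'k) set \<Rightarrow> ((int \<times> ('a \<times> ('a \<Rightarrow> 'k))) list \<Rightarrow>\<^sub>0 'k) set" where
  "iota r s d = induced (Drels (r + s) d) E"

abbreviation "EndD \<equiv> End_cyc (double V) (double_form V)"

sublocale EndD: cyclic_operad "End_cyc (double V) (double_form V)"
  by (rule double.End_cyc_cyclic_operad)

lemma End_di_cls:
  "x \<in> frees (di_words V r s d) \<Longrightarrow> dif (dobj (End_di V) r s) d (cls (di_rels V r s d) x) = cls (di_rels V r s (d + 1)) (fextend (di_dif V) x)"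
  "\<sigma> permutes {..<r} \<Longrightarrow> \<tau> permutes {..<s} \<Longrightarrow>
    dact (End_di V) r s \<sigma> \<tau> d (cls (di_rels V r s d) x) = cls (di_rels V r s d) (fextend (di_act \<sigma> \<tau>) x)"
  "3 \<le> r + s + r' + s' \<Longrightarrow> i < r \<Longrightarrow> j < s' \<Longrightarrow> x \<in> frees (di_words V r s d) \<Longrightarrow> y \<in> frees (di_words V r' s' e) \<Longrightarrow>
    dcomp (End_di V) r s i r' s' j d e (cls (di_rels V r s d) x) (cls (di_rels V r' s' e) y) =
    cls (di_rels V (r + r' - 1) (s + s' - 1) (d + e)) (fextend2 (di_glue i j) x y)"
  by (simp_all add: End_di_simps induced_cls[OF di_dif_rel_map] induced_cls[OF di_act_rel_map] induced2_cls[OF di_glue_rel_map2])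

lemma iota_cls: "iota r s d (cls (di_rels V r s d) x) = cls (Drels (r + s) d) (fextend E x)"
  unfolding iota_def by (rule induced_cls[OF E_rel_map])

lemma E_frees: "x \<in> frees (di_words V r s d) \<Longrightarrow> fextend E x \<in> frees (words D (r + s) d)"
  by (rule rel_map_frees[OF E_rel_map])

lemma el_End_di: "p \<in> el (dobj (End_di V) r s) d \<longleftrightarrow> (\<exists>x\<in>frees (di_words V r s d). p = cls (di_rels V r s d) x)"
  by (auto simp: End_di_simps)

lemma iota_linear: "linear_on (gr (dobj (End_di V) r s) d) (gr (cobj EndD (r + s)) d) (iota r s d)"
  unfolding iota_def End_di_simps End_cyc_simps by (rule induced_linear[OF E_rel_map])

lemma iota_inj: "inj_on (iota r s d) (el (dobj (End_di V) r s) d)"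
  unfolding iota_def End_di_simps by (rule rel_embed_inj[OF E_embed])

lemma iota_dif:
  assumes "p \<in> el (dobj (End_di V) r s) d"
  shows "iota r s (d + 1) (dif (dobj (End_di V) r s) d p) = dif (cobj EndD (r + s)) d (iota r s d p)"
proof -
  obtain x where x: "x \<in> frees (di_words V r s d)" "p = cls (di_rels V r s d) x" using assms by (auto simp: el_End_di)
  then show ?thesis by (simp add: End_di_cls iota_cls E_di_dif double.End_cyc_ops E_frees)
qed

lemma iota_act:
  assumes "\<sigma> permutes {..<r}" "\<tau> permutes {..<s}" "p \<in> el (dobj (End_di V) r s) d"
  shows "iota r s d (dact (End_di V) r s \<sigma> \<tau> d p) = cact EndD (r + s) (block_sum r s \<sigma> \<tau>) d (iota r s d p)"
proof -
  obtain x where x: "x \<in> frees (di_words V r s d)" "p = cls (di_rels V r s d) x" using assms by (auto simp: el_End_di)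
  then show ?thesis
    using assms by (simp add: End_di_cls iota_cls E_di_act double.End_cyc_ops E_frees block_sum_permutes)
qed

lemma iota_comp:
  assumes "3 \<le> r + s + r' + s'" "i < r" "j < s'" "p \<in> el (dobj (End_di V) r s) d" "q \<in> el (dobj (End_di V) r' s') e"
  shows "cact EndD (r + s + (r' + s') - 2) (block_swap (r - 1) s r') (d + e)
      (iota (r + r' - 1) (s + s' - 1) (d + e) (dcomp (End_di V) r s i r' s' j d e p q)) =
    ccomp EndD (r + s) i (r' + s') (r' + j) d e (iota r s d p) (iota r' s' e q)"
proof -
  obtain x where x: "x \<in> frees (di_words V r s d)" "p = cls (di_rels V r s d) x" using assms by (auto simp: el_End_di)
  obtain y where y: "y \<in> frees (di_words V r' s' e)" "q = cls (di_rels V r' s' e) y" using assms by (auto simp: el_End_di)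
  have n: "r + r' - 1 + (s + s' - 1) = r + s + (r' + s') - 2" using assms by simp
  have b: "block_swap (r - 1) s r' permutes {..<r + s + (r' + s') - 2}" using assms by (intro block_swap_permutes) auto
  have ij: "i < r + s" "r' + j < r' + s'" using assms by auto
  have xy: "fextend2 (di_glue i j) x y \<in> frees (di_words V (r + r' - 1) (s + s' - 1) (d + e))"
    by (rule rel_map2_frees[OF di_glue_rel_map2[OF assms(1-3)] x(1) y(1)])
  have "iota (r + r' - 1) (s + s' - 1) (d + e) (dcomp (End_di V) r s i r' s' j d e p q) =
      cls (Drels (r + s + (r' + s') - 2) (d + e)) (fextend E (fextend2 (di_glue i j) x y))"
    using assms(1-3) x y iota_cls[of "r + r' - 1" "s + s' - 1" "d + e" "fextend2 (di_glue i j) x y"]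
    unfolding n by (simp add: End_di_cls)
  moreover have "fextend E (fextend2 (di_glue i j) x y) \<in> frees (words D (r + s + (r' + s') - 2) (d + e))"
    using E_frees[OF xy] unfolding n .
  ultimately show ?thesis
    using x y by (simp add: iota_cls double.End_cyc_ops(2)[OF b] double.End_cyc_ops(3)[OF ij] E_frees E_di_glue[OF assms(1-3)])
qed

theorem End_di_dioperad: "dioperad (End_di V)"
proof (rule EndD.dioperad_by_embedding[where \<iota> = iota])
  show "Module.module (kring :: 'k ring) (gr (dobj (End_di V) r s) d)" for r s d
    unfolding End_di_simps by (rule presented_module)
  show "linear_on (gr (dobj (End_di V) r s) d) (gr (dobj (End_di V) r s) (d + 1)) (dif (dobj (End_di V) r s) d)" for r s d
    unfolding End_di_simps by (rule induced_linear[OF di_dif_rel_map])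
  show "linear_on (gr (dobj (End_di V) r s) d) (gr (dobj (End_di V) r s) d) (dact (End_di V) r s \<sigma> \<tau> d)"
    if "\<sigma> permutes {..<r}" "\<tau> permutes {..<s}" for r s \<sigma> \<tau> d
    unfolding End_di_simps by (rule induced_linear[OF di_act_rel_map[OF that]])
  show "bilinear_on (gr (dobj (End_di V) r s) d) (gr (dobj (End_di V) r' s') e)
        (gr (dobj (End_di V) (r + r' - 1) (s + s' - 1)) (d + e)) (dcomp (End_di V) r s i r' s' j d e)"
    if "3 \<le> r + s + r' + s'" "i < r" "j < s'" for r s r' s' i j d e
    unfolding End_di_simps by (rule induced2_bilinear[OF di_glue_rel_map2[OF that]])
qed (rule iota_linear iota_inj iota_dif iota_act iota_comp; assumption)+

end

lemma (in dg_vector_space) dg_double: "dg_double V"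
  by (intro dg_double.intro dg_vector_space_axioms dual_dg double_dg_form)

section \<open>Transport of cyclic operads along isomorphisms\<close>

text \<open>\<open>\<Phi>\<close> is injective and respects all operations, so each axiom of
  \<open>C'\<close> can be read back in \<open>C\<close>. The linearity hypotheses on
  \<open>C\<close> ensure that both sides of an axiom lie in the component on which
  \<open>\<Phi>\<close> is injective.\<close>

lemma cyclic_operad_transport:
  fixes C :: "('k::field_char_0, 'x) cyclic_data" and C' :: "('k, 'y) cyclic_data"
  assumes C': "cyclic_operad C'" and iso: "cyclic_operad_iso C C' \<Phi>"
    and module: "\<And>n d. Module.module (kring :: 'k ring) (gr (cobj C n) d)"
    and dif_linear: "\<And>n d. 1 \<le> n \<Longrightarrow> linear_on (gr (cobj C n) d) (gr (cobj C n) (d + 1)) (dif (cobj C n) d)"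
    and act_linear: "\<And>n \<sigma> d. 1 \<le> n \<Longrightarrow> \<sigma> permutes {..<n} \<Longrightarrow>
      linear_on (gr (cobj C n) d) (gr (cobj C n) d) (cact C n \<sigma> d)"
    and comp_bilinear: "\<And>n m i j d e. 3 \<le> n + m \<Longrightarrow> i < n \<Longrightarrow> j < m \<Longrightarrow>
      bilinear_on (gr (cobj C n) d) (gr (cobj C m) e) (gr (cobj C (n + m - 2)) (d + e)) (ccomp C n i m j d e)"
  shows "cyclic_operad C"
proof -
  interpret D: cyclic_operad C' by fact
  have \<Phi>_linear: "linear_on (gr (cobj C n) d) (gr (cobj C' n) d) (\<Phi> n d)"
    and \<Phi>_bij: "bij_betw (\<Phi> n d) (el (cobj C n) d) (el (cobj C' n) d)" if "1 \<le> n" for n d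
    using iso that unfolding cyclic_operad_iso_def by blast+
  have \<Phi>_dif: "\<Phi> n (d + 1) (dif (cobj C n) d x) = dif (cobj C' n) d (\<Phi> n d x)"
    if "1 \<le> n" "x \<in> el (cobj C n) d" for n d x
    using iso that unfolding cyclic_operad_iso_def by blast
  have \<Phi>_act: "\<Phi> n d (cact C n \<sigma> d x) = cact C' n \<sigma> d (\<Phi> n d x)"
    if "1 \<le> n" "\<sigma> permutes {..<n}" "x \<in> el (cobj C n) d" for n d \<sigma> x
    using iso that unfolding cyclic_operad_iso_def by blast
  have \<Phi>_comp: "\<Phi> (n + m - 2) (d + e) (ccomp C n i m j d e x y) = ccomp C' n i m j d e (\<Phi> n d x) (\<Phi> m e y)"
    if "3 \<le> n + m" "i < n" "j < m" "x \<in> el (cobj C n) d" "y \<in> el (cobj C m) e" for n m i j d e x y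
    using iso that unfolding cyclic_operad_iso_def by blast
  have dif_cl: "dif (cobj C n) d x \<in> el (cobj C n) (d + 1)" if "1 \<le> n" "x \<in> el (cobj C n) d" for n d x
    using dif_linear[OF that(1), of d] that(2) unfolding linear_on_def by blast
  have act_cl: "cact C n \<sigma> d x \<in> el (cobj C n) d" if "1 \<le> n" "\<sigma> permutes {..<n}" "x \<in> el (cobj C n) d" for n \<sigma> d x
    using act_linear[OF that(1,2), of d] that(3) unfolding linear_on_def by blast
  have comp_cl: "ccomp C n i m j d e x y \<in> el (cobj C (n + m - 2)) (d + e)"
    if "3 \<le> n + m" "i < n" "j < m" "x \<in> el (cobj C n) d" "y \<in> el (cobj C m) e" for n m i j d e x y
    using comp_bilinear[OF that(1-3), of d e] that(4,5) unfolding bilinear_on_def linear_on_def by blast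
  have cl: "\<Phi> n d x \<in> el (cobj C' n) d" if "1 \<le> n" "x \<in> el (cobj C n) d" for n d x
    using \<Phi>_linear[OF that(1), of d] that(2) unfolding linear_on_def by blast
  have \<Phi>_add: "\<Phi> n d (x \<oplus>\<^bsub>gr (cobj C n) d\<^esub> y) = \<Phi> n d x \<oplus>\<^bsub>gr (cobj C' n) d\<^esub> \<Phi> n d y"
    if "1 \<le> n" "x \<in> el (cobj C n) d" "y \<in> el (cobj C n) d" for n d x y
    using \<Phi>_linear[OF that(1), of d] that(2,3) unfolding linear_on_def by blast
  have \<Phi>_smult: "\<Phi> n d (c \<odot>\<^bsub>gr (cobj C n) d\<^esub> x) = c \<odot>\<^bsub>gr (cobj C' n) d\<^esub> \<Phi> n d x"
    if "1 \<le> n" "x \<in> el (cobj C n) d" for n d x c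
    using \<Phi>_linear[OF that(1), of d] that(2) unfolding linear_on_def by blast
  have eqD: "x = y" if "1 \<le> n" "x \<in> el (cobj C n) d" "y \<in> el (cobj C n) d" "\<Phi> n d x = \<Phi> n d y" for n d x y
    using bij_betw_imp_inj_on[OF \<Phi>_bij[OF that(1)], of d] that(2-4) by (auto dest: inj_onD)
  have add_cl: "x \<oplus>\<^bsub>gr (cobj C n) d\<^esub> y \<in> el (cobj C n) d" if "x \<in> el (cobj C n) d" "y \<in> el (cobj C n) d" for n d x y
  proof -
    interpret Module.module kring "gr (cobj C n) d" by (rule module)
    show ?thesis using that by (simp add: M.add.m_closed)
  qed
  have smult_cl: "c \<odot>\<^bsub>gr (cobj C n) d\<^esub> x \<in> el (cobj C n) d" if "x \<in> el (cobj C n) d" for n d x c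
  proof -
    interpret Module.module kring "gr (cobj C n) d" by (rule module)
    show ?thesis using that by simp
  qed
  show ?thesis
  proof (rule cyclic_operad.intro)
    fix n :: nat assume n: "1 \<le> n"
    interpret Dn: dg_vector_space "cobj C' n" by (rule D.dg[OF n])
    show "dg_vector_space (cobj C n)"
    proof (rule dg_vector_space.intro)
      fix d x assume x: "x \<in> el (cobj C n) d"
      have z: "\<zero>\<^bsub>gr (cobj C n) (d + 2)\<^esub> \<in> el (cobj C n) (d + 2)"
      proof -
        interpret Module.module kring "gr (cobj C n) (d + 2)" by (rule module)
        show ?thesis by (rule M.zero_closed)
      qed
      have d: "d + 1 + 1 = d + 2" by simp
      have "\<Phi> n (d + 1 + 1) (dif (cobj C n) (d + 1) (dif (cobj C n) d x)) = dif (cobj C' n) (d + 1) (dif (cobj C' n) d (\<Phi> n d x))"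
        by (simp only: \<Phi>_dif[OF n dif_cl[OF n x]] \<Phi>_dif[OF n x])
      also have "\<dots> = \<zero>\<^bsub>gr (cobj C' n) (d + 2)\<^esub>" by (rule Dn.dif_dif[OF cl[OF n x]])
      also have "\<dots> = \<Phi> n (d + 2) \<zero>\<^bsub>gr (cobj C n) (d + 2)\<^esub>"
        by (rule linear_on_zero[OF \<Phi>_linear[OF n] module Dn.vector_space, symmetric])
      finally show "dif (cobj C n) (d + 1) (dif (cobj C n) d x) = \<zero>\<^bsub>gr (cobj C n) (d + 2)\<^esub>"
        using eqD[OF n _ z] dif_cl[OF n dif_cl[OF n x]] unfolding d by blast
    qed (use module dif_linear n in blast)+
  next
    fix n \<sigma> d x assume n: "1 \<le> n" "\<sigma> permutes {..<n}" and x: "x \<in> el (cobj C n) d"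
    show "cact C n \<sigma> (d + 1) (dif (cobj C n) d x) = dif (cobj C n) d (cact C n \<sigma> d x)"
      by (rule eqD[OF n(1) act_cl[OF n dif_cl[OF n(1) x]] dif_cl[OF n(1) act_cl[OF n x]]])
        (simp only: \<Phi>_act[OF n dif_cl[OF n(1) x]] \<Phi>_act[OF n x] \<Phi>_dif[OF n(1) x] \<Phi>_dif[OF n(1) act_cl[OF n x]] D.act_dif[OF n cl[OF n(1) x]])
  next
    fix n d x assume n: "1 \<le> n" and x: "x \<in> el (cobj C n) d"
    show "cact C n id d x = x"
      by (rule eqD[OF n act_cl[OF n permutes_id x] x])
        (simp only: \<Phi>_act[OF n permutes_id x] D.act_id[OF n cl[OF n x]])
  next
    fix n \<sigma> \<tau> d x assume n: "1 \<le> n" and p: "\<sigma> permutes {..<n}" "\<tau> permutes {..<n}" and x: "x \<in> el (cobj C n) d"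
    show "cact C n (\<sigma> \<circ> \<tau>) d x = cact C n \<tau> d (cact C n \<sigma> d x)"
      by (rule eqD[OF n act_cl[OF n permutes_compose[OF p(2,1)] x] act_cl[OF n p(2) act_cl[OF n p(1) x]]])
        (simp only: \<Phi>_act[OF n permutes_compose[OF p(2,1)] x] \<Phi>_act[OF n p(2) act_cl[OF n p(1) x]] \<Phi>_act[OF n p(1) x] D.act_comp[OF n p cl[OF n x]])
  next
    fix n m i j :: nat and x d y e
    assume n: "3 \<le> n + m" "i < n" "j < m" and x: "x \<in> el (cobj C n) d" and y: "y \<in> el (cobj C m) e"
    have ar: "1 \<le> n" "1 \<le> m" "1 \<le> n + m - 2" "d + 1 + e = d + e + 1" "d + (e + 1) = d + e + 1" using n by auto
    note dx = comp_cl[OF n dif_cl[OF ar(1) x] y, unfolded ar] and dy = comp_cl[OF n x dif_cl[OF ar(2) y], unfolded ar]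
    show "dif (cobj C (n + m - 2)) (d + e) (ccomp C n i m j d e x y) =
        ccomp C n i m j (d + 1) e (dif (cobj C n) d x) y
          \<oplus>\<^bsub>gr (cobj C (n + m - 2)) (d + e + 1)\<^esub>
        ksign d \<odot>\<^bsub>gr (cobj C (n + m - 2)) (d + e + 1)\<^esub>
          ccomp C n i m j d (e + 1) x (dif (cobj C m) e y)"
      by (rule eqD[OF ar(3) dif_cl[OF ar(3) comp_cl[OF n x y]] add_cl[OF dx smult_cl[OF dy]]])
        (simp only: \<Phi>_dif[OF ar(3) comp_cl[OF n x y]] \<Phi>_comp[OF n x y] \<Phi>_add[OF ar(3) dx smult_cl[OF dy]] \<Phi>_smult[OF ar(3) dy]
          \<Phi>_comp[OF n dif_cl[OF ar(1) x] y, unfolded ar] \<Phi>_comp[OF n x dif_cl[OF ar(2) y], unfolded ar] \<Phi>_dif[OF ar(1) x] \<Phi>_dif[OF ar(2) y]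
          D.comp_dif[OF n cl[OF ar(1) x] cl[OF ar(2) y]])
  next
    fix n m i j :: nat and \<sigma> \<tau> x d y e
    assume n: "3 \<le> n + m" "i < n" "j < m" and p: "\<sigma> permutes {..<n}" "\<tau> permutes {..<m}"
      and x: "x \<in> el (cobj C n) d" and y: "y \<in> el (cobj C m) e"
    let ?\<rho> = "perm_upto (n + m - 2) (cpos n (\<sigma> i) (\<tau> j) \<circ> map_sum \<sigma> \<tau> \<circ> cflag n i j)"
    have ar: "1 \<le> n" "1 \<le> m" "1 \<le> n + m - 2" "n - 1 + (m - 1) = n + m - 2" "\<sigma> i < n" "\<tau> j < m" using n p by auto
    have \<rho>: "?\<rho> permutes {..<n + m - 2}"
      using block_sum_permutes[OF del_perm_permutes[OF p(1) n(2)] del_perm_permutes[OF p(2) n(3)]]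
      unfolding comp_perm_eq_block_sum[OF p n(2,3)] ar(4) .
    note xy = comp_cl[OF n(1) ar(5,6) x y]
    show "ccomp C n i m j d e (cact C n \<sigma> d x) (cact C m \<tau> e y) =
        cact C (n + m - 2) ?\<rho> (d + e) (ccomp C n (\<sigma> i) m (\<tau> j) d e x y)"
      by (rule eqD[OF ar(3) comp_cl[OF n act_cl[OF ar(1) p(1) x] act_cl[OF ar(2) p(2) y]] act_cl[OF ar(3) \<rho> xy]])
        (simp only: \<Phi>_comp[OF n act_cl[OF ar(1) p(1) x] act_cl[OF ar(2) p(2) y]] \<Phi>_act[OF ar(3) \<rho> xy] \<Phi>_comp[OF n(1) ar(5,6) x y]
          \<Phi>_act[OF ar(1) p(1) x] \<Phi>_act[OF ar(2) p(2) y] D.equivariance[OF n p cl[OF ar(1) x] cl[OF ar(2) y]])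
  next
    fix n m i j :: nat and x d y e
    assume n: "3 \<le> n + m" "i < n" "j < m" and x: "x \<in> el (cobj C n) d" and y: "y \<in> el (cobj C m) e"
    let ?\<rho> = "perm_upto (n + m - 2) (cpos m j i \<circ> case_sum Inr Inl \<circ> cflag n i j)"
    have ar: "1 \<le> n" "1 \<le> m" "1 \<le> n + m - 2" "m + n - 2 = n + m - 2" "e + d = d + e" "3 \<le> m + n" using n by auto
    have "?\<rho> = block_swap 0 (n - 1) (m - 1)"
      using n by (auto simp: fun_eq_iff perm_upto_def block_swap_def cpos_def cflag_def)
    then have \<rho>: "?\<rho> permutes {..<n + m - 2}" using n by (simp add: block_swap_permutes)
    note yx = comp_cl[OF ar(6) n(3,2) y x, unfolded ar]
    show "ccomp C n i m j d e x y =
        ksign (d * e) \<odot>\<^bsub>gr (cobj C (n + m - 2)) (d + e)\<^esub>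
          cact C (n + m - 2) ?\<rho> (d + e) (ccomp C m j n i e d y x)"
      by (rule eqD[OF ar(3) comp_cl[OF n x y] smult_cl[OF act_cl[OF ar(3) \<rho> yx]]])
        (simp only: \<Phi>_comp[OF n x y] \<Phi>_smult[OF ar(3) act_cl[OF ar(3) \<rho> yx]] \<Phi>_act[OF ar(3) \<rho> yx] \<Phi>_comp[OF ar(6) n(3,2) y x, unfolded ar]
          D.symmetry[OF n cl[OF ar(1) x] cl[OF ar(2) y]])
  next
    fix n m p i j k l :: nat and x d y e z f
    assume n: "5 \<le> n + m + p" "i < n" "j < m" "k < m" "j \<noteq> k" "l < p"
      and x: "x \<in> el (cobj C n) d" and y: "y \<in> el (cobj C m) e" and z: "z \<in> el (cobj C p) f"
    have u: "unskip j k < m - 1" "unskip k j < m - 1" using n by (metis unskip_less)+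
    have ar: "n + (m + p - 2) - 2 = n + m - 2 + p - 2" "d + (e + f) = d + e + f" using n by auto
    have ineq: "1 \<le> n" "1 \<le> m" "1 \<le> p" "3 \<le> n + m" "3 \<le> m + p" "3 \<le> n + m - 2 + p" "3 \<le> n + (m + p - 2)"
      "1 \<le> n + m - 2 + p - 2" "n - 1 + unskip j k < n + m - 2" "unskip k j < m + p - 2"
      using n u by auto
    note xy = comp_cl[OF ineq(4) n(2,3) x y] and yz = comp_cl[OF ineq(5) n(4,6) y z]
    show "ccomp C (n + m - 2) (n - 1 + unskip j k) p l (d + e) f (ccomp C n i m j d e x y) z =
        ccomp C n i (m + p - 2) (unskip k j) d (e + f) x (ccomp C m k p l e f y z)"
      by (rule eqD[OF ineq(8) comp_cl[OF ineq(6,9) n(6) xy z] comp_cl[OF ineq(7) n(2) ineq(10) x yz, unfolded ar]])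
        (simp only: \<Phi>_comp[OF ineq(6,9) n(6) xy z] \<Phi>_comp[OF ineq(7) n(2) ineq(10) x yz, unfolded ar]
          \<Phi>_comp[OF ineq(4) n(2,3) x y] \<Phi>_comp[OF ineq(5) n(4,6) y z] D.assoc[OF n cl[OF ineq(1) x] cl[OF ineq(2) y] cl[OF ineq(3) z]])
  qed (use act_linear comp_bilinear in blast)+
qed

section \<open>Permutations with prescribed blocks\<close>

text \<open>Glues a bijection of \<open>S\<close> onto the first \<open>card S\<close> positions
  with one of the complement onto the rest; no order inside the two blocks is prescribed.\<close>

lemma ex_block_perm:
  assumes "S \<subseteq> {..<n::nat}"
  shows "\<exists>\<rho>. \<rho> permutes {..<n} \<and> (\<forall>l<n. \<rho> l < card S \<longleftrightarrow> l \<in> S)"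
proof -
  have fin: "finite S" using assms finite_subset by blast
  have c: "card S \<le> n" using card_mono[OF _ assms] by simp
  obtain f where f: "bij_betw f S {..<card S}"
    using fin by (metis card_lessThan finite_lessThan finite_same_card_bij)
  have "card ({..<n} - S) = card {card S..<n}" using assms fin by (simp add: card_Diff_subset)
  then obtain g where g: "bij_betw g ({..<n} - S) {card S..<n}"
    using finite_same_card_bij[of "{..<n} - S" "{card S..<n}"] by auto
  define h where "h l = (if l \<in> S then f l else g l)" for l
  have "bij_betw h S {..<card S}" using f by (rule bij_betw_cong[THEN iffD1, rotated]) (simp add: h_def)
  moreover have "bij_betw h ({..<n} - S) {card S..<n}" using g by (rule bij_betw_cong[THEN iffD1, rotated]) (simp add: h_def)
  ultimately have "bij_betw h (S \<union> ({..<n} - S)) ({..<card S} \<union> {card S..<n})"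
    by (rule bij_betw_combine) auto
  moreover have "S \<union> ({..<n} - S) = {..<n}" "{..<card S} \<union> {card S..<n} = {..<n}" using assms c by auto
  ultimately have h: "bij_betw h {..<n} {..<n}" by simp
  have "perm_upto n h permutes {..<n}"
    using h by (intro perm_upto_permutes) (auto simp: bij_betw_def)
  moreover have "perm_upto n h l < card S \<longleftrightarrow> l \<in> S" if "l < n" for l
    using that bij_betw_apply[OF f, of l] bij_betw_apply[OF g, of l] by (auto simp: perm_upto_def h_def)
  ultimately show ?thesis by blast
qed

text \<open>A permutation that preserves the first block also preserves the second, and so is a pair
  of permutations. Such pairs are what the tensor product over the group algebra of
  \<open>S_r x S_s\<close> absorbs.\<close>

lemma perm_eq_block_sum:
  assumes "\<kappa> permutes {..<n}" "r \<le> n" "\<And>l. l < n \<Longrightarrow> \<kappa> l < r \<longleftrightarrow> l < r"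
  shows "\<exists>\<sigma> \<tau>. \<sigma> permutes {..<r} \<and> \<tau> permutes {..<n - r} \<and> \<kappa> = block_sum r (n - r) \<sigma> \<tau>"
proof (intro exI conjI)
  let ?\<sigma> = "perm_upto r \<kappa>" and ?\<tau> = "perm_upto (n - r) (\<lambda>l. \<kappa> (r + l) - r)"
  show "?\<sigma> permutes {..<r}"
    using assms by (intro perm_upto_permutes) (auto simp: inj_on_def permutes_eq_iff[OF assms(1)])
  have k: "r \<le> \<kappa> (r + l)" if "l < n - r" for l
  proof -
    have "r + l < n" using that by simp
    from assms(3)[OF this] show ?thesis by simp
  qed
  show "?\<tau> permutes {..<n - r}"
  proof (rule perm_upto_permutes)
    show "inj_on (\<lambda>l. \<kappa> (r + l) - r) {..<n - r}"
    proof (rule inj_onI)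
      fix a b assume ab: "a \<in> {..<n - r}" "b \<in> {..<n - r}" "\<kappa> (r + a) - r = \<kappa> (r + b) - r"
      then have "\<kappa> (r + a) = \<kappa> (r + b)" using k[of a] k[of b] by simp
      then show "a = b" using permutes_eq_iff[OF assms(1)] by simp
    qed
    show "\<kappa> (r + l) - r < n - r" if "l < n - r" for l
      using that k[OF that] permutes_lessThan[OF assms(1), of "r + l"] by linarith
  qed
  show "\<kappa> = block_sum r (n - r) ?\<sigma> ?\<tau>"
  proof
    fix l
    show "\<kappa> l = block_sum r (n - r) ?\<sigma> ?\<tau> l"
      using k[of "l - r"] permutes_not_in[OF assms(1), of l] assms(2) by (auto simp: block_sum_def perm_upto_def)
  qed
qed

text \<open>The dioperadic numbering of a composite is the cyclic one followed by sorting outputs to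
  the front. The glued flags are excluded, as they have no position.\<close>

lemma dpos_eq_block_swap:
  assumes "a < r" "b < s'"
  shows "h < r + s \<Longrightarrow> h \<noteq> a \<Longrightarrow> dpos r s r' a b (Inl h) = block_swap (r - 1) s r' (cpos (r + s) a (r' + b) (Inl h))"
    and "h < r' + s' \<Longrightarrow> h \<noteq> r' + b \<Longrightarrow> dpos r s r' a b (Inr h) = block_swap (r - 1) s r' (cpos (r + s) a (r' + b) (Inr h))"
proof -
  assume h: "h < r + s" "h \<noteq> a"
  show "dpos r s r' a b (Inl h) = block_swap (r - 1) s r' (cpos (r + s) a (r' + b) (Inl h))"
  proof (cases "h < r")
    case True
    then have "unskip a h < r - 1" using h assms by (intro unskip_less) auto
    then show ?thesis using True by (simp add: dpos_def opos_def cpos_def block_swap_fix)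
  next
    case False
    then have "cpos (r + s) a (r' + b) (Inl h) = (r - 1) + (h - r)"
      using assms by (simp add: cpos_def unskip_def)
    then show ?thesis using False h assms block_swap_eval(1)[of "h - r" s "r - 1" r'] by (simp add: dpos_def ipos_def)
  qed
next
  assume h: "h < r' + s'" "h \<noteq> r' + b"
  show "dpos r s r' a b (Inr h) = block_swap (r - 1) s r' (cpos (r + s) a (r' + b) (Inr h))"
  proof (cases "h < r'")
    case True
    then have "cpos (r + s) a (r' + b) (Inr h) = (r - 1) + s + h"
      using assms by (simp add: cpos_def unskip_def)
    then show ?thesis using True block_swap_eval(2)[of h r' "r - 1" s] by (simp add: dpos_def opos_def)
  next
    case False
    then have "unskip (r' + b) h = r' + unskip b (h - r')" using h by (auto simp: unskip_def)
    then have c: "cpos (r + s) a (r' + b) (Inr h) = (r - 1) + s + r' + unskip b (h - r')"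
      using assms by (simp add: cpos_def)
    have "block_swap (r - 1) s r' ((r - 1) + s + r' + unskip b (h - r')) = (r - 1) + s + r' + unskip b (h - r')"
      by (rule block_swap_fix(2)) simp
    then show ?thesis using False assms unfolding c by (simp add: dpos_def ipos_def)
  qed
qed

lemma perm_upto_cong: "(\<And>l. l < n \<Longrightarrow> f l = g l) \<Longrightarrow> perm_upto n f = perm_upto n g"
  by (auto simp: perm_upto_def)

lemma perm_upto_comp:
  assumes "\<sigma> permutes {..<n}"
  shows "perm_upto n (\<sigma> \<circ> f) = \<sigma> \<circ> perm_upto n f"
  using permutes_not_in[OF assms] by (auto simp: perm_upto_def fun_eq_iff)

lemma cflag_cases:
  assumes "\<rho> permutes {..<n}" "\<pi> permutes {..<m}" "i < n" "j < m" "l < n + m - 2"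
  obtains h where "h < n" "h \<noteq> \<rho> i" "map_sum \<rho> \<pi> (cflag n i j l) = Inl h"
  | h where "h < m" "h \<noteq> \<pi> j" "map_sum \<rho> \<pi> (cflag n i j l) = Inr h"
proof (cases "l < n - 1")
  case True
  moreover have "\<rho> (skip i l) < n" using True permutes_lessThan[OF assms(1), of "skip i l"] by (auto simp: skip_def)
  moreover have "\<rho> (skip i l) \<noteq> \<rho> i" unfolding permutes_eq_iff[OF assms(1)] by (simp add: skip_def)
  ultimately show thesis by (intro that(1)) (auto simp: cflag_def)
next
  case False
  let ?l = "l - (n - 1)"
  have "skip j ?l < m" using False assms by (auto simp: skip_def)
  then have "\<pi> (skip j ?l) < m" using permutes_lessThan[OF assms(2)] by simp
  moreover have "\<pi> (skip j ?l) \<noteq> \<pi> j" unfolding permutes_eq_iff[OF assms(2)] by (simp add: skip_def)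
  ultimately show thesis using False by (intro that(2)) (auto simp: cflag_def)
qed

lemma dpos_perm:
  assumes "\<rho> permutes {..<r + s}" "\<pi> permutes {..<r' + s'}" "i < r + s" "j < r' + s'" "\<rho> i < r" "r' \<le> \<pi> j"
  shows "perm_upto (r + s + (r' + s') - 2) (dpos r s r' (\<rho> i) (\<pi> j - r') \<circ> map_sum \<rho> \<pi> \<circ> cflag (r + s) i j) =
    block_swap (r - 1) s r' \<circ> perm_upto (r + s + (r' + s') - 2) (cpos (r + s) (\<rho> i) (\<pi> j) \<circ> map_sum \<rho> \<pi> \<circ> cflag (r + s) i j)"
proof -
  have "\<pi> j < r' + s'" using assms(2,4) by (simp only: permutes_lessThan)
  then have b: "\<pi> j - r' < s'" "r' + (\<pi> j - r') = \<pi> j"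
    using assms(6) by linarith+
  note dp = dpos_eq_block_swap(1)[OF assms(5) b(1), of _ s r', unfolded b] dpos_eq_block_swap(2)[OF assms(5) b(1), of _ r' s, unfolded b]
  have "block_swap (r - 1) s r' permutes {..<r + s + (r' + s') - 2}"
    using assms b by (intro block_swap_permutes) auto
  note pc = perm_upto_comp[OF this, symmetric]
  show ?thesis
    unfolding pc
  proof (rule perm_upto_cong)
    fix l assume "l < r + s + (r' + s') - 2"
    with assms(1-4) show "(dpos r s r' (\<rho> i) (\<pi> j - r') \<circ> map_sum \<rho> \<pi> \<circ> cflag (r + s) i j) l =
        (block_swap (r - 1) s r' \<circ> (cpos (r + s) (\<rho> i) (\<pi> j) \<circ> map_sum \<rho> \<pi> \<circ> cflag (r + s) i j)) l"
      by (cases rule: cflag_cases) (use dp in auto)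
  qed
qed

text \<open>The first corolla is glued at an input, so the dioperad takes the second corolla as its
  first argument. The additional block swap exchanges the two groups of flags.\<close>

lemma dpos_perm_swap:
  assumes "\<rho> permutes {..<r + s}" "\<pi> permutes {..<r' + s'}" "i < r + s" "j < r' + s'" "r \<le> \<rho> i" "\<pi> j < r'"
  shows "perm_upto (r + s + (r' + s') - 2) (dpos r' s' r (\<pi> j) (\<rho> i - r) \<circ> case_sum Inr Inl \<circ> map_sum \<rho> \<pi> \<circ> cflag (r + s) i j) =
    block_swap (r' - 1) s' r \<circ> block_swap 0 (r + s - 1) (r' + s' - 1) \<circ>
      perm_upto (r + s + (r' + s') - 2) (cpos (r + s) (\<rho> i) (\<pi> j) \<circ> map_sum \<rho> \<pi> \<circ> cflag (r + s) i j)"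
proof -
  have lt: "\<rho> i < r + s" "\<pi> j < r' + s'" using assms(1-4) by (simp_all only: permutes_lessThan)
  then have a: "\<rho> i - r < s" "r + (\<rho> i - r) = \<rho> i"
    using assms(5) by linarith+
  note dp = dpos_eq_block_swap(1)[OF assms(6) a(1), of _ s' r, unfolded a] dpos_eq_block_swap(2)[OF assms(6) a(1), of _ r s', unfolded a]
  have "block_swap (r' - 1) s' r \<circ> block_swap 0 (r + s - 1) (r' + s' - 1) permutes {..<r + s + (r' + s') - 2}"
    using assms a by (intro permutes_compose block_swap_permutes) auto
  note pc = perm_upto_comp[OF this, symmetric]
  show ?thesis
    unfolding pc
  proof (rule perm_upto_cong)
    fix l assume "l < r + s + (r' + s') - 2"
    with assms(1-4) show "(dpos r' s' r (\<pi> j) (\<rho> i - r) \<circ> case_sum Inr Inl \<circ> map_sum \<rho> \<pi> \<circ> cflag (r + s) i j) l =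
        (block_swap (r' - 1) s' r \<circ> block_swap 0 (r + s - 1) (r' + s' - 1) \<circ> (cpos (r + s) (\<rho> i) (\<pi> j) \<circ> map_sum \<rho> \<pi> \<circ> cflag (r + s) i j)) l"
    proof (cases rule: cflag_cases)
      case (1 h)
      then have "unskip (\<rho> i) h < r + s - 1" using lt by (intro unskip_less) auto
      then have "block_swap 0 (r + s - 1) (r' + s' - 1) (unskip (\<rho> i) h) = r' + s' - 1 + unskip (\<rho> i) h"
        using block_swap_eval(1)[of "unskip (\<rho> i) h" "r + s - 1" 0 "r' + s' - 1"] by simp
      then show ?thesis using 1 dp(2)[of h] by (simp add: cpos_def)
    next
      case (2 h)
      then have "unskip (\<pi> j) h < r' + s' - 1" using lt by (intro unskip_less) auto
      then have "block_swap 0 (r + s - 1) (r' + s' - 1) (r + s - 1 + unskip (\<pi> j) h) = unskip (\<pi> j) h"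
        using block_swap_eval(2)[of "unskip (\<pi> j) h" "r' + s' - 1" 0 "r + s - 1"] by simp
      then show ?thesis using 2 dp(1)[of h] by (simp add: cpos_def)
    qed
  qed
qed

section \<open>The isomorphism\<close>

definition cor_dif :: "('k, 'x) dioperad_data \<Rightarrow> nat \<Rightarrow> int \<Rightarrow> nat \<times> 'x \<times> (nat \<Rightarrow> nat) \<Rightarrow> (nat \<times> 'x \<times> (nat \<Rightarrow> nat) \<Rightarrow>\<^sub>0 'k::field_char_0)" where
  "cor_dif P n d = (\<lambda>(r, p, \<rho>). Poly_Mapping.single (r, dif (dobj P r (n - r)) d p, \<rho>) 1)"

definition cor_act :: "(nat \<Rightarrow> nat) \<Rightarrow> nat \<times> 'x \<times> (nat \<Rightarrow> nat) \<Rightarrow> (nat \<times> 'x \<times> (nat \<Rightarrow> nat) \<Rightarrow>\<^sub>0 'k::field_char_0)" where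
  "cor_act \<sigma> = (\<lambda>(r, p, \<rho>). Poly_Mapping.single (r, p, \<rho> \<circ> \<sigma>) 1)"

lemma phi_shriek_simps:
  "gr (cobj (\<phi>\<^sub>! P) n) d = presented (corollas P n d) (corolla_rels P n d)"
  "dif (cobj (\<phi>\<^sub>! P) n) d = induced (corolla_rels P n (d + 1)) (cor_dif P n d)"
  "cact (\<phi>\<^sub>! P) n \<sigma> d = induced (corolla_rels P n d) (cor_act \<sigma>)"
  "ccomp (\<phi>\<^sub>! P) n i m j d e = induced2 (corolla_rels P (n + m - 2) (d + e)) (corolla_glue P n i m j d e)"
  by (simp_all add: phi_shriek_def cor_dif_def cor_act_def)

section \<open>Corollas and their images as words\<close>

context dg_double
begin

abbreviation "EndP \<equiv> End_di V"
abbreviation "cors n d \<equiv> corollas (End_di V) n d"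
abbreviation "crels n d \<equiv> corolla_rels (End_di V) n d"

lemma cors_iff: "(r, p, \<rho>) \<in> cors n d \<longleftrightarrow> r \<le> n \<and> p \<in> el (dobj EndP r (n - r)) d \<and> \<rho> permutes {..<n}"
  by (simp add: corollas_def)

lemma di_act_closed:
  "\<sigma> permutes {..<r} \<Longrightarrow> \<tau> permutes {..<s} \<Longrightarrow> p \<in> el (dobj EndP r s) d \<Longrightarrow> dact EndP r s \<sigma> \<tau> d p \<in> el (dobj EndP r s) d"
  using induced_linear[OF di_act_rel_map] unfolding linear_on_def End_di_simps by blast

lemma di_dif_closed: "p \<in> el (dobj EndP r s) d \<Longrightarrow> dif (dobj EndP r s) d p \<in> el (dobj EndP r s) (d + 1)"
  using induced_linear[OF di_dif_rel_map] unfolding linear_on_def End_di_simps by blast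

lemma di_comp_closed:
  "3 \<le> r + s + r' + s' \<Longrightarrow> i < r \<Longrightarrow> j < s' \<Longrightarrow> p \<in> el (dobj EndP r s) d \<Longrightarrow> q \<in> el (dobj EndP r' s') e \<Longrightarrow>
    dcomp EndP r s i r' s' j d e p q \<in> el (dobj EndP (r + r' - 1) (s + s' - 1)) (d + e)"
  using induced2_bilinear[OF di_glue_rel_map2] unfolding linear_on_def bilinear_on_def End_di_simps by blast

lemma iota_closed: "p \<in> el (dobj EndP r s) d \<Longrightarrow> iota r s d p \<in> el (cobj EndD (r + s)) d"
  using iota_linear unfolding linear_on_def by blast

lemma cor_lin:
  assumes "r \<le> n" "\<rho> permutes {..<n}"
  shows "lin_mod (gr (dobj EndP r (n - r)) d) (crels n d) (\<lambda>p. Poly_Mapping.single (r, p, \<rho>) c)"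
proof (rule lin_mod_single)
  have "lin_rels (gr (dobj EndP r (n - r)) d) (\<lambda>p. (r, p, \<rho>)) \<subseteq> crels n d"
    unfolding corolla_rels_def using assms by blast
  then show "lin_rels (gr (dobj EndP r (n - r)) d) (\<lambda>p. (r, p, \<rho>)) \<subseteq> free.span (crels n d)"
    using free.span_superset by blast
qed

lemma cor_act_rel:
  assumes "(r, p, \<rho>) \<in> cors n d" "\<sigma> permutes {..<r}" "\<tau> permutes {..<n - r}"
  shows "cls (crels n d) (Poly_Mapping.single (r, dact EndP r (n - r) \<sigma> \<tau> d p, \<rho>) 1) =
    cls (crels n d) (Poly_Mapping.single (r, p, block_sum r (n - r) \<sigma> \<tau> \<circ> \<rho>) 1)"
  unfolding cls_eq_iff corolla_rels_def using assms by (intro free.span_base UnI2) blast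

lemma cors_presentation: "presentation (cors n d) (crels n d)"
  unfolding presentation_def
proof
  fix x assume "x \<in> crels n d"
  then consider (lin) r \<rho> where "r \<le> n" "\<rho> permutes {..<n}" "x \<in> lin_rels (gr (dobj EndP r (n - r)) d) (\<lambda>p. (r, p, \<rho>))" |
    (act) r p \<rho> \<sigma> \<tau> where "(r, p, \<rho>) \<in> cors n d" "\<sigma> permutes {..<r}" "\<tau> permutes {..<n - r}"
      "x = Poly_Mapping.single (r, dact EndP r (n - r) \<sigma> \<tau> d p, \<rho>) 1 - Poly_Mapping.single (r, p, block_sum r (n - r) \<sigma> \<tau> \<circ> \<rho>) 1"
    unfolding corolla_rels_def by blast
  then show "x \<in> frees (cors n d)"
  proof cases
    case lin
    have "Module.module (kring :: 'k ring) (gr (dobj EndP r (n - r)) d)"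
      unfolding End_di_simps by (rule presented_module)
    from lin_rels_frees[OF this, of "\<lambda>p. (r, p, \<rho>)" "cors n d"] show ?thesis
      using lin by (auto simp: cors_iff)
  next
    case act
    have "block_sum r (n - r) \<sigma> \<tau> permutes {..<n}"
      using block_sum_permutes[OF act(2,3)] act(1) by (simp add: cors_iff)
    then show ?thesis
      unfolding act(4) using act(1-3)
      by (intro frees_diff frees_single) (auto simp: cors_iff di_act_closed intro: permutes_compose)
  qed
qed

text \<open>A corolla is decorated by a class, while a map of presentations has to assign a vector
  to it. Any representative will do, since only the class of the resulting vector is used.\<close>

definition rep :: "nat \<Rightarrow> nat \<Rightarrow> int \<Rightarrow> (('k, 'a) di_word \<Rightarrow>\<^sub>0 'k) set \<Rightarrow> (('k, 'a) di_word \<Rightarrow>\<^sub>0 'k)" where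
  "rep r s d p = (SOME x. x \<in> frees (di_words V r s d) \<and> p = cls (di_rels V r s d) x)"

lemma rep: 
  assumes "p \<in> el (dobj EndP r s) d"
  shows "rep r s d p \<in> frees (di_words V r s d)" "p = cls (di_rels V r s d) (rep r s d p)"
proof -
  have "\<exists>x. x \<in> frees (di_words V r s d) \<and> p = cls (di_rels V r s d) x" using assms by (auto simp: el_End_di)
  from someI_ex[OF this] show "rep r s d p \<in> frees (di_words V r s d)" "p = cls (di_rels V r s d) (rep r s d p)"
    unfolding rep_def by blast+
qed

definition phi_gen :: "nat \<Rightarrow> int \<Rightarrow> nat \<times> (('k, 'a) di_word \<Rightarrow>\<^sub>0 'k) set \<times> (nat \<Rightarrow> nat) \<Rightarrow> ((int \<times> ('a \<times> ('a \<Rightarrow> 'k))) list \<Rightarrow>\<^sub>0 'k)" where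
  "phi_gen n d = (\<lambda>(r, p, \<rho>). fextend (wact \<rho>) (fextend E (rep r (n - r) d p)))"

text \<open>The second claim eliminates the choice of a representative, because \<open>iota\<close>
  is defined on classes.\<close>

lemma phi_gen:
  assumes "(r, p, \<rho>) \<in> cors n d"
  shows "phi_gen n d (r, p, \<rho>) \<in> frees (words D n d)"
    and "cls (Drels n d) (phi_gen n d (r, p, \<rho>)) = cact EndD n \<rho> d (iota r (n - r) d p)"
proof -
  have *: "r \<le> n" "p \<in> el (dobj EndP r (n - r)) d" "\<rho> permutes {..<n}" using assms by (auto simp: cors_iff)
  have E: "fextend E (rep r (n - r) d p) \<in> frees (words D n d)"
    using E_frees[OF rep(1)[OF *(2)]] *(1) by simp
  then show "phi_gen n d (r, p, \<rho>) \<in> frees (words D n d)"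
    by (simp add: phi_gen_def rel_map_frees[OF double.wact_rel_map[OF *(3)]])
  have "iota r (n - r) d p = cls (Drels n d) (fextend E (rep r (n - r) d p))"
    using iota_cls[of r "n - r" d "rep r (n - r) d p"] rep(2)[OF *(2)] *(1) by simp
  then show "cls (Drels n d) (phi_gen n d (r, p, \<rho>)) = cact EndD n \<rho> d (iota r (n - r) d p)"
    by (simp add: phi_gen_def double.End_cyc_ops(2)[OF *(3) E])
qed

text \<open>The linearity relations are respected because \<open>iota\<close> and the action are
  linear, the relations over \<open>S_r x S_s\<close> because \<open>iota\<close> turns pairs of
  permutations into block sums and right actions compose.\<close>

lemma phi_gen_rel_map:
  assumes n: "1 \<le> n"
  shows "rel_map (cors n d) (crels n d) (words D n d) (Drels n d) (phi_gen n d)"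
  unfolding rel_map_def
proof (intro conjI ballI)
  fix g assume "g \<in> cors n d"
  then show "phi_gen n d g \<in> frees (words D n d)" using phi_gen(1) by (cases g) auto
next
  fix x assume "x \<in> crels n d"
  then consider (lin) r \<rho> where "r \<le> n" "\<rho> permutes {..<n}" "x \<in> lin_rels (gr (dobj EndP r (n - r)) d) (\<lambda>p. (r, p, \<rho>))" |
    (act) r p \<rho> \<sigma> \<tau> where "(r, p, \<rho>) \<in> cors n d" "\<sigma> permutes {..<r}" "\<tau> permutes {..<n - r}"
      "x = Poly_Mapping.single (r, dact EndP r (n - r) \<sigma> \<tau> d p, \<rho>) 1 - Poly_Mapping.single (r, p, block_sum r (n - r) \<sigma> \<tau> \<circ> \<rho>) 1"
    unfolding corolla_rels_def by blast
  then show "fextend (phi_gen n d) x \<in> free.span (Drels n d)"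
  proof cases
    case lin
    let ?M = "gr (dobj EndP r (n - r)) d"
    have rn: "r + (n - r) = n" using lin by simp
    interpret M: Module.module kring ?M unfolding End_di_simps by (rule presented_module)
    have cor: "(r, p, \<rho>) \<in> cors n d" if "p \<in> carrier ?M" for p using lin that by (simp add: cors_iff)
    have iota: "iota r (n - r) d p \<in> el (cobj EndD n) d" if "p \<in> carrier ?M" for p
      using iota_closed[OF that] rn by simp
    have "lin_mod ?M (Drels n d) (\<lambda>p. phi_gen n d (r, p, \<rho>))"
      unfolding lin_mod_def
    proof (intro conjI ballI allI)
      fix p q assume pq: "p \<in> carrier ?M" "q \<in> carrier ?M"
      have "iota r (n - r) d (p \<oplus>\<^bsub>?M\<^esub> q) = iota r (n - r) d p \<oplus>\<^bsub>gr (cobj EndD n) d\<^esub> iota r (n - r) d q"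
        using iota_linear[of r "n - r" d] pq rn unfolding linear_on_def by simp
      then show "cls (Drels n d) (phi_gen n d (r, p \<oplus>\<^bsub>?M\<^esub> q, \<rho>)) = cls (Drels n d) (phi_gen n d (r, p, \<rho>) + phi_gen n d (r, q, \<rho>))"
        unfolding cls_add phi_gen(2)[OF cor[OF pq(1)]] phi_gen(2)[OF cor[OF pq(2)]] phi_gen(2)[OF cor[OF M.M.add.m_closed[OF pq]]]
        using EndD.act_add[OF n lin(2) iota[OF pq(1)] iota[OF pq(2)]] by (simp add: End_cyc_simps(1))
    next
      fix c p assume p: "p \<in> carrier ?M"
      have cp: "c \<odot>\<^bsub>?M\<^esub> p \<in> carrier ?M" using M.smult_closed[of c p] p by simp
      have "iota r (n - r) d (c \<odot>\<^bsub>?M\<^esub> p) = c \<odot>\<^bsub>gr (cobj EndD n) d\<^esub> iota r (n - r) d p"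
        using iota_linear[of r "n - r" d] p rn unfolding linear_on_def by simp
      then show "cls (Drels n d) (phi_gen n d (r, c \<odot>\<^bsub>?M\<^esub> p, \<rho>)) = cls (Drels n d) (fscale c (phi_gen n d (r, p, \<rho>)))"
        unfolding cls_scale phi_gen(2)[OF cor[OF p]] phi_gen(2)[OF cor[OF cp]]
        using EndD.act_smult[OF n lin(2) iota[OF p]] by (simp add: End_cyc_simps(1))
    qed
    from lin_mod_fextend_rels[OF this lin(3)] show ?thesis .
  next
    case act
    have *: "r \<le> n" "p \<in> el (dobj EndP r (n - r)) d" "\<rho> permutes {..<n}" using act by (auto simp: cors_iff)
    have rn: "r + (n - r) = n" using * by simp
    have bs: "block_sum r (n - r) \<sigma> \<tau> permutes {..<n}" using block_sum_permutes[OF act(2,3)] rn by simp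
    have c1: "(r, dact EndP r (n - r) \<sigma> \<tau> d p, \<rho>) \<in> cors n d" using * act by (simp add: cors_iff di_act_closed)
    have c2: "(r, p, block_sum r (n - r) \<sigma> \<tau> \<circ> \<rho>) \<in> cors n d" using * bs by (simp add: cors_iff permutes_compose)
    have "iota r (n - r) d p \<in> el (cobj EndD n) d" using iota_closed[OF *(2)] rn by simp
    then have "cls (Drels n d) (phi_gen n d (r, dact EndP r (n - r) \<sigma> \<tau> d p, \<rho>)) =
        cls (Drels n d) (phi_gen n d (r, p, block_sum r (n - r) \<sigma> \<tau> \<circ> \<rho>))"
      unfolding phi_gen(2)[OF c1] phi_gen(2)[OF c2]
      using iota_act[OF act(2,3) *(2)] EndD.act_comp[OF n bs *(3)] rn by simp
    then show ?thesis unfolding act(4) by (simp add: fextend_diff cls_eq_iff)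
  qed
qed

section \<open>Expansion of words into corollas\<close>

lemma cor_lin_nested:
  assumes "r \<le> n" "\<rho> permutes {..<n}" "Module.module (kring :: 'k ring) M"
    and h: "lin_mod M (di_rels V r (n - r) d) h" "\<And>v. v \<in> carrier M \<Longrightarrow> h v \<in> frees (di_words V r (n - r) d)"
  shows "lin_mod M (crels n d) (\<lambda>v. Poly_Mapping.single (r, cls (di_rels V r (n - r) d) (h v), \<rho>) c)"
proof -
  let ?R = "di_rels V r (n - r) d"
  note lin = cor_lin[OF assms(1,2), of d c, unfolded End_di_simps]
  show ?thesis
    unfolding lin_mod_def
  proof (intro conjI ballI allI)
    fix v w assume "v \<in> carrier M" "w \<in> carrier M"
    then show "cls (crels n d) (Poly_Mapping.single (r, cls ?R (h (v \<oplus>\<^bsub>M\<^esub> w)), \<rho>) c) =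
        cls (crels n d) (Poly_Mapping.single (r, cls ?R (h v), \<rho>) c + Poly_Mapping.single (r, cls ?R (h w), \<rho>) c)"
      using lin_mod_add[OF lin, of "cls ?R (h v)" "cls ?R (h w)"] h(2) by (simp add: lin_mod_add[OF h(1)] cls_add)
  next
    fix a v assume "v \<in> carrier M"
    then show "cls (crels n d) (Poly_Mapping.single (r, cls ?R (h (a \<odot>\<^bsub>M\<^esub> v)), \<rho>) c) =
        cls (crels n d) (fscale a (Poly_Mapping.single (r, cls ?R (h v), \<rho>) c))"
      using lin_mod_smult[OF lin, of "cls ?R (h v)" a] h(2) by (simp add: lin_mod_smult[OF h(1)] cls_scale)
  qed
qed

text \<open>The decoration is a class, so a corolla depends linearly on a representing vector only
  modulo the relations of corollas. Induction on the support of \<open>x\<close> unfolds this inner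
  linearity.\<close>

lemma cor_expand:
  assumes r: "r \<le> n" "\<rho> permutes {..<n}" and x: "x \<in> frees (di_words V r (n - r) d)"
  shows "cls (crels n d) (Poly_Mapping.single (r, cls (di_rels V r (n - r) d) x, \<rho>) 1) =
    cls (crels n d) (fextend (\<lambda>h. Poly_Mapping.single (r, cls (di_rels V r (n - r) d) (Poly_Mapping.single h 1), \<rho>) 1) x)"
proof -
  let ?R = "di_rels V r (n - r) d"
  let ?K = "\<lambda>x. Poly_Mapping.single (r, cls ?R x, \<rho>) (1 :: 'k)"
  note lin = cor_lin[OF r, of d 1, unfolded End_di_simps]
  have fr: "(\<Sum>h\<in>A. fscale (f h) (Poly_Mapping.single h 1)) \<in> frees (di_words V r (n - r) d)"
    if "A \<subseteq> di_words V r (n - r) d" for A and f :: "_ \<Rightarrow> 'k"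
    using that by (intro frees_sum frees_scale frees_single) auto
  have "cls (crels n d) (?K (\<Sum>h\<in>A. fscale (f h) (Poly_Mapping.single h 1))) =
      cls (crels n d) (\<Sum>h\<in>A. fscale (f h) (?K (Poly_Mapping.single h 1)))"
    if "finite A" "A \<subseteq> di_words V r (n - r) d" for A f
    using that
  proof (induction A rule: finite_induct)
    case empty
    have "cls (crels n d) (?K 0) = cls (crels n d) 0"
      using lin_mod_zero[OF lin presented_module] by simp
    then show ?case by simp
  next
    case (insert h A)
    let ?s = "Poly_Mapping.single h (1 :: 'k)" and ?t = "\<Sum>h\<in>A. fscale (f h) (Poly_Mapping.single h (1 :: 'k))"
    have h: "?s \<in> frees (di_words V r (n - r) d)" "?t \<in> frees (di_words V r (n - r) d)"
      using insert fr[of A f] by (auto intro: frees_single)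
    have "cls (crels n d) (?K (fscale (f h) ?s + ?t)) = cls (crels n d) (?K (fscale (f h) ?s) + ?K ?t)"
      using lin_mod_add[OF lin, of "cls ?R (fscale (f h) ?s)" "cls ?R ?t"] frees_scale[OF h(1), of "f h"] h(2) by (simp add: cls_add)
    also have "\<dots> = cls (crels n d) (fscale (f h) (?K ?s) + (\<Sum>h\<in>A. fscale (f h) (?K (Poly_Mapping.single h 1))))"
    proof (rule cls_cong_add)
      show "cls (crels n d) (?K (fscale (f h) ?s)) = cls (crels n d) (fscale (f h) (?K ?s))"
        using lin_mod_smult[OF lin, of "cls ?R ?s" "f h"] h(1) by (simp only: presented_simps cls_scale imageI)
      show "cls (crels n d) (?K ?t) = cls (crels n d) (\<Sum>h\<in>A. fscale (f h) (?K (Poly_Mapping.single h 1)))"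
        using insert by simp
    qed
    finally show ?case by (simp only: sum.insert[OF insert.hyps])
  qed
  from this[of "Poly_Mapping.keys x" "Poly_Mapping.lookup x"]
  have "cls (crels n d) (?K (fextend (\<lambda>h. Poly_Mapping.single h 1) x)) = cls (crels n d) (fextend (\<lambda>h. ?K (Poly_Mapping.single h 1)) x)"
    using x by (simp only: fextend_def frees_def mem_Collect_eq finite_keys)
  then show ?thesis by (simp only: fextend_single_eq)
qed

text \<open>A choice of a permutation that brings the positions in \<open>S\<close> to the front.
  Any other choice differs from it by a block sum, which the relations absorb.\<close>

definition blk :: "nat \<Rightarrow> nat set \<Rightarrow> nat \<Rightarrow> nat" where
  "blk n S = (SOME \<rho>. \<rho> permutes {..<n} \<and> (\<forall>l<n. \<rho> l < card S \<longleftrightarrow> l \<in> S))"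

lemma blk:
  assumes "S \<subseteq> {..<n}"
  shows "blk n S permutes {..<n}" "l < n \<Longrightarrow> blk n S l < card S \<longleftrightarrow> l \<in> S"
  using someI_ex[OF ex_block_perm[OF assms]] unfolding blk_def by blast+

text \<open>The component of a word with letters in the vector space at the positions in
  \<open>S\<close> and in the dual elsewhere. \<open>pinv (blk n S)\<close> sorts the letters,
  \<open>unemb\<close> discards the unwanted components, and \<open>blk n S\<close>, kept as the
  permutation of the corolla, puts the letters back.\<close>

definition psi_term :: "nat \<Rightarrow> int \<Rightarrow> nat set \<Rightarrow> (int \<times> ('a \<times> ('a \<Rightarrow> 'k))) list \<Rightarrow>
    (nat \<times> (('k, 'a) di_word \<Rightarrow>\<^sub>0 'k) set \<times> (nat \<Rightarrow> nat) \<Rightarrow>\<^sub>0 'k)" where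
  "psi_term n d S w = Poly_Mapping.single
     (card S, cls (di_rels V (card S) (n - card S) d)
       (Poly_Mapping.single (unemb (card S) (wperm (pinv (blk n S)) w)) 1), blk n S)
     (wsign (pinv (blk n S)) w)"

definition psi_gen :: "nat \<Rightarrow> int \<Rightarrow> (int \<times> ('a \<times> ('a \<Rightarrow> 'k))) list \<Rightarrow>
    (nat \<times> (('k, 'a) di_word \<Rightarrow>\<^sub>0 'k) set \<times> (nat \<Rightarrow> nat) \<Rightarrow>\<^sub>0 'k)" where
  "psi_gen n d w = (\<Sum>S\<in>Pow {..<n}. psi_term n d S w)"

lemma card_le: "S \<subseteq> {..<n::nat} \<Longrightarrow> card S \<le> n"
  using card_mono[of "{..<n}" S] by simp

lemma psi_term_word:
  assumes "S \<subseteq> {..<n}" "w \<in> words D n d"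
  shows "unemb (card S) (wperm (pinv (blk n S)) w) \<in> di_words V (card S) (n - card S) d"
    and "(card S, cls (di_rels V (card S) (n - card S) d)
       (Poly_Mapping.single (unemb (card S) (wperm (pinv (blk n S)) w)) c), blk n S) \<in> cors n d"
proof -
  have "wperm (pinv (blk n S)) w \<in> words D (card S + (n - card S)) d"
    using wperm_words[OF assms(2) permutes_inv[OF blk(1)[OF assms(1)]]] card_le[OF assms(1)] by simp
  from unemb_words[OF this]
  show u: "unemb (card S) (wperm (pinv (blk n S)) w) \<in> di_words V (card S) (n - card S) d" .
  show "(card S, cls (di_rels V (card S) (n - card S) d)
       (Poly_Mapping.single (unemb (card S) (wperm (pinv (blk n S)) w)) c), blk n S) \<in> cors n d"
    using card_le[OF assms(1)] blk(1)[OF assms(1)] frees_single[OF u, of c] by (auto simp: cors_iff el_End_di)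
qed

text \<open>Each term is multilinear through two layers: the letter varies inside a pair of words,
  whose class in turn decorates a corolla.\<close>

lemma psi_gen_rel_map: "rel_map (words D n d) (Drels n d) (cors n d) (crels n d) (psi_gen n d)"
proof (rule double.words_rel_mapI)
  fix w assume w: "w \<in> words D n d"
  then show "psi_gen n d w \<in> frees (cors n d)"
    unfolding psi_gen_def psi_term_def by (intro frees_sum frees_single psi_term_word(2)) auto
  fix k assume k: "k < n"
  have len: "length w = n" using w by (simp add: words_iff)
  show "lin_mod (gr D (fst (w ! k))) (crels n d) (\<lambda>v. psi_gen n d (w[k := (fst (w ! k), v)]))"
    unfolding psi_gen_def
  proof (rule lin_mod_sum)
    fix S assume "S \<in> Pow {..<n}"
    then have S: "S \<subseteq> {..<n}" by simp
    let ?r = "card S" and ?p = "pinv (blk n S)"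
    let ?R = "di_rels V ?r (n - ?r) d"
    note p = permutes_inv[OF blk(1)[OF S]]
    have rn: "?r + (n - ?r) = n" using card_le[OF S] by simp
    have k': "pinv ?p k < n" "?p (pinv ?p k) = k"
      using permutes_lessThan[OF permutes_inv[OF p]] k permutes_inverses[OF p] by auto
    have pw: "wperm ?p w \<in> words D (?r + (n - ?r)) d" using wperm_words[OF w p] rn by simp
    have "lin_mod (gr D (fst (w ! k))) ?R (\<lambda>v. Poly_Mapping.single (unemb ?r ((wperm ?p w)[pinv ?p k := (fst (w ! k), v)])) 1)"
      using unemb_lin[OF pw, of "pinv ?p k" 1] k' len rn by simp
    moreover have "Poly_Mapping.single (unemb ?r ((wperm ?p w)[pinv ?p k := (fst (w ! k), v)])) 1 \<in> frees (di_words V ?r (n - ?r) d)"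
      if "v \<in> el D (fst (w ! k))" for v
    proof -
      have "(wperm ?p w)[pinv ?p k := (fst (wperm ?p w ! pinv ?p k), v)] \<in> words D (?r + (n - ?r)) d"
        using that k' len rn by (intro words_update_fst pw) auto
      then show ?thesis using unemb_words k' len by (intro frees_single) simp
    qed
    ultimately have "lin_mod (gr D (fst (w ! k))) (crels n d) (\<lambda>v. Poly_Mapping.single (?r, cls ?R (Poly_Mapping.single
        (unemb ?r ((wperm ?p w)[pinv ?p k := (fst (w ! k), v)])) 1), blk n S) (wsign ?p w))"
      by (rule cor_lin_nested[OF card_le[OF S] blk(1)[OF S] double.vector_space])
    moreover have "psi_term n d S (w[k := (fst (w ! k), v)]) = Poly_Mapping.single (?r, cls ?R (Poly_Mapping.single
        (unemb ?r ((wperm ?p w)[pinv ?p k := (fst (w ! k), v)])) 1), blk n S) (wsign ?p w)" for v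
      using p len by (simp add: psi_term_def wperm_update wsign_cong[of "w[k := (fst (w ! k), v)]" w ?p ?p])
    ultimately show "lin_mod (gr D (fst (w ! k))) (crels n d) (\<lambda>v. psi_term n d S (w[k := (fst (w ! k), v)]))"
      by simp
  qed
qed

lemma unemb_zero:
  assumes w: "w \<in> words D (r + s) d" and j: "j < r + s"
    and z: "if j < r then fst (snd (w ! j)) = \<zero>\<^bsub>gr V (fst (w ! j))\<^esub> else snd (snd (w ! j)) = \<zero>\<^bsub>gr (dual V) (fst (w ! j))\<^esub>"
  shows "cls (di_rels V r s d) (Poly_Mapping.single (unemb r w) 1) = cls (di_rels V r s d) 0"
proof -
  have len: "length w = r + s" using w by (simp add: words_iff)
  obtain u v where uv: "unemb r w = (u, v)" by (cases "unemb r w")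
  have g: "(u, v) \<in> di_words V r s d" using unemb_words[OF w] uv by simp
  have u: "u = map (\<lambda>x. (fst x, fst (snd x))) (take r w)" and v: "v = map (\<lambda>x. (fst x, snd (snd x))) (drop r w)"
    using uv by (auto simp: unemb_def)
  show ?thesis
  proof (cases "j < r")
    case True
    then have "u[j := (fst (w ! j), \<zero>\<^bsub>gr V (fst (w ! j))\<^esub>)] = u"
      using z len by (intro nth_equalityI) (auto simp: u nth_list_update)
    moreover have "fst (u ! j) = fst (w ! j)" using True len by (simp add: u)
    ultimately show ?thesis
      using lin_mod_zero[OF di_lin_left[OF g True] vector_space, of "fst (w ! j)" 1] uv by simp
  next
    case False
    then have wj: "drop r w ! (j - r) = w ! j" using len j by (subst nth_drop) auto
    have "v[j - r := (fst (w ! j), \<zero>\<^bsub>gr (dual V) (fst (w ! j))\<^esub>)] = v"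
      using z False len j wj by (intro nth_equalityI) (auto simp: v nth_list_update)
    moreover have "fst (v ! (j - r)) = fst (w ! j)" using False len j wj by (simp add: v)
    moreover have "j - r < s" using j False by simp
    ultimately show ?thesis
      using lin_mod_zero[OF di_lin_right[OF g, of "j - r"] dual.vector_space, of "fst (w ! j)" 1] uv by simp
  qed
qed

text \<open>\<open>S\<close> and the set of outputs of the corolla differ at some position
  \<open>l\<close>. The letter there has one component equal to zero, and \<open>unemb\<close> keeps
  just that one.\<close>

lemma psi_term_emb_other:
  assumes r: "r \<le> n" "\<rho> permutes {..<n}" and h: "h \<in> di_words V r (n - r) d"
    and S: "S \<subseteq> {..<n}" "S \<noteq> {l. l < n \<and> \<rho> l < r}"
  shows "cls (crels n d) (psi_term n d S (wperm \<rho> (emb V h))) = cls (crels n d) 0"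
proof -
  let ?w = "wperm \<rho> (emb V h)" and ?\<beta> = "blk n S" and ?r = "card S"
  let ?u = "wperm (pinv ?\<beta>) ?w"
  note \<beta> = blk(1)[OF S(1)]
  obtain u v where uv: "h = (u, v)" by (cases h)
  have len: "length u = r" "length v = n - r" using h by (auto simp: uv di_words_iff words_iff)
  have W: "emb V h \<in> words D n d" using emb_words[of u v r "n - r" d] h r(1) by (simp add: uv)
  have w: "?w \<in> words D n d" by (rule wperm_words[OF W r(2)])
  have lenw: "length ?w = n" using w by (simp add: words_iff)
  have rn: "?r + (n - ?r) = n" using card_le[OF S(1)] by simp
  have u: "?u \<in> words D (?r + (n - ?r)) d" using wperm_words[OF w permutes_inv[OF \<beta>]] rn by simp
  obtain l where l: "l < n" "(l \<in> S) \<noteq> (\<rho> l < r)" using S by blast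
  have \<beta>l: "?\<beta> l < n" using permutes_lessThan[OF \<beta>] l(1) by simp
  have \<rho>l: "\<rho> l < n" using permutes_lessThan[OF r(2)] l(1) by simp
  have ul: "?u ! ?\<beta> l = emb V h ! \<rho> l"
    using \<beta>l l(1) lenw permutes_inverses(2)[OF \<beta>] by simp
  have "cls (di_rels V ?r (n - ?r) d) (Poly_Mapping.single (unemb ?r ?u) 1) = cls (di_rels V ?r (n - ?r) d) 0"
  proof (rule unemb_zero[OF u])
    show "?\<beta> l < ?r + (n - ?r)" using \<beta>l rn by simp
    have "emb V h ! \<rho> l = (if \<rho> l < r then inl_letter V (u ! \<rho> l) else inr_letter V (v ! (\<rho> l - r)))"
      using len \<rho>l by (simp add: uv emb_def nth_append)
    then show "if ?\<beta> l < ?r then fst (snd (?u ! ?\<beta> l)) = \<zero>\<^bsub>gr V (fst (?u ! ?\<beta> l))\<^esub>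
        else snd (snd (?u ! ?\<beta> l)) = \<zero>\<^bsub>gr (dual V) (fst (?u ! ?\<beta> l))\<^esub>"
      using l(2) blk(2)[OF S(1) l(1)] unfolding ul by (auto simp: inl_letter_def inr_letter_def)
  qed
  then have "psi_term n d S ?w = Poly_Mapping.single (?r, cls (di_rels V ?r (n - ?r) d) 0, ?\<beta>) (wsign (pinv ?\<beta>) ?w)"
    by (simp only: psi_term_def)
  then show ?thesis
    using lin_mod_zero[OF cor_lin[OF card_le[OF S(1)] \<beta>, of d "wsign (pinv ?\<beta>) ?w", unfolded End_di_simps] presented_module] by simp
qed

text \<open>\<open>\<rho>\<close> is \<open>?\<kappa>\<close> after \<open>blk n S\<close>, and
  \<open>?\<kappa>\<close> preserves the two blocks. It is therefore a block sum, and the relation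
  over \<open>S_r x S_s\<close> moves it between the decoration and the permutation of the
  corolla.\<close>

lemma psi_term_emb_same:
  assumes r: "r \<le> n" "\<rho> permutes {..<n}" and h: "h \<in> di_words V r (n - r) d"
    and S: "S = {l. l < n \<and> \<rho> l < r}"
  shows "cls (crels n d) (fscale (wsign \<rho> (emb V h)) (psi_term n d S (wperm \<rho> (emb V h)))) =
    cls (crels n d) (Poly_Mapping.single (r, cls (di_rels V r (n - r) d) (Poly_Mapping.single h 1), \<rho>) 1)"
proof -
  let ?W = "emb V h" and ?\<beta> = "blk n S" and ?R = "di_rels V r (n - r) d"
  let ?\<kappa> = "\<rho> \<circ> pinv ?\<beta>"
  have Sn: "S \<subseteq> {..<n}" using S by auto
  note \<beta> = blk(1)[OF Sn]
  have "S = pinv \<rho> ` {..<r}"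
  proof -
    have "l \<in> pinv \<rho> ` {..<r}" if "\<rho> l < r" for l
      using that permutes_inverses(2)[OF r(2), of l] by (metis imageI lessThan_iff)
    moreover have "pinv \<rho> k < n" if "k < r" for k
      using that r(1) permutes_lessThan[OF permutes_inv[OF r(2)], of k] by simp
    ultimately show ?thesis using permutes_inverses(1)[OF r(2)] by (auto simp: S)
  qed
  then have cS: "card S = r"
    using permutes_inj[OF permutes_inv[OF r(2)]] by (simp add: card_image inj_on_subset[OF _ subset_UNIV])
  obtain u v where uv: "h = (u, v)" by (cases h)
  have len: "length u = r" "length v = n - r" using h by (auto simp: uv di_words_iff words_iff)
  have W: "?W \<in> words D n d" using emb_words[of u v r "n - r" d] h r(1) by (simp add: uv)
  have lenW: "length ?W = n" using W by (simp add: words_iff)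
  have \<kappa>: "?\<kappa> permutes {..<n}" by (rule permutes_compose[OF permutes_inv[OF \<beta>] r(2)])
  have "?\<kappa> l < r \<longleftrightarrow> l < r" if "l < n" for l
  proof -
    have l: "pinv ?\<beta> l < n" using that permutes_lessThan[OF permutes_inv[OF \<beta>]] by simp
    have "?\<kappa> l < r \<longleftrightarrow> pinv ?\<beta> l \<in> S" using l by (simp add: S)
    also have "\<dots> \<longleftrightarrow> ?\<beta> (pinv ?\<beta> l) < card S" using blk(2)[OF Sn l] by simp
    finally show ?thesis using cS permutes_inverses(1)[OF \<beta>] by simp
  qed
  then obtain \<sigma> \<tau> where \<sigma>\<tau>: "\<sigma> permutes {..<r}" "\<tau> permutes {..<n - r}" "?\<kappa> = block_sum r (n - r) \<sigma> \<tau>"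
    using perm_eq_block_sum[OF \<kappa> r(1)] by blast
  \<comment> \<open>The left inverse of \<open>E\<close> reads off the action of the block sum on
    pairs of words from its action on words.\<close>
  have "fextend (\<lambda>w. Poly_Mapping.single (unemb r w) 1) (fextend E (di_act \<sigma> \<tau> (u, v))) = di_act \<sigma> \<tau> (u, v)"
    using len by (simp add: di_act_def E_def unemb_emb)
  then have act: "di_act \<sigma> \<tau> h = Poly_Mapping.single (unemb r (wperm ?\<kappa> ?W)) (wsign ?\<kappa> ?W :: 'k)"
    using E_act[OF h[unfolded uv] \<sigma>\<tau>(1,2)] by (simp add: uv \<sigma>\<tau>(3) wact_def)
  have "wperm (pinv ?\<beta>) (wperm \<rho> ?W) = wperm ?\<kappa> ?W" 
    using lenW permutes_inv[OF \<beta>] by (simp add: wperm_comp)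
  moreover have "wsign \<rho> ?W * wsign (pinv ?\<beta>) (wperm \<rho> ?W) = (wsign ?\<kappa> ?W :: 'k)"
    using lenW permutes_inv[OF \<beta>] r(2) by (simp add: wsign_comp)
  ultimately have "fscale (wsign \<rho> ?W) (psi_term n d S (wperm \<rho> ?W)) =
      fscale (wsign ?\<kappa> ?W) (Poly_Mapping.single (r, cls ?R (Poly_Mapping.single (unemb r (wperm ?\<kappa> ?W)) 1), ?\<beta>) 1)"
    by (simp add: psi_term_def cS)
  moreover have "unemb r (wperm ?\<kappa> ?W) \<in> di_words V r (n - r) d"
    using unemb_words[of "wperm ?\<kappa> ?W" r "n - r" d] wperm_words[OF W \<kappa>] r(1) by simp
  then have f: "Poly_Mapping.single (unemb r (wperm ?\<kappa> ?W)) (1 :: 'k) \<in> frees (di_words V r (n - r) d)" by (rule frees_single)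
  have "cls (crels n d) (fscale (wsign ?\<kappa> ?W) (Poly_Mapping.single (r, cls ?R (Poly_Mapping.single (unemb r (wperm ?\<kappa> ?W)) 1), ?\<beta>) 1)) =
      cls (crels n d) (Poly_Mapping.single (r, cls ?R (fscale (wsign ?\<kappa> ?W) (Poly_Mapping.single (unemb r (wperm ?\<kappa> ?W)) 1)), ?\<beta>) 1)"
    using lin_mod_smult[OF cor_lin[OF r(1) \<beta>, of d 1, unfolded End_di_simps],
        of "cls ?R (Poly_Mapping.single (unemb r (wperm ?\<kappa> ?W)) 1)" "wsign ?\<kappa> ?W"] f
    by (simp only: presented_simps cls_scale imageI)
  moreover have "cls ?R (fscale (wsign ?\<kappa> ?W) (Poly_Mapping.single (unemb r (wperm ?\<kappa> ?W)) 1)) =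
      dact EndP r (n - r) \<sigma> \<tau> d (cls ?R (Poly_Mapping.single h 1))"
    using frees_single[OF h, of "1 :: 'k"] act by (simp add: End_di_cls(2)[OF \<sigma>\<tau>(1,2)])
  moreover have "cls (crels n d) (Poly_Mapping.single (r, dact EndP r (n - r) \<sigma> \<tau> d (cls ?R (Poly_Mapping.single h 1)), ?\<beta>) 1) =
      cls (crels n d) (Poly_Mapping.single (r, cls ?R (Poly_Mapping.single h 1), block_sum r (n - r) \<sigma> \<tau> \<circ> ?\<beta>) 1)"
    using frees_single[OF h, of "1 :: 'k"] r \<beta> by (intro cor_act_rel[OF _ \<sigma>\<tau>(1,2)]) (auto simp: cors_iff el_End_di)
  moreover have "block_sum r (n - r) \<sigma> \<tau> \<circ> ?\<beta> = \<rho>"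
    unfolding \<sigma>\<tau>(3)[symmetric] using permutes_inv_o(2)[OF \<beta>] by (simp add: comp_assoc)
  ultimately show ?thesis by simp
qed

text \<open>Among the terms for all \<open>S\<close> only the one for the outputs of the corolla
  survives. The terms can be computed for single pairs of words, so the representative is expanded
  into these and reassembled at the end.\<close>

lemma psi_phi:
  assumes "(r, p, \<rho>) \<in> cors n d"
  shows "cls (crels n d) (fextend (psi_gen n d) (phi_gen n d (r, p, \<rho>))) = cls (crels n d) (Poly_Mapping.single (r, p, \<rho>) 1)"
proof -
  have *: "r \<le> n" "p \<in> el (dobj EndP r (n - r)) d" "\<rho> permutes {..<n}" using assms by (auto simp: cors_iff)
  let ?x = "rep r (n - r) d p" and ?R = "di_rels V r (n - r) d"
  let ?T = "\<lambda>h. Poly_Mapping.single (r, cls ?R (Poly_Mapping.single h (1 :: 'k)), \<rho>) (1 :: 'k)"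
  let ?S = "{l. l < n \<and> \<rho> l < r}"
  have "cls (crels n d) (fextend (psi_gen n d) (fextend (wact \<rho>) (fextend E ?x))) = cls (crels n d) (fextend ?T ?x)"
  proof (rule flin_cls_ext[where L = "\<lambda>x. fextend (psi_gen n d) (fextend (wact \<rho>) (fextend E x))" and M = "fextend ?T"
        and G = "di_words V r (n - r) d"])
    show "flin (\<lambda>x. fextend (psi_gen n d) (fextend (wact \<rho>) (fextend E x)))"
      by (rule flinI) (simp_all add: lin_simps)
    show "flin (fextend ?T)" by (rule flin_fextend)
    show "Poly_Mapping.keys ?x \<subseteq> di_words V r (n - r) d" using rep(1)[OF *(2)] by (simp add: frees_def)
    fix h assume h: "h \<in> di_words V r (n - r) d"
    let ?W = "emb V h"
    have "fextend (psi_gen n d) (fextend (wact \<rho>) (fextend E (Poly_Mapping.single h 1))) =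
        (\<Sum>S\<in>Pow {..<n}. fscale (wsign \<rho> ?W) (psi_term n d S (wperm \<rho> ?W)))"
      by (simp add: E_def wact_def psi_gen_def fscale_sum)
    moreover have "cls (crels n d) (\<Sum>S\<in>Pow {..<n}. fscale (wsign \<rho> ?W) (psi_term n d S (wperm \<rho> ?W))) =
        cls (crels n d) (\<Sum>S\<in>Pow {..<n}. if S = ?S then ?T h else 0)"
    proof (rule cls_cong_sum)
      fix S assume S: "S \<in> Pow {..<n}"
      show "cls (crels n d) (fscale (wsign \<rho> ?W) (psi_term n d S (wperm \<rho> ?W))) = cls (crels n d) (if S = ?S then ?T h else 0)"
      proof (cases "S = ?S")
        case True
        then show ?thesis using psi_term_emb_same[OF *(1,3) h True] by simp
      next
        case False
        then show ?thesis
          using cls_cong_scale[OF psi_term_emb_other[OF *(1,3) h _ False], of "wsign \<rho> ?W"] S by simp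
      qed
    qed
    moreover have "(\<Sum>S\<in>Pow {..<n}. if S = ?S then ?T h else 0) = ?T h"
    proof -
      have "?S \<in> Pow {..<n}" by auto
      then show ?thesis by (simp only: sum.delta' finite_Pow_iff finite_lessThan if_True sum.delta)
    qed
    ultimately show "cls (crels n d) (fextend (psi_gen n d) (fextend (wact \<rho>) (fextend E (Poly_Mapping.single h 1)))) =
        cls (crels n d) (fextend ?T (Poly_Mapping.single h 1))"
      by simp
  qed
  also have "\<dots> = cls (crels n d) (Poly_Mapping.single (r, cls ?R ?x, \<rho>) 1)"
    by (rule cor_expand[OF *(1,3) rep(1)[OF *(2)], symmetric])
  finally show ?thesis using rep(2)[OF *(2)] by (simp add: phi_gen_def)
qed

lemma phi_gen_embed: "1 \<le> n \<Longrightarrow> rel_embed (cors n d) (crels n d) (words D n d) (Drels n d) (phi_gen n d)"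
  by (rule rel_embed_left_inverse[OF cors_presentation phi_gen_rel_map psi_gen_rel_map]) (use psi_phi in auto)

section \<open>Projections of words onto their components\<close>

definition proj_letter :: "bool \<Rightarrow> int \<times> ('a \<times> ('a \<Rightarrow> 'k)) \<Rightarrow> int \<times> ('a \<times> ('a \<Rightarrow> 'k))" where
  "proj_letter b x = (if b then inl_letter V (fst x, fst (snd x)) else inr_letter V (fst x, snd (snd x)))"

text \<open>\<open>K\<close> is the set of positions that have already been expanded; it makes an
  induction possible that treats one position at a time.\<close>

definition proj_word :: "nat set \<Rightarrow> nat set \<Rightarrow> (int \<times> ('a \<times> ('a \<Rightarrow> 'k))) list \<Rightarrow> (int \<times> ('a \<times> ('a \<Rightarrow> 'k))) list" where
  "proj_word K S w = map (\<lambda>l. if l \<in> K then proj_letter (l \<in> S) (w ! l) else w ! l) [0..<length w]"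

lemma fst_proj_letter [simp]: "fst (proj_letter b x) = fst x"
  by (simp add: proj_letter_def)

lemma proj_letter_closed: "snd x \<in> el D (fst x) \<Longrightarrow> snd (proj_letter b x) \<in> el D (fst x)"
  by (auto simp: proj_letter_def inl_letter_def inr_letter_def double_def dsum_simps zero_closed dual.zero_closed)

lemma proj_letter_add:
  assumes "snd x \<in> el D (fst x)"
  shows "snd (proj_letter True x) \<oplus>\<^bsub>gr D (fst x)\<^esub> snd (proj_letter False x) = snd x"
proof -
  interpret V: Module.module kring "gr V (fst x)" by (rule vector_space)
  interpret V': Module.module kring "gr (dual V) (fst x)" by (rule dual.vector_space)
  show ?thesis
    using assms by (auto simp: proj_letter_def inl_letter_def inr_letter_def double_def dsum_simps prod_eq_iff V.M.r_zero V'.M.l_zero)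
qed

lemma proj_word_words:
  assumes "w \<in> words D n d"
  shows "proj_word K S w \<in> words D n d"
proof -
  have "wdeg (proj_word K S w) = wdeg w"
    by (rule wdeg_cong, rule nth_equalityI) (auto simp: proj_word_def)
  then show ?thesis
    using assms proj_letter_closed by (auto simp: words_iff proj_word_def)
qed

text \<open>A letter is the sum of its two projections. Expanding one more position \<open>x\<close>
  splits each term in two, according to whether \<open>x\<close> belongs to the set of positions
  taken from the vector space.\<close>

lemma proj_word_sum:
  assumes w: "w \<in> words D n d" and K: "finite K" "K \<subseteq> {..<n}"
  shows "cls (Drels n d) (\<Sum>S\<in>Pow K. Poly_Mapping.single (proj_word K S w) 1) = cls (Drels n d) (Poly_Mapping.single w 1)"
  using K
proof (induction K rule: finite_induct)
  case empty
  have "proj_word {} {} w = w" by (rule nth_equalityI) (auto simp: proj_word_def)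
  then show ?case by simp
next
  case (insert x K)
  let ?s = "\<lambda>S. Poly_Mapping.single (proj_word (insert x K) S w) (1 :: 'k)"
  have len: "length w = n" using w by (simp add: words_iff)
  have x: "x < n" using insert by simp
  have wx: "snd (w ! x) \<in> el D (fst (w ! x))" using w x by (simp add: words_iff)
  have inj: "inj_on (insert x) (Pow K)" using insert.hyps(2) by (intro inj_onI) (metis PowD insert_ident subsetD)
  have "sum ?s (Pow (insert x K)) = sum ?s (insert x ` Pow K) + sum ?s (Pow K)"
    unfolding Pow_insert using insert.hyps by (subst sum.union_disjoint) (auto simp: add.commute)
  also have "\<dots> = (\<Sum>S\<in>Pow K. ?s (insert x S) + ?s S)"
    unfolding sum.reindex[OF inj] sum.distrib by simp
  finally have "cls (Drels n d) (sum ?s (Pow (insert x K))) = cls (Drels n d) (\<Sum>S\<in>Pow K. ?s (insert x S) + ?s S)" by simp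
  also have "\<dots> = cls (Drels n d) (\<Sum>S\<in>Pow K. Poly_Mapping.single (proj_word K S w) 1)"
  proof (rule cls_cong_sum)
    fix S assume S: "S \<in> Pow K"
    let ?w = "proj_word K S w" and ?e = "fst (w ! x)"
    have xS: "x \<in> S \<longleftrightarrow> False" using S insert.hyps(2) by blast
    have upd: "proj_word (insert x K) (insert x S) w = ?w[x := (?e, snd (proj_letter True (w ! x)))]"
      "proj_word (insert x K) S w = ?w[x := (?e, snd (proj_letter False (w ! x)))]"
      "?w = ?w[x := (?e, snd (w ! x))]"
      using S insert.hyps(2) x len
      by (auto intro!: nth_equalityI simp: xS proj_word_def nth_list_update prod_eq_iff)
    have "fst (?w ! x) = ?e" using x len by (simp add: proj_word_def)
    note lin = double.lin_mod_word[OF proj_word_words[OF w, of K S] x this, of 1]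
    show "cls (Drels n d) (?s (insert x S) + ?s S) = cls (Drels n d) (Poly_Mapping.single ?w 1)"
      using lin_mod_add[OF lin proj_letter_closed[OF wx, of True] proj_letter_closed[OF wx, of False]]
      unfolding proj_letter_add[OF wx] upd(1,2) upd(3)[symmetric] by simp
  qed
  also have "\<dots> = cls (Drels n d) (Poly_Mapping.single w 1)"
    by (rule insert.IH) (use insert.prems in simp)
  finally show ?case .
qed

text \<open>Sorting the letters and putting them back cancels both the permutation and its sign;
  what remains is the projection performed by \<open>unemb\<close> and \<open>emb\<close>.\<close>

lemma phi_psi_term:
  assumes w: "w \<in> words D n d" and S: "S \<subseteq> {..<n}"
  shows "cls (Drels n d) (fextend (phi_gen n d) (psi_term n d S w)) = cls (Drels n d) (Poly_Mapping.single (proj_word {..<n} S w) 1)"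
proof -
  let ?r = "card S" and ?\<beta> = "blk n S"
  let ?u = "wperm (pinv ?\<beta>) w"
  let ?e = "emb V (unemb ?r ?u)"
  note \<beta> = blk(1)[OF S]
  have len: "length w = n" using w by (simp add: words_iff)
  have rn: "?r + (n - ?r) = n" using card_le[OF S] by simp
  have g: "unemb ?r ?u \<in> di_words V ?r (n - ?r) d" by (rule psi_term_word(1)[OF S w])
  then have e: "?e \<in> words D n d"
    using emb_words[of "fst (unemb ?r ?u)" "snd (unemb ?r ?u)" ?r "n - ?r" d] rn by simp
  have lene: "length ?e = n" using e by (simp add: words_iff)
  have nth: "?e ! k = proj_letter (k < ?r) (?u ! k)" if "k < n" for k
  proof (cases "k < ?r")
    case True
    then show ?thesis using that len by (simp add: emb_def unemb_def nth_append proj_letter_def)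
  next
    case False
    then have "drop ?r ?u ! (k - ?r) = ?u ! k" using that len by (subst nth_drop) auto
    then show ?thesis using that len rn False by (simp add: emb_def unemb_def nth_append proj_letter_def)
  qed
  have perm: "wperm ?\<beta> ?e = proj_word {..<n} S w"
  proof (rule nth_equalityI)
    show "length (wperm ?\<beta> ?e) = length (proj_word {..<n} S w)" using lene len by (simp add: proj_word_def)
    fix l assume "l < length (wperm ?\<beta> ?e)"
    then have l: "l < n" using lene by simp
    have \<beta>l: "?\<beta> l < n" using permutes_lessThan[OF \<beta>] l by simp
    have "?u ! ?\<beta> l = w ! l" using \<beta>l len permutes_inverses(2)[OF \<beta>] by simp
    then show "wperm ?\<beta> ?e ! l = proj_word {..<n} S w ! l"
      using l lene len nth[OF \<beta>l] blk(2)[OF S l] by (simp add: proj_word_def)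
  qed
  have "map fst ?e = map fst ?u" by (rule nth_equalityI) (use lene len nth in auto)
  then have "wsign ?\<beta> ?e = (wsign ?\<beta> ?u :: 'k)" using \<beta> lene by (intro wsign_cong) auto
  \<comment> \<open>The projected word has the degrees of the sorted one, so the cocycle rule
    applies to \<open>blk n S\<close> and its inverse.\<close>
  then have sign: "wsign (pinv ?\<beta>) w * wsign ?\<beta> ?e = (1 :: 'k)"
    using wsign_comp[of "pinv ?\<beta>" w ?\<beta>, symmetric] \<beta> permutes_inv[OF \<beta>] len permutes_inv_o(2)[OF \<beta>] by simp
  let ?p = "cls (di_rels V ?r (n - ?r) d) (Poly_Mapping.single (unemb ?r ?u) 1)"
  have "cls (Drels n d) (phi_gen n d (?r, ?p, ?\<beta>)) = cact EndD n ?\<beta> d (cls (Drels n d) (Poly_Mapping.single ?e 1))"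
    using phi_gen(2)[OF psi_term_word(2)[OF S w, of 1]] iota_cls[of ?r "n - ?r" d "Poly_Mapping.single (unemb ?r ?u) 1"] rn by (simp add: E_def)
  also have "\<dots> = cls (Drels n d) (Poly_Mapping.single (proj_word {..<n} S w) (wsign ?\<beta> ?e))"
    using double.End_cyc_ops(2)[OF \<beta> frees_single[OF e, of 1]] by (simp add: wact_def perm)
  finally have "cls (Drels n d) (fscale (wsign (pinv ?\<beta>) w) (phi_gen n d (?r, ?p, ?\<beta>))) =
      cls (Drels n d) (fscale (wsign (pinv ?\<beta>) w) (Poly_Mapping.single (proj_word {..<n} S w) (wsign ?\<beta> ?e)))"
    by (rule cls_cong_scale)
  then show ?thesis by (simp add: psi_term_def sign)
qed

lemma phi_psi:
  assumes y: "y \<in> frees (words D n d)"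
  shows "cls (Drels n d) (fextend (phi_gen n d) (fextend (psi_gen n d) y)) = cls (Drels n d) y"
proof (rule flin_cls_ext[where L = "\<lambda>y. fextend (phi_gen n d) (fextend (psi_gen n d) y)" and M = "\<lambda>y. y" and G = "words D n d"])
  show "flin (\<lambda>y. fextend (phi_gen n d) (fextend (psi_gen n d) y))" by (rule flinI) (simp_all add: lin_simps)
  show "Poly_Mapping.keys y \<subseteq> words D n d" using y by (simp add: frees_def)
  fix w assume w: "w \<in> words D n d"
  have "fextend (phi_gen n d) (fextend (psi_gen n d) (Poly_Mapping.single w 1)) =
      (\<Sum>S\<in>Pow {..<n}. fextend (phi_gen n d) (psi_term n d S w))"
    by (simp add: psi_gen_def fextend_sum)
  moreover have "cls (Drels n d) (\<Sum>S\<in>Pow {..<n}. fextend (phi_gen n d) (psi_term n d S w)) =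
      cls (Drels n d) (\<Sum>S\<in>Pow {..<n}. Poly_Mapping.single (proj_word {..<n} S w) 1)"
    by (rule cls_cong_sum) (rule phi_psi_term[OF w], simp)
  moreover have "\<dots> = cls (Drels n d) (Poly_Mapping.single w 1)"
    by (rule proj_word_sum[OF w]) auto
  ultimately show "cls (Drels n d) (fextend (phi_gen n d) (fextend (psi_gen n d) (Poly_Mapping.single w 1))) = cls (Drels n d) (Poly_Mapping.single w 1)"
    by simp
qed (rule flin_id)

section \<open>The isomorphism on classes and its compatibility with the operations\<close>

definition Phi :: "nat \<Rightarrow> int \<Rightarrow> (nat \<times> (('k, 'a) di_word \<Rightarrow>\<^sub>0 'k) set \<times> (nat \<Rightarrow> nat) \<Rightarrow>\<^sub>0 'k) set \<Rightarrow>
    ((int \<times> ('a \<times> ('a \<Rightarrow> 'k))) list \<Rightarrow>\<^sub>0 'k) set" where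
  "Phi n d = induced (Drels n d) (phi_gen n d)"

lemma Phi_cls: "1 \<le> n \<Longrightarrow> Phi n d (cls (crels n d) x) = cls (Drels n d) (fextend (phi_gen n d) x)"
  unfolding Phi_def by (rule induced_cls[OF phi_gen_rel_map])

lemma Phi_linear: "1 \<le> n \<Longrightarrow> linear_on (gr (cobj (\<phi>\<^sub>! EndP) n) d) (gr (cobj EndD n) d) (Phi n d)"
  unfolding Phi_def phi_shriek_simps End_cyc_simps by (rule induced_linear[OF phi_gen_rel_map])

text \<open>Injectivity is the embedding property of \<open>phi_gen\<close>; preimages are provided
  by \<open>psi_gen\<close>.\<close>

lemma Phi_bij:
  assumes n: "1 \<le> n"
  shows "bij_betw (Phi n d) (el (cobj (\<phi>\<^sub>! EndP) n) d) (el (cobj EndD n) d)"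
proof -
  have "inj_on (Phi n d) (el (cobj (\<phi>\<^sub>! EndP) n) d)"
    unfolding Phi_def phi_shriek_simps by (rule rel_embed_inj[OF phi_gen_embed[OF n]])
  moreover have "Phi n d ` el (cobj (\<phi>\<^sub>! EndP) n) d = el (cobj EndD n) d"
  proof
    show "Phi n d ` el (cobj (\<phi>\<^sub>! EndP) n) d \<subseteq> el (cobj EndD n) d"
      using Phi_linear[OF n, of d] unfolding linear_on_def by blast
    show "el (cobj EndD n) d \<subseteq> Phi n d ` el (cobj (\<phi>\<^sub>! EndP) n) d"
    proof
      fix y assume "y \<in> el (cobj EndD n) d"
      then obtain y' where y: "y' \<in> frees (words D n d)" "y = cls (Drels n d) y'" by (auto simp: double.el_End_cyc)
      have "y = Phi n d (cls (crels n d) (fextend (psi_gen n d) y'))" by (simp add: Phi_cls[OF n] phi_psi[OF y(1)] y(2))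
      moreover have "fextend (psi_gen n d) y' \<in> frees (cors n d)" by (rule rel_map_frees[OF psi_gen_rel_map y(1)])
      ultimately show "y \<in> Phi n d ` el (cobj (\<phi>\<^sub>! EndP) n) d" by (simp add: phi_shriek_simps)
    qed
  qed
  ultimately show ?thesis by (simp add: bij_betw_def)
qed

text \<open>On generators both sides are evaluated through \<open>iota\<close>, which commutes with
  the differential; the embedding \<open>phi_gen\<close> then yields the compatibility of the
  differential of corollas with the relations.\<close>

lemma
  assumes n: "1 \<le> n"
  shows cor_dif_rel_map: "rel_map (cors n d) (crels n d) (cors n (d + 1)) (crels n (d + 1)) (cor_dif EndP n d)"
    and phi_cor_dif: "x \<in> frees (cors n d) \<Longrightarrow>
      cls (Drels n (d + 1)) (fextend (phi_gen n (d + 1)) (fextend (cor_dif EndP n d) x)) =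
      cls (Drels n (d + 1)) (fextend (wdif D) (fextend (phi_gen n d) x))"
proof -
  have cor: "(r, dif (dobj EndP r (n - r)) d p, \<rho>) \<in> cors n (d + 1)" if "(r, p, \<rho>) \<in> cors n d" for r p \<rho>
    using that by (simp add: cors_iff di_dif_closed)
  have eq: "cls (Drels n (d + 1)) (fextend (phi_gen n (d + 1)) (cor_dif EndP n d g)) = cls (Drels n (d + 1)) (fextend (wdif D) (phi_gen n d g))"
    if g: "g \<in> cors n d" for g
  proof -
    obtain r p \<rho> where g': "g = (r, p, \<rho>)" by (cases g)
    note c = g[unfolded g']
    have *: "r \<le> n" "p \<in> el (dobj EndP r (n - r)) d" "\<rho> permutes {..<n}" using c by (auto simp: cors_iff)
    have rn: "r + (n - r) = n" using * by simp
    have i: "iota r (n - r) d p \<in> el (cobj EndD n) d" using iota_closed[OF *(2)] rn by simp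
    have "cls (Drels n (d + 1)) (fextend (phi_gen n (d + 1)) (cor_dif EndP n d g)) = dif (cobj EndD n) d (cact EndD n \<rho> d (iota r (n - r) d p))"
      using phi_gen(2)[OF cor[OF c]] iota_dif[OF *(2)] EndD.act_dif[OF n *(3) i] rn by (simp add: g' cor_dif_def)
    also have "\<dots> = cls (Drels n (d + 1)) (fextend (wdif D) (phi_gen n d g))"
      unfolding phi_gen(2)[OF c, symmetric] g' by (rule double.End_cyc_ops(1)[OF phi_gen(1)[OF c]])
    finally show ?thesis .
  qed
  have fr: "cor_dif EndP n d g \<in> frees (cors n (d + 1))" if "g \<in> cors n d" for g
    using that cor by (cases g) (auto simp: cor_dif_def intro!: frees_single)
  note pb = rel_map_pullback[OF phi_gen_embed[OF n] cors_presentation phi_gen_rel_map[OF n] double.wdif_rel_map fr eq]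
  show "rel_map (cors n d) (crels n d) (cors n (d + 1)) (crels n (d + 1)) (cor_dif EndP n d)" by (rule pb(1))
  show "x \<in> frees (cors n d) \<Longrightarrow>
      cls (Drels n (d + 1)) (fextend (phi_gen n (d + 1)) (fextend (cor_dif EndP n d) x)) =
      cls (Drels n (d + 1)) (fextend (wdif D) (fextend (phi_gen n d) x))" by (rule pb(2))
qed

lemma
  assumes n: "1 \<le> n" and \<sigma>: "\<sigma> permutes {..<n}"
  shows cor_act_rel_map: "rel_map (cors n d) (crels n d) (cors n d) (crels n d) (cor_act \<sigma>)"
    and phi_cor_act: "x \<in> frees (cors n d) \<Longrightarrow>
      cls (Drels n d) (fextend (phi_gen n d) (fextend (cor_act \<sigma>) x)) =
      cls (Drels n d) (fextend (wact \<sigma>) (fextend (phi_gen n d) x))"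
proof -
  have cor: "(r, p, \<rho> \<circ> \<sigma>) \<in> cors n d" if "(r, p, \<rho>) \<in> cors n d" for r p \<rho>
    using that by (simp add: cors_iff permutes_compose[OF \<sigma>])
  have eq: "cls (Drels n d) (fextend (phi_gen n d) (cor_act \<sigma> g)) = cls (Drels n d) (fextend (wact \<sigma>) (phi_gen n d g))"
    if g: "g \<in> cors n d" for g
  proof -
    obtain r p \<rho> where g': "g = (r, p, \<rho>)" by (cases g)
    note c = g[unfolded g']
    have *: "r \<le> n" "p \<in> el (dobj EndP r (n - r)) d" "\<rho> permutes {..<n}" using c by (auto simp: cors_iff)
    have rn: "r + (n - r) = n" using * by simp
    have i: "iota r (n - r) d p \<in> el (cobj EndD n) d" using iota_closed[OF *(2)] rn by simp
    have "cls (Drels n d) (fextend (phi_gen n d) (cor_act \<sigma> g)) = cact EndD n \<sigma> d (cact EndD n \<rho> d (iota r (n - r) d p))"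
      using phi_gen(2)[OF cor[OF c]] EndD.act_comp[OF n *(3) \<sigma> i] by (simp add: g' cor_act_def)
    also have "\<dots> = cls (Drels n d) (fextend (wact \<sigma>) (phi_gen n d g))"
      unfolding phi_gen(2)[OF c, symmetric] g' by (rule double.End_cyc_ops(2)[OF \<sigma> phi_gen(1)[OF c]])
    finally show ?thesis .
  qed
  have fr: "cor_act \<sigma> g \<in> frees (cors n d)" if "g \<in> cors n d" for g
    using that cor by (cases g) (auto simp: cor_act_def intro!: frees_single)
  note pb = rel_map_pullback[OF phi_gen_embed[OF n] cors_presentation phi_gen_rel_map[OF n] double.wact_rel_map[OF \<sigma>] fr eq]
  show "rel_map (cors n d) (crels n d) (cors n d) (crels n d) (cor_act \<sigma>)" by (rule pb(1))
  show "x \<in> frees (cors n d) \<Longrightarrow>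
      cls (Drels n d) (fextend (phi_gen n d) (fextend (cor_act \<sigma>) x)) =
      cls (Drels n d) (fextend (wact \<sigma>) (fextend (phi_gen n d) x))" by (rule pb(2))
qed

section \<open>Gluing corollas compared with gluing words\<close>

lemma double_form_isotropic:
  "a \<in> el V p \<Longrightarrow> b \<in> el V q \<Longrightarrow> double_form V p q (a, \<zero>\<^bsub>gr (dual V) p\<^esub>) (b, \<zero>\<^bsub>gr (dual V) q\<^esub>) = 0"
  "\<eta> \<in> el (dual V) p \<Longrightarrow> \<xi> \<in> el (dual V) q \<Longrightarrow> double_form V p q (\<zero>\<^bsub>gr V p\<^esub>, \<eta>) (\<zero>\<^bsub>gr V q\<^esub>, \<xi>) = 0"
proof -
  have pq: "p = - q" "q = - p" if "p + q = 0" using that by auto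
  show "a \<in> el V p \<Longrightarrow> b \<in> el V q \<Longrightarrow> double_form V p q (a, \<zero>\<^bsub>gr (dual V) p\<^esub>) (b, \<zero>\<^bsub>gr (dual V) q\<^esub>) = 0"
    by (cases "p + q = 0") (auto simp: double_form_def dual_simps(2) pq(2))
  show "\<eta> \<in> el (dual V) p \<Longrightarrow> \<xi> \<in> el (dual V) q \<Longrightarrow> double_form V p q (\<zero>\<^bsub>gr V p\<^esub>, \<eta>) (\<zero>\<^bsub>gr V q\<^esub>, \<xi>) = 0"
    using dual_zero[of \<eta> p] dual_zero[of \<xi> q] by (cases "p + q = 0") (auto simp: double_form_def pq(2))
qed

text \<open>The coefficient is 0 for every pair of generators, so the composite vanishes before
  passing to classes.\<close>

lemma comp_iota_same:
  assumes ab: "a < r \<and> b < r' \<or> r \<le> a \<and> a < r + s \<and> r' \<le> b \<and> b < r' + s'"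
    and p: "p \<in> el (dobj EndP r s) d" and q: "q \<in> el (dobj EndP r' s') e"
  shows "ccomp EndD (r + s) a (r' + s') b d e (iota r s d p) (iota r' s' e q) = cls (Drels (r + s + (r' + s') - 2) (d + e)) 0"
proof -
  obtain x where x: "x \<in> frees (di_words V r s d)" "p = cls (di_rels V r s d) x" using p by (auto simp: el_End_di)
  obtain y where y: "y \<in> frees (di_words V r' s' e)" "q = cls (di_rels V r' s' e) y" using q by (auto simp: el_End_di)
  have "fextend2 (wglue (double_form V) a b) (fextend E x) (fextend E y) = 0"
  proof (rule bilin_ext[where L = "\<lambda>x y. fextend2 (wglue (double_form V) a b) (fextend E x) (fextend E y)" and M = "\<lambda>x y. 0"
        and G = "di_words V r s d" and H = "di_words V r' s' e"])
    fix g h assume g: "g \<in> di_words V r s d" and h: "h \<in> di_words V r' s' e"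
    obtain u v u' v' where uv: "g = (u, v)" "h = (u', v')" by (cases g, cases h)
    have *: "length u = r" "length v = s" "length u' = r'" "length v' = s'"
      "\<forall>k<r. snd (u ! k) \<in> el V (fst (u ! k))" "\<forall>k<s. snd (v ! k) \<in> el (dual V) (fst (v ! k))"
      "\<forall>k<r'. snd (u' ! k) \<in> el V (fst (u' ! k))" "\<forall>k<s'. snd (v' ! k) \<in> el (dual V) (fst (v' ! k))"
      using g h by (auto simp: uv di_words_iff words_iff)
    have "wcoef (double_form V) a b (emb V g) (emb V h) = 0"
      using ab
    proof
      assume "a < r \<and> b < r'"
      then have "emb V g ! a = inl_letter V (u ! a)" "emb V h ! b = inl_letter V (u' ! b)"
        "snd (u ! a) \<in> el V (fst (u ! a))" "snd (u' ! b) \<in> el V (fst (u' ! b))"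
        using * by (auto simp: uv emb_def nth_append)
      then show ?thesis by (simp add: wcoef_def inl_letter_def double_form_isotropic)
    next
      assume ab: "r \<le> a \<and> a < r + s \<and> r' \<le> b \<and> b < r' + s'"
      then have "a - r < s" "b - r' < s'" by auto
      then have "emb V g ! a = inr_letter V (v ! (a - r))" "emb V h ! b = inr_letter V (v' ! (b - r'))"
        "snd (v ! (a - r)) \<in> el (dual V) (fst (v ! (a - r)))" "snd (v' ! (b - r')) \<in> el (dual V) (fst (v' ! (b - r')))"
        using * ab by (auto simp: uv emb_def nth_append)
      then show ?thesis by (simp add: wcoef_def inr_letter_def double_form_isotropic)
    qed
    then show "fextend2 (wglue (double_form V) a b) (fextend E (Poly_Mapping.single g 1)) (fextend E (Poly_Mapping.single h 1)) = 0"
      by (simp add: E_def wglue_def)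
  qed (use x y in \<open>auto intro!: flinI simp: lin_simps\<close>)
  moreover have "a < r + s" "b < r' + s'" using ab by auto
  ultimately show ?thesis
    using x y by (simp add: iota_cls double.End_cyc_ops(3) E_frees)
qed

lemma comp_iota_output_input:
  assumes "3 \<le> r + s + (r' + s')" "a < r" "r' \<le> b" "b < r' + s'" "p \<in> el (dobj EndP r s) d" "q \<in> el (dobj EndP r' s') e"
  shows "ccomp EndD (r + s) a (r' + s') b d e (iota r s d p) (iota r' s' e q) =
    cact EndD (r + s + (r' + s') - 2) (block_swap (r - 1) s r') (d + e)
      (iota (r + r' - 1) (s + s' - 1) (d + e) (dcomp EndP r s a r' s' (b - r') d e p q))"
  using iota_comp[of r s r' s' a "b - r'" p d q e] assms by (simp add: add.assoc)

text \<open>Exchanging the two factors reduces this to an output glued to an input. The exchange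
  accounts for the sign \<open>ksign (d * e)\<close> and for the second block swap, in agreement
  with \<open>corolla_glue\<close>.\<close>

lemma comp_iota_input_output:
  assumes n: "3 \<le> r + s + (r' + s')" "r \<le> a" "a < r + s" "b < r'" and p: "p \<in> el (dobj EndP r s) d" and q: "q \<in> el (dobj EndP r' s') e"
  shows "ccomp EndD (r + s) a (r' + s') b d e (iota r s d p) (iota r' s' e q) =
    csmult (Drels (r + s + (r' + s') - 2) (d + e)) (ksign (d * e))
      (cact EndD (r + s + (r' + s') - 2) (block_swap (r' - 1) s' r \<circ> block_swap 0 (r + s - 1) (r' + s' - 1)) (d + e)
        (iota (r + r' - 1) (s + s' - 1) (d + e) (dcomp EndP r' s' b r s (a - r) e d q p)))"
proof -
  let ?N = "r + s + (r' + s') - 2"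
  let ?c = "dcomp EndP r' s' b r s (a - r) e d q p"
  have ar: "r' + s' + (r + s) - 2 = ?N" "r' + r - 1 = r + r' - 1" "s' + s - 1 = s + s' - 1" "e + d = d + e"
    "r + r' - 1 + (s + s' - 1) = ?N" using n by auto
  have "?c \<in> el (dobj EndP (r' + r - 1) (s' + s - 1)) (e + d)"
    using n by (intro di_comp_closed p q) auto
  then have i: "iota (r + r' - 1) (s + s' - 1) (d + e) ?c \<in> el (cobj EndD ?N) (d + e)"
    using iota_closed[of ?c "r + r' - 1" "s + s' - 1" "d + e"] unfolding ar by simp
  have "ccomp EndD (r' + s') b (r + s) a e d (iota r' s' e q) (iota r s d p) =
      cact EndD ?N (block_swap (r' - 1) s' r) (d + e) (iota (r + r' - 1) (s + s' - 1) (d + e) ?c)"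
    using comp_iota_output_input[of r' s' r s b a q e p d] n p q unfolding ar by simp
  moreover have "block_swap 0 (r + s - 1) (r' + s' - 1) permutes {..<?N}" "block_swap (r' - 1) s' r permutes {..<?N}"
    using n by (auto intro!: block_swap_permutes)
  ultimately show ?thesis
    using EndD.comp_symmetric[OF _ _ _ iota_closed[OF p] iota_closed[OF q], of a b]
      EndD.act_comp[OF _ _ _ i, of "block_swap (r' - 1) s' r" "block_swap 0 (r + s - 1) (r' + s' - 1)"] n
    by (simp add: End_cyc_simps(1))
qed

text \<open>Equivariance moves the permutations of both corollas out of the composite and leaves the
  composite of the \<open>iota\<close> images at the flags \<open>\<rho> i\<close> and
  \<open>\<pi> j\<close>. The directions of these two flags decide between the cases of
  \<open>corolla_glue\<close>.\<close>

lemma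
  assumes nm: "3 \<le> n + m" and ij: "i < n" "j < m" and g: "g \<in> cors n d" and h: "h \<in> cors m e"
  shows corolla_glue_frees: "corolla_glue EndP n i m j d e g h \<in> frees (cors (n + m - 2) (d + e))"
    and phi_corolla_glue: "cls (Drels (n + m - 2) (d + e)) (fextend (phi_gen (n + m - 2) (d + e)) (corolla_glue EndP n i m j d e g h)) =
      cls (Drels (n + m - 2) (d + e)) (fextend2 (wglue (double_form V) i j) (phi_gen n d g) (phi_gen m e h))"
proof -
  obtain r p \<rho> where g': "g = (r, p, \<rho>)" by (cases g)
  obtain r' q \<pi> where h': "h = (r', q, \<pi>)" by (cases h)
  note cg = g[unfolded g'] and ch = h[unfolded h']
  obtain s where s: "n = r + s" using cg by (auto simp: cors_iff le_iff_add)
  obtain s' where s': "m = r' + s'" using ch by (auto simp: cors_iff le_iff_add)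
  let ?N = "r + s + (r' + s') - 2"
  have p: "p \<in> el (dobj EndP r s) d" and q: "q \<in> el (dobj EndP r' s') e"
    and \<rho>: "\<rho> permutes {..<r + s}" and \<pi>: "\<pi> permutes {..<r' + s'}"
    using cg ch by (auto simp: cors_iff s s')
  note nm' = nm[unfolded s s'] and ij' = ij[unfolded s s']
  let ?a = "\<rho> i" and ?b = "\<pi> j"
  let ?\<omega> = "perm_upto ?N (cpos (r + s) ?a ?b \<circ> map_sum \<rho> \<pi> \<circ> cflag (r + s) i j)"
  have ab: "?a < r + s" "?b < r' + s'" using ij' \<rho> \<pi> by (simp_all only: permutes_lessThan)
  have ar: "1 \<le> r + s" "1 \<le> r' + s'" "1 \<le> ?N" "3 \<le> r + s + r' + s'" "r' + r - 1 = r + r' - 1" "s' + s - 1 = s + s' - 1" "e + d = d + e"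
    "r + s - 1 + (r' + s' - 1) = ?N" using nm' ij' by auto
  have \<omega>: "?\<omega> permutes {..<?N}"
    unfolding comp_perm_eq_block_sum[OF \<rho> \<pi> ij']
    using block_sum_permutes[OF del_perm_permutes[OF \<rho> ij'(1)] del_perm_permutes[OF \<pi> ij'(2)]] unfolding ar(8) .
  note ip = iota_closed[OF p] and iq = iota_closed[OF q]
  have rhs: "cls (Drels ?N (d + e)) (fextend2 (wglue (double_form V) i j) (phi_gen n d g) (phi_gen m e h)) =
      cact EndD ?N ?\<omega> (d + e) (ccomp EndD (r + s) ?a (r' + s') ?b d e (iota r s d p) (iota r' s' e q))"
  proof -
    have "cls (Drels ?N (d + e)) (fextend2 (wglue (double_form V) i j) (phi_gen n d g) (phi_gen m e h)) =
        ccomp EndD (r + s) i (r' + s') j d e (cls (Drels n d) (phi_gen n d g)) (cls (Drels m e) (phi_gen m e h))"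
      using double.End_cyc_ops(3)[OF ij' phi_gen(1)[OF cg, unfolded s] phi_gen(1)[OF ch, unfolded s']] by (simp add: s s' g' h')
    also have "\<dots> = ccomp EndD (r + s) i (r' + s') j d e (cact EndD (r + s) \<rho> d (iota r s d p)) (cact EndD (r' + s') \<pi> e (iota r' s' e q))"
      unfolding g' h' phi_gen(2)[OF cg] phi_gen(2)[OF ch] by (simp add: s s')
    also have "\<dots> = cact EndD ?N ?\<omega> (d + e) (ccomp EndD (r + s) ?a (r' + s') ?b d e (iota r s d p) (iota r' s' e q))"
      by (rule EndD.equivariance[OF nm' ij' \<rho> \<pi> ip iq])
    finally show ?thesis .
  qed
  have cor: "(r + r' - 1, c, \<theta>) \<in> cors ?N (d + e)" and i_cor: "iota (r + r' - 1) (s + s' - 1) (d + e) c \<in> el (cobj EndD ?N) (d + e)"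
    and phi_cor: "cls (Drels ?N (d + e)) (phi_gen ?N (d + e) (r + r' - 1, c, \<theta>)) = cact EndD ?N \<theta> (d + e) (iota (r + r' - 1) (s + s' - 1) (d + e) c)"
    if "c \<in> el (dobj EndP (r + r' - 1) (s + s' - 1)) (d + e)" "\<theta> permutes {..<?N}" "1 \<le> r + r'" "1 \<le> s + s'" for c \<theta>
  proof -
    have eq: "?N - (r + r' - 1) = s + s' - 1" "r + r' - 1 + (s + s' - 1) = ?N" using that(3,4) by auto
    show "(r + r' - 1, c, \<theta>) \<in> cors ?N (d + e)" unfolding cors_iff eq using that by auto
    from phi_gen(2)[OF this]
    show "cls (Drels ?N (d + e)) (phi_gen ?N (d + e) (r + r' - 1, c, \<theta>)) = cact EndD ?N \<theta> (d + e) (iota (r + r' - 1) (s + s' - 1) (d + e) c)"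
      unfolding eq .
    show "iota (r + r' - 1) (s + s' - 1) (d + e) c \<in> el (cobj EndD ?N) (d + e)"
      using iota_closed[OF that(1)] unfolding eq .
  qed
  have "corolla_glue EndP n i m j d e g h \<in> frees (cors ?N (d + e)) \<and>
    cls (Drels ?N (d + e)) (fextend (phi_gen ?N (d + e)) (corolla_glue EndP n i m j d e g h)) =
      cls (Drels ?N (d + e)) (fextend2 (wglue (double_form V) i j) (phi_gen n d g) (phi_gen m e h))"
  proof -
    consider (oi) "?a < r" "r' \<le> ?b" | (io) "r \<le> ?a" "?b < r'" |
      (same) "?a < r \<and> ?b < r' \<or> r \<le> ?a \<and> ?a < r + s \<and> r' \<le> ?b \<and> ?b < r' + s'"
      using ab by linarith
    then show ?thesis
    proof cases
      case oi
      let ?c = "dcomp EndP r s ?a r' s' (?b - r') d e p q"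
      let ?\<theta> = "perm_upto ?N (dpos r s r' ?a (?b - r') \<circ> map_sum \<rho> \<pi> \<circ> cflag (r + s) i j)"
      have le: "?b - r' < s'" "1 \<le> r + r'" "1 \<le> s + s'" using oi ab by auto
      have c: "?c \<in> el (dobj EndP (r + r' - 1) (s + s' - 1)) (d + e)" by (rule di_comp_closed[OF ar(4) oi(1) le(1) p q])
      \<comment> \<open>Splits the permutation in \<open>corolla_glue\<close> into the relabelling
        \<open>?\<omega>\<close> of the cyclic composite and the sorting of outputs before
        inputs.\<close>
      have \<theta>: "?\<theta> = block_swap (r - 1) s r' \<circ> ?\<omega>" by (rule dpos_perm[OF \<rho> \<pi> ij' oi])
      have sw: "block_swap (r - 1) s r' permutes {..<?N}" using oi le by (intro block_swap_permutes) auto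
      have perm: "?\<theta> permutes {..<?N}" unfolding \<theta> by (rule permutes_compose[OF \<omega> sw])
      have glue: "corolla_glue EndP n i m j d e g h = Poly_Mapping.single (r + r' - 1, ?c, ?\<theta>) 1"
        using oi by (simp add: corolla_glue_def g' h' Let_def s s')
      have "cls (Drels ?N (d + e)) (phi_gen ?N (d + e) (r + r' - 1, ?c, ?\<theta>)) =
          cact EndD ?N (block_swap (r - 1) s r' \<circ> ?\<omega>) (d + e) (iota (r + r' - 1) (s + s' - 1) (d + e) ?c)"
        unfolding \<theta>[symmetric] by (rule phi_cor[OF c perm le(2,3)])
      also have "\<dots> = cact EndD ?N ?\<omega> (d + e) (ccomp EndD (r + s) ?a (r' + s') ?b d e (iota r s d p) (iota r' s' e q))"
        unfolding comp_iota_output_input[OF nm' oi ab(2) p q] by (rule EndD.act_comp[OF ar(3) sw \<omega> i_cor[OF c perm le(2,3)]])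
      finally show ?thesis
        unfolding rhs glue using cor[OF c perm le(2,3)] by (simp add: frees_single)
    next
      case io
      let ?c = "dcomp EndP r' s' ?b r s (?a - r) e d q p"
      let ?\<theta> = "perm_upto ?N (dpos r' s' r ?b (?a - r) \<circ> case_sum Inr Inl \<circ> map_sum \<rho> \<pi> \<circ> cflag (r + s) i j)"
      let ?sw = "block_swap (r' - 1) s' r \<circ> block_swap 0 (r + s - 1) (r' + s' - 1)"
      have le: "?a - r < s" "1 \<le> r + r'" "1 \<le> s + s'" "3 \<le> r' + s' + r + s" using io ab ar(4) by auto
      have c: "?c \<in> el (dobj EndP (r + r' - 1) (s + s' - 1)) (d + e)"
        using di_comp_closed[OF le(4) io(2) le(1) q p] unfolding ar(5-7) .
      have \<theta>: "?\<theta> = ?sw \<circ> ?\<omega>" by (rule dpos_perm_swap[OF \<rho> \<pi> ij' io])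
      have sw: "?sw permutes {..<?N}" using io le by (intro permutes_compose block_swap_permutes) auto
      have perm: "?\<theta> permutes {..<?N}" unfolding \<theta> by (rule permutes_compose[OF \<omega> sw])
      have glue: "corolla_glue EndP n i m j d e g h = Poly_Mapping.single (r + r' - 1, ?c, ?\<theta>) (ksign (d * e))"
        using io by (simp add: corolla_glue_def g' h' Let_def s s')
      note i = i_cor[OF c perm le(2,3)]
      have "cls (Drels ?N (d + e)) (phi_gen ?N (d + e) (r + r' - 1, ?c, ?\<theta>)) =
          cact EndD ?N (?sw \<circ> ?\<omega>) (d + e) (iota (r + r' - 1) (s + s' - 1) (d + e) ?c)"
        unfolding \<theta>[symmetric] by (rule phi_cor[OF c perm le(2,3)])
      also have "\<dots> = cact EndD ?N ?\<omega> (d + e) (cact EndD ?N ?sw (d + e) (iota (r + r' - 1) (s + s' - 1) (d + e) ?c))"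
        by (rule EndD.act_comp[OF ar(3) sw \<omega> i])
      finally have "csmult (Drels ?N (d + e)) (ksign (d * e)) (cls (Drels ?N (d + e)) (phi_gen ?N (d + e) (r + r' - 1, ?c, ?\<theta>))) =
          cact EndD ?N ?\<omega> (d + e) (ccomp EndD (r + s) ?a (r' + s') ?b d e (iota r s d p) (iota r' s' e q))"
        unfolding comp_iota_input_output[OF nm' io(1) ab(1) io(2) p q]
        using EndD.act_smult[OF ar(3) \<omega> EndD.act_closed[OF ar(3) sw i]] by (simp only: End_cyc_simps(1) presented_simps)
      then show ?thesis
        unfolding rhs glue using cor[OF c perm le(2,3)] by (simp add: frees_single cls_scale)
    next
      case same
      then have "corolla_glue EndP n i m j d e g h = 0"
        by (auto simp: corolla_glue_def g' h' Let_def)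
      moreover have "cact EndD ?N ?\<omega> (d + e) (cls (Drels ?N (d + e)) 0) = cls (Drels ?N (d + e)) 0"
        using double.End_cyc_ops(2)[OF \<omega> frees_0] by simp
      ultimately show ?thesis
        unfolding rhs comp_iota_same[OF same p q] by (simp add: frees_0)
    qed
  qed
  then show "corolla_glue EndP n i m j d e g h \<in> frees (cors (n + m - 2) (d + e))"
    and "cls (Drels (n + m - 2) (d + e)) (fextend (phi_gen (n + m - 2) (d + e)) (corolla_glue EndP n i m j d e g h)) =
      cls (Drels (n + m - 2) (d + e)) (fextend2 (wglue (double_form V) i j) (phi_gen n d g) (phi_gen m e h))"
    by (simp_all add: s s')
qed

lemma
  assumes "3 \<le> n + m" "i < n" "j < m"
  shows corolla_glue_rel_map2: "rel_map2 (cors n d) (crels n d) (cors m e) (crels m e)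
      (cors (n + m - 2) (d + e)) (crels (n + m - 2) (d + e)) (corolla_glue EndP n i m j d e)"
    and phi_corolla_glue_frees: "x \<in> frees (cors n d) \<Longrightarrow> y \<in> frees (cors m e) \<Longrightarrow>
      cls (Drels (n + m - 2) (d + e)) (fextend (phi_gen (n + m - 2) (d + e)) (fextend2 (corolla_glue EndP n i m j d e) x y)) =
      cls (Drels (n + m - 2) (d + e)) (fextend2 (wglue (double_form V) i j) (fextend (phi_gen n d) x) (fextend (phi_gen m e) y))"
proof -
  have ar: "1 \<le> n" "1 \<le> m" "1 \<le> n + m - 2" using assms by auto
  note pb = rel_map2_pullback[OF phi_gen_embed[OF ar(3)] phi_gen_rel_map[OF ar(1)] phi_gen_rel_map[OF ar(2)]
      cors_presentation cors_presentation double.wglue_rel_map2[OF assms(2,3)] corolla_glue_frees[OF assms] phi_corolla_glue[OF assms]]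
  show "rel_map2 (cors n d) (crels n d) (cors m e) (crels m e)
      (cors (n + m - 2) (d + e)) (crels (n + m - 2) (d + e)) (corolla_glue EndP n i m j d e)"
    by (rule pb(1))
  show "x \<in> frees (cors n d) \<Longrightarrow> y \<in> frees (cors m e) \<Longrightarrow>
      cls (Drels (n + m - 2) (d + e)) (fextend (phi_gen (n + m - 2) (d + e)) (fextend2 (corolla_glue EndP n i m j d e) x y)) =
      cls (Drels (n + m - 2) (d + e)) (fextend2 (wglue (double_form V) i j) (fextend (phi_gen n d) x) (fextend (phi_gen m e) y))"
    by (rule pb(2))
qed

lemma Phi_iso: "cyclic_operad_iso (\<phi>\<^sub>! EndP) EndD Phi"
  unfolding cyclic_operad_iso_def
proof (intro conjI allI impI ballI)
  fix n d x assume x: "x \<in> el (cobj (\<phi>\<^sub>! EndP) n) d" and n: "1 \<le> n"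
  obtain x' where x': "x' \<in> frees (cors n d)" "x = cls (crels n d) x'" using x by (auto simp: phi_shriek_simps)
  note fr = rel_map_frees[OF phi_gen_rel_map[OF n] x'(1)]
  show "Phi n (d + 1) (dif (cobj (\<phi>\<^sub>! EndP) n) d x) = dif (cobj EndD n) d (Phi n d x)"
    by (simp add: x'(2) phi_shriek_simps induced_cls[OF cor_dif_rel_map[OF n]] Phi_cls[OF n] phi_cor_dif[OF n x'(1)] double.End_cyc_ops(1)[OF fr])
  fix \<sigma> assume \<sigma>: "\<sigma> permutes {..<n}"
  show "Phi n d (cact (\<phi>\<^sub>! EndP) n \<sigma> d x) = cact EndD n \<sigma> d (Phi n d x)"
    by (simp add: x'(2) phi_shriek_simps induced_cls[OF cor_act_rel_map[OF n \<sigma>]] Phi_cls[OF n] phi_cor_act[OF n \<sigma> x'(1)] double.End_cyc_ops(2)[OF \<sigma> fr])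
next
  fix n m i j d e x y
  assume x: "x \<in> el (cobj (\<phi>\<^sub>! EndP) n) d" and y: "y \<in> el (cobj (\<phi>\<^sub>! EndP) m) e" and ar: "3 \<le> n + m" "i < n" "j < m"
  obtain x' where x': "x' \<in> frees (cors n d)" "x = cls (crels n d) x'" using x by (auto simp: phi_shriek_simps)
  obtain y' where y': "y' \<in> frees (cors m e)" "y = cls (crels m e) y'" using y by (auto simp: phi_shriek_simps)
  have n: "1 \<le> n" "1 \<le> m" "1 \<le> n + m - 2" using ar by auto
  note frx = rel_map_frees[OF phi_gen_rel_map[OF n(1)] x'(1)] and fry = rel_map_frees[OF phi_gen_rel_map[OF n(2)] y'(1)]
  show "Phi (n + m - 2) (d + e) (ccomp (\<phi>\<^sub>! EndP) n i m j d e x y) = ccomp EndD n i m j d e (Phi n d x) (Phi m e y)"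
    by (simp add: x'(2) y'(2) phi_shriek_simps induced2_cls[OF corolla_glue_rel_map2[OF ar] x'(1) y'(1)] Phi_cls n
        phi_corolla_glue_frees[OF ar x'(1) y'(1)] double.End_cyc_ops(3)[OF ar(2,3) frx fry])
qed (fact Phi_linear Phi_bij)+

text \<open>The identities are not verified on corollas: the bijection respects all operations, and
  they hold in the tensor powers of the double.\<close>

lemma phi_shriek_cyclic_operad: "cyclic_operad (\<phi>\<^sub>! EndP)"
proof (rule cyclic_operad_transport[OF EndD.cyclic_operad_axioms Phi_iso]; unfold phi_shriek_simps)
  show "Module.module (kring :: 'k ring) (presented (cors n d) (crels n d))" for n d
    by (rule presented_module)
qed (fact induced_linear[OF cor_dif_rel_map] induced_linear[OF cor_act_rel_map] induced2_bilinear[OF corolla_glue_rel_map2])+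

end

theorem proposition9p7:
  fixes A :: "('k::field_char_0, 'a) dg"
  assumes "dg_vector_space A" and "finite_type A"
  shows "dioperad (End_di A) \<and>
    cyclic_operad (\<phi>\<^sub>! (End_di A)) \<and>
    cyclic_operad (End_cyc (double A) (double_form A)) \<and>
    (\<exists>\<Phi>. cyclic_operad_iso (\<phi>\<^sub>! (End_di A)) (End_cyc (double A) (double_form A)) \<Phi>)"
proof -
  interpret dg_double A by (rule dg_vector_space.dg_double[OF assms(1)])
  show ?thesis
    using End_di_dioperad phi_shriek_cyclic_operad EndD.cyclic_operad_axioms Phi_iso by blast
qed

end
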